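(* Let $M_1, M_2$ be two locally standard $T^k$-manifolds with orbit spaces $P_i = M_i/T^k$, orbit maps $\pi_i: M_i\to P_i$ and characteristic functions $\lambda_i$ ($i=1,2$). Assume that there are continuous sections $s_i: P_i\to M_i$ to the orbit maps $\pi_i$, $i=1,2$. If there is a diffeomorphism (of manifolds with corners) $\Phi: P_1\to P_2$ such that $\lambda_1=\lambda_2\circ\Phi$, then there is a $T^k$-equivariant diffeomorphism $\Psi: M_1\to M_2$.
   Context: $T^k=(S^1)^k$ is the compact $k$-dimensional torus. Manifolds are smooth, without boundary, not necessarily compact. A smooth action of $T^k$ on $M$ is locally standard (and $M$ is a locally standard $T^k$-manifold) if each $T^k$-orbit in $M$ has an invariant neighborhood equivariantly diffeomorphic to some $V=\mathbb{C}^n\times T^{k-n}\times\mathbb{R}^m$, where $n,m$ may depend on the orbit, and where the action on $V$ is as follows: there is a splitting $T^k=T^n\times T^{k-n}$ such that $T^n$ acts linearly and effectively on $\mathbb{C}^n$, $T^{k-n}$ acts by left multiplication on itself, $T^k$ acts trivially on $\mathbb{R}^m$, and the action on $V$ is the product of these actions. The orbit space $M/T^k$ of a locally standard $T^k$-manifold is a smooth manifold with corners: after choosing linear coordinates on $\mathbb{C}^n$ in which $T^n$ acts as the standard coordinate-wise torus (up to an automorphism of $T^n$), the map $(z_1,\dots,z_n,t,y)\mapsto(|z_1|^2,\dots,|z_n|^2,y)$ identifies $V/T^k$ with $\mathbb{R}_{\ge0}^n\times\mathbb{R}^m$, and these identifications give the charts of $M/T^k$. The characteristic function $\lambda$ of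 $M$ is the map from $M/T^k$ to the set of subtori of $T^k$ which assigns to each orbit its isotropy group. A section to the orbit map $\pi$ is a map $s$ with $\pi\circ s=\mathrm{id}$. *)

theory Defs
  imports "HOL-Analysis.Analysis" "HOL-Algebra.Group_Action"
begin

section \<open>Smooth functions on subsets of Euclidean space\<close>

text \<open>
  \<open>\<real>\<^sup>n\<close> is the carrier of \<^const>\<open>Euclidean_space\<close> \<open>n\<close>: the functions \<open>nat \<Rightarrow> real\<close> that vanish at
  all indices \<open>\<ge> n\<close>.
\<close>

definition partial_deriv :: "nat \<Rightarrow> ((nat \<Rightarrow> real) \<Rightarrow> real) \<Rightarrow> (nat \<Rightarrow> real) \<Rightarrow> real" where
  "partial_deriv i f x = deriv (\<lambda>t. f (x(i := t))) (x i)"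

text \<open>For \<open>U\<close> open in \<open>\<real>\<^sup>n\<close>: all partial derivatives of order \<open>\<le> r\<close> exist and are continuous on \<open>U\<close>.\<close>

primrec C_k_on :: "nat \<Rightarrow> nat \<Rightarrow> (nat \<Rightarrow> real) set \<Rightarrow> ((nat \<Rightarrow> real) \<Rightarrow> real) \<Rightarrow> bool" where
  "C_k_on n 0 U f \<longleftrightarrow> continuous_on U f"
| "C_k_on n (Suc r) U f \<longleftrightarrow> continuous_on U f \<and>
     (\<forall>i<n. (\<forall>x\<in>U. (\<lambda>t. f (x(i := t))) differentiable (at (x i))) \<and>
            C_k_on n r U (partial_deriv i f))"

text \<open>
  On an arbitrary subset \<open>S\<close> of \<open>\<real>\<^sup>n\<close> (an open set, an open part of \<open>\<real>\<^sub>\<ge>\<^sub>0\<^sup>p \<times> \<real>\<^sup>q\<close>, an embedded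
  submanifold), a function is smooth if it locally extends to a smooth function on an open
  subset of \<open>\<real>\<^sup>n\<close>.
\<close>

definition smooth_on :: "nat \<Rightarrow> (nat \<Rightarrow> real) set \<Rightarrow> ((nat \<Rightarrow> real) \<Rightarrow> real) \<Rightarrow> bool" where
  "smooth_on n S f \<longleftrightarrow>
     (\<forall>x\<in>S. \<exists>U g. openin (Euclidean_space n) U \<and> x \<in> U \<and>
        (\<forall>r. C_k_on n r U g) \<and> (\<forall>y\<in>S \<inter> U. f y = g y))"

section \<open>Spaces with smooth charts\<close>

text \<open>
  A chart \<open>(a, U, \<phi>)\<close> is a map \<open>\<phi>\<close> from \<open>U\<close> onto a subset of \<open>\<real>\<^sup>a\<close>. The image need not be open: it
  is an open set for the charts of a manifold, an open part of \<open>\<real>\<^sub>\<ge>\<^sub>0\<^sup>p \<times> \<real>\<^sup>q\<close> for a manifold with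
  corners, and an embedded submanifold for the standard spaces below, which are charted by
  their inclusion. The same notion of smooth map serves all three.
\<close>

record 'a smooth_space =
  underlying :: "'a topology"
  charts :: "(nat \<times> 'a set \<times> ('a \<Rightarrow> nat \<Rightarrow> real)) set"

abbreviation points :: "'a smooth_space \<Rightarrow> 'a set" where
  "points X \<equiv> topspace (underlying X)"

definition smooth_map :: "'a smooth_space \<Rightarrow> 'b smooth_space \<Rightarrow> ('a \<Rightarrow> 'b) \<Rightarrow> bool" where
  "smooth_map X Y f \<longleftrightarrow> continuous_map (underlying X) (underlying Y) f \<and>
     (\<forall>(a, U, \<phi>)\<in>charts X. \<forall>(b, V, \<psi>)\<in>charts Y. \<forall>j<b.
        smooth_on a (\<phi> ` {x\<in>U. f x \<in> V}) (\<lambda>u. \<psi> (f (inv_into U \<phi> u)) j))"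

definition diffeomorphism :: "'a smooth_space \<Rightarrow> 'b smooth_space \<Rightarrow> ('a \<Rightarrow> 'b) \<Rightarrow> bool" where
  "diffeomorphism X Y f \<longleftrightarrow> bij_betw f (points X) (points Y) \<and>
     smooth_map X Y f \<and> smooth_map Y X (inv_into (points X) f)"

text \<open>Smooth manifolds without boundary; the atlas need not be maximal.\<close>

definition smooth_manifold :: "'a smooth_space \<Rightarrow> bool" where
  "smooth_manifold X \<longleftrightarrow>
     Hausdorff_space (underlying X) \<and> second_countable (underlying X) \<and>
     (\<exists>d. \<forall>(a, U, \<phi>)\<in>charts X. a = d \<and> openin (underlying X) U \<and>
        (\<exists>W. openin (Euclidean_space d) W \<and>
           homeomorphic_map (subtopology (underlying X) U)
             (subtopology (Euclidean_space d) W) \<phi>)) \<and>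
     (\<Union>(a, U, \<phi>)\<in>charts X. U) = points X \<and>
     (\<forall>(a, U, \<phi>)\<in>charts X. \<forall>(b, V, \<psi>)\<in>charts X. \<forall>j<b.
        smooth_on a (\<phi> ` (U \<inter> V)) (\<lambda>u. \<psi> (inv_into U \<phi> u) j))"

definition open_subspace :: "'a smooth_space \<Rightarrow> 'a set \<Rightarrow> 'a smooth_space" where
  "open_subspace X W =
     \<lparr>underlying = subtopology (underlying X) W,
      charts = {(a, U \<inter> W, \<phi>) | a U \<phi>. (a, U, \<phi>) \<in> charts X}\<rparr>"

definition prod_space :: "'a smooth_space \<Rightarrow> 'b smooth_space \<Rightarrow> ('a \<times> 'b) smooth_space" where
  "prod_space X Y =
     \<lparr>underlying = prod_topology (underlying X) (underlying Y),
      charts = {(a + b, U \<times> V, \<lambda>(x, y) j. if j < a then \<phi> x j else \<psi> y (j - a)) |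
                a U \<phi> b V \<psi>. (a, U, \<phi>) \<in> charts X \<and> (b, V, \<psi>) \<in> charts Y}\<rparr>"

section \<open>The spaces \<open>\<real>\<^sup>m\<close>, \<open>\<complex>\<^sup>n\<close> and \<open>T\<^sup>k\<close>\<close>

definition R_space :: "nat \<Rightarrow> (nat \<Rightarrow> real) smooth_space" where
  "R_space m = \<lparr>underlying = Euclidean_space m, charts = {(m, topspace (Euclidean_space m), \<lambda>x. x)}\<rparr>"

definition real_coords :: "nat \<Rightarrow> (nat \<Rightarrow> complex) \<Rightarrow> nat \<Rightarrow> real" where
  "real_coords n z j =
     (if j < 2 * n then (if even j then Re (z (j div 2)) else Im (z (j div 2))) else 0)"

definition C_vecs :: "nat \<Rightarrow> (nat \<Rightarrow> complex) set" where
  "C_vecs n = {z. \<forall>i\<ge>n. z i = 0}"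

definition C_space :: "nat \<Rightarrow> (nat \<Rightarrow> complex) smooth_space" where
  "C_space n = \<lparr>underlying = top_of_set (C_vecs n), charts = {(2 * n, C_vecs n, real_coords n)}\<rparr>"

text \<open>Elements of the torus are padded with \<open>1\<close>, vectors of \<open>\<complex>\<^sup>n\<close> with \<open>0\<close>.\<close>

definition torus :: "nat \<Rightarrow> (nat \<Rightarrow> complex) set" where
  "torus k = {t. (\<forall>i<k. cmod (t i) = 1) \<and> (\<forall>i\<ge>k. t i = 1)}"

definition torus_group :: "nat \<Rightarrow> (nat \<Rightarrow> complex) monoid" where
  "torus_group k = \<lparr>carrier = torus k, mult = (\<lambda>s t i. s i * t i), one = (\<lambda>i. 1)\<rparr>"

text \<open>\<open>T\<^sup>k\<close> carries the smooth structure of an embedded submanifold of \<open>\<complex>\<^sup>k = \<real>\<^sup>2\<^sup>k\<close>.\<close>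

definition T_space :: "nat \<Rightarrow> (nat \<Rightarrow> complex) smooth_space" where
  "T_space k = \<lparr>underlying = top_of_set (torus k), charts = {(2 * k, torus k, real_coords k)}\<rparr>"

section \<open>Locally standard torus manifolds\<close>

text \<open>
  In \<^locale>\<open>group_action\<close> each group element acts by an extensional bijection of the space, that is,
  one with value \<^const>\<open>undefined\<close> outside of it.
\<close>

definition smooth_torus_action ::
    "nat \<Rightarrow> 'a smooth_space \<Rightarrow> ((nat \<Rightarrow> complex) \<Rightarrow> 'a \<Rightarrow> 'a) \<Rightarrow> bool" where
  "smooth_torus_action k X \<theta> \<longleftrightarrow> group_action (torus_group k) (points X) \<theta> \<and>
     smooth_map (prod_space (T_space k) X) X (\<lambda>(t, x). \<theta> t x)"

text \<open>
  A splitting \<open>T\<^sup>k = T\<^sup>n \<times> T\<^sup>k\<^sup>-\<^sup>n\<close>, as an isomorphism of topological groups (continuous homomorphisms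
  of Lie groups are smooth). The two subtori are the preimages of the factors.
\<close>

definition torus_splitting ::
    "nat \<Rightarrow> nat \<Rightarrow> ((nat \<Rightarrow> complex) \<Rightarrow> (nat \<Rightarrow> complex) \<times> (nat \<Rightarrow> complex)) \<Rightarrow> bool" where
  "torus_splitting k n \<sigma> \<longleftrightarrow> n \<le> k \<and>
     \<sigma> \<in> iso (torus_group k) (torus_group n \<times>\<times> torus_group (k - n)) \<and>
     homeomorphic_map (top_of_set (torus k))
       (prod_topology (top_of_set (torus n)) (top_of_set (torus (k - n)))) \<sigma>"

definition torus_automorphism :: "nat \<Rightarrow> ((nat \<Rightarrow> complex) \<Rightarrow> nat \<Rightarrow> complex) \<Rightarrow> bool" where
  "torus_automorphism n \<alpha> \<longleftrightarrow> \<alpha> \<in> iso (torus_group n) (torus_group n) \<and>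
     homeomorphic_map (top_of_set (torus n)) (top_of_set (torus n)) \<alpha>"

definition effective_linear_action ::
    "nat \<Rightarrow> ((nat \<Rightarrow> complex) \<Rightarrow> (nat \<Rightarrow> complex) \<Rightarrow> (nat \<Rightarrow> complex)) \<Rightarrow> bool" where
  "effective_linear_action n \<rho> \<longleftrightarrow> faithful_action (torus_group n) (C_vecs n) \<rho> \<and>
     (\<forall>g\<in>torus n. \<forall>z\<in>C_vecs n. \<forall>w\<in>C_vecs n. \<forall>c.
        \<rho> g (\<lambda>i. z i + w i) = (\<lambda>i. \<rho> g z i + \<rho> g w i) \<and>
        \<rho> g (\<lambda>i. c * z i) = (\<lambda>i. c * \<rho> g z i)) \<and>
     continuous_map (prod_topology (top_of_set (torus n)) (top_of_set (C_vecs n)))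
       (top_of_set (C_vecs n)) (\<lambda>(g, z). \<rho> g z)"

text \<open>The model \<open>V = \<complex>\<^sup>n \<times> T\<^sup>k\<^sup>-\<^sup>n \<times> \<real>\<^sup>m\<close> and the product action on it.\<close>

type_synonym model = "(nat \<Rightarrow> complex) \<times> (nat \<Rightarrow> complex) \<times> (nat \<Rightarrow> real)"

definition model_space :: "nat \<Rightarrow> nat \<Rightarrow> nat \<Rightarrow> model smooth_space" where
  "model_space k n m = prod_space (C_space n) (prod_space (T_space (k - n)) (R_space m))"

definition model_action ::
    "((nat \<Rightarrow> complex) \<Rightarrow> (nat \<Rightarrow> complex) \<times> (nat \<Rightarrow> complex)) \<Rightarrow>
     ((nat \<Rightarrow> complex) \<Rightarrow> (nat \<Rightarrow> complex) \<Rightarrow> (nat \<Rightarrow> complex)) \<Rightarrow>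
     (nat \<Rightarrow> complex) \<Rightarrow> model \<Rightarrow> model" where
  "model_action \<sigma> \<rho> t = (\<lambda>(z, w, y). (\<rho> (fst (\<sigma> t)) z, (\<lambda>i. snd (\<sigma> t) i * w i), y))"

definition model_chart ::
    "nat \<Rightarrow> 'a smooth_space \<Rightarrow> ((nat \<Rightarrow> complex) \<Rightarrow> 'a \<Rightarrow> 'a) \<Rightarrow> nat \<Rightarrow> nat \<Rightarrow>
     ((nat \<Rightarrow> complex) \<Rightarrow> (nat \<Rightarrow> complex) \<times> (nat \<Rightarrow> complex)) \<Rightarrow>
     ((nat \<Rightarrow> complex) \<Rightarrow> (nat \<Rightarrow> complex) \<Rightarrow> (nat \<Rightarrow> complex)) \<Rightarrow>
     'a set \<Rightarrow> ('a \<Rightarrow> model) \<Rightarrow> bool" where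
  "model_chart k X \<theta> n m \<sigma> \<rho> U \<phi> \<longleftrightarrow>
     openin (underlying X) U \<and> (\<forall>t\<in>torus k. \<forall>x\<in>U. \<theta> t x \<in> U) \<and>
     torus_splitting k n \<sigma> \<and> effective_linear_action n \<rho> \<and>
     diffeomorphism (open_subspace X U) (model_space k n m) \<phi> \<and>
     (\<forall>t\<in>torus k. \<forall>x\<in>U. \<phi> (\<theta> t x) = model_action \<sigma> \<rho> t (\<phi> x))"

definition locally_standard ::
    "nat \<Rightarrow> 'a smooth_space \<Rightarrow> ((nat \<Rightarrow> complex) \<Rightarrow> 'a \<Rightarrow> 'a) \<Rightarrow> bool" where
  "locally_standard k X \<theta> \<longleftrightarrow> smooth_manifold X \<and> smooth_torus_action k X \<theta> \<and>
     (\<forall>p\<in>orbits (torus_group k) (points X) \<theta>.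
        \<exists>n m \<sigma> \<rho> U \<phi>. p \<subseteq> U \<and> model_chart k X \<theta> n m \<sigma> \<rho> U \<phi>)"

section \<open>Orbit spaces, characteristic functions and sections\<close>

abbreviation orbit_map ::
    "nat \<Rightarrow> ((nat \<Rightarrow> complex) \<Rightarrow> 'a \<Rightarrow> 'a) \<Rightarrow> 'a \<Rightarrow> 'a set" where
  "orbit_map k \<theta> \<equiv> orbit (torus_group k) \<theta>"

definition orbit_topology ::
    "nat \<Rightarrow> 'a smooth_space \<Rightarrow> ((nat \<Rightarrow> complex) \<Rightarrow> 'a \<Rightarrow> 'a) \<Rightarrow> 'a set topology" where
  "orbit_topology k X \<theta> = topology (\<lambda>W. W \<subseteq> orbits (torus_group k) (points X) \<theta> \<and>
     openin (underlying X) {x \<in> points X. orbit_map k \<theta> x \<in> W})"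

lemma openin_orbit_topology:
  "openin (orbit_topology k X \<theta>) W \<longleftrightarrow> W \<subseteq> orbits (torus_group k) (points X) \<theta> \<and>
     openin (underlying X) {x \<in> points X. orbit_map k \<theta> x \<in> W}"
proof -
  let ?Q = "\<lambda>W. W \<subseteq> orbits (torus_group k) (points X) \<theta> \<and>
     openin (underlying X) {x \<in> points X. orbit_map k \<theta> x \<in> W}"
  have "istopology ?Q"
    unfolding istopology_def
  proof (intro conjI allI impI)
    fix S T assume "?Q S" "?Q T"
    moreover have "{x \<in> points X. orbit_map k \<theta> x \<in> S \<inter> T} =
        {x \<in> points X. orbit_map k \<theta> x \<in> S} \<inter> {x \<in> points X. orbit_map k \<theta> x \<in> T}" by auto
    ultimately show "S \<inter> T \<subseteq> orbits (torus_group k) (points X) \<theta>"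
      and "openin (underlying X) {x \<in> points X. orbit_map k \<theta> x \<in> S \<inter> T}" by auto
  next
    fix \<K> assume *: "\<forall>K\<in>\<K>. ?Q K"
    have "{x \<in> points X. orbit_map k \<theta> x \<in> \<Union>\<K>} =
        (\<Union>K\<in>\<K>. {x \<in> points X. orbit_map k \<theta> x \<in> K})" by auto
    with * show "openin (underlying X) {x \<in> points X. orbit_map k \<theta> x \<in> \<Union>\<K>}" by auto
    show "\<Union>\<K> \<subseteq> orbits (torus_group k) (points X) \<theta>" using * by auto
  qed
  then show ?thesis unfolding orbit_topology_def by (simp add: topology_inverse')
qed

text \<open>The map \<open>(z\<^sub>1,\<dots>,z\<^sub>n,t,y) \<mapsto> (|z\<^sub>1|\<^sup>2,\<dots>,|z\<^sub>n|\<^sup>2,y)\<close> from the model onto \<open>\<real>\<^sub>\<ge>\<^sub>0\<^sup>n \<times> \<real>\<^sup>m\<close>.\<close>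

definition model_orbit_coords :: "nat \<Rightarrow> model \<Rightarrow> nat \<Rightarrow> real" where
  "model_orbit_coords n = (\<lambda>(z, w, y) j. if j < n then (cmod (z j))\<^sup>2 else y (j - n))"

text \<open>
  The orbit space as a manifold with corners. Its charts come from those model charts in which
  \<open>T\<^sup>n\<close> acts on \<open>\<complex>\<^sup>n\<close> coordinate-wise up to an automorphism \<open>\<alpha>\<close> of \<open>T\<^sup>n\<close>; the linear change of
  coordinates on \<open>\<complex>\<^sup>n\<close> that achieves this is absorbed into \<open>\<phi>\<close>. The chart \<open>\<psi>\<close> is the map
  induced on orbits.
\<close>

definition orbit_space ::
    "nat \<Rightarrow> 'a smooth_space \<Rightarrow> ((nat \<Rightarrow> complex) \<Rightarrow> 'a \<Rightarrow> 'a) \<Rightarrow> 'a set smooth_space" where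
  "orbit_space k X \<theta> =
     \<lparr>underlying = orbit_topology k X \<theta>,
      charts = {(n + m, orbit_map k \<theta> ` U, \<psi>) | n m U \<psi>.
        \<exists>\<sigma> \<alpha> \<phi>. torus_automorphism n \<alpha> \<and>
          model_chart k X \<theta> n m \<sigma> (\<lambda>g. \<lambda>z\<in>C_vecs n. (\<lambda>i. \<alpha> g i * z i)) U \<phi> \<and>
          (\<forall>x\<in>U. \<psi> (orbit_map k \<theta> x) = model_orbit_coords n (\<phi> x))}\<rparr>"

text \<open>As \<open>T\<^sup>k\<close> is commutative, all points of an orbit \<open>p\<close> have the same isotropy group.\<close>

definition characteristic_function ::
    "nat \<Rightarrow> ((nat \<Rightarrow> complex) \<Rightarrow> 'a \<Rightarrow> 'a) \<Rightarrow> 'a set \<Rightarrow> (nat \<Rightarrow> complex) set" where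
  "characteristic_function k \<theta> p = (\<Inter>x\<in>p. stabilizer (torus_group k) \<theta> x)"

definition continuous_section ::
    "nat \<Rightarrow> 'a smooth_space \<Rightarrow> ((nat \<Rightarrow> complex) \<Rightarrow> 'a \<Rightarrow> 'a) \<Rightarrow> ('a set \<Rightarrow> 'a) \<Rightarrow> bool" where
  "continuous_section k X \<theta> s \<longleftrightarrow>
     continuous_map (underlying (orbit_space k X \<theta>)) (underlying X) s \<and>
     (\<forall>p\<in>points (orbit_space k X \<theta>). orbit_map k \<theta> (s p) = p)"

end

theory Submission
  imports Defs "HOL-Library.Function_Algebras"
begin

text \<open>Smooth functions near a point of a locally standard manifold are controlled by the coordinates
\<open>\<zeta>\<^sub>1,\<dots>,\<zeta>\<^sub>k\<close> of a standard chart, on which the torus acts by an automorphism followed by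
coordinatewise multiplication; a free direction is a coordinate of modulus one. Two division theorems
carry the local part: a smooth function of weight one under the \<open>j\<close>th circle is \<open>\<zeta>\<^sub>j\<close> times a smooth
function, and a smooth invariant function that vanishes where \<open>\<zeta>\<^sub>j = 0\<close> is \<open>|\<zeta>\<^sub>j|\<^sup>2\<close> times a smooth
function. Both follow from Hadamard's lemma and from the fact that a function of a plane which is
even in the appropriate sense is a smooth function of the squared radius.

The map \<open>lam = s\<^sub>2 \<circ> \<Phi> \<circ> \<pi>\<^sub>1\<close> is continuous, constant on orbits, preserves isotropy groups, and the orbit
coordinates \<open>|\<zeta>\<^sub>i|\<^sup>2\<close> and the real coordinates of its values are smooth. Comparing isotropy groups pairs the
vanishing coordinates of a chart of \<open>M\<^sub>1\<close> with those of a chart of \<open>M\<^sub>2\<close>, up to complex conjugation, and the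
quotient \<open>g\<close> of the two squared moduli is smooth and positive. Hence \<open>\<zeta>\<^sub>j \<cdot> sqrt g\<close> is the \<open>i\<close>th coordinate
of a smooth equivariant map over \<open>\<Phi>\<close>: these maps exist near every point (\<open>local_lift\<close>), and
two of them differ by a smooth invariant map into the torus (\<open>compare\<close>).

The sections make the local lifts fit together. On the free orbits they give an equivariant
map \<open>base\<close>, and a local lift over a box in the orbit coordinates is \<open>cis g\<close> times
\<open>base\<close> for continuous invariant angles \<open>g\<close>, because the free part of the box is convex. The angles of two
local lifts differ by a function that extends smoothly over the non-free orbits. Averaging the angles with a
partition of unity therefore changes each local lift by a smooth torus-valued function and yields one global
smooth equivariant map over \<open>\<Phi>\<close> (\<open>smooth_lift_exists\<close>). Such maps exist in both directions; their composite is, locally,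
multiplication by a smooth invariant torus-valued function, so each of them has a smooth inverse.\<close>

section \<open>Functions of class C^r in finitely many coordinates\<close>

abbreviation R_vecs :: "nat => (nat => real) set" where
"R_vecs n \<equiv> topspace (Euclidean_space n)"

abbreviation openR :: "nat => (nat => real) set => bool" where
"openR n \<equiv> openin (Euclidean_space n)"

lemma Euclidean_space_eq_top_of_set:
"Euclidean_space n = top_of_set {x. \<forall>i\<ge>n. x i = 0}"
unfolding Euclidean_space_def by (simp add: euclidean_product_topology)

lemma openR_iff: "openR n U \<longleftrightarrow> (EX T. open T & U = R_vecs n \<inter> T)"
unfolding Euclidean_space_eq_top_of_set by (simp add: openin_open)

lemma openR_preimage:
fixes g :: "(nat => real) => 'b::topological_space"
assumes "openR n U" "continuous_on U g" "open T"
shows "openR n {x\<in>U. g x:T}"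
proof -
have "openin (top_of_set U) (U \<inter> g -` T)"
 using assms continuous_openin_preimage_gen by blast
moreover have "openin (top_of_set {x. \<forall>i\<ge>n. x i = 0}) U"
 using assms(1) by (simp add: Euclidean_space_eq_top_of_set)
ultimately have "openin (top_of_set {x. \<forall>i\<ge>n. x i = 0}) (U \<inter> g -` T)"
 using openin_trans by blast
moreover have "{x\<in>U. g x:T} = U \<inter> g -` T" by auto
ultimately show ?thesis by (simp add: Euclidean_space_eq_top_of_set)
qed

lemma openR_preimage_coordinatewise:
assumes "openR n U" "!!j. j < b ==> continuous_on U (%x. g x j)"
 "!!x. x:U ==> g x:R_vecs b" "openR b V"
shows "openR n {x\<in>U. g x:V}"
proof -
obtain T where T: "open T" "V = R_vecs b \<inter> T"
 using assms(4) unfolding openR_iff by blast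
have "continuous_on U g"
proof (rule continuous_on_coordinatewise_then_product)
 fix j show "continuous_on U (%x. g x j)"
 proof (cases "j < b")
 case False
 hence "g x j = 0" if "x:U" for x
  using assms(3)[OF that] by (auto simp: topspace_Euclidean_space)
 thus ?thesis by (simp cong: continuous_on_cong)
 qed (use assms in auto)
qed
hence "openR n {x\<in>U. g x:T}" using openR_preimage assms(1) T by blast
moreover have "{x\<in>U. g x:V} = {x\<in>U. g x:T}" using assms(3) T by auto
ultimately show ?thesis by simp
qed

lemma continuous_on_R_vecs_coordinatewise:
assumes "!!j. j < b ==> continuous_on U (%x. g x j)" "!!x. x:U ==> g x:R_vecs b"
shows "continuous_on U g"
proof (rule continuous_on_coordinatewise_then_product)
fix j show "continuous_on U (%x. g x j)"
proof (cases "j < b")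
 case False
 hence "g x j = 0" if "x:U" for x
 using assms(2)[OF that] by (auto simp: topspace_Euclidean_space)
 thus ?thesis by (simp cong: continuous_on_cong)
qed (use assms in auto)
qed

lemma continuous_on_upd: "continuous_on T (%t::real. x(i := t))"
proof (rule continuous_on_coordinatewise_then_product)
fix j show "continuous_on T (%t::real. (x(i := t)) j)" by (cases "j = i") auto
qed

lemma open_upd_preimage:
assumes "openR n U" "x:R_vecs n" "i < n"
shows "open {t. x(i := t):U}"
proof -
obtain T where T: "open T" "U = R_vecs n \<inter> T"
 using assms(1) unfolding openR_iff by blast
have "open ((%t. x(i := t)) -` T)"
 by (rule open_vimage[OF T(1) continuous_on_upd])
moreover have "{t. x(i := t):U} = (%t. x(i := t)) -` T"
 using assms T by (auto simp: topspace_Euclidean_space)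
ultimately show ?thesis by simp
qed

lemma eventually_upd_in:
assumes "openR n U" "x:U" "i < n"
shows "\<forall>\<^sub>F t in nhds (x i). x(i := t):U"
proof -
have "x:R_vecs n" using assms(1,2) openin_subset by blast
hence "open {t. x(i := t):U}" "x i:{t. x(i := t):U}"
 using open_upd_preimage[OF assms(1) _ assms(3)] assms(2) by simp_all
from eventually_nhds_in_open[OF this] show ?thesis by simp
qed

text \<open>Every open subset of \<open>\<real>\<^sup>n\<close> contains a coordinate box around each of its points.\<close>

lemma openR_contains_box:
assumes "openR n U" "x:U"
obtains de where "de > 0" "!!y. y:R_vecs n ==> (!!j. j < n ==> \<bar>y j - x j\<bar> < de) ==> y:U"
proof -
obtain T where T: "open T" "U = R_vecs n \<inter> T"
 using assms(1) unfolding openR_iff by blast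
have "openin (powertop_real UNIV) T" "x:T"
 using T assms(2) by (simp_all add: euclidean_product_topology)
from product_topology_open_contains_basis[OF this]
obtain X where X: "x:(\<Pi>\<^sub>E i\<in>UNIV. X i)" "ALL i. open (X i)" "(\<Pi>\<^sub>E i\<in>UNIV. X i) \<subseteq> T" by force
have "x i:X i" for i using X(1) by (auto simp: PiE_iff)
hence "ALL i. \<exists>d>0. ball (x i) d \<subseteq> X i" using X(2) by (meson open_contains_ball)
then obtain d where d: "!!i. d i > 0" "!!i. ball (x i) (d i) \<subseteq> X i" by metis
define de where "de = Min (insert 1 (d ` {..<n}))"
have "de > 0" unfolding de_def using d by (subst Min_gr_iff) auto
moreover have "y:U" if y: "y:R_vecs n" "!!j. j < n ==> \<bar>y j - x j\<bar> < de" for y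
proof -
 have "y j:X j" for j
 proof (cases "j < n")
 case True
 hence "de \<le> d j" unfolding de_def by auto
 hence "y j:ball (x j) (d j)" using y(2)[OF True] by (auto simp: dist_real_def)
 thus ?thesis using d by blast
 next
 case False
 hence "y j = 0" "x j = 0"
  using y(1) assms openin_subset[OF assms(1)] by (auto simp: topspace_Euclidean_space)
 thus ?thesis using d(1)[of j] d(2)[of j] by auto
 qed
 hence "y:T" using X(3) by (auto simp: PiE_iff)
 thus ?thesis using T(2) y(1) by simp
qed
ultimately show ?thesis using that by blast
qed

lemma openR_box:
assumes "x:R_vecs n"
shows "openR n {y:R_vecs n. ALL j<n. \<bar>y j - x j\<bar> < de}"
proof -
have "open {y. ALL j:{..<n}. \<bar>y j - x j\<bar> < de}"
proof (cases "n = 0")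
 case False
 have "open (\<Inter>j\<in>{..<n}. {y::nat=>real. \<bar>y j - x j\<bar> < de})"
 by (intro open_INT ballI finite_lessThan open_Collect_less continuous_intros
  continuous_on_product_then_coordinatewise[OF continuous_on_id])
 moreover have "(\<Inter>j\<in>{..<n}. {y::nat=>real. \<bar>y j - x j\<bar> < de}) = {y. ALL j:{..<n}. \<bar>y j - x j\<bar> < de}" by auto
 ultimately show ?thesis by simp
qed auto
thus ?thesis unfolding openR_iff
 by (auto intro!: exI[of _ "{y. ALL j:{..<n}. \<bar>y j - x j\<bar> < de}"])
qed

lemma C_k_on_imp_continuous: "C_k_on n r U f ==> continuous_on U f"
by (cases r) auto

lemma C_k_on_Suc_imp: "C_k_on n (Suc r) U f ==> C_k_on n r U f"
by (induction r arbitrary: f) (auto intro: C_k_on_imp_continuous)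

lemma C_k_on_has_partial:
assumes "C_k_on n (Suc r) U f" "x(i := t):U" "i < n"
shows "((%t. f (x(i := t))) has_real_derivative partial_deriv i f (x(i := t))) (at t)"
proof -
define y where "y = x(i := t)"
have "(%s. f (y(i := s))) differentiable (at (y i))"
 using assms by (auto simp: y_def[symmetric])
hence "((%s. f (y(i := s))) has_real_derivative partial_deriv i f y) (at (y i))"
 unfolding partial_deriv_def using DERIV_deriv_iff_real_differentiable by blast
moreover have "y(i := s) = x(i := s)" "y i = t" for s by (simp_all add: y_def)
ultimately show ?thesis unfolding y_def by simp
qed

lemma C_k_on_has_partial_at:
assumes "C_k_on n (Suc r) U f" "x:U" "i < n"
shows "((%t. f (x(i := t))) has_real_derivative partial_deriv i f x) (at (x i))"
using C_k_on_has_partial[OF assms(1), of x i "x i"] assms by simp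

lemma eventually_eq_upd:
assumes "openR n U" "!!x. x:U ==> f x = g x" "x:U" "i < n"
shows "\<forall>\<^sub>F t in nhds (x i). f (x(i := t)) = g (x(i := t))"
using eventually_upd_in[OF assms(1,3,4)] by eventually_elim (use assms in auto)

lemma C_k_on_cong:
assumes "openR n U" "!!x. x:U ==> f x = g x" "C_k_on n r U f"
shows "C_k_on n r U g"
using assms(2,3)
proof (induction r arbitrary: f g)
case 0
thus ?case by (simp cong: continuous_on_cong)
next
case (Suc r)
have pd: "partial_deriv i f x = partial_deriv i g x" if "x:U" "i < n" for x i
 unfolding partial_deriv_def
 by (rule deriv_cong_ev[OF eventually_eq_upd[OF assms(1)]]) (use Suc that in auto)
have "(%t. g (x(i := t))) differentiable (at (x i))" if "x:U" "i < n" for x i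
proof -
 have "((%t. f (x(i := t))) has_real_derivative partial_deriv i f x) (at (x i))"
 using C_k_on_has_partial_at Suc.prems that by blast
 hence "((%t. g (x(i := t))) has_real_derivative partial_deriv i f x) (at (x i))"
 by (subst DERIV_cong_ev[OF refl eventually_eq_upd[OF assms(1), of g f] refl])
  (use Suc.prems that in auto)
 thus ?thesis using real_differentiable_def by blast
qed
moreover have "continuous_on U g" using Suc.prems by (simp cong: continuous_on_cong)
moreover have "C_k_on n r U (partial_deriv i g)" if "i < n" for i
 using Suc.IH[of "partial_deriv i f"] pd Suc.prems that by simp
ultimately show ?case by simp
qed

lemma C_k_on_SucI:
assumes "openR n U" "continuous_on U f"
 "!!i x. i < n ==> x:U ==> ((%t. f (x(i := t))) has_real_derivative f' i x) (at (x i))"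
 "!!i. i < n ==> C_k_on n r U (f' i)"
shows "C_k_on n (Suc r) U f"
proof -
have "C_k_on n r U (partial_deriv i f)" if "i < n" for i
proof (rule C_k_on_cong[OF assms(1) _ assms(4)[OF that]])
 show "f' i x = partial_deriv i f x" if "x:U" for x
 unfolding partial_deriv_def using DERIV_imp_deriv[OF assms(3)[OF \<open>i < n\<close> that]] by simp
qed
thus ?thesis using assms(2,3) by (auto simp: real_differentiable_def)
qed

lemma C_k_on_mono: "C_k_on n r U f ==> V \<subseteq> U ==> C_k_on n r V f"
proof (induction r arbitrary: f)
case 0 thus ?case using continuous_on_subset[of U f V] by simp
next
case (Suc r) thus ?case using continuous_on_subset[of U f V] by auto
qed

lemma C_k_on_const: "openR n U ==> C_k_on n r U (%x. c)"
proof (induction r arbitrary: c)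
case (Suc r)
show ?case
 by (rule C_k_on_SucI[where f' = "%i x. 0"]) (use Suc.IH Suc.prems in simp_all)
qed simp

lemma C_k_on_coord: "openR n U ==> C_k_on n r U (%x. x i)"
proof (cases r)
case 0 thus ?thesis by (auto intro: continuous_on_product_then_coordinatewise)
next
case (Suc r)
assume U: "openR n U"
show ?thesis unfolding Suc
proof (rule C_k_on_SucI[where f' = "%j x. if j = i then 1 else 0", OF U])
 show "continuous_on U (%x. x i)"
 by (rule continuous_on_product_then_coordinatewise[OF continuous_on_id])
 show "((%t. (x(j := t)) i) has_real_derivative (if j = i then 1 else 0)) (at (x j))" for j x
 by (cases "j = i") auto
qed (rule C_k_on_const[OF U])
qed

lemma C_k_on_add:
assumes "openR n U" shows "C_k_on n r U f ==> C_k_on n r U g ==> C_k_on n r U (%x. f x + g x)"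
proof (induction r arbitrary: f g)
case 0 thus ?case by (auto intro: continuous_intros)
next
case (Suc r)
show ?case
proof (rule C_k_on_SucI[where f' = "%i x. partial_deriv i f x + partial_deriv i g x"])
 show "continuous_on U (%x. f x + g x)" using Suc.prems by (auto intro: continuous_intros)
 fix i x assume ix: "i < n" "x:U"
 show "((%t. f (x(i := t)) + g (x(i := t))) has_real_derivative
 partial_deriv i f x + partial_deriv i g x) (at (x i))"
 by (rule DERIV_add[OF C_k_on_has_partial_at[OF Suc.prems(1) ix(2,1)]
  C_k_on_has_partial_at[OF Suc.prems(2) ix(2,1)]])
qed (use assms Suc in auto)
qed

lemma C_k_on_mult:
assumes "openR n U" shows "C_k_on n r U f ==> C_k_on n r U g ==> C_k_on n r U (%x. f x * g x)"
proof (induction r arbitrary: f g)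
case 0 thus ?case by (auto intro: continuous_intros)
next
case (Suc r)
note fg = C_k_on_Suc_imp[OF Suc.prems(1)] C_k_on_Suc_imp[OF Suc.prems(2)]
show ?case
proof (rule C_k_on_SucI[where f' = "%i x. partial_deriv i f x * g x + partial_deriv i g x * f x"])
 show "continuous_on U (%x. f x * g x)" using Suc.prems by (auto intro: continuous_intros)
 fix i x assume ix: "i < n" "x:U"
 show "((%t. f (x(i := t)) * g (x(i := t))) has_real_derivative
 partial_deriv i f x * g x + partial_deriv i g x * f x) (at (x i))"
 using DERIV_mult[OF C_k_on_has_partial_at[OF Suc.prems(1) ix(2,1)]
  C_k_on_has_partial_at[OF Suc.prems(2) ix(2,1)]] by (simp only: fun_upd_triv)
next
 fix i assume "i < n"
 thus "C_k_on n r U (%x. partial_deriv i f x * g x + partial_deriv i g x * f x)"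
 using Suc fg by (intro C_k_on_add[OF assms] Suc.IH) auto
qed (use assms in auto)
qed

lemma C_k_on_sum:
assumes "openR n U" "finite I" "!!j. j:I ==> C_k_on n r U (f j)"
shows "C_k_on n r U (%x. \<Sum>j\<in>I. f j x)"
using assms(2,3)
by (induction I rule: finite_induct) (auto intro: C_k_on_const C_k_on_add assms(1))

text \<open>
The chain rule along a curve: change the coordinates of the curve one at a time, and apply the
mean value theorem to each change; continuity of the partial derivatives does the rest.
\<close>

lemma C_k_on_chain:
fixes gmm :: "real => nat => real"
assumes V: "openR b V" and f: "C_k_on b (Suc 0) V f"
 and gmm: "!!t. gmm t:R_vecs b" "gmm t0:V"
 and dgmm: "!!j. j < b ==> ((%t. gmm t j) has_real_derivative gmm' j) (at t0)"
shows "((%t. f (gmm t)) has_real_derivative (\<Sum>j<b. partial_deriv j f (gmm t0) * gmm' j)) (at t0)"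
proof -
define mix where "mix m t = (%j. if j < m then gmm t j else gmm t0 j)" for m t
have mix0: "mix m t0 = gmm t0" for m by (auto simp: mix_def)
have mixb: "mix b t = gmm t" for t
 using gmm(1) by (auto simp: mix_def topspace_Euclidean_space fun_eq_iff)
have mixR: "mix m t:R_vecs b" for m t
 using gmm(1) by (auto simp: mix_def topspace_Euclidean_space)
have "m \<le> b ==> ((%t. f (mix m t)) has_real_derivative (\<Sum>j<m. partial_deriv j f (gmm t0) * gmm' j)) (at t0)" for m
proof (induction m)
 case 0
 have "mix 0 t = gmm t0" for t by (auto simp: mix_def)
 thus ?case by simp
next
 case (Suc m)
 hence m: "m < b" by simp
 define p where "p = partial_deriv m f"
 have p: "continuous_on V p" using f m by (simp add: p_def)
 have S: "mix (Suc m) t = (mix m t)(m := gmm t m)" for t by (auto simp: mix_def fun_eq_iff)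
 have S0: "(mix m t)(m := gmm t0 m) = mix m t" for t by (auto simp: mix_def fun_eq_iff)
 let ?D = "%t. f (mix (Suc m) t) - f (mix m t)"
 \<comment> \<open>an intermediate point for the change of the \<open>m\<close>th coordinate\<close>
 have "EX q. (ALL t. ?D t = q t * (gmm t m - gmm t0 m) ) & isCont q t0 & q t0 = p (gmm t0)"
 proof -
 define q where "q t = (if gmm t m = gmm t0 m then p (gmm t0) else ?D t / (gmm t m - gmm t0 m))" for t
 have "?D t = q t * (gmm t m - gmm t0 m)" for t
  using S S0 by (auto simp: q_def)
 moreover have "q t0 = p (gmm t0)" by (simp add: q_def)
 moreover have "(q \<longlongrightarrow> p (gmm t0)) (at t0)"
 proof (rule tendstoI)
  fix e :: real assume "e > 0"
  have "openR b {x\<in>V. p x:ball (p (gmm t0)) e}" by (rule openR_preimage[OF V p]) simp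
  moreover have "gmm t0:{x\<in>V. p x:ball (p (gmm t0)) e}" using gmm \<open>e > 0\<close> by simp
  ultimately obtain de where de: "de > 0" "!!y. y:R_vecs b ==>
   (!!j. j < b ==> \<bar>y j - gmm t0 j\<bar> < de) ==> y:V & p y:ball (p (gmm t0)) e"
  using openR_contains_box by (smt (verit, ccfv_SIG) mem_Collect_eq)
  have "\<forall>\<^sub>F t in at t0. ALL j:{..<b}. \<bar>gmm t j - gmm t0 j\<bar> < de"
  proof (intro eventually_ball_finite finite_lessThan ballI)
  fix j assume "j:{..<b}"
  hence "((%t. gmm t j) \<longlongrightarrow> gmm t0 j) (at t0)"
   using dgmm[of j] DERIV_isCont isContD by blast
  thus "\<forall>\<^sub>F t in at t0. \<bar>gmm t j - gmm t0 j\<bar> < de"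
   using de(1) tendstoD by (fastforce simp: dist_real_def)
  qed
  thus "\<forall>\<^sub>F t in at t0. dist (q t) (p (gmm t0)) < e"
  proof eventually_elim
  case (elim t)
  show ?case
  proof (cases "gmm t m = gmm t0 m")
   case True thus ?thesis using \<open>e > 0\<close> by (simp add: q_def)
  next
   case False
   have box: "(mix m t)(m := s):V & p ((mix m t)(m := s)):ball (p (gmm t0)) e"
   if "\<bar>s - gmm t0 m\<bar> \<le> \<bar>gmm t m - gmm t0 m\<bar>" for s
   proof (rule de(2))
   show "(mix m t)(m := s):R_vecs b" using mixR m by (auto simp: topspace_Euclidean_space)
   fix j assume "j < b"
   thus "\<bar>((mix m t)(m := s)) j - gmm t0 j\<bar> < de"
    using elim that m de(1) by (force simp: mix_def)
   qed
   define h where "h s = f ((mix m t)(m := s))" for s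
   have hd: "(h has_real_derivative p ((mix m t)(m := s))) (at s)"
   if "\<bar>s - gmm t0 m\<bar> \<le> \<bar>gmm t m - gmm t0 m\<bar>" for s
   unfolding h_def p_def using C_k_on_has_partial[OF f _ m] box[OF that] by blast
   have "EX s. \<bar>s - gmm t0 m\<bar> \<le> \<bar>gmm t m - gmm t0 m\<bar> &
    h (gmm t m) - h (gmm t0 m) = (gmm t m - gmm t0 m) * p ((mix m t)(m := s))"
   proof (cases "gmm t0 m < gmm t m")
   case True
   thus ?thesis using MVT2[OF True, of h "%s. p ((mix m t)(m := s))"] hd
    by (smt (verit))
   next
   case 2: False
   hence lt: "gmm t m < gmm t0 m" using False by simp
   obtain s where s: "gmm t m < s" "s < gmm t0 m"
    "h (gmm t0 m) - h (gmm t m) = (gmm t0 m - gmm t m) * p ((mix m t)(m := s))"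
    using MVT2[OF lt, of h "%s. p ((mix m t)(m := s))"] hd by (smt (verit))
   show ?thesis
    by (rule exI[of _ s]) (use s in \<open>auto simp: algebra_simps\<close>)
   qed
   then obtain s where s: "\<bar>s - gmm t0 m\<bar> \<le> \<bar>gmm t m - gmm t0 m\<bar>"
    "h (gmm t m) - h (gmm t0 m) = (gmm t m - gmm t0 m) * p ((mix m t)(m := s))" by blast
   have "?D t = (gmm t m - gmm t0 m) * p ((mix m t)(m := s))"
   using s(2) unfolding h_def S S0 .
   hence "q t = p ((mix m t)(m := s))" using False by (simp add: q_def)
   thus ?thesis using box[OF s(1)] by (simp add: dist_commute)
  qed
  qed
 qed
 ultimately show ?thesis unfolding isCont_def by metis
 qed
 then obtain q where q: "!!t. ?D t = q t * (gmm t m - gmm t0 m)" "isCont q t0" "q t0 = p (gmm t0)" by blast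
 have "(?D has_real_derivative p (gmm t0) * gmm' m) (at t0)"
 proof -
 obtain g where g: "ALL z. gmm z m - gmm t0 m = g z * (z - t0)" "isCont g t0" "g t0 = gmm' m"
  using dgmm[OF m] unfolding CARAT_DERIV by blast
 show ?thesis unfolding CARAT_DERIV
  by (rule exI[of _ "%z. q z * g z"]) (use g q mix0 in \<open>auto intro!: continuous_intros\<close>)
 qed
 from DERIV_add[OF Suc.IH this] m show ?case by (simp add: p_def)
qed
from this[of b] show ?thesis by (simp add: mixb)
qed

lemma C_k_on_comp:
assumes "openR a U" "openR b V" "!!x. x:U ==> G x:V"
shows "C_k_on b r V f ==> (!!j. j < b ==> C_k_on a r U (%x. G x j)) ==> C_k_on a r U (%x. f (G x))"
proof (induction r arbitrary: f)
case 0
have "continuous_on U G"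
 by (rule continuous_on_R_vecs_coordinatewise[where b = b])
 (use 0 assms(3) openin_subset[OF assms(2)] in auto)
thus ?case using 0(1) assms(3) continuous_on_compose2[of V f U G] by auto
next
case (Suc r)
have G: "C_k_on a r U (%x. G x j)" if "j < b" for j
 using C_k_on_Suc_imp Suc.prems that by blast
have Gc: "continuous_on U G"
 by (rule continuous_on_R_vecs_coordinatewise[where b = b])
 (use C_k_on_imp_continuous[OF G] assms(3) openin_subset[OF assms(2)] in auto)
have f1: "C_k_on b (Suc 0) V f" using Suc.prems(1) C_k_on_imp_continuous by fastforce
define D where "D i x = (\<Sum>j<b. partial_deriv j f (G x) * partial_deriv i (%x. G x j) x)" for i x
have cont: "continuous_on U (%x. f (G x))"
 using Gc assms(3) continuous_on_compose2[OF C_k_on_imp_continuous[OF Suc.prems(1)], of U G] by auto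
have der: "((%t. f (G (x(i := t)))) has_real_derivative D i x) (at (x i))"
 if ix: "i < a" "x:U" for i x
proof -
 \<comment> \<open>off \<open>U\<close> the curve is modified to stay in the ambient space\<close>
 define gmm where "gmm t = (if x(i := t):U then G (x(i := t)) else G x)" for t
 have ev: "\<forall>\<^sub>F t in nhds (x i). gmm t = G (x(i := t))"
 using eventually_upd_in[OF assms(1) ix(2,1)] by eventually_elim (simp add: gmm_def)
 have gmm0: "gmm (x i) = G x" using ix by (simp add: gmm_def)
 have gmmV: "gmm t:V" for t using assms(3) ix by (simp add: gmm_def)
 have dgmm: "((%t. gmm t j) has_real_derivative partial_deriv i (%x. G x j) x) (at (x i))" if "j < b" for j
 proof -
 have ev2: "\<forall>\<^sub>F t in nhds (x i). gmm t j = G (x(i := t)) j"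
  using ev by eventually_elim simp
 have "((%t. G (x(i := t)) j) has_real_derivative partial_deriv i (%x. G x j) x) (at (x i))"
  by (rule C_k_on_has_partial_at[OF Suc.prems(2)[OF that] ix(2,1)])
 thus ?thesis by (rule DERIV_cong_ev[OF refl ev2 refl, THEN iffD2])
 qed
 have 1: "((%t. f (gmm t)) has_real_derivative D i x) (at (x i))"
 using C_k_on_chain[OF assms(2) f1, of gmm "x i", OF _ gmmV dgmm] openin_subset[OF assms(2)] gmmV
 unfolding D_def gmm0 by blast
 have ev2: "\<forall>\<^sub>F t in nhds (x i). f (gmm t) = f (G (x(i := t)))"
 using ev by eventually_elim simp
 show ?thesis by (rule DERIV_cong_ev[OF refl ev2 refl, THEN iffD1, OF 1])
qed
have ck: "C_k_on a r U (D i)" if i: "i < a" for i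
proof -
 have "C_k_on a r U (%x. partial_deriv j f (G x) * partial_deriv i (%x. G x j) x)" if "j < b" for j
 proof (rule C_k_on_mult[OF assms(1)])
 have "C_k_on b r V (partial_deriv j f)" using Suc.prems(1) that by simp
 from Suc.IH[OF this G] show "C_k_on a r U (%x. partial_deriv j f (G x))" .
 show "C_k_on a r U (partial_deriv i (%x. G x j))" using Suc.prems(2)[OF that] i by simp
 qed
 hence "C_k_on a r U (%x. \<Sum>j<b. partial_deriv j f (G x) * partial_deriv i (%x. G x j) x)"
 by (intro C_k_on_sum assms(1) finite_lessThan) simp
 thus ?thesis unfolding D_def .
qed
show ?case by (rule C_k_on_SucI[OF assms(1) cont der ck])
qed

text \<open>Post-composition with a function of one variable.\<close>

lemma C_k_on_comp_real:
assumes "openR n U" "C_k_on n (Suc r) U g" "!!x. x:U ==> g x:T"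
 "!!t. t:T ==> (ph has_real_derivative ph' t) (at t)" "C_k_on n r U (%x. ph' (g x))"
shows "C_k_on n (Suc r) U (%x. ph (g x))"
proof (rule C_k_on_SucI[where f' = "%i x. ph' (g x) * partial_deriv i g x"])
have "continuous_on T ph"
 by (rule continuous_at_imp_continuous_on) (use assms(4) DERIV_isCont in blast)
thus "continuous_on U (%x. ph (g x))"
 by (rule continuous_on_compose2[OF _ C_k_on_imp_continuous[OF assms(2)]]) (use assms(3) in auto)
fix i x assume ix: "i < n" "x:U"
show "((%t. ph (g (x(i := t)))) has_real_derivative ph' (g x) * partial_deriv i g x) (at (x i))"
 using DERIV_chain2[of ph "ph' (g x)" "%t. g (x(i := t))" "x i", OF _ C_k_on_has_partial_at[OF assms(2) ix(2,1)]]
 assms(4)[OF assms(3)[OF ix(2)]] by (simp only: fun_upd_triv)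
next
show "C_k_on n r U (%x. ph' (g x) * partial_deriv i g x)" if "i < n" for i
 using C_k_on_mult[OF assms(1,5)] assms(2) that by simp
qed (rule assms(1))

definition Cinf_on :: "nat => (nat => real) set => ((nat => real) => real) => bool" where
"Cinf_on n U f \<longleftrightarrow> (ALL r. C_k_on n r U f)"

lemma Cinf_on_const: "openR n U ==> Cinf_on n U (%x. c)"
unfolding Cinf_on_def by (rule allI) (rule C_k_on_const)

lemma Cinf_on_coord: "openR n U ==> Cinf_on n U (%x. x i)"
unfolding Cinf_on_def by (rule allI) (rule C_k_on_coord)

lemma Cinf_on_add: "openR n U ==> Cinf_on n U f ==> Cinf_on n U g ==> Cinf_on n U (%x. f x + g x)"
unfolding Cinf_on_def by (intro allI C_k_on_add) simp_all

lemma Cinf_on_mult: "openR n U ==> Cinf_on n U f ==> Cinf_on n U g ==> Cinf_on n U (%x. f x * g x)"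
unfolding Cinf_on_def by (intro allI C_k_on_mult) simp_all

lemma Cinf_on_mono: "Cinf_on n U f ==> V \<subseteq> U ==> Cinf_on n V f"
unfolding Cinf_on_def using C_k_on_mono by metis

lemma Cinf_on_comp:
assumes "openR a U" "openR b V" "!!x. x:U ==> G x:V" "Cinf_on b V f"
 "!!j. j < b ==> Cinf_on a U (%x. G x j)"
shows "Cinf_on a U (%x. f (G x))"
unfolding Cinf_on_def
proof
fix r
have f: "C_k_on b r V f" using assms(4) unfolding Cinf_on_def by (rule spec)
have G: "C_k_on a r U (%x. G x j)" if "j < b" for j
 using assms(5)[OF that] unfolding Cinf_on_def by (rule spec)
show "C_k_on a r U (%x. f (G x))"
 by (rule C_k_on_comp[OF assms(1,2) assms(3) f G])
qed

lemma Cinf_on_imp_continuous: "Cinf_on n U f ==> continuous_on U f"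
unfolding Cinf_on_def by (metis C_k_on.simps(1))

lemma Cinf_on_partial: "Cinf_on n U f ==> i < n ==> Cinf_on n U (partial_deriv i f)"
unfolding Cinf_on_def by (metis C_k_on.simps(2))

lemma Cinf_on_has_partial:
assumes "Cinf_on n U f" "x(i := t):U" "i < n"
shows "((%t. f (x(i := t))) has_real_derivative partial_deriv i f (x(i := t))) (at t)"
proof -
have "C_k_on n (Suc 0) U f" using assms(1) unfolding Cinf_on_def by (rule spec)
from C_k_on_has_partial[OF this assms(2,3)] show ?thesis .
qed

lemma Cinf_on_imp_C_k_on: "Cinf_on n U f ==> C_k_on n r U f"
unfolding Cinf_on_def by (rule spec)

lemma Cinf_on_inverse:
assumes U: "openR n U" and f: "Cinf_on n U f" and f0: "!!x. x:U ==> f x ~= 0"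
shows "Cinf_on n U (%x. inverse (f x))"
unfolding Cinf_on_def
proof
fix r show "C_k_on n r U (%x. inverse (f x))"
proof (induction r)
 case 0 show ?case using continuous_on_inverse[OF Cinf_on_imp_continuous[OF f]] f0 by simp
next
 case (Suc r)
 have 1: "f x:-{0}" if "x:U" for x using f0[OF that] by simp
 have 2: "(inverse has_real_derivative (-1) * (inverse t * inverse t)) (at t)" if "t:-{0}" for t :: real
 using DERIV_inverse[of t] that by (simp add: power2_eq_square)
 have 3: "C_k_on n r U (%x. (-1) * (inverse (f x) * inverse (f x)))"
 by (intro C_k_on_mult C_k_on_const U Suc)
 show ?case
 by (rule C_k_on_comp_real[OF U Cinf_on_imp_C_k_on[OF f] 1 2 3])
qed
qed

lemma Cinf_on_sqrt:
assumes U: "openR n U" and f: "Cinf_on n U f" and f0: "!!x. x:U ==> f x > 0"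
shows "Cinf_on n U (%x. sqrt (f x))"
unfolding Cinf_on_def
proof
fix r show "C_k_on n r U (%x. sqrt (f x))"
proof (induction r)
 case 0 show ?case using continuous_on_real_sqrt[OF Cinf_on_imp_continuous[OF f]] by simp
next
 case (Suc r)
 have fne: "f x ~= 0" if "x:U" for x using f0[OF that] by simp
 have 1: "f x:{0<..}" if "x:U" for x using f0[OF that] by simp
 have 2: "(sqrt has_real_derivative sqrt t * inverse t * (1/2)) (at t)" if "t:{0<..}" for t
 proof -
 have "inverse (sqrt t) = sqrt t * inverse t"
  using real_div_sqrt[of t] that by (simp add: field_simps)
 thus ?thesis using DERIV_real_sqrt[of t] that by simp
 qed
 have 3: "C_k_on n r U (%x. sqrt (f x) * inverse (f x) * (1/2))"
 by (intro C_k_on_mult C_k_on_const U Suc Cinf_on_imp_C_k_on[OF Cinf_on_inverse[OF U f fne]])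
 show ?case by (rule C_k_on_comp_real[OF U Cinf_on_imp_C_k_on[OF f] 1 2 3])
qed
qed

lemma Cinf_on_arctan:
assumes U: "openR n U" and f: "Cinf_on n U f"
shows "Cinf_on n U (%x. arctan (f x))"
unfolding Cinf_on_def
proof
fix r show "C_k_on n r U (%x. arctan (f x))"
proof (cases r)
 case 0 show ?thesis unfolding 0 using continuous_on_arctan[OF Cinf_on_imp_continuous[OF f]] by simp
next
 case (Suc r)
 have "1 + f x * f x ~= 0" for x
 using zero_le_square[of "f x"] by linarith
 hence "Cinf_on n U (%x. inverse (1 + f x * f x))"
 by (intro Cinf_on_inverse Cinf_on_add Cinf_on_mult Cinf_on_const U f)
 note 3 = Cinf_on_imp_C_k_on[OF this]
 have 2: "(arctan has_real_derivative inverse (1 + t * t)) (at t)" if "t:UNIV" for t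
 using DERIV_arctan[of t] by (simp add: power2_eq_square)
 show ?thesis unfolding Suc by (rule C_k_on_comp_real[OF U Cinf_on_imp_C_k_on[OF f] UNIV_I 2 3])
qed
qed

lemma Cinf_on_sin_cos:
assumes U: "openR n U" and f: "Cinf_on n U f"
shows Cinf_on_sin: "Cinf_on n U (%x. sin (f x))" and Cinf_on_cos: "Cinf_on n U (%x. cos (f x))"
proof -
have *: "C_k_on n r U (%x. sin (f x)) & C_k_on n r U (%x. cos (f x))" for r
proof (induction r)
 case 0 show ?case using continuous_on_sin continuous_on_cos Cinf_on_imp_continuous[OF f] by auto
next
 case (Suc r)
 hence s: "C_k_on n r U (%x. (-1) * sin (f x))" and c: "C_k_on n r U (%x. cos (f x))"
 using C_k_on_mult[OF U C_k_on_const[OF U]] by blast+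
 have ds: "(sin has_real_derivative cos t) (at t)" if "t:UNIV" for t by (rule DERIV_sin)
 have dc: "(cos has_real_derivative (-1) * sin t) (at t)" if "t:UNIV" for t
 using DERIV_cos[of t] by simp
 show ?case using C_k_on_comp_real[OF U Cinf_on_imp_C_k_on[OF f] UNIV_I ds c]
 C_k_on_comp_real[OF U Cinf_on_imp_C_k_on[OF f] UNIV_I dc s] by blast
qed
show "Cinf_on n U (%x. sin (f x))" "Cinf_on n U (%x. cos (f x))"
 using * unfolding Cinf_on_def by blast+
qed

section \<open>Functions with smooth local extensions\<close>

lemma smooth_on_iff:
"smooth_on n S f \<longleftrightarrow>
 (ALL x:S. EX U g. openR n U & x:U & Cinf_on n U g & (ALL y:S \<inter> U. f y = g y))"
unfolding smooth_on_def Cinf_on_def ..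

lemma smooth_onE:
assumes "smooth_on n S f" "x:S"
obtains U g where "openR n U" "x:U" "Cinf_on n U g" "!!y. y:S ==> y:U ==> f y = g y"
proof -
have "EX U g. openR n U & x:U & Cinf_on n U g & (ALL y:S \<inter> U. f y = g y)"
 using assms unfolding smooth_on_iff by (rule bspec)
then obtain U g where "openR n U" "x:U" "Cinf_on n U g" "ALL y:S \<inter> U. f y = g y" by blast
thus ?thesis using that[of U g] by blast
qed

lemma smooth_onI:
assumes "!!x. x:S ==> EX U g. openR n U & x:U & Cinf_on n U g & (ALL y:S \<inter> U. f y = g y)"
shows "smooth_on n S f"
unfolding smooth_on_iff using assms by (rule ballI)

lemma smooth_on_subset:
assumes "smooth_on n S f" "T \<subseteq> S" shows "smooth_on n T f"
proof (rule smooth_onI)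
fix x assume "x:T"
with assms(2) have "x:S" by blast
from smooth_onE[OF assms(1) this] obtain U g where
 "openR n U" "x:U" "Cinf_on n U g" "!!y. y:S ==> y:U ==> f y = g y" by metis
thus "EX U g. openR n U & x:U & Cinf_on n U g & (ALL y:T \<inter> U. f y = g y)"
 using assms(2) by (intro exI[of _ U] exI[of _ g]) auto
qed

lemma smooth_on_cong:
assumes "smooth_on n S f" "!!x. x:S ==> f x = g x" shows "smooth_on n S g"
proof (rule smooth_onI)
fix x assume "x:S"
from smooth_onE[OF assms(1) this] obtain U h where
 "openR n U" "x:U" "Cinf_on n U h" "!!y. y:S ==> y:U ==> f y = h y" by metis
thus "EX U h. openR n U & x:U & Cinf_on n U h & (ALL y:S \<inter> U. g y = h y)"
 using assms(2) by (intro exI[of _ U] exI[of _ h]) auto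
qed

lemma smooth_on_local:
assumes "!!x. x:S ==> EX U. openR n U & x:U & smooth_on n (S \<inter> U) f"
shows "smooth_on n S f"
proof (rule smooth_onI)
fix x assume x: "x:S"
from assms[OF x] obtain U where U: "openR n U" "x:U" "smooth_on n (S \<inter> U) f" by blast
from x U have "x:S \<inter> U" by blast
from smooth_onE[OF U(3) this] obtain V g where V: "openR n V" "x:V" "Cinf_on n V g"
 "!!y. y:S \<inter> U ==> y:V ==> f y = g y" by metis
show "EX U g. openR n U & x:U & Cinf_on n U g & (ALL y:S \<inter> U. f y = g y)"
proof (intro exI conjI)
 show "openR n (U \<inter> V)" using U V by blast
 show "Cinf_on n (U \<inter> V) g" by (rule Cinf_on_mono[OF V(3)]) simp
qed (use U V in auto)
qed

lemma smooth_on_imp_continuous_on: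
assumes "smooth_on n S f" "S \<subseteq> R_vecs n" shows "continuous_on S f"
proof -
have "EX T. open T & x:T & continuous_on (S \<inter> T) f" if x: "x:S" for x
proof -
 from smooth_onE[OF assms(1) x] obtain U g where U: "openR n U" "x:U" "Cinf_on n U g"
 "!!y. y:S ==> y:U ==> f y = g y" by metis
 obtain T where T: "open T" "U = R_vecs n \<inter> T" using U(1) unfolding openR_iff by blast
 have "continuous_on (S \<inter> T) g"
 by (rule continuous_on_subset[OF Cinf_on_imp_continuous[OF U(3)]]) (use T assms(2) in auto)
 moreover have "!!y. y:S \<inter> T ==> g y = f y" using U(4) T assms(2) by auto
 ultimately have "continuous_on (S \<inter> T) f"
 using continuous_on_cong[of "S \<inter> T" "S \<inter> T" g f] by blast
 thus ?thesis using T U(2) by auto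
qed
hence "ALL x:S. EX T. open T & x:T & continuous_on (S \<inter> T) f" by blast
then obtain T where T: "!!x. x:S ==> open (T x) & x:T x & continuous_on (S \<inter> T x) f"
 by metis
have "continuous (at x within S) f" if x: "x:S" for x
proof -
 have "continuous (at x within S \<inter> T x) f"
 using T[OF x] x by (simp add: continuous_on_eq_continuous_within)
 moreover have "at x within S \<inter> T x = at x within S"
 by (rule at_within_nhd[of x "T x"]) (use T[OF x] in auto)
 ultimately show ?thesis by simp
qed
thus ?thesis by (simp add: continuous_on_eq_continuous_within)
qed

lemma smooth_on_unop:
assumes f: "smooth_on n S f" and T: "open (T::real set)" "!!x. x:S ==> f x:T"
 and op: "!!U g. openR n U ==> Cinf_on n U g ==> (!!x. x:U ==> g x:T) ==> Cinf_on n U (%x. ph (g x))"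
shows "smooth_on n S (%x. ph (f x))"
proof (rule smooth_onI)
fix x assume x: "x:S"
from smooth_onE[OF f x] obtain U g where U: "openR n U" "x:U" "Cinf_on n U g"
 "!!y. y:S ==> y:U ==> f y = g y" by metis
let ?U = "{y\<in>U. g y:T}"
have 1: "openR n ?U" by (rule openR_preimage[OF U(1) Cinf_on_imp_continuous[OF U(3)] T(1)])
have "Cinf_on n ?U g" by (rule Cinf_on_mono[OF U(3)]) auto
from op[OF 1 this] have 2: "Cinf_on n ?U (%x. ph (g x))" by simp
show "EX U g. openR n U & x:U & Cinf_on n U g & (ALL y:S \<inter> U. ph (f y) = g y)"
 by (intro exI conjI, rule 1, use U(2) U(4)[OF x] T(2)[OF x] in simp, rule 2, use U(4) in auto)
qed

lemma smooth_on_binop: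
assumes f: "smooth_on n S f" and f': "smooth_on n S f'"
 and op: "!!U g h. openR n U ==> Cinf_on n U g ==> Cinf_on n U h ==> Cinf_on n U (%x. ph (g x) (h x))"
shows "smooth_on n S (%x. ph (f x) (f' x))"
proof (rule smooth_onI)
fix x assume x: "x:S"
from smooth_onE[OF f x] obtain U g where U: "openR n U" "x:U" "Cinf_on n U g"
 "!!y. y:S ==> y:U ==> f y = g y" by metis
from smooth_onE[OF f' x] obtain V h where V: "openR n V" "x:V" "Cinf_on n V h"
 "!!y. y:S ==> y:V ==> f' y = h y" by metis
have 1: "openR n (U \<inter> V)" using U V by blast
have 2: "Cinf_on n (U \<inter> V) (%x. ph (g x) (h x))"
 by (rule op[OF 1]; rule Cinf_on_mono[OF U(3)] Cinf_on_mono[OF V(3)]; simp)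
show "EX U g. openR n U & x:U & Cinf_on n U g & (ALL y:S \<inter> U. ph (f y) (f' y) = g y)"
 by (intro exI conjI, rule 1, use U(2) V(2) in simp, rule 2, use U(4) V(4) in auto)
qed

lemma openR_R_vecs: "openR n (R_vecs n)" by (rule openin_topspace)

lemma smooth_on_of_Cinf_on:
assumes "openR n U" "Cinf_on n U f" "S \<subseteq> U" shows "smooth_on n S f"
by (rule smooth_onI) (use assms in blast)

lemma smooth_on_const: "S \<subseteq> R_vecs n ==> smooth_on n S (%x. c)"
by (rule smooth_on_of_Cinf_on[OF openR_R_vecs Cinf_on_const[OF openR_R_vecs]])

lemma smooth_on_coord: "S \<subseteq> R_vecs n ==> smooth_on n S (%x. x i)"
by (rule smooth_on_of_Cinf_on[OF openR_R_vecs Cinf_on_coord[OF openR_R_vecs]])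

lemma smooth_on_add: "smooth_on n S f ==> smooth_on n S g ==> smooth_on n S (%x. f x + g x)"
by (rule smooth_on_binop[where ph = "(+)"]) (simp_all add: Cinf_on_add)

lemma smooth_on_mult: "smooth_on n S f ==> smooth_on n S g ==> smooth_on n S (%x. f x * g x)"
by (rule smooth_on_binop[where ph = "(*)"]) (simp_all add: Cinf_on_mult)

lemma smooth_on_inverse:
assumes "smooth_on n S f" "!!x. x:S ==> f x ~= 0"
shows "smooth_on n S (%x. inverse (f x))"
by (rule smooth_on_unop[where T = "-{0}" and ph = inverse, OF assms(1)])
 (use assms(2) in \<open>auto intro: Cinf_on_inverse\<close>)

lemma smooth_on_sqrt:
assumes "smooth_on n S f" "!!x. x:S ==> f x > 0"
shows "smooth_on n S (%x. sqrt (f x))"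
by (rule smooth_on_unop[where T = "{0<..}" and ph = sqrt, OF assms(1)])
 (use assms(2) in \<open>auto intro: Cinf_on_sqrt\<close>)

lemma smooth_on_arctan: "smooth_on n S f ==> smooth_on n S (%x. arctan (f x))"
and smooth_on_sin: "smooth_on n S f ==> smooth_on n S (%x. sin (f x))"
and smooth_on_cos: "smooth_on n S f ==> smooth_on n S (%x. cos (f x))"
by (rule smooth_on_unop[where T = UNIV]; simp add: Cinf_on_arctan Cinf_on_sin Cinf_on_cos)+

lemma smooth_on_compose:
assumes f: "smooth_on b V f" and V: "V \<subseteq> R_vecs b" and S: "S \<subseteq> R_vecs a"
 and G: "!!x. x:S ==> G x:V" "!!j. j < b ==> smooth_on a S (%x. G x j)"
shows "smooth_on a S (%x. f (G x))"
proof (rule smooth_onI)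
fix x assume x: "x:S"
from smooth_onE[OF f G(1)[OF x]] obtain W h where W: "openR b W" "G x:W" "Cinf_on b W h"
 "!!y. y:V ==> y:W ==> f y = h y" by metis
have "EX U g. openR a U & x:U & Cinf_on a U g & (ALL y:S \<inter> U. G y j = g y)" if "j < b" for j
 using G(2)[OF that] x unfolding smooth_on_iff by (rule bspec)
then obtain U g where U: "!!j. j < b ==> openR a (U j) & x:U j & Cinf_on a (U j) (g j) & (ALL y:S \<inter> U j. G y j = g j y)"
 by metis
define U' where "U' = R_vecs a \<inter> (\<Inter>j<b. U j)"
have U'o: "openR a U'"
proof (cases "b = 0")
 case True thus ?thesis using openR_R_vecs by (simp add: U'_def)
next
 case False
 hence "openR a (\<Inter>j<b. U j)" by (intro openin_INT2) (use U in auto)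
 thus ?thesis unfolding U'_def using openR_R_vecs by blast
qed
have xU': "x:U'" using U x S by (auto simp: U'_def)
define G' where "G' y = (%j. if j < b then g j y else 0)" for y
have G'R: "G' y:R_vecs b" for y by (auto simp: G'_def topspace_Euclidean_space)
have gC: "Cinf_on a U' (g j)" if "j < b" for j
 by (rule Cinf_on_mono[of a "U j"]) (use U that in \<open>auto simp: U'_def\<close>)
have GG': "G y = G' y" if "y:S" "y:U'" for y
proof
 fix j show "G y j = G' y j"
 proof (cases "j < b")
 case True
 hence "y:U j" using that by (auto simp: U'_def)
 thus ?thesis using U[OF True] that True by (auto simp: G'_def)
 next
 case False
 thus ?thesis using G(1)[OF that(1)] V by (auto simp: G'_def topspace_Euclidean_space)
 qed
qed
let ?O = "{y\<in>U'. G' y:W}"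
have O: "openR a ?O"
proof (rule openR_preimage_coordinatewise[OF U'o _ _ W(1)])
 show "continuous_on U' (%x. G' x j)" if "j < b" for j
 using Cinf_on_imp_continuous[OF gC[OF that]] that by (simp add: G'_def)
qed (rule G'R)
have C: "Cinf_on a ?O (%y. h (G' y))"
proof (rule Cinf_on_comp[OF O W(1) _ W(3)])
 show "Cinf_on a ?O (%x. G' x j)" if "j < b" for j
 using Cinf_on_mono[OF gC[OF that], of ?O] that by (simp add: G'_def)
qed simp
show "EX U g. openR a U & x:U & Cinf_on a U g & (ALL y:S \<inter> U. f (G y) = g y)"
proof (intro exI conjI)
 show "openR a ?O" by (rule O)
 show "Cinf_on a ?O (%y. h (G' y))" by (rule C)
 show "x:?O" using xU' W(2) GG'[OF x xU'] by simp
 show "ALL y:S \<inter> ?O. f (G y) = h (G' y)"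
 proof
 fix y assume y: "y:S \<inter> ?O"
 hence "G y = G' y" using GG' by simp
 thus "f (G y) = h (G' y)" using W(4)[OF G(1)[of y]] y by simp
 qed
qed
qed

section \<open>A smooth cutoff function\<close>

definition flat :: "nat => real => real" where
"flat m t = (if t > 0 then exp (- inverse t) * inverse t ^ m else 0)"

lemma flat_bound: "\<bar>flat m t\<bar> \<le> real (m + 2) ^ (m + 2) * t^2"
proof (cases "t > 0")
case True
define N where "N = m + 2"
have N: "N > 0" by (simp add: N_def)
have "(inverse t / real N) ^ N \<le> (1 + inverse t / real N) ^ N"
 using True by (intro power_mono) auto
also have "\<dots> \<le> exp (inverse t)"
 using exp_ge_one_plus_x_over_n_power_n[of N "inverse t"] N True
 by (smt (verit, best) inverse_positive_iff_positive of_nat_0_le_iff)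
finally have "inverse (exp (inverse t)) \<le> inverse ((inverse t / real N) ^ N)"
 using True N by (intro le_imp_inverse_le) auto
hence "exp (- inverse t) \<le> real N ^ N * t ^ N"
 using True N by (simp add: exp_minus power_divide field_simps)
hence "exp (- inverse t) * inverse t ^ m \<le> (real N ^ N * t ^ N) * inverse t ^ m"
 using True by (intro mult_right_mono) auto
also have "\<dots> = real N ^ N * t^2"
proof -
 have "t ^ N * inverse t ^ m = t^2"
 using True by (simp add: N_def power_inverse field_simps power2_eq_square)
 thus ?thesis by (simp add: mult.assoc)
qed
finally show ?thesis using True by (simp add: flat_def N_def)
qed (simp add: flat_def)

lemma flat_has_derivative:
"(flat m has_real_derivative flat (m + 2) t - real m * flat (m + 1) t) (at t)"
proof -
consider "t > 0" | "t < 0" | "t = 0" by linarith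
thus ?thesis
proof cases
 case 1
 have "((%t. exp (- inverse t) * inverse t ^ m) has_real_derivative
  flat (m + 2) t - real m * flat (m + 1) t) (at t)"
 proof -
 define u where "u = inverse t"
 have i: "(inverse has_real_derivative - (u * u)) (at t)"
  using DERIV_inverse[of t] 1 by (simp add: u_def power2_eq_square)
 have p: "((%t. inverse t ^ m) has_real_derivative real m * (- (u * u) * u ^ (m - Suc 0))) (at t)"
  using DERIV_power[OF i, of m] by (simp add: u_def)
 have e: "((%t. exp (- inverse t)) has_real_derivative exp (- u) * (u * u)) (at t)"
  using DERIV_fun_exp[OF DERIV_minus[OF i]] by (simp add: u_def)
 have "exp (- u) * (u * u) * u ^ m + real m * (- (u * u) * u ^ (m - Suc 0)) * exp (- u)
  = exp (- u) * u ^ (m + 2) - real m * (exp (- u) * u ^ (m + 1))"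
  by (cases m) (simp_all add: algebra_simps)
 hence "exp (- u) * (u * u) * u ^ m + real m * (- (u * u) * u ^ (m - Suc 0)) * exp (- u)
  = flat (m + 2) t - real m * flat (m + 1) t"
  using 1 by (simp add: flat_def u_def)
 thus ?thesis using DERIV_mult[OF e p] by (simp add: u_def)
 qed
 note d = this
 have ev: "\<forall>\<^sub>F s in nhds t. flat m s = exp (- inverse s) * inverse s ^ m"
 using eventually_nhds_in_open[of "{0<..}" t] 1
 by (auto elim!: eventually_mono simp: flat_def)
 show ?thesis by (rule DERIV_cong_ev[OF refl ev refl, THEN iffD2, OF d])
next
 case 2
 have "\<forall>\<^sub>F s in nhds t. flat m s = 0"
 using eventually_nhds_in_open[of "{..<0}" t] 2 by (auto elim!: eventually_mono simp: flat_def)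
 hence "(flat m has_real_derivative 0) (at t)"
 using DERIV_cong_ev[OF refl, of "flat m" "%_. 0" t 0 0] by simp
 thus ?thesis using 2 by (simp add: flat_def)
next
 case 3
 define C where "C = real (m + 2) ^ (m + 2)"
 have "((%h. (flat m (0 + h) - flat m 0) / h) \<longlongrightarrow> 0) (at 0)"
 proof (rule Lim_null_comparison)
 show "\<forall>\<^sub>F h in at 0. norm ((flat m (0 + h) - flat m 0) / h) \<le> C * \<bar>h\<bar>"
 proof (rule always_eventually, rule allI)
  fix h :: real
  show "norm ((flat m (0 + h) - flat m 0) / h) \<le> C * \<bar>h\<bar>"
  proof (cases "h = 0")
  case False
  have "\<bar>flat m h\<bar> \<le> C * \<bar>h\<bar> * \<bar>h\<bar>"
   using flat_bound[of m h] by (simp add: C_def power2_eq_square mult.assoc)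
  thus ?thesis using False by (simp add: flat_def[of m 0] divide_le_eq)
  qed (simp add: C_def)
 qed
 show "((%h. C * \<bar>h\<bar>) \<longlongrightarrow> 0) (at 0)" by (auto intro!: tendsto_eq_intros)
 qed
 hence "(flat m has_real_derivative 0) (at 0)" unfolding DERIV_def .
 thus ?thesis using 3 by (simp add: flat_def)
qed
qed

lemma Cinf_on_flat:
assumes U: "openR n U" and f: "Cinf_on n U f"
shows "Cinf_on n U (%x. flat m (f x))"
unfolding Cinf_on_def
proof
fix r show "C_k_on n r U (%x. flat m (f x))"
proof (induction r arbitrary: m)
 case 0
 have "continuous_on UNIV (flat m)"
 by (rule continuous_at_imp_continuous_on) (blast intro: DERIV_isCont flat_has_derivative)
 thus ?case using continuous_on_compose2[OF _ Cinf_on_imp_continuous[OF f], of UNIV "flat m"] by simp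
next
 case (Suc r)
 have 3: "C_k_on n r U (%x. flat (m + 2) (f x) + (- real m) * flat (m + 1) (f x))"
 by (intro C_k_on_add C_k_on_mult C_k_on_const U Suc)
 have 2: "(flat m has_real_derivative flat (m + 2) t + (- real m) * flat (m + 1) t) (at t)" if "t:UNIV" for t
 using flat_has_derivative[of m t] by simp
 show ?case by (rule C_k_on_comp_real[OF U Cinf_on_imp_C_k_on[OF f] UNIV_I 2 3])
qed
qed

definition cutoff :: "real => real" where
"cutoff t = flat 0 (2 - t) * inverse (flat 0 (2 - t) + flat 0 (t - 1))"

lemma flat0_pos: "t > 0 ==> flat 0 t > 0" and flat0_zero: "t \<le> 0 ==> flat 0 t = 0"
and flat0_nonneg: "flat 0 t \<ge> 0"
by (auto simp: flat_def)

lemma cutoff_denominator: "flat 0 (2 - t) + flat 0 (t - 1) > 0"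
using flat0_pos[of "2 - t"] flat0_pos[of "t - 1"] flat0_nonneg[of "2 - t"] flat0_nonneg[of "t - 1"]
by (cases "t < 2") (linarith, smt (verit))

lemma cutoff_one: "t \<le> 1 ==> cutoff t = 1"
using flat0_pos[of "2 - t"] flat0_zero[of "t - 1"] by (simp add: cutoff_def)

lemma cutoff_zero: "t \<ge> 2 ==> cutoff t = 0"
using flat0_zero[of "2 - t"] by (simp add: cutoff_def)

lemma Cinf_on_cutoff:
assumes U: "openR n U" and f: "Cinf_on n U f"
shows "Cinf_on n U (%x. cutoff (f x))"
proof -
have 1: "Cinf_on n U (%x. 2 + (-1) * f x)" "Cinf_on n U (%x. f x + (-1))"
 by (intro Cinf_on_add Cinf_on_mult Cinf_on_const U f)+
have e: "2 + (-1) * f x = 2 - f x" "f x + (-1) = f x - 1" for x by simp_all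
have 2: "Cinf_on n U (%x. flat 0 (2 - f x))" "Cinf_on n U (%x. flat 0 (f x - 1))"
 using Cinf_on_flat[OF U 1(1), of 0] Cinf_on_flat[OF U 1(2), of 0] unfolding e .
have "flat 0 (2 - f x) + flat 0 (f x - 1) ~= 0" for x
 using cutoff_denominator[of "f x"] by simp
thus ?thesis unfolding cutoff_def
 by (intro Cinf_on_mult Cinf_on_inverse Cinf_on_add U 2)
qed

lemma smooth_on_cutoff: "smooth_on n S f ==> smooth_on n S (%x. cutoff (f x))"
by (rule smooth_on_unop[where T = UNIV]; simp add: Cinf_on_cutoff)

section \<open>Division by a coordinate, and even functions\<close>

text \<open>
The integral in Hadamard's lemma. The weight \<open>t ^ w\<close> makes the family closed under partial
derivatives.
\<close>

definition hadamard :: "nat => nat => ((nat => real) => real) => (nat => real) => real" where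
"hadamard w a L x = integral (cbox 0 1) (%t::real. t ^ w * L (x(a := t * x a)))"

lemma continuous_on_contraction:
"continuous_on T (%(x::nat => real, t::real). x(a := t * x a))"
proof (rule continuous_on_coordinatewise_then_product)
fix i
have 1: "continuous_on T (%p. fst p j)" for j
proof -
 have "continuous_on UNIV (%x::nat => real. x j)"
 by (rule continuous_on_product_then_coordinatewise[OF continuous_on_id])
 from continuous_on_compose2[OF this continuous_on_fst[OF continuous_on_id]] show ?thesis by simp
qed
have "continuous_on T (%p. snd p * fst p a)"
 by (rule continuous_on_mult[OF continuous_on_snd[OF continuous_on_id] 1])
hence "continuous_on T (%p. if i = a then snd p * fst p a else fst p i)"
 using 1[of i] by (cases "i = a") simp_all
thus "continuous_on T (%p. (case p of (x, t) => x(a := t * x a)) i)"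
 by (simp add: case_prod_beta)
qed

lemma continuous_on_hadamard_integrand:
fixes P :: "'b::topological_space => nat => real" and L :: "(nat => real) => real"
assumes "!!x. x:V ==> P x:O'" "!!x t. x:O' ==> t:{0..1} ==> x(a := t * x a):O'"
 and "continuous_on V P" "continuous_on O' L"
shows "continuous_on (V \<times> cbox 0 1) (%(x, t::real). t ^ w * L ((P x)(a := t * P x a)))"
proof -
have 1: "continuous_on (V \<times> cbox (0::real) 1) (%z. (P (fst z), snd z))"
proof (rule continuous_on_Pair)
 show "continuous_on (V \<times> cbox (0::real) 1) (%z. P (fst z))"
 by (rule continuous_on_compose2[OF assms(3) continuous_on_fst[OF continuous_on_id]]) auto
 show "continuous_on (V \<times> cbox (0::real) 1) snd" by (rule continuous_on_snd[OF continuous_on_id])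
qed
have 2: "continuous_on (V \<times> cbox (0::real) 1) (%z. (P (fst z))(a := snd z * P (fst z) a))"
proof -
 have "continuous_on (V \<times> cbox (0::real) 1) (%z. (case (P (fst z), snd z) of (x, t) => x(a := t * x a)))"
 by (rule continuous_on_compose2[OF continuous_on_contraction[of UNIV a] 1]) simp
 thus ?thesis unfolding prod.case .
qed
have "continuous_on (V \<times> cbox (0::real) 1) (%z. L ((P (fst z))(a := snd z * P (fst z) a)))"
proof (rule continuous_on_compose2[OF assms(4) 2], rule image_subsetI)
 fix z assume "z:V \<times> cbox (0::real) 1"
 hence "fst z:V" "snd z:{0..1}" by auto
 thus "(P (fst z))(a := snd z * P (fst z) a):O'"
 using assms(2)[OF assms(1)[of "fst z"], of "snd z"] by blast
qed
hence "continuous_on (V \<times> cbox (0::real) 1) (%z. snd z ^ w * L ((P (fst z))(a := snd z * P (fst z) a)))"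
 by (rule continuous_on_mult[OF continuous_on_power[OF continuous_on_snd[OF continuous_on_id]]])
thus ?thesis unfolding case_prod_beta .
qed

lemma C_k_on_hadamard:
assumes O: "openR n O'" and star: "!!x t. x:O' ==> t:{0..1} ==> x(a := t * x a):O'"
shows "Cinf_on n O' L ==> C_k_on n r O' (hadamard w a L)"
proof (induction r arbitrary: w L)
case 0
have "continuous_on (O' \<times> cbox 0 1) (%(x, t::real). t ^ w * L (x(a := t * x a)))"
 by (rule continuous_on_hadamard_integrand[OF _ star continuous_on_id Cinf_on_imp_continuous[OF 0]])
thus ?case unfolding hadamard_def C_k_on.simps by (rule integral_continuous_on_param)
next
case (Suc r)
note L = Suc.prems
define W where "W i = (if i = a then Suc w else w)" for i
have cont: "continuous_on O' (hadamard w a L)"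
proof -
 have "continuous_on (O' \<times> cbox 0 1) (%(x, t::real). t ^ w * L (x(a := t * x a)))"
 by (rule continuous_on_hadamard_integrand[OF _ star continuous_on_id Cinf_on_imp_continuous[OF L]])
 thus ?thesis unfolding hadamard_def by (rule integral_continuous_on_param)
qed
have der: "((%s. hadamard w a L (x(i := s))) has_real_derivative hadamard (W i) a (partial_deriv i L) x) (at (x i))"
 if i: "i < n" and x: "x:O'" for i x
proof -
 have xR: "x:R_vecs n" using openin_subset[OF O] x by blast
 have "open {s. x(i := s):O'}" by (rule open_upd_preimage[OF O xR i])
 moreover have "x i:{s. x(i := s):O'}" using x by simp
 ultimately obtain e where e: "e > 0" "ball (x i) e \<subseteq> {s. x(i := s):O'}"
 unfolding open_contains_ball by blast
 define B where "B = ball (x i) e"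
 have BO: "x(i := s):O'" if "s:B" for s using e(2) that by (auto simp: B_def)
 have 1: "((%s. t ^ w * L ((x(i := s))(a := t * (x(i := s)) a))) has_real_derivative
  t ^ W i * partial_deriv i L ((x(i := s))(a := t * (x(i := s)) a))) (at s within B)"
 if s: "s:B" and t: "t:cbox 0 1" for s t
 proof (cases "i = a")
 case True
 have p: "x(a := t * s):O'" using star[OF BO[OF s], of t] t True by simp
 have "((%u. L (x(a := u))) has_real_derivative partial_deriv a L (x(a := t * s))) (at (t * s))"
  by (rule Cinf_on_has_partial[OF L p]) (use True i in simp)
 hence "((%s. L (x(a := t * s))) has_real_derivative partial_deriv a L (x(a := t * s)) * t) (at s)"
  by (rule DERIV_chain2) (auto intro!: derivative_eq_intros)
 note d = DERIV_subset[OF DERIV_cmult[OF this, of "t ^ w"] subset_UNIV, of B]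
 have c: "(x(i := u))(a := t * (x(i := u)) a) = x(a := t * u)" for u using True by simp
 have "t ^ w * (partial_deriv a L (x(a := t * s)) * t) = t ^ W i * partial_deriv i L (x(a := t * s))"
  using True by (simp add: W_def)
 thus ?thesis using d unfolding c by (simp only:)
 next
 case False
 define z where "z = x(a := t * x a)"
 have c: "(x(i := u))(a := t * (x(i := u)) a) = z(i := u)" for u
  using False by (auto simp: z_def fun_eq_iff)
 have p: "z(i := s):O'" using star[OF BO[OF s], of t] t unfolding c by simp
 have "((%u. L (z(i := u))) has_real_derivative partial_deriv i L (z(i := s))) (at s)"
  by (rule Cinf_on_has_partial[OF L p i])
 note d = DERIV_subset[OF DERIV_cmult[OF this, of "t ^ w"] subset_UNIV, of B]
 have "W i = w" using False by (simp add: W_def)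
 thus ?thesis using d unfolding c by (simp only:)
 qed
 have cP: "continuous_on B (%s. x(i := s))" by (rule continuous_on_upd)
 have 2: "continuous_on (B \<times> cbox 0 1) (%(s, t). t ^ W i * partial_deriv i L ((x(i := s))(a := t * (x(i := s)) a)))"
 using continuous_on_hadamard_integrand[OF BO star cP
  Cinf_on_imp_continuous[OF Cinf_on_partial[OF L i]]] .
 have q0: "continuous_on (B \<times> cbox 0 1) (%(s, t). t ^ w * L ((x(i := s))(a := t * (x(i := s)) a)))"
 using continuous_on_hadamard_integrand[OF BO star cP Cinf_on_imp_continuous[OF L]] .
 have 3: "(%t. t ^ w * L ((x(i := s))(a := t * (x(i := s)) a))) integrable_on cbox 0 1" if "s:B" for s
 proof (rule integrable_continuous)
 have c: "continuous_on (cbox 0 1) (%t::real. (s, t))"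
  by (intro continuous_on_Pair continuous_on_const continuous_on_id)
 have "continuous_on (cbox 0 1) (%t. case (s, t) of (s, t) => t ^ w * L ((x(i := s))(a := t * (x(i := s)) a)))"
  by (rule continuous_on_compose2[OF q0 c]) (use that in blast)
 thus "continuous_on (cbox 0 1) (%t. t ^ w * L ((x(i := s))(a := t * (x(i := s)) a)))"
  unfolding prod.case .
 qed
 define f where "f s t = t ^ w * L ((x(i := s))(a := t * (x(i := s)) a))" for s t
 define f' where "f' s t = t ^ W i * partial_deriv i L ((x(i := s))(a := t * (x(i := s)) a))" for s t
 have xB: "x i:B" and cB: "convex B" using e(1) by (simp_all add: B_def)
 have q1: "((%s. f s t) has_real_derivative f' s t) (at s within B)" if "s:B" "t:cbox 0 1" for s t
  unfolding f_def f'_def by (rule 1[OF that])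
 have q2: "continuous_on (B \<times> cbox 0 1) (%(s, t). f' s t)" unfolding f'_def by (rule 2)
 have q3: "f s integrable_on cbox 0 1" if "s:B" for s unfolding f_def by (rule 3[OF that])
 have "((%s. integral (cbox 0 1) (f s)) has_real_derivative integral (cbox 0 1) (f' (x i))) (at (x i) within B)"
 proof (rule leibniz_rule_field_derivative[where f = f and fx = f' and U = B and a = 0 and b = 1])
 fix s t :: real assume st: "s:B" "t:cbox 0 1"
 show "((%s. f s t) has_real_derivative f' s t) (at s within B)" by (rule q1[OF st])
 next
 fix s assume "s:B" thus "f s integrable_on cbox 0 1" by (rule q3)
 next
 show "continuous_on (B \<times> cbox 0 1) (%(s, t). f' s t)" by (rule q2)
 next
 show "x i:B" by (rule xB)
 next
 show "convex B" by (rule cB)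
 qed
 hence d: "((%s. integral (cbox 0 1) (f s)) has_real_derivative integral (cbox 0 1) (f' (x i))) (at (x i))"
 unfolding at_within_open[OF xB open_ball[of "x i" e, folded B_def]] .
 have "integral (cbox 0 1) (f s) = hadamard w a L (x(i := s))" for s
 unfolding f_def hadamard_def ..
 moreover have "integral (cbox 0 1) (f' (x i)) = hadamard (W i) a (partial_deriv i L) x"
 unfolding f'_def hadamard_def fun_upd_triv ..
 ultimately show ?thesis using d by (simp only:)
qed
show ?case
 by (rule C_k_on_SucI[OF O cont der Suc.IH[OF Cinf_on_partial[OF L]]])
qed

lemma Cinf_on_hadamard:
assumes "openR n O'" "!!x t. x:O' ==> t:{0..1} ==> x(a := t * x a):O'" "Cinf_on n O' L"
shows "Cinf_on n O' (hadamard w a L)"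
unfolding Cinf_on_def by (rule allI) (rule C_k_on_hadamard[OF assms])

lemma hadamard_eq:
assumes O: "openR n O'" and star: "!!x t. x:O' ==> t:{0..1} ==> x(a := t * x a):O'"
 and f: "Cinf_on n O' f" and a: "a < n" and x: "x:O'"
shows "x a * hadamard 0 a (partial_deriv a f) x = f x - f (x(a := 0))"
proof -
have "((%t. f (x(a := t * x a))) has_vector_derivative partial_deriv a f (x(a := t * x a)) * x a) (at t within {0..1})"
 if t: "t:{0..1}" for t
proof -
 have "((%u. f (x(a := u))) has_real_derivative partial_deriv a f (x(a := t * x a))) (at (t * x a))"
 by (rule Cinf_on_has_partial[OF f star[OF x t] a])
 hence "((%t. f (x(a := t * x a))) has_real_derivative partial_deriv a f (x(a := t * x a)) * x a) (at t)"
 by (rule DERIV_chain2) (auto intro!: derivative_eq_intros)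
 thus ?thesis
 using DERIV_subset has_real_derivative_iff_has_vector_derivative by blast
qed
hence "((%t. partial_deriv a f (x(a := t * x a)) * x a) has_integral f (x(a := 1 * x a)) - f (x(a := 0 * x a))) {0..1}"
 by (rule fundamental_theorem_of_calculus[of 0 1 "%t. f (x(a := t * x a))", OF zero_le_one])
from integral_unique[OF this]
have "integral {0..1} (%t. partial_deriv a f (x(a := t * x a)) * x a) = f x - f (x(a := 0))"
 by (simp only: mult_1_left mult_zero_left fun_upd_triv)
moreover have "integral {0..1} (%t. partial_deriv a f (x(a := t * x a)) * x a)
 = integral {0..1} (%t. partial_deriv a f (x(a := t * x a))) * x a"
 by (rule integral_mult_left)
ultimately show ?thesis unfolding hadamard_def power_0 mult_1_left cbox_interval
 by (simp only: mult.commute[of "x a" "integral _ _"])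
qed

definition fold_plane :: "nat => nat => (nat => real) => nat => real" where
"fold_plane a b x = x(a := sqrt ((x a)\<^sup>2 + (x b)\<^sup>2), b := 0)"

lemma partial_deriv_even_odd:
assumes O: "openR n O'" and f: "Cinf_on n O' f" and a: "a < n"
 and even: "!!y. y:O' ==> y(a := - y a):O'" "!!y. y:O' ==> f (y(a := - y a)) = f y"
 and y: "y:O'"
shows "partial_deriv a f (y(a := - y a)) = - partial_deriv a f y"
proof -
have yR: "y:R_vecs n" using openin_subset[OF O] y by blast
have "((%t. f (y(a := t))) has_real_derivative partial_deriv a f (y(a := - y a))) (at (- y a))"
 by (rule Cinf_on_has_partial[OF f even(1)[OF y] a])
hence "((%t. f (y(a := - t))) has_real_derivative partial_deriv a f (y(a := - y a)) * (-1)) (at (y a))"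
 by (rule DERIV_chain2) (auto intro!: derivative_eq_intros)
moreover have "\<forall>\<^sub>F t in nhds (y a). f (y(a := - t)) = f (y(a := t))"
 using eventually_upd_in[OF O y a]
proof eventually_elim
 case (elim t)
 from even(2)[OF elim] show ?case by simp
qed
ultimately have "((%t. f (y(a := t))) has_real_derivative - partial_deriv a f (y(a := - y a))) (at (y a))"
 using DERIV_cong_ev[OF refl, of "%t. f (y(a := - t))" "%t. f (y(a := t))" "y a"] by simp
moreover have "((%t. f (y(a := t))) has_real_derivative partial_deriv a f y) (at (y a))"
 using Cinf_on_has_partial[OF f _ a, of y "y a"] y by simp
ultimately have "- partial_deriv a f (y(a := - y a)) = partial_deriv a f y" by (rule DERIV_unique)
thus ?thesis by simp
qed

text \<open>
If \<open>L\<close> is smooth and even in \<open>u\<close> then \<open>L (\<bar>z\<bar>)\<close> is smooth in \<open>z\<close>: the odd function \<open>\<partial>L/\<partial>u\<close> is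
\<open>u\<close> times a smooth even function \<open>M\<close>, so that the gradient of \<open>L (\<bar>z\<bar>)\<close> is \<open>z\<close> times \<open>M (\<bar>z\<bar>)\<close>,
and one more derivative is gained by induction.
\<close>

lemma C_k_on_fold_plane:
assumes O: "openR n O'" and ab: "a < n" "b < n" "a ~= b"
 and star: "!!x t. x:O' ==> t:{-1..1} ==> x(a := t * x a):O'"
defines "Q \<equiv> fold_plane a b"
defines "V \<equiv> {x:R_vecs n. Q x:O'}"
shows "Cinf_on n O' L ==> (!!y. y:O' ==> L (y(a := - y a)) = L y) ==> C_k_on n r V (%x. L (Q x))"
proof (induction r arbitrary: L)
case (0 L)
have cQ: "continuous_on S Q" for S
proof (rule continuous_on_coordinatewise_then_product)
 fix i
 have 1: "continuous_on S (%x. x j)" for j :: nat and S :: "(nat => real) set"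
 by (rule continuous_on_product_then_coordinatewise[OF continuous_on_id])
 show "continuous_on S (%x. Q x i)"
 by (cases "i = b"; cases "i = a") (auto simp: Q_def fold_plane_def intro!: continuous_intros 1)
qed
show ?case unfolding C_k_on.simps
 by (rule continuous_on_compose2[OF Cinf_on_imp_continuous[OF 0(1)] cQ]) (auto simp: V_def)
next
case (Suc r L)
note L = Suc.prems(1) and ev = Suc.prems(2)
have star01: "x(a := t * x a):O'" if "x:O'" "t:{0..1}" for x t using star[OF that(1), of t] that(2) by simp
have neg: "y(a := - y a):O'" if "y:O'" for y using star[OF that, of "-1"] by simp
have cQ: "continuous_on S Q" for S
proof (rule continuous_on_coordinatewise_then_product)
 fix i
 have 1: "continuous_on S (%x. x j)" for j :: nat and S :: "(nat => real) set"
 by (rule continuous_on_product_then_coordinatewise[OF continuous_on_id])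
 show "continuous_on S (%x. Q x i)"
 by (cases "i = b"; cases "i = a") (auto simp: Q_def fold_plane_def intro!: continuous_intros 1)
qed
have V: "openR n V" unfolding V_def
proof (rule openR_preimage_coordinatewise[OF openR_R_vecs _ _ O])
 show "continuous_on (R_vecs n) (%x. Q x j)" for j
 by (rule continuous_on_product_then_coordinatewise[OF cQ])
 show "Q x:R_vecs n" if "x:R_vecs n" for x
 using that ab by (auto simp: Q_def fold_plane_def topspace_Euclidean_space)
qed
define K where "K = partial_deriv a L"
have K: "Cinf_on n O' K" unfolding K_def by (rule Cinf_on_partial[OF L ab(1)])
have Kodd: "K (y(a := - y a)) = - K y" if "y:O'" for y
 unfolding K_def
proof (rule partial_deriv_even_odd[where f = L and n = n and O' = O'])
 show "y(a := - y a):O'" if "y:O'" for y by (rule neg[OF that])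
 show "L (y(a := - y a)) = L y" if "y:O'" for y by (rule ev[OF that])
qed (fact O L ab(1) that)+
define M where "M = hadamard 0 a (partial_deriv a K)"
have M: "Cinf_on n O' M" unfolding M_def
 by (rule Cinf_on_hadamard[OF O star01 Cinf_on_partial[OF K ab(1)]])
have KM: "K y = y a * M y" if "y:O'" for y
proof -
 have y0: "y(a := 0):O'" using star[OF that, of 0] by simp
 have "K (y(a := 0)) = - K (y(a := 0))" using Kodd[OF y0] by simp
 hence "K (y(a := 0)) = 0" by simp
 thus ?thesis using hadamard_eq[OF O star01 K ab(1) that] by (simp add: M_def)
qed
have Mev: "M (y(a := - y a)) = M y" if "y:O'" for y
proof (cases "y a = 0")
 case True
 hence "y(a := - y a) = y" by (auto simp: fun_eq_iff)
 thus ?thesis by simp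
next
 case False
 have "K (y(a := - y a)) = - y a * M (y(a := - y a))"
 using KM[OF neg[OF that]] by (simp only: fun_upd_same)
 hence "y a * M (y(a := - y a)) = y a * M y"
 unfolding Kodd[OF that] KM[OF that] by linarith
 thus ?thesis unfolding mult_cancel_left using False by blast
qed
\<comment> \<open>the derivative along a line in the plane, at fixed other coordinate \<open>c\<close>\<close>
have line: "((%s. L (z(a := sqrt (s\<^sup>2 + c\<^sup>2)))) has_real_derivative s * M (z(a := sqrt (s\<^sup>2 + c\<^sup>2)))) (at s)"
 if z: "z(a := sqrt (s\<^sup>2 + c\<^sup>2)):O'" for z s c
proof (cases "c = 0")
 case False
 define rh where "rh = sqrt (s\<^sup>2 + c\<^sup>2)"
 have pos: "s\<^sup>2 + c\<^sup>2 > 0" using False by (simp add: add_nonneg_pos)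
 hence rh: "rh > 0" by (simp add: rh_def)
 have d1: "((%u. L (z(a := u))) has_real_derivative K (z(a := rh))) (at rh)"
 unfolding K_def rh_def by (rule Cinf_on_has_partial[OF L z ab(1)])
 have d2: "((%s. sqrt (s\<^sup>2 + c\<^sup>2)) has_real_derivative s / rh) (at s)"
 using pos by (auto intro!: derivative_eq_intros simp: rh_def field_simps)
 have "((%s. L (z(a := sqrt (s\<^sup>2 + c\<^sup>2)))) has_real_derivative K (z(a := rh)) * (s / rh)) (at s)"
 proof (rule DERIV_chain2[where f = "%u. L (z(a := u))" and g = "%s. sqrt (s\<^sup>2 + c\<^sup>2)", OF _ d2])
 show "((%u. L (z(a := u))) has_real_derivative K (z(a := rh))) (at (sqrt (s\<^sup>2 + c\<^sup>2)))"
  using d1 unfolding rh_def .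
 qed
 moreover have "K (z(a := rh)) * (s / rh) = s * M (z(a := rh))"
 using KM[OF z] rh unfolding rh_def[symmetric] fun_upd_same by simp
 ultimately show ?thesis unfolding rh_def by (simp only:)
next
 case True
 have abs: "sqrt (u\<^sup>2 + c\<^sup>2) = \<bar>u\<bar>" for u using True by simp
 have sgn: "z(a := u):O'" if "z(a := \<bar>u\<bar>):O'" for u
 using that neg[OF that] by (cases "u \<ge> 0") auto
 have absL: "F (z(a := \<bar>u\<bar>)) = F (z(a := u))" if "z(a := \<bar>u\<bar>):O'" "ALL y:O'. F (y(a := - y a)) = F y"
 for u and F :: "(nat => real) => real"
 using bspec[OF that(2,1)] by (cases "u \<ge> 0") auto
 have z1: "z(a := \<bar>s\<bar>):O'" using z unfolding abs .
 have z2: "z(a := s):O'" by (rule sgn[OF z1])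
 have zn: "(z(a := \<bar>s\<bar>)):R_vecs n" using openin_subset[OF O] z1 by blast
 have zR: "z(a := 0):R_vecs n" using zn ab by (auto simp: topspace_Euclidean_space)
 have "open {t. (z(a := 0))(a := t):O'}" by (rule open_upd_preimage[OF O zR ab(1)])
 hence "open ((%u. \<bar>u\<bar>) -` {t. z(a := t):O'})"
 by (intro open_vimage) (auto intro!: continuous_intros)
 hence "\<forall>\<^sub>F u in nhds s. u:(%u. \<bar>u\<bar>) -` {t. z(a := t):O'}"
 by (rule eventually_nhds_in_open) (use z1 in simp)
 hence evn: "\<forall>\<^sub>F u in nhds s. L (z(a := sqrt (u\<^sup>2 + c\<^sup>2))) = L (z(a := u))"
 proof eventually_elim
 case (elim u)
 hence "z(a := \<bar>u\<bar>):O'" by simp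
 moreover have "ALL y:O'. L (y(a := - y a)) = L y" using ev by (rule ballI)
 ultimately show ?case unfolding abs by (rule absL)
 qed
 have "((%u. L (z(a := u))) has_real_derivative K (z(a := s))) (at s)"
 unfolding K_def by (rule Cinf_on_has_partial[OF L z2 ab(1)])
 moreover have "K (z(a := s)) = s * M (z(a := sqrt (s\<^sup>2 + c\<^sup>2)))"
 proof -
 have "ALL y:O'. M (y(a := - y a)) = M y" using Mev by (rule ballI)
 from absL[OF z1 this] show ?thesis using KM[OF z2] unfolding abs fun_upd_same by simp
 qed
 ultimately have "((%u. L (z(a := u))) has_real_derivative s * M (z(a := sqrt (s\<^sup>2 + c\<^sup>2)))) (at s)" by (simp only:)
 thus ?thesis by (rule DERIV_cong_ev[OF refl evn refl, THEN iffD2])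
qed
define D where "D i x = (if i = a \<or> i = b then x i * M (Q x) else partial_deriv i L (Q x))" for i x
have der: "((%t. L (Q (x(i := t)))) has_real_derivative D i x) (at (x i))" if i: "i < n" and x: "x:V" for i x
proof -
 have QO: "Q x:O'" using x by (simp add: V_def)
 consider "i = a" | "i = b" | "i ~= a" "i ~= b" by blast
 thus ?thesis
 proof cases
 case 1
 have e: "Q (x(a := t)) = (x(b := 0))(a := sqrt (t\<^sup>2 + (x b)\<^sup>2))" for t
  using ab by (auto simp: Q_def fold_plane_def fun_eq_iff)
 have "Q x = (x(b := 0))(a := sqrt ((x a)\<^sup>2 + (x b)\<^sup>2))" using e[of "x a"] by simp
 thus ?thesis using line[of "x(b := 0)" "x a" "x b"] QO 1 unfolding D_def by (simp only: e refl if_True simp_thms)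
 next
 case 2
 have e: "Q (x(b := t)) = (x(b := 0))(a := sqrt (t\<^sup>2 + (x a)\<^sup>2))" for t
  using ab by (auto simp: Q_def fold_plane_def fun_eq_iff add.commute)
 have "Q x = (x(b := 0))(a := sqrt ((x b)\<^sup>2 + (x a)\<^sup>2))" using e[of "x b"] by simp
 thus ?thesis using line[of "x(b := 0)" "x b" "x a"] QO 2 unfolding D_def by (simp only: e refl if_True simp_thms)
 next
 case 3
 have e: "Q (x(i := t)) = (Q x)(i := t)" for t
  using ab 3 by (auto simp: Q_def fold_plane_def fun_eq_iff)
 have xi: "x i = Q x i" using 3 by (simp add: Q_def fold_plane_def)
 have "((%t. L ((Q x)(i := t))) has_real_derivative partial_deriv i L (Q x)) (at (Q x i))"
  using Cinf_on_has_partial[OF L _ i, of "Q x" "Q x i"] QO by (simp only: fun_upd_triv)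
 moreover have "D i x = partial_deriv i L (Q x)" using 3 by (simp add: D_def)
 ultimately show ?thesis by (simp only: e fun_upd_triv xi[symmetric])
 qed
qed
have ck: "C_k_on n r V (D i)" if i: "i < n" for i
proof (cases "i = a \<or> i = b")
 case True
 have "C_k_on n r V (%x. M (Q x))"
 by (rule Suc.IH[of M, OF M]) (rule Mev)
 hence "C_k_on n r V (%x. x i * M (Q x))"
 by (rule C_k_on_mult[OF V C_k_on_coord[OF V]])
 moreover have "D i = (%x. x i * M (Q x))" unfolding D_def using True by (simp only: if_True)
 ultimately show ?thesis by (simp only:)
next
 case False
 have pe: "partial_deriv i L (y(a := - y a)) = partial_deriv i L y" if y: "y:O'" for y
 proof -
 have e: "(y(i := t))(a := - (y(i := t)) a) = (y(a := - y a))(i := t)" for t using False by (auto simp: fun_eq_iff)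
 have evn: "\<forall>\<^sub>F t in nhds (y i). L (y(i := t)) = L ((y(a := - y a))(i := t))"
  using eventually_upd_in[OF O y i]
 proof eventually_elim
  case (elim t)
  show ?case using ev[OF elim, symmetric] unfolding e .
 qed
 have "deriv (%t. L (y(i := t))) (y i) = deriv (%t. L ((y(a := - y a))(i := t))) (y i)"
  by (rule deriv_cong_ev[OF evn refl])
 moreover have "(y(a := - y a)) i = y i" using False by simp
 ultimately show ?thesis unfolding partial_deriv_def by (simp only:)
 qed
 have "C_k_on n r V (%x. partial_deriv i L (Q x))"
 by (rule Suc.IH[of "partial_deriv i L", OF Cinf_on_partial[OF L i]]) (rule pe)
 moreover have "D i = (%x. partial_deriv i L (Q x))" unfolding D_def using False by (simp only: if_False)
 ultimately show ?thesis by (simp only:)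
qed
have "continuous_on V (%x. L (Q x))"
 by (rule continuous_on_compose2[OF Cinf_on_imp_continuous[OF L] cQ]) (auto simp: V_def)
thus ?case
proof (rule C_k_on_SucI[where f = "%x. L (Q x)" and f' = D, OF V])
 show "((%t. L (Q (x(i := t)))) has_real_derivative D i x) (at (x i))" if "i < n" "x:V" for i x
 by (rule der[OF that])
 show "C_k_on n r V (D i)" if "i < n" for i by (rule ck[OF that])
qed
qed

abbreviation box_at :: "nat => (nat => real) => real => (nat => real) set" where
"box_at n p de \<equiv> {y:R_vecs n. ALL j<n. \<bar>y j - p j\<bar> < de}"

definition rotate_plane :: "nat => nat => real => real => (nat => real) => nat => real" where
"rotate_plane a b u v x = x(a := u * x a - v * x b, b := u * x b + v * x a)"

lemma box_star:
assumes "p a = 0" "a < n" "x:box_at n p de" "t:{-1..1}"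
shows "x(a := t * x a):box_at n p de"
proof -
have "\<bar>x a\<bar> < de" using assms(1,2,3) by fastforce
moreover have "\<bar>t * x a\<bar> \<le> 1 * \<bar>x a\<bar>" unfolding abs_mult
 using assms(4) by (intro mult_right_mono) auto
ultimately have "\<bar>t * x a - p a\<bar> < de" using assms(1) by simp
thus ?thesis using assms(2,3) by (auto simp: topspace_Euclidean_space)
qed

lemma smooth_on_power: "S \<subseteq> R_vecs n ==> smooth_on n S f ==> smooth_on n S (%x. f x ^ e)"
proof (induction e)
case 0 thus ?case by (simp add: smooth_on_const)
next
case (Suc e) thus ?case by (simp add: smooth_on_mult)
qed

lemma openR_fold_preimage:
assumes "openR n O'" "a < n" "b < n"
shows "openR n {x:R_vecs n. fold_plane a b x:O'}"
proof (rule openR_preimage_coordinatewise[OF openR_R_vecs _ _ assms(1)])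
have 1: "continuous_on S (%x. x j)" for j :: nat and S :: "(nat => real) set"
 by (rule continuous_on_product_then_coordinatewise[OF continuous_on_id])
show "continuous_on (R_vecs n) (%x. fold_plane a b x j)" for j
 by (cases "j = b"; cases "j = a") (auto simp: fold_plane_def intro!: continuous_intros 1)
show "fold_plane a b x:R_vecs n" if "x:R_vecs n" for x
 using that assms by (auto simp: fold_plane_def topspace_Euclidean_space)
qed

text \<open>
A quotient that is known locally along the plane \<open>x_a = x_b = 0\<close>, on the slice \<open>x_b = 0\<close> and with
an even value, is globally a smooth function of the folded coordinates.
\<close>

lemma fold_quotient:
assumes S: "S \<subseteq> R_vecs n" and ab: "a < n" "b < n" "a ~= b"
 and Q: "!!x. x:S ==> fold_plane a b x:S"
 and f: "smooth_on n S f"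
 and loc: "!!p. p:S ==> p a = 0 ==> p b = 0 ==> EX de L. de > 0 & Cinf_on n (box_at n p de) L &
  (ALL y:box_at n p de. L (y(a := - y a)) = L y) &
  (ALL x:S \<inter> box_at n p de. x b = 0 --> f x = x a ^ e * L x) &
  (ALL x:S \<inter> box_at n p de. ALL u. \<bar>u\<bar> < de --> x b = 0 --> x(a := u):S)"
 and e: "e > 0"
shows "EX g. smooth_on n S g & (ALL x:S. f (fold_plane a b x) = sqrt ((x a)\<^sup>2 + (x b)\<^sup>2) ^ e * g x)"
proof -
define rh where "rh x = sqrt ((x a)\<^sup>2 + (x b)\<^sup>2)" for x :: "nat => real"
have rh0: "rh x = 0 \<longleftrightarrow> x a = 0 & x b = 0" for x by (simp add: rh_def sum_power2_eq_zero_iff)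
have Qfix: "fold_plane a b x = x" if "rh x = 0" for x
 using that unfolding rh0 fold_plane_def by (auto simp: fun_eq_iff)
have Qa: "fold_plane a b x a = rh x" and Qb: "fold_plane a b x b = 0" for x
 using ab(3) by (simp_all add: fold_plane_def rh_def)
define g where "g x = (if rh x = 0 then Lim (at_right 0) (%s. f (x(a := s)) / s ^ e)
 else f (fold_plane a b x) * inverse (rh x ^ e))" for x
have "smooth_on n S g"
proof (rule smooth_on_local)
 fix p assume p: "p:S"
 show "EX U. openR n U & p:U & smooth_on n (S \<inter> U) g"
 proof (cases "rh p = 0")
 case False
 define U where "U = {x:R_vecs n. (x a)\<^sup>2 + (x b)\<^sup>2:{0<..}}"
 have U: "openR n U" unfolding U_def
 proof (rule openR_preimage[OF openR_R_vecs])
  have 1: "continuous_on S (%x. x j)" for j :: nat and S :: "(nat => real) set"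
  by (rule continuous_on_product_then_coordinatewise[OF continuous_on_id])
  show "continuous_on (R_vecs n) (%x. (x a)\<^sup>2 + (x b)\<^sup>2)" by (intro continuous_intros 1)
 qed simp
 have pos: "(x a)\<^sup>2 + (x b)\<^sup>2 > 0" if "x:U" for x using that by (simp add: U_def)
 have SU: "S \<inter> U \<subseteq> R_vecs n" using S by blast
 have sq: "smooth_on n (S \<inter> U) (%x. (x a)\<^sup>2 + (x b)\<^sup>2)"
  by (intro smooth_on_add smooth_on_power smooth_on_coord SU)
 have srh: "smooth_on n (S \<inter> U) rh" unfolding rh_def
  by (rule smooth_on_sqrt[OF sq]) (use pos in blast)
 have fQ: "smooth_on n (S \<inter> U) (%x. f (fold_plane a b x))"
 proof (rule smooth_on_compose[OF f S SU])
  show "fold_plane a b x:S" if "x:S \<inter> U" for x using Q that by blast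
  show "smooth_on n (S \<inter> U) (%x. fold_plane a b x j)" for j
  proof -
  consider "j = b" | "j = a" "j ~= b" | "j ~= a" "j ~= b" by blast
  thus ?thesis
  proof cases
   case 1
   hence "fold_plane a b x j = 0" for x using Qb by simp
   thus ?thesis using smooth_on_const[OF SU] by simp
  next
   case 2
   hence "fold_plane a b x j = rh x" for x using Qa by simp
   thus ?thesis using srh by simp
  next
   case 3
   hence "fold_plane a b x j = x j" for x by (simp add: fold_plane_def)
   thus ?thesis using smooth_on_coord[OF SU] by simp
  qed
  qed
 qed
 have rhU: "rh x ~= 0" if "x:U" for x using pos[OF that] unfolding rh_def real_sqrt_eq_zero_cancel_iff by linarith
 have "smooth_on n (S \<inter> U) (%x. f (fold_plane a b x) * inverse (rh x ^ e))"
  by (intro smooth_on_mult fQ smooth_on_inverse smooth_on_power SU srh) (use rhU in auto)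
 hence "smooth_on n (S \<inter> U) g"
  by (rule smooth_on_cong) (use rhU in \<open>auto simp: g_def\<close>)
 moreover have "p:U"
 proof -
  have "p a ~= 0 \<or> p b ~= 0" using False rh0 by blast
  hence "(p a)\<^sup>2 + (p b)\<^sup>2 > 0" by (simp add: sum_power2_gt_zero_iff)
  thus ?thesis using subsetD[OF S p] unfolding U_def by simp
 qed
 ultimately show ?thesis using U by (intro exI[of _ U] conjI)
 next
 case True
 hence "p a = 0" "p b = 0" using rh0 by blast+
 from loc[OF p this] obtain de L where d: "de > 0" and L: "Cinf_on n (box_at n p de) L"
  and Lev: "ALL y:box_at n p de. L (y(a := - y a)) = L y"
  and fL: "ALL x:S \<inter> box_at n p de. x b = 0 --> f x = x a ^ e * L x"
  and ext: "ALL x:S \<inter> box_at n p de. ALL u. \<bar>u\<bar> < de --> x b = 0 --> x(a := u):S"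
  by (elim exE conjE) (rule that)
 define B where "B = box_at n p de"
 have pR: "p:R_vecs n" using p S by blast
 have B: "openR n B" unfolding B_def by (rule openR_box[OF pR])
 define V where "V = {x:R_vecs n. fold_plane a b x:B}"
 have V: "openR n V" unfolding V_def by (rule openR_fold_preimage[OF B ab(1,2)])
 have C: "Cinf_on n V (%x. L (fold_plane a b x))"
  unfolding Cinf_on_def V_def
 proof
  fix r show "C_k_on n r {x:R_vecs n. fold_plane a b x:B} (%x. L (fold_plane a b x))"
  proof (rule C_k_on_fold_plane[OF B ab])
  show "x(a := t * x a):B" if "x:B" "t:{-1..1}" for x t
   using box_star[of p a n x de t, OF \<open>p a = 0\<close> ab(1)] that unfolding B_def by blast
  show "Cinf_on n B L" unfolding B_def by (rule L)
  show "L (y(a := - y a)) = L y" if "y:B" for y using Lev that unfolding B_def by blast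
  qed
 qed
 have pV: "p:V" using Qfix[OF True] pR d by (simp add: V_def B_def)
 have gL: "g x = L (fold_plane a b x)" if x: "x:S" "x:V" for x
 proof (cases "rh x = 0")
  case False
  have "fold_plane a b x:S \<inter> B" using Q[OF x(1)] x(2) by (simp add: V_def)
  hence "f (fold_plane a b x) = rh x ^ e * L (fold_plane a b x)"
  using fL Qb[of x] unfolding B_def Qa[symmetric] by blast
  thus ?thesis using False by (simp add: g_def)
 next
  case True
  hence xB: "x:B" using x(2) Qfix by (simp add: V_def)
  have x0: "x a = 0" "x b = 0" using True rh0 by blast+
  have xR: "x:R_vecs n" using x(1) S by blast
  have in': "x(a := s):S \<inter> B" if "\<bar>s\<bar> < de" for s
  proof
  show "x(a := s):S" using ext x(1) xB that x0 unfolding B_def by blast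
  show "x(a := s):B" using xB that ab(1) \<open>p a = 0\<close>
   unfolding B_def by (auto simp: topspace_Euclidean_space)
  qed
  have "isCont (%s. L (x(a := s))) 0"
  proof -
  have "((%t. L (x(a := t))) has_real_derivative partial_deriv a L (x(a := 0))) (at 0)"
   by (rule Cinf_on_has_partial[OF L _ ab(1)]) (use in'[of 0] d in \<open>simp add: B_def\<close>)
  thus ?thesis by (rule DERIV_isCont)
  qed
  hence lim: "((%s. L (x(a := s))) \<longlongrightarrow> L (x(a := 0))) (at_right 0)"
  unfolding isCont_def by (rule filterlim_mono[OF _ order_refl]) (simp add: at_le)
  have ev: "\<forall>\<^sub>F s in at_right 0. L (x(a := s)) = f (x(a := s)) / s ^ e"
  proof -
  have "\<forall>\<^sub>F s in at_right 0. s:{0<..<de}"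
   by (rule eventually_at_right_real[OF d])
  thus ?thesis
  proof eventually_elim
   case (elim s)
   hence "x(a := s):S \<inter> box_at n p de" using in'[of s] unfolding B_def by simp
   moreover have "(x(a := s)) b = 0" using x0 ab(3) by simp
   ultimately have "f (x(a := s)) = (x(a := s)) a ^ e * L (x(a := s))" using fL by blast
   thus ?case using elim by simp
  qed
  qed
  have "((%s. f (x(a := s)) / s ^ e) \<longlongrightarrow> L (x(a := 0))) (at_right 0)"
  by (rule Lim_transform_eventually[OF lim ev])
  hence "Lim (at_right 0) (%s. f (x(a := s)) / s ^ e) = L (x(a := 0))"
  by (rule tendsto_Lim[rotated]) simp
  moreover have "x(a := 0) = x" using x0 by (auto simp: fun_eq_iff)
  ultimately have "g x = L x" using True unfolding g_def by (simp only: if_True refl)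
  thus ?thesis using Qfix[OF True] by (simp only:)
 qed
 have "smooth_on n (S \<inter> V) (%x. L (fold_plane a b x))"
  by (rule smooth_on_of_Cinf_on[OF V C]) blast
 hence "smooth_on n (S \<inter> V) g"
  by (rule smooth_on_cong) (use gL in auto)
 thus ?thesis using V pV by (intro exI[of _ V] conjI)
 qed
qed
moreover have "f (fold_plane a b x) = rh x ^ e * g x" if x: "x:S" for x
proof (cases "rh x = 0")
 case False thus ?thesis by (simp add: g_def)
next
 case True
 hence x0: "x a = 0" "x b = 0" using rh0 by blast+
 from loc[OF x this] obtain de L where "de > 0"
  "ALL z:S \<inter> box_at n x de. z b = 0 --> f z = z a ^ e * L z" by (elim exE conjE) (rule that)
 moreover have "x:S \<inter> box_at n x de" using x S \<open>de > 0\<close> by auto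
 ultimately have "f x = x a ^ e * L x" using x0(2) by blast
 hence "f x = 0" using x0(1) e by simp
 thus ?thesis using Qfix[OF True] True e by simp
qed
ultimately show ?thesis unfolding rh_def by blast
qed

lemma local_odd_quotient:
assumes S: "S \<subseteq> R_vecs n" and a: "a < n" and f: "smooth_on n S f"
 and odd: "ALL x:S. x b = 0 --> x(a := - x a):S & f (x(a := - x a)) = - f x"
 and p: "p:S" "p a = 0" and de0: "de_0 > 0"
shows "EX de L. de > 0 & de \<le> de_0 & Cinf_on n (box_at n p de) L &
  (ALL y:box_at n p de. L (y(a := - y a)) = L y) &
  (ALL x:S \<inter> box_at n p de. x b = 0 --> f x = x a * L x)"
proof -
from smooth_onE[OF f p(1)] obtain U h where U: "openR n U" "p:U" "Cinf_on n U h"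
 "!!y. y:S ==> y:U ==> f y = h y" by metis
obtain de1 where de1: "de1 > 0" "!!y. y:R_vecs n ==> (!!j. j < n ==> \<bar>y j - p j\<bar> < de1) ==> y:U"
 using openR_contains_box[OF U(1,2)] by blast
define de where "de = min de_0 de1"
define B where "B = box_at n p de"
have d: "de > 0" "de \<le> de_0" "de \<le> de1" using de0 de1 by (auto simp: de_def)
have BU: "B \<subseteq> U" using de1(2) d(3) by (force simp: B_def)
have B: "openR n B" unfolding B_def by (rule openR_box) (use p S in blast)
have star: "x(a := t * x a):B" if "x:B" "t:{-1..1}" for x t
 using box_star[of p a n x de t, OF p(2) a] that unfolding B_def by blast
have star01: "x(a := t * x a):B" if "x:B" "t:{0..1}" for x t using star[OF that(1), of t] that(2) by simp
have neg: "x(a := - x a):B" if "x:B" for x using star[OF that, of "-1"] by simp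
have hB: "Cinf_on n B h" by (rule Cinf_on_mono[OF U(3) BU])
have hN: "Cinf_on n B (%x. h (x(a := - x a)))"
proof (rule Cinf_on_comp[OF B B neg hB])
 fix j assume "j < n"
 show "Cinf_on n B (%x. (x(a := - x a)) j)"
 proof (cases "j = a")
 case True
 have "Cinf_on n B (%x. (-1) * x a)" by (intro Cinf_on_mult Cinf_on_const Cinf_on_coord B)
 thus ?thesis using True by simp
 next
 case False thus ?thesis using Cinf_on_coord[OF B, of j] by simp
 qed
qed
\<comment> \<open>the extension of \<open>f\<close> need not be odd, but its odd part is another extension on the slice\<close>
define k where "k x = (1/2) * (h x + (-1) * h (x(a := - x a)))" for x
have k: "Cinf_on n B k" unfolding k_def
 by (intro Cinf_on_add Cinf_on_mult Cinf_on_const B hB hN)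
have half: "(1/2) * (v + (-1) * u) = - ((1/2) * (u + (-1) * v))" for u v :: real by algebra
have kodd: "k (x(a := - x a)) = - k x" for x
 unfolding k_def fun_upd_same fun_upd_upd minus_minus fun_upd_triv by (rule half)
have fk: "f x = k x" if "x:S" "x:B" "x b = 0" for x
proof -
 have o: "x(a := - x a):S" "f (x(a := - x a)) = - f x" using odd that(1,3) by blast+
 have "f x = h x" using U(4)[OF that(1)] BU that(2) by blast
 moreover have "- f x = h (x(a := - x a))" using U(4)[OF o(1)] BU neg[OF that(2)] o(2) by auto
 ultimately show ?thesis by (simp add: k_def)
qed
define L where "L = hadamard 0 a (partial_deriv a k)"
have L: "Cinf_on n B L" unfolding L_def
 by (rule Cinf_on_hadamard[OF B star01 Cinf_on_partial[OF k a]])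
have kL: "x a * L x = k x" if "x:B" for x
proof -
 have "k (x(a := 0)) = 0" using kodd[of "x(a := 0)"] by simp
 thus ?thesis using hadamard_eq[OF B star01 k a that] by (simp add: L_def)
qed
have Lev: "L (y(a := - y a)) = L y" if y: "y:B" for y
proof (cases "y a = 0")
 case True
 hence "y(a := - y a) = y" by (auto simp: fun_eq_iff)
 thus ?thesis by simp
next
 case False
 have "k (y(a := - y a)) = - y a * L (y(a := - y a))"
 using kL[OF neg[OF y]] by (simp only: fun_upd_same)
 hence "y a * L (y(a := - y a)) = y a * L y"
 unfolding kodd kL[OF y] by linarith
 thus ?thesis unfolding mult_cancel_left using False by blast
qed
have "ALL x:S \<inter> B. x b = 0 --> f x = x a * L x" using fk kL by simp
moreover have "ALL y:B. L (y(a := - y a)) = L y" using Lev by (rule ballI)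
ultimately show ?thesis using d(1,2) L unfolding B_def by (intro exI[of _ de] exI[of _ L] conjI)
qed

lemma local_even_quotient:
assumes S: "S \<subseteq> R_vecs n" and ab: "a < n" "a ~= b" and f: "smooth_on n S f"
 and even: "ALL x:S. x b = 0 --> x(a := - x a):S & f (x(a := - x a)) = f x"
 and zero: "ALL x:S. x a = 0 --> x b = 0 --> f x = 0"
 and p: "p:S" "p a = 0" and de0: "de_0 > 0"
 and ext: "ALL x:S \<inter> box_at n p de_0. x b = 0 --> x(a := 0):S"
shows "EX de L. de > 0 & de \<le> de_0 & Cinf_on n (box_at n p de) L &
  (ALL y:box_at n p de. L (y(a := - y a)) = L y) &
  (ALL x:S \<inter> box_at n p de. x b = 0 --> f x = x a ^ 2 * L x)"
proof -
from smooth_onE[OF f p(1)] obtain U h where U: "openR n U" "p:U" "Cinf_on n U h"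
 "!!y. y:S ==> y:U ==> f y = h y" by metis
obtain de1 where de1: "de1 > 0" "!!y. y:R_vecs n ==> (!!j. j < n ==> \<bar>y j - p j\<bar> < de1) ==> y:U"
 using openR_contains_box[OF U(1,2)] by blast
define de where "de = min de_0 de1"
define B where "B = box_at n p de"
have d: "de > 0" "de \<le> de_0" "de \<le> de1" using de0 de1 by (auto simp: de_def)
have BU: "B \<subseteq> U" using de1(2) d(3) by (force simp: B_def)
have B0: "B \<subseteq> box_at n p de_0" using d(2) by (force simp: B_def)
have pR: "p:R_vecs n" using p S by blast
have B: "openR n B" unfolding B_def by (rule openR_box[OF pR])
have star: "x(a := t * x a):B" if "x:B" "t:{-1..1}" for x t
 using box_star[of p a n x de t, OF p(2) ab(1)] that unfolding B_def by blast
have star01: "x(a := t * x a):B" if "x:B" "t:{0..1}" for x t using star[OF that(1), of t] that(2) by simp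
have neg: "x(a := - x a):B" if "x:B" for x using star[OF that, of "-1"] by simp
have nul: "x(a := 0):B" if "x:B" for x using star[OF that, of 0] by simp
have hB: "Cinf_on n B h" by (rule Cinf_on_mono[OF U(3) BU])
have hN: "Cinf_on n B (%x. h (x(a := - x a)))"
proof (rule Cinf_on_comp[OF B B neg hB])
 fix j assume "j < n"
 show "Cinf_on n B (%x. (x(a := - x a)) j)"
 proof (cases "j = a")
 case True
 have "Cinf_on n B (%x. (-1) * x a)" by (intro Cinf_on_mult Cinf_on_const Cinf_on_coord B)
 thus ?thesis using True by simp
 next
 case False thus ?thesis using Cinf_on_coord[OF B, of j] by simp
 qed
qed
define k where "k x = (1/2) * (h x + h (x(a := - x a)))" for x
have k: "Cinf_on n B k" unfolding k_def
 by (intro Cinf_on_add Cinf_on_mult Cinf_on_const B hB hN)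
have kev: "k (x(a := - x a)) = k x" for x
 unfolding k_def fun_upd_same fun_upd_upd minus_minus fun_upd_triv by (rule arg_cong[OF add.commute])
have fk: "f x = k x" if "x:S" "x:B" "x b = 0" for x
proof -
 have o: "x(a := - x a):S" "f (x(a := - x a)) = f x" using even that(1,3) by blast+
 have "f x = h x" using U(4)[OF that(1)] BU that(2) by blast
 moreover have "f x = h (x(a := - x a))" using U(4)[OF o(1)] BU neg[OF that(2)] o(2) by auto
 ultimately show ?thesis by (simp add: k_def)
qed
define K where "K = hadamard 0 a (partial_deriv a k)"
have K: "Cinf_on n B K" unfolding K_def
 by (rule Cinf_on_hadamard[OF B star01 Cinf_on_partial[OF k ab(1)]])
have kK: "x a * K x = k x - k (x(a := 0))" if "x:B" for x
 using hadamard_eq[OF B star01 k ab(1) that] by (simp only: K_def)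
have Kodd: "K (y(a := - y a)) = - K y" if y: "y:B" for y
proof (cases "y a = 0")
 case False
 have "- y a * K (y(a := - y a)) = k y - k (y(a := 0))"
 using kK[OF neg[OF y]] by (simp only: fun_upd_same fun_upd_upd kev)
 hence "y a * K (y(a := - y a)) = y a * (- K y)"
 unfolding kK[OF y, symmetric] by simp
 thus ?thesis unfolding mult_cancel_left using False by blast
next
 case True
 hence e: "y(a := - y a) = y" by (auto simp: fun_eq_iff)
 \<comment> \<open>the quotient \<open>K\<close> is odd off \<open>x_a = 0\<close> and continuous, hence vanishes there\<close>
 have "K y = 0"
 proof -
 have kd: "partial_deriv a k (x(a := - x a)) = - partial_deriv a k x" if "x:B" for x
 proof (rule partial_deriv_even_odd[where f = k and n = n and O' = B])
  show "y(a := - y a):B" if "y:B" for y by (rule neg[OF that])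
  show "k (y(a := - y a)) = k y" if "y:B" for y by (rule kev)
 qed (fact B k ab(1) that)+
 have "partial_deriv a k y = 0" using kd[OF y] unfolding e by simp
 moreover have "y(a := t * y a) = y" for t using True by (auto simp: fun_eq_iff)
 ultimately show ?thesis unfolding K_def hadamard_def by (simp only: mult_zero_right integral_0)
 qed
 thus ?thesis unfolding e by simp
qed
define L where "L = hadamard 0 a (partial_deriv a K)"
have L: "Cinf_on n B L" unfolding L_def
 by (rule Cinf_on_hadamard[OF B star01 Cinf_on_partial[OF K ab(1)]])
have KL: "x a * L x = K x" if "x:B" for x
proof -
 have "K (x(a := 0)) = 0" using Kodd[OF nul[OF that]] by simp
 thus ?thesis using hadamard_eq[OF B star01 K ab(1) that] by (simp add: L_def)
qed
have Lev: "L (y(a := - y a)) = L y" if y: "y:B" for y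
proof (cases "y a = 0")
 case True
 hence "y(a := - y a) = y" by (auto simp: fun_eq_iff)
 thus ?thesis by simp
next
 case False
 have "K (y(a := - y a)) = - y a * L (y(a := - y a))"
 using KL[OF neg[OF y]] by (simp only: fun_upd_same)
 hence "y a * L (y(a := - y a)) = y a * L y"
 unfolding Kodd[OF y] KL[OF y] by linarith
 thus ?thesis unfolding mult_cancel_left using False by blast
qed
have "f x = x a ^ 2 * L x" if x: "x:S" "x:B" "x b = 0" for x
proof -
 have x0: "x(a := 0):S" using ext x(1,3) B0 x(2) by blast
 have "(x(a := 0)) a = 0" "(x(a := 0)) b = 0" using x(3) ab(2) by simp_all
 hence "f (x(a := 0)) = 0" using zero x0 by blast
 moreover have "f (x(a := 0)) = k (x(a := 0))"
 by (rule fk[OF x0 nul[OF x(2)]]) (use x(3) ab(2) in simp)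
 ultimately have "k x = x a * K x" using kK[OF x(2)] by simp
 thus ?thesis using fk[OF x] KL[OF x(2)] by (simp add: power2_eq_square mult.assoc)
qed
hence "ALL x:S \<inter> B. x b = 0 --> f x = x a ^ 2 * L x" by blast
moreover have "ALL y:B. L (y(a := - y a)) = L y" using Lev by (rule ballI)
ultimately show ?thesis using d(1,2) L unfolding B_def by (intro exI[of _ de] exI[of _ L] conjI)
qed

text \<open>
A set that is invariant under the rotations of the plane of the coordinates \<open>a\<close>, \<open>b\<close>, and contains
locally uniform discs in this plane around its points with \<open>x_a = x_b = 0\<close>.
\<close>

definition rotational :: "nat => nat => nat => (nat => real) set => bool" where
"rotational n a b S \<longleftrightarrow> S \<subseteq> R_vecs n & a < n & b < n & a ~= b &
 (ALL x:S. ALL u v. u\<^sup>2 + v\<^sup>2 = 1 --> rotate_plane a b u v x:S) &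
 (ALL p:S. p a = 0 & p b = 0 --> (\<exists>de>0. ALL x:S \<inter> box_at n p de. ALL u. \<bar>u\<bar> < de --> x b = 0 --> x(a := u):S))"

lemma rotate_plane_fold:
assumes "a ~= b" "sqrt ((x a)\<^sup>2 + (x b)\<^sup>2) = rh" "rh ~= 0"
shows "rotate_plane a b (x a / rh) (x b / rh) (fold_plane a b x) = x"
 "rotate_plane a b (x a / rh) (- (x b / rh)) x = fold_plane a b x"
 "(x a / rh)\<^sup>2 + (x b / rh)\<^sup>2 = 1"
proof -
have r: "rh * rh = (x a)\<^sup>2 + (x b)\<^sup>2" using assms(2) by (metis real_sqrt_mult_self abs_of_nonneg sum_power2_ge_zero)
show "rotate_plane a b (x a / rh) (x b / rh) (fold_plane a b x) = x"
 using assms by (auto simp: rotate_plane_def fold_plane_def fun_eq_iff)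
have "x a * x a / rh + x b * x b / rh = rh" using r assms(3)
 by (simp add: add_divide_distrib[symmetric] power2_eq_square[symmetric] divide_eq_eq)
thus "rotate_plane a b (x a / rh) (- (x b / rh)) x = fold_plane a b x"
 using assms by (auto simp: rotate_plane_def fold_plane_def fun_eq_iff)
show "(x a / rh)\<^sup>2 + (x b / rh)\<^sup>2 = 1"
proof -
 have "((x a)\<^sup>2 + (x b)\<^sup>2) / (rh * rh) = 1" unfolding r[symmetric] using assms(3) by simp
 thus ?thesis unfolding power_divide add_divide_distrib power2_eq_square[of rh] .
qed
qed

lemma rotational_fold:
assumes "rotational n a b S" "x:S" shows "fold_plane a b x:S"
proof (cases "sqrt ((x a)\<^sup>2 + (x b)\<^sup>2) = 0")
case True
hence "x a = 0" "x b = 0" by (simp_all add: sum_power2_eq_zero_iff)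
hence "fold_plane a b x = x" by (auto simp: fold_plane_def fun_eq_iff)
thus ?thesis using assms by simp
next
case False
have ab: "a ~= b" using assms(1) unfolding rotational_def by blast
note r = rotate_plane_fold[where x = x, OF ab refl False]
have "ALL u v. u\<^sup>2 + v\<^sup>2 = 1 --> rotate_plane a b u v x:S" using assms unfolding rotational_def by blast
thus ?thesis using r(2,3) by (metis power2_minus)
qed

lemma rotate_plane_neg: "a ~= b ==> x b = 0 ==> rotate_plane a b (-1) 0 x = x(a := - x a)"
by (auto simp: rotate_plane_def fun_eq_iff)

theorem weight_one_division:
assumes S: "rotational n a b S" and F: "smooth_on n S F1" "smooth_on n S F2"
 and rot: "!!x u v. x:S ==> u\<^sup>2 + v\<^sup>2 = 1 ==>
 F1 (rotate_plane a b u v x) = u * F1 x - v * F2 x & F2 (rotate_plane a b u v x) = u * F2 x + v * F1 x"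
shows "EX A1 A2. smooth_on n S A1 & smooth_on n S A2 &
 (ALL x:S. F1 x = x a * A1 x - x b * A2 x & F2 x = x a * A2 x + x b * A1 x)"
proof -
have SR: "S \<subseteq> R_vecs n" and ab: "a < n" "b < n" "a ~= b" using S unfolding rotational_def by blast+
have Srot: "rotate_plane a b u v x:S" if "x:S" "u\<^sup>2 + v\<^sup>2 = 1" for x u v
 using S that unfolding rotational_def by blast
have quot: "EX g. smooth_on n S g & (ALL x:S. f (fold_plane a b x) = sqrt ((x a)\<^sup>2 + (x b)\<^sup>2) ^ 1 * g x)"
 if f: "smooth_on n S f" and odd: "!!x. x:S ==> f (rotate_plane a b (-1) 0 x) = - f x" for f
proof (rule fold_quotient[OF SR ab rotational_fold[OF S] f])
 fix p assume p: "p:S" "p a = 0" "p b = 0"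
 hence "\<exists>de>0. ALL x:S \<inter> box_at n p de. ALL u. \<bar>u\<bar> < de --> x b = 0 --> x(a := u):S"
 using S unfolding rotational_def by blast
 then obtain de_0 where d0: "de_0 > 0" "ALL x:S \<inter> box_at n p de_0. ALL u. \<bar>u\<bar> < de_0 --> x b = 0 --> x(a := u):S" by blast
 have o: "ALL x:S. x b = 0 --> x(a := - x a):S & f (x(a := - x a)) = - f x"
 proof (intro ballI impI)
 fix x assume x: "x:S" "x b = 0"
 show "x(a := - x a):S & f (x(a := - x a)) = - f x"
  using odd[OF x(1)] Srot[OF x(1), of "-1" 0] unfolding rotate_plane_neg[of a b x, OF ab(3) x(2)] by simp
 qed
 obtain de L where L: "de > 0" "de \<le> de_0" "Cinf_on n (box_at n p de) L"
  "ALL y:box_at n p de. L (y(a := - y a)) = L y"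
  "ALL x:S \<inter> box_at n p de. x b = 0 --> f x = x a * L x"
 using local_odd_quotient[OF SR ab(1) f o p(1,2) d0(1)] by (elim exE conjE) (rule that)
 have bb: "box_at n p de \<subseteq> box_at n p de_0" using L(2) by force
 have "ALL x:S \<inter> box_at n p de. ALL u. \<bar>u\<bar> < de --> x b = 0 --> x(a := u):S"
 proof (intro ballI allI impI)
 fix x u assume x: "x:S \<inter> box_at n p de" "\<bar>u\<bar> < de" "x b = 0"
 hence "x:S \<inter> box_at n p de_0" "\<bar>u\<bar> < de_0" using bb L(2) by auto
 thus "x(a := u):S" using d0(2) x(3) by blast
 qed
 thus "EX de L. de > 0 & Cinf_on n (box_at n p de) L &
  (ALL y:box_at n p de. L (y(a := - y a)) = L y) &
  (ALL x:S \<inter> box_at n p de. x b = 0 --> f x = x a ^ 1 * L x) &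
  (ALL x:S \<inter> box_at n p de. ALL u. \<bar>u\<bar> < de --> x b = 0 --> x(a := u):S)"
 using L unfolding power_one_right by (intro exI[of _ de] exI[of _ L] conjI)
qed simp_all
have m1: "(-1::real)\<^sup>2 + 0\<^sup>2 = 1" by simp
have odd1: "F1 (rotate_plane a b (-1) 0 x) = - F1 x" and odd2: "F2 (rotate_plane a b (-1) 0 x) = - F2 x" if "x:S" for x
 using rot[OF that m1] by simp_all
obtain A1 where A1: "smooth_on n S A1" "ALL x:S. F1 (fold_plane a b x) = sqrt ((x a)\<^sup>2 + (x b)\<^sup>2) ^ 1 * A1 x"
 using quot[OF F(1) odd1] by blast
obtain A2 where A2: "smooth_on n S A2" "ALL x:S. F2 (fold_plane a b x) = sqrt ((x a)\<^sup>2 + (x b)\<^sup>2) ^ 1 * A2 x"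
 using quot[OF F(2) odd2] by blast
have "F1 x = x a * A1 x - x b * A2 x & F2 x = x a * A2 x + x b * A1 x" if x: "x:S" for x
proof (cases "sqrt ((x a)\<^sup>2 + (x b)\<^sup>2) = 0")
 case True
 hence x0: "x a = 0" "x b = 0" by (simp_all add: sum_power2_eq_zero_iff)
 hence "rotate_plane a b (-1) 0 x = x" by (auto simp: rotate_plane_def fun_eq_iff)
 thus ?thesis using odd1[OF x] odd2[OF x] x0 by simp
next
 case False
 define rh where "rh = sqrt ((x a)\<^sup>2 + (x b)\<^sup>2)"
 have rh: "rh ~= 0" using False by (simp add: rh_def)
 note r = rotate_plane_fold[where x = x and rh = rh, OF ab(3) rh_def[symmetric] rh]
 have a12: "F1 (fold_plane a b x) = rh * A1 x" "F2 (fold_plane a b x) = rh * A2 x"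
 using A1(2) A2(2) x unfolding rh_def by simp_all
 have "F1 x = x a / rh * (rh * A1 x) - x b / rh * (rh * A2 x) &
  F2 x = x a / rh * (rh * A2 x) + x b / rh * (rh * A1 x)"
 using rot[OF rotational_fold[OF S x] r(3)] unfolding r(1) a12 .
 thus ?thesis using rh by simp
qed
thus ?thesis using A1(1) A2(1) by blast
qed

theorem invariant_division:
assumes S: "rotational n a b S" and f: "smooth_on n S f"
 and rot: "!!x u v. x:S ==> u\<^sup>2 + v\<^sup>2 = 1 ==> f (rotate_plane a b u v x) = f x"
 and zero: "!!x. x:S ==> x a = 0 ==> x b = 0 ==> f x = 0"
shows "EX g. smooth_on n S g & (ALL x:S. f x = ((x a)\<^sup>2 + (x b)\<^sup>2) * g x)"
proof -
have SR: "S \<subseteq> R_vecs n" and ab: "a < n" "b < n" "a ~= b" using S unfolding rotational_def by blast+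
have Srot: "rotate_plane a b u v x:S" if "x:S" "u\<^sup>2 + v\<^sup>2 = 1" for x u v
 using S that unfolding rotational_def by blast
have m1: "(-1::real)\<^sup>2 + 0\<^sup>2 = 1" by simp
have "EX g. smooth_on n S g & (ALL x:S. f (fold_plane a b x) = sqrt ((x a)\<^sup>2 + (x b)\<^sup>2) ^ 2 * g x)"
proof (rule fold_quotient[OF SR ab rotational_fold[OF S] f])
 fix p assume p: "p:S" "p a = 0" "p b = 0"
 hence "\<exists>de>0. ALL x:S \<inter> box_at n p de. ALL u. \<bar>u\<bar> < de --> x b = 0 --> x(a := u):S"
 using S unfolding rotational_def by blast
 then obtain de_0 where d0: "de_0 > 0" "ALL x:S \<inter> box_at n p de_0. ALL u. \<bar>u\<bar> < de_0 --> x b = 0 --> x(a := u):S" by blast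
 have o: "ALL x:S. x b = 0 --> x(a := - x a):S & f (x(a := - x a)) = f x"
 proof (intro ballI impI)
 fix x assume x: "x:S" "x b = 0"
 show "x(a := - x a):S & f (x(a := - x a)) = f x"
  using rot[OF x(1) m1] Srot[OF x(1) m1] unfolding rotate_plane_neg[of a b x, OF ab(3) x(2)] by simp
 qed
 have ext: "ALL x:S \<inter> box_at n p de_0. x b = 0 --> x(a := 0):S"
 using d0(1) bspec[OF d0(2)] by fastforce
 have z: "ALL x:S. x a = 0 --> x b = 0 --> f x = 0" using zero by blast
 obtain de L where L: "de > 0" "de \<le> de_0" "Cinf_on n (box_at n p de) L"
  "ALL y:box_at n p de. L (y(a := - y a)) = L y"
  "ALL x:S \<inter> box_at n p de. x b = 0 --> f x = x a ^ 2 * L x"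
 using local_even_quotient[OF SR ab(1,3) f o z p(1,2) d0(1) ext] by (elim exE conjE) (rule that)
 have bb: "box_at n p de \<subseteq> box_at n p de_0" using L(2) by force
 have "ALL x:S \<inter> box_at n p de. ALL u. \<bar>u\<bar> < de --> x b = 0 --> x(a := u):S"
 proof (intro ballI allI impI)
 fix x u assume x: "x:S \<inter> box_at n p de" "\<bar>u\<bar> < de" "x b = 0"
 hence "x:S \<inter> box_at n p de_0" "\<bar>u\<bar> < de_0" using bb L(2) by auto
 thus "x(a := u):S" using d0(2) x(3) by blast
 qed
 thus "EX de L. de > 0 & Cinf_on n (box_at n p de) L &
  (ALL y:box_at n p de. L (y(a := - y a)) = L y) &
  (ALL x:S \<inter> box_at n p de. x b = 0 --> f x = x a ^ 2 * L x) &
  (ALL x:S \<inter> box_at n p de. ALL u. \<bar>u\<bar> < de --> x b = 0 --> x(a := u):S)"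
 using L by (intro exI[of _ de] exI[of _ L] conjI)
qed simp_all
then obtain g where g: "smooth_on n S g" "ALL x:S. f (fold_plane a b x) = sqrt ((x a)\<^sup>2 + (x b)\<^sup>2) ^ 2 * g x" by blast
have "f x = ((x a)\<^sup>2 + (x b)\<^sup>2) * g x" if x: "x:S" for x
proof (cases "sqrt ((x a)\<^sup>2 + (x b)\<^sup>2) = 0")
 case True
 hence x0: "x a = 0" "x b = 0" by (simp_all add: sum_power2_eq_zero_iff)
 thus ?thesis using zero[OF x x0] by simp
next
 case False
 note r = rotate_plane_fold[where x = x, OF ab(3) refl False]
 have "f x = f (fold_plane a b x)" using rot[OF rotational_fold[OF S x] r(3)] unfolding r(1) .
 thus ?thesis using g(2) x by simp
qed
thus ?thesis using g(1) by blast
qed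

section \<open>Smooth functions on a manifold\<close>

definition sm :: "'a smooth_space => 'a set => ('a => real) => bool" where
"sm X W f \<longleftrightarrow> (\<forall>(a, U, ph)\<in>charts X. smooth_on a (ph ` (U \<inter> W)) (%u. f (inv_into U ph u)))"

definition csm :: "'a smooth_space => 'a set => ('a => complex) => bool" where
"csm X W f \<longleftrightarrow> sm X W (%x. Re (f x)) & sm X W (%x. Im (f x))"

lemma smD: "sm X W f ==> (a, U, ph):charts X ==> smooth_on a (ph ` (U \<inter> W)) (%u. f (inv_into U ph u))"
unfolding sm_def by blast

lemma smI: "(!!a U ph. (a, U, ph):charts X ==> smooth_on a (ph ` (U \<inter> W)) (%u. f (inv_into U ph u))) ==> sm X W f"
unfolding sm_def by blast

lemma sm_subset: assumes "sm X W f" "V \<subseteq> W" shows "sm X V f"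
by (rule smI, rule smooth_on_subset[OF smD[OF assms(1)]]) (use assms(2) in auto)

lemma csm_subset: "csm X W f ==> V \<subseteq> W ==> csm X V f"
unfolding csm_def using sm_subset by blast

lemma sm_add: assumes "sm X W f" "sm X W g" shows "sm X W (%x. f x + g x)"
by (rule smI, rule smooth_on_add[OF smD[OF assms(1)] smD[OF assms(2)]])

lemma sm_mult: assumes "sm X W f" "sm X W g" shows "sm X W (%x. f x * g x)"
by (rule smI, rule smooth_on_mult[OF smD[OF assms(1)] smD[OF assms(2)]])

lemma sm_arctan: assumes "sm X W f" shows "sm X W (%x. arctan (f x))"
by (rule smI, rule smooth_on_arctan[OF smD[OF assms]])

lemma sm_sin: assumes "sm X W f" shows "sm X W (%x. sin (f x))"
by (rule smI, rule smooth_on_sin[OF smD[OF assms]])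

lemma sm_cos: assumes "sm X W f" shows "sm X W (%x. cos (f x))"
by (rule smI, rule smooth_on_cos[OF smD[OF assms]])

lemma sm_cutoff: assumes "sm X W f" shows "sm X W (%x. cutoff (f x))"
by (rule smI, rule smooth_on_cutoff[OF smD[OF assms]])

locale manifold =
fixes X :: "'a smooth_space"
assumes manifold: "smooth_manifold X"
begin

abbreviation "opn W \<equiv> openin (underlying X) W"

lemma Hausdorff: "Hausdorff_space (underlying X)" and second_countable: "second_countable (underlying X)"
and charts_cover: "(\<Union>(a, U, ph)\<in>charts X. U) = points X"
and charts_homeo: "EX d. \<forall>(a, U, ph)\<in>charts X. a = d & opn U & (EX W. openR d W &
 homeomorphic_map (subtopology (underlying X) U) (subtopology (Euclidean_space d) W) ph)"
and charts_compatible: "\<forall>(a, U, ph)\<in>charts X. \<forall>(b, V, psi)\<in>charts X. ALL j<b.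
  smooth_on a (ph ` (U \<inter> V)) (%u. psi (inv_into U ph u) j)"
by (rule manifold[unfolded smooth_manifold_def, THEN conjunct1]
 manifold[unfolded smooth_manifold_def, THEN conjunct2, THEN conjunct1]
 manifold[unfolded smooth_manifold_def, THEN conjunct2, THEN conjunct2, THEN conjunct2, THEN conjunct1]
 manifold[unfolded smooth_manifold_def, THEN conjunct2, THEN conjunct2, THEN conjunct1]
 manifold[unfolded smooth_manifold_def, THEN conjunct2, THEN conjunct2, THEN conjunct2, THEN conjunct2])+

lemma chart_homeo:
assumes "(a, U, ph):charts X"
obtains W where "opn U" "openR a W"
 "homeomorphic_map (subtopology (underlying X) U) (subtopology (Euclidean_space a) W) ph"
proof -
from charts_homeo obtain d where d: "\<forall>(a, U, ph)\<in>charts X. a = d & opn U & (EX W. openR d W &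
 homeomorphic_map (subtopology (underlying X) U) (subtopology (Euclidean_space d) W) ph)" ..
from bspec[OF d assms] have "a = d" "opn U" "EX W. openR d W &
 homeomorphic_map (subtopology (underlying X) U) (subtopology (Euclidean_space d) W) ph" by simp_all
thus ?thesis using that by blast
qed

lemma chart_open: "(a, U, ph):charts X ==> opn U"
using chart_homeo by metis

lemma chart_sub: "(a, U, ph):charts X ==> U \<subseteq> points X"
using chart_open openin_subset by metis

lemma chart_inj: assumes c: "(a, U, ph):charts X" shows "inj_on ph U"
proof -
obtain W where W: "homeomorphic_map (subtopology (underlying X) U) (subtopology (Euclidean_space a) W) ph"
 using chart_homeo[OF c] by metis
have "topspace (subtopology (underlying X) U) = U" using chart_sub[OF c] by auto
thus ?thesis using homeomorphic_imp_injective_map[OF W] by simp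
qed

lemma chart_image_open:
assumes c: "(a, U, ph):charts X" and V: "opn V" shows "openR a (ph ` (U \<inter> V))"
proof -
obtain W where W: "openR a W" "homeomorphic_map (subtopology (underlying X) U) (subtopology (Euclidean_space a) W) ph"
 using chart_homeo[OF c] by metis
have "openin (subtopology (underlying X) U) (U \<inter> V)" by (rule openin_subtopology_Int2[OF V])
hence "openin (subtopology (Euclidean_space a) W) (ph ` (U \<inter> V))"
 using homeomorphic_imp_open_map[OF W(2)] unfolding open_map_def by blast
thus ?thesis using openin_trans_full[OF _ W(1)] by blast
qed

lemma chart_image_sub: assumes c: "(a, U, ph):charts X" shows "ph ` U \<subseteq> R_vecs a"
using openin_subset[OF chart_image_open[OF c openin_topspace]] chart_sub[OF c] by (simp add: Int_absorb2)

lemma chart_continuous: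
assumes c: "(a, U, ph):charts X" and V: "openR a V" shows "opn {x\<in>U. ph x:V}"
proof -
obtain W where W: "homeomorphic_map (subtopology (underlying X) U) (subtopology (Euclidean_space a) W) ph"
 using chart_homeo[OF c] by metis
have "continuous_map (subtopology (underlying X) U) (Euclidean_space a) ph"
 using homeomorphic_imp_continuous_map[OF W] continuous_map_in_subtopology by blast
note 1 = openin_continuous_map_preimage[OF this V]
have 2: "topspace (subtopology (underlying X) U) = U" using chart_sub[OF c] by auto
show ?thesis by (rule openin_trans_full[OF 1[unfolded 2] chart_open[OF c]])
qed

lemma chart_covers: assumes "x:points X" obtains a U ph where "(a, U, ph):charts X" "x:U"
proof -
have "x:(\<Union>(a, U, ph)\<in>charts X. U)" unfolding charts_cover by (rule assms)
thus ?thesis using that by auto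
qed

lemma sm_const: "sm X W (%x. c)"
by (rule smI, rule smooth_on_const) (use chart_image_sub in blast)

lemma sm_cong: assumes "sm X W f" "!!x. x:W ==> f x = g x" shows "sm X W g"
proof (rule smI)
fix a U ph assume c: "(a, U, ph):charts X"
show "smooth_on a (ph ` (U \<inter> W)) (%u. g (inv_into U ph u))"
proof (rule smooth_on_cong[OF smD[OF assms(1) c]])
 fix u assume "u:ph ` (U \<inter> W)"
 then obtain x where x: "x:U" "x:W" "u = ph x" by blast
 hence "inv_into U ph u = x" using chart_inj[OF c] by simp
 thus "f (inv_into U ph u) = g (inv_into U ph u)" using assms(2) x by simp
qed
qed

lemma sm_minus: "sm X W f ==> sm X W (%x. - f x)"
using sm_mult[OF sm_const[of W "-1"], of f] by simp

lemma sm_diff: "sm X W f ==> sm X W g ==> sm X W (%x. f x - g x)"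
using sm_add[OF _ sm_minus, of W f g] by simp

lemma sm_power: "sm X W f ==> sm X W (%x. f x ^ n)"
by (induction n) (simp_all add: sm_const sm_mult)

lemma sm_sum: "finite I ==> (!!i. i:I ==> sm X W (f i)) ==> sm X W (%x. \<Sum>i\<in>I. f i x)"
by (induction I rule: finite_induct) (simp_all add: sm_const sm_add)

lemma sm_prod: "finite I ==> (!!i. i:I ==> sm X W (f i)) ==> sm X W (%x. \<Prod>i\<in>I. f i x)"
by (induction I rule: finite_induct) (simp_all add: sm_const sm_mult)

lemma inv_into_chart:
assumes c: "(a, U, ph):charts X" and "u:ph ` (U \<inter> W)" shows "inv_into U ph u:W"
proof -
obtain x where x: "x:U" "x:W" "u = ph x" using assms(2) by blast
hence "inv_into U ph u = x" using chart_inj[OF c] by simp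
thus ?thesis using x by simp
qed

lemma sm_inverse: assumes "sm X W f" "!!x. x:W ==> f x ~= 0" shows "sm X W (%x. inverse (f x))"
proof (rule smI)
fix a U ph assume c: "(a, U, ph):charts X"
show "smooth_on a (ph ` (U \<inter> W)) (%u. inverse (f (inv_into U ph u)))"
 by (rule smooth_on_inverse[OF smD[OF assms(1) c]], rule assms(2)[OF inv_into_chart[OF c]])
qed

lemma sm_sqrt: assumes "sm X W f" "!!x. x:W ==> f x > 0" shows "sm X W (%x. sqrt (f x))"
proof (rule smI)
fix a U ph assume c: "(a, U, ph):charts X"
show "smooth_on a (ph ` (U \<inter> W)) (%u. sqrt (f (inv_into U ph u)))"
 by (rule smooth_on_sqrt[OF smD[OF assms(1) c]], rule assms(2)[OF inv_into_chart[OF c]])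
qed

lemma sm_compose:
assumes F: "smooth_on b V F" "V \<subseteq> R_vecs b" and G: "!!j. j < b ==> sm X W (%x. G x j)" "!!x. x:W ==> G x:V"
shows "sm X W (%x. F (G x))"
proof (rule smI)
fix a U ph assume c: "(a, U, ph):charts X"
show "smooth_on a (ph ` (U \<inter> W)) (%u. F (G (inv_into U ph u)))"
proof (rule smooth_on_compose[OF F(1,2)])
 show "ph ` (U \<inter> W) \<subseteq> R_vecs a" using chart_image_sub[OF c] by blast
 show "G (inv_into U ph u):V" if "u:ph ` (U \<inter> W)" for u by (rule G(2)[OF inv_into_chart[OF c that]])
 show "smooth_on a (ph ` (U \<inter> W)) (%u. G (inv_into U ph u) j)" if "j < b" for j
 by (rule smD[OF G(1)[OF that] c])
qed
qed

lemma sm_local: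
assumes "!!x. x:W ==> EX V. opn V & x:V & sm X (W \<inter> V) f" shows "sm X W f"
proof (rule smI)
fix a U ph assume c: "(a, U, ph):charts X"
show "smooth_on a (ph ` (U \<inter> W)) (%u. f (inv_into U ph u))"
proof (rule smooth_on_local)
 fix u assume "u:ph ` (U \<inter> W)"
 then obtain x where x: "x:U" "x:W" "u = ph x" by blast
 obtain V where V: "opn V" "x:V" "sm X (W \<inter> V) f" using assms[OF x(2)] by blast
 have sub: "ph ` (U \<inter> W) \<inter> ph ` (U \<inter> V) \<subseteq> ph ` (U \<inter> (W \<inter> V))"
 using chart_inj[OF c] by (auto simp: inj_on_def)
 show "EX N. openR a N & u:N & smooth_on a (ph ` (U \<inter> W) \<inter> N) (%u. f (inv_into U ph u))"
 proof (intro exI conjI)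
 show "openR a (ph ` (U \<inter> V))" by (rule chart_image_open[OF c V(1)])
 show "u:ph ` (U \<inter> V)" using x V by blast
 show "smooth_on a (ph ` (U \<inter> W) \<inter> ph ` (U \<inter> V)) (%u. f (inv_into U ph u))"
  by (rule smooth_on_subset[OF smD[OF V(3) c] sub])
 qed
qed
qed

lemma sm_chart: assumes c: "(b, V, psi):charts X" and "j < b" shows "sm X V (%x. psi x j)"
proof (rule smI)
fix a U ph assume c': "(a, U, ph):charts X"
from bspec[OF charts_compatible c'] have "\<forall>(b, V, psi)\<in>charts X. ALL j<b.
  smooth_on a (ph ` (U \<inter> V)) (%u. psi (inv_into U ph u) j)" by simp
from bspec[OF this c] show "smooth_on a (ph ` (U \<inter> V)) (%u. psi (inv_into U ph u) j)"
 using assms(2) by simp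
qed

lemma sm_preimage_open:
assumes f: "sm X W f" and W: "opn W" and T: "open T" shows "opn {x\<in>W. f x:T}"
proof (subst openin_subopen, intro ballI)
fix x assume x: "x:{x\<in>W. f x:T}"
hence "x:points X" using openin_subset[OF W] by blast
then obtain a U ph where c: "(a, U, ph):charts X" "x:U" by (rule chart_covers)
define g where "g u = f (inv_into U ph u)" for u
have O: "openR a (ph ` (U \<inter> W))" by (rule chart_image_open[OF c(1) W])
have "smooth_on a (ph ` (U \<inter> W)) g" unfolding g_def by (rule smD[OF f c(1)])
hence "continuous_on (ph ` (U \<inter> W)) g"
 by (rule smooth_on_imp_continuous_on[OF _ openin_subset[OF O]])
from openR_preimage[OF O this T] have "openR a {u:ph ` (U \<inter> W). g u:T}" .
from chart_continuous[OF c(1) this] have "opn {z\<in>U. ph z:{u:ph ` (U \<inter> W). g u:T}}" .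
moreover have "{z\<in>U. ph z:{u:ph ` (U \<inter> W). g u:T}} = {z\<in>U \<inter> W. f z:T}"
proof -
 have *: "ph z:ph ` (U \<inter> W) \<longleftrightarrow> z:U \<inter> W" "g (ph z) = f z" if "z:U" for z
 using inj_on_image_mem_iff[OF chart_inj[OF c(1)] that, of "U \<inter> W"] chart_inj[OF c(1)] that
 by (auto simp: g_def)
 show ?thesis
 proof (rule Collect_cong)
 fix z show "(z:U & ph z:{u:ph ` (U \<inter> W). g u:T}) = (z:U \<inter> W & f z:T)"
 proof (cases "z:U")
  case True show ?thesis unfolding mem_Collect_eq *[OF True] using True by simp
 qed simp
 qed
qed
ultimately have "opn {z\<in>U \<inter> W. f z:T}" by simp
thus "EX S. opn S & x:S & S \<subseteq> {x\<in>W. f x:T}"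
 using x c(2) by (intro exI[of _ "{z\<in>U \<inter> W. f z:T}"]) blast
qed

lemma sm_continuous:
assumes f: "sm X W f" and W: "opn W" shows "continuous_map (subtopology (underlying X) W) euclidean f"
proof -
have "topspace (subtopology (underlying X) W) = W" using openin_subset[OF W] by auto
moreover have "openin (subtopology (underlying X) W) {x\<in>W. f x:T}" if "open T" for T
 using sm_preimage_open[OF f W that] W by (simp add: openin_open_subtopology)
ultimately show ?thesis unfolding continuous_map_def by simp
qed

lemma csm_continuous:
assumes f: "csm X W f" and W: "opn W" shows "continuous_map (subtopology (underlying X) W) euclidean f"
proof -
let ?S = "subtopology (underlying X) W"
have 1: "continuous_map ?S euclidean (%x. Re (f x))" and 2: "continuous_map ?S euclidean (%x. Im (f x))"
 by (rule sm_continuous[OF f[unfolded csm_def, THEN conjunct1] W] sm_continuous[OF f[unfolded csm_def, THEN conjunct2] W])+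
have 3: "continuous_map euclidean euclidean complex_of_real"
 "continuous_map euclidean euclidean (%t. \<i> * complex_of_real t)"
 unfolding continuous_map_iff_continuous2 by (intro continuous_intros)+
have "continuous_map ?S euclidean (%x. (complex_of_real \<circ> (%x. Re (f x))) x + ((%t. \<i> * complex_of_real t) \<circ> (%x. Im (f x))) x)"
 by (rule continuous_map_add[OF continuous_map_compose[OF 1 3(1)] continuous_map_compose[OF 2 3(2)]])
thus ?thesis unfolding o_def complex_eq[symmetric] .
qed

lemma csm_const: "csm X W (%x. c)" by (simp add: csm_def sm_const)

lemma csm_of_real: "sm X W f ==> csm X W (%x. complex_of_real (f x))" by (simp add: csm_def sm_const)

lemma csm_cnj: "csm X W f ==> csm X W (%x. cnj (f x))" by (simp add: csm_def sm_minus)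

lemma csm_mult: "csm X W f ==> csm X W g ==> csm X W (%x. f x * g x)"
by (simp add: csm_def sm_mult sm_add sm_diff)

lemma csm_cong: assumes "csm X W f" "!!x. x:W ==> f x = g x" shows "csm X W g"
using assms(1) sm_cong[of W "%x. Re (f x)" "%x. Re (g x)"] sm_cong[of W "%x. Im (f x)" "%x. Im (g x)"] assms(2)
by (simp add: csm_def)

lemma csm_power: "csm X W f ==> csm X W (%x. f x ^ n)"
by (induction n) (simp_all add: csm_const csm_mult)

lemma csm_prod: "finite I ==> (!!i. i:I ==> csm X W (f i)) ==> csm X W (%x. \<Prod>i\<in>I. f i x)"
by (induction I rule: finite_induct) (simp_all add: csm_const csm_mult)

lemma sm_cmod2: "csm X W f ==> sm X W (%x. (cmod (f x))\<^sup>2)"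
by (simp add: csm_def cmod_power2 sm_add sm_power)

lemma csm_inverse: assumes "csm X W f" "!!x. x:W ==> f x ~= 0" shows "csm X W (%x. inverse (f x))"
proof -
have "csm X W (%x. cnj (f x) * complex_of_real (inverse ((cmod (f x))\<^sup>2)))"
 by (intro csm_mult csm_cnj csm_of_real sm_inverse sm_cmod2 assms(1)) (use assms(2) in simp)
thus ?thesis
proof (rule csm_cong)
 fix x assume "x:W"
 hence "f x ~= 0" by (rule assms(2))
 thus "cnj (f x) * complex_of_real (inverse ((cmod (f x))\<^sup>2)) = inverse (f x)"
 proof -
 have "complex_of_real (inverse ((cmod (f x))\<^sup>2)) = inverse (f x * cnj (f x))"
  by (simp only: of_real_inverse complex_norm_square)
 thus ?thesis using \<open>f x ~= 0\<close> by (simp add: field_simps)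
 qed
qed
qed

lemma csm_divide: assumes "csm X W f" "csm X W g" "!!x. x:W ==> g x ~= 0" shows "csm X W (%x. f x / g x)"
unfolding divide_inverse by (intro csm_mult csm_inverse assms)

lemma csm_cis: "sm X W f ==> csm X W (%x. cis (f x))"
by (simp add: csm_def sm_sin sm_cos)

lemma csm_open_nonzero:
assumes "csm X W f" "opn W" shows "opn {x\<in>W. f x ~= 0}"
proof -
have "opn {x\<in>W. (cmod (f x))\<^sup>2:{0<..}}" by (rule sm_preimage_open[OF sm_cmod2[OF assms(1)] assms(2)]) simp
moreover have "(cmod (f x))\<^sup>2:{0<..} \<longleftrightarrow> f x ~= 0" for x by simp
ultimately show ?thesis by simp
qed

end

section \<open>Maps that pull smooth functions back to smooth functions\<close>

definition smap :: "'a smooth_space => 'a set => 'b smooth_space => ('a => 'b) => bool" where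
"smap X W Y psi \<longleftrightarrow> continuous_map (subtopology (underlying X) W) (underlying Y) psi &
 (ALL V F. openin (underlying Y) V --> sm Y V F --> sm X {x\<in>W. psi x:V} (%x. F (psi x)))"

lemma smap_continuous: "smap X W Y psi ==> continuous_map (subtopology (underlying X) W) (underlying Y) psi"
unfolding smap_def by (rule conjunct1)

lemma smap_pullback:
assumes "smap X W Y psi" "openin (underlying Y) V" "sm Y V F"
shows "sm X {x\<in>W. psi x:V} (%x. F (psi x))"
using assms(1)[unfolded smap_def, THEN conjunct2, rule_format, OF assms(2,3)] .

lemma smap_cpullback:
assumes "smap X W Y psi" "openin (underlying Y) V" "csm Y V F"
shows "csm X {x\<in>W. psi x:V} (%x. F (psi x))"
unfolding csm_def
by (intro conjI smap_pullback[OF assms(1,2)] assms(3)[unfolded csm_def, THEN conjunct1]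
 assms(3)[unfolded csm_def, THEN conjunct2])

lemma smap_preimage_open:
assumes "smap X W Y psi" "openin (underlying X) W" "openin (underlying Y) V"
shows "openin (underlying X) {x\<in>W. psi x:V}"
proof -
note 1 = openin_continuous_map_preimage[OF smap_continuous[OF assms(1)] assms(3)]
have 2: "topspace (subtopology (underlying X) W) = W" using openin_subset[OF assms(2)] by auto
show ?thesis by (rule openin_trans_full[OF 1[unfolded 2] assms(2)])
qed

lemma smap_into: "smap X W Y psi ==> W \<subseteq> points X ==> x:W ==> psi x:points Y"
using continuous_map_funspace[OF smap_continuous] by fastforce

lemma smap_subset:
assumes "smap X W Y psi" "V \<subseteq> W" shows "smap X V Y psi"
unfolding smap_def
proof (intro conjI allI impI)
show "continuous_map (subtopology (underlying X) V) (underlying Y) psi"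
 by (rule continuous_map_from_subtopology_mono[OF smap_continuous[OF assms(1)] assms(2)])
fix V' F assume "openin (underlying Y) V'" "sm Y V' F"
from smap_pullback[OF assms(1) this] show "sm X {x\<in>V. psi x:V'} (%x. F (psi x))"
 by (rule sm_subset) (use assms(2) in auto)
qed

lemma (in manifold) smap_local:
assumes W: "opn W" and loc: "!!x. x:W ==> EX V psi'. opn V & x:V & V \<subseteq> W & smap X V Y psi' & (ALL z:V. psi z = psi' z)"
shows "smap X W Y psi"
unfolding smap_def
proof (intro conjI allI impI)
have WX: "W \<subseteq> points X" using openin_subset[OF W] .
have nbhd: thesis if x: "x:W" and *: "!!V psi'. opn V ==> x:V ==> V \<subseteq> W ==> smap X V Y psi' ==>
 (!!z. z:V ==> psi z = psi' z) ==> thesis" for x thesis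
proof -
 from loc[OF x] show thesis
 proof (elim exE conjE)
 fix V psi' assume V: "opn V" "x:V" "V \<subseteq> W" "smap X V Y psi'" "ALL z:V. psi z = psi' z"
 show thesis by (rule *[OF V(1-4)]) (rule bspec[OF V(5)])
 qed
qed
have op: "opn {x\<in>W. psi x:T}" if T: "openin (underlying Y) T" for T
proof (subst openin_subopen, intro ballI)
 fix x assume x: "x:{x\<in>W. psi x:T}"
 hence "x:W" by simp
 thus "EX S. opn S & x:S & S \<subseteq> {x\<in>W. psi x:T}"
 proof (rule nbhd)
 fix V psi' assume V: "opn V" "x:V" "V \<subseteq> W" "smap X V Y psi'" and e: "!!z. z:V ==> psi z = psi' z"
 have "opn {z\<in>V. psi' z:T}" by (rule smap_preimage_open[OF V(4,1) T])
 moreover have "x:{z\<in>V. psi' z:T}" using x V(2) e[OF V(2)] by simp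
 moreover have "{z\<in>V. psi' z:T} \<subseteq> {x\<in>W. psi x:T}" using V(3) e by auto
 ultimately show ?thesis by (intro exI conjI)
 qed
qed
have into: "psi x:points Y" if "x:W" for x
 using that
proof (rule nbhd)
 fix V psi' assume V: "opn V" "x:V" "smap X V Y psi'" and e: "!!z. z:V ==> psi z = psi' z"
 thus ?thesis using smap_into[OF V(3) openin_subset[OF V(1)] V(2)] e[OF V(2)] by simp
qed
have tW: "topspace (subtopology (underlying X) W) = W" using WX by auto
have "openin (subtopology (underlying X) W) {x\<in>W. psi x:T}" if "openin (underlying Y) T" for T
 using op[OF that] by (simp add: openin_open_subtopology[OF W])
thus "continuous_map (subtopology (underlying X) W) (underlying Y) psi"
 unfolding continuous_map_def tW using into by blast
fix V' F assume V': "openin (underlying Y) V'" and F: "sm Y V' F"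
show "sm X {x\<in>W. psi x:V'} (%x. F (psi x))"
proof (rule sm_local)
 fix x assume x: "x:{x\<in>W. psi x:V'}"
 hence "x:W" by simp
 thus "EX V. opn V & x:V & sm X ({x\<in>W. psi x:V'} \<inter> V) (%x. F (psi x))"
 proof (rule nbhd)
 fix V psi' assume V: "opn V" "x:V" "V \<subseteq> W" "smap X V Y psi'" and e: "!!z. z:V ==> psi z = psi' z"
 have "sm X {z\<in>V. psi' z:V'} (%x. F (psi' x))" by (rule smap_pullback[OF V(4) V' F])
 hence "sm X {z\<in>V. psi' z:V'} (%x. F (psi x))" by (rule sm_cong) (simp add: e)
 hence "sm X ({x\<in>W. psi x:V'} \<inter> V) (%x. F (psi x))" by (rule sm_subset) (use e in auto)
 thus ?thesis using V(1,2) by (intro exI[of _ V] conjI)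
 qed
qed
qed

lemma smap_compose:
assumes "smap X W Y psi" "smap Y V Z bmp" "W \<subseteq> points X" "!!x. x:W ==> psi x:V"
 and V: "openin (underlying Y) V"
shows "smap X W Z (%x. bmp (psi x))"
unfolding smap_def
proof (intro conjI allI impI)
have "continuous_map (subtopology (underlying X) W) (subtopology (underlying Y) V) psi"
 unfolding continuous_map_in_subtopology using smap_continuous[OF assms(1)] assms(4) by auto
moreover have "continuous_map (subtopology (underlying Y) V) (underlying Z) bmp" by (rule smap_continuous[OF assms(2)])
ultimately have "continuous_map (subtopology (underlying X) W) (underlying Z) (bmp \<circ> psi)" by (rule continuous_map_compose)
thus "continuous_map (subtopology (underlying X) W) (underlying Z) (%x. bmp (psi x))" by (simp add: o_def)
fix T F assume T: "openin (underlying Z) T" "sm Z T F"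
have o: "openin (underlying Y) {y\<in>V. bmp y:T}" by (rule smap_preimage_open[OF assms(2) V T(1)])
have "sm X {x\<in>W. psi x:{y\<in>V. bmp y:T}} (%x. F (bmp (psi x)))"
 by (rule smap_pullback[OF assms(1) o smap_pullback[OF assms(2) T]])
thus "sm X {x\<in>W. bmp (psi x):T} (%x. F (bmp (psi x)))" by (rule sm_subset) (use assms(4) in auto)
qed

lemma smooth_map_if_smap:
assumes X: "smooth_manifold X" and Y: "smooth_manifold Y" and f: "smap X (points X) Y f"
shows "smooth_map X Y f"
proof -
interpret X: manifold X by (rule manifold.intro[OF X])
interpret Y: manifold Y by (rule manifold.intro[OF Y])
have "smooth_on a (ph ` {x\<in>U. f x:V}) (%u. psi (f (inv_into U ph u)) j)"
 if c: "(a, U, ph):charts X" "(b, V, psi):charts Y" "j < b" for a U ph b V psi j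
proof -
 have "sm X {x\<in>points X. f x:V} (%x. psi (f x) j)"
 by (rule smap_pullback[OF f Y.chart_open[OF c(2)] Y.sm_chart[OF c(2,3)]])
 from smD[OF this c(1)] have "smooth_on a (ph ` (U \<inter> {x\<in>points X. f x:V})) (%u. psi (f (inv_into U ph u)) j)" .
 moreover have "U \<inter> {x\<in>points X. f x:V} = {x\<in>U. f x:V}" using X.chart_sub[OF c(1)] by auto
 ultimately show ?thesis by simp
qed
moreover have "continuous_map (underlying X) (underlying Y) f" using smap_continuous[OF f] by simp
ultimately show ?thesis unfolding smooth_map_def by auto
qed

section \<open>The torus and its characters\<close>

abbreviation tmul :: "(nat => complex) => (nat => complex) => nat => complex" where
"tmul s t \<equiv> (%i. s i * t i)"

definition circ :: "nat => complex => nat => complex" where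
"circ l v = (%i. if i = l then v else 1)"

lemma torus_mult: "s:torus k ==> t:torus k ==> tmul s t:torus k"
by (auto simp: torus_def norm_mult)

lemma torus_one: "(%_. 1):torus k" by (simp add: torus_def)

lemma torus_inverse: "t:torus k ==> (%i. inverse (t i)):torus k"
by (auto simp: torus_def norm_inverse)

lemma torus_cmod: "t:torus k ==> cmod (t i) = 1"
unfolding torus_def by (cases "i < k") auto

lemma torus_nonzero: "t:torus k ==> t i ~= 0"
using torus_cmod[of t k i] by auto

lemma torusI: "(!!i. i < k ==> cmod (t i) = 1) ==> (!!i. i \<ge> k ==> t i = 1) ==> t:torus k"
by (simp add: torus_def)

lemma torus_ge: "t:torus k ==> i \<ge> k ==> t i = 1" by (simp add: torus_def)

lemma tmul_inverse: "t:torus k ==> tmul t (%i. inverse (t i)) = (%_. 1)"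
"t:torus k ==> tmul (%i. inverse (t i)) t = (%_. 1)"
using torus_nonzero by (auto simp: fun_eq_iff)

lemma circ_torus: "l < k ==> cmod v = 1 ==> circ l v:torus k"
by (auto simp: torus_def circ_def)

lemma circ_mult: "circ l (v * w) = tmul (circ l v) (circ l w)"
by (auto simp: circ_def fun_eq_iff)

lemma circ_same: "circ l v l = v" by (simp add: circ_def)

lemma torus_group_group: "group (torus_group k)"
proof (rule groupI)
show "EX y:carrier (torus_group k). y \<otimes>\<^bsub>torus_group k\<^esub> x = \<one>\<^bsub>torus_group k\<^esub>" if "x:carrier (torus_group k)" for x
proof (rule bexI)
 show "(%i. inverse (x i)) \<otimes>\<^bsub>torus_group k\<^esub> x = \<one>\<^bsub>torus_group k\<^esub>"
 using that tmul_inverse(2)[of x k] by (simp add: torus_group_def)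
 show "(%i. inverse (x i)):carrier (torus_group k)"
 using that torus_inverse[of x k] by (simp add: torus_group_def)
qed
qed (auto simp: torus_group_def torus_mult torus_one mult.assoc)

lemma continuous_on_coord: "continuous_on S (%t. t i)" for S :: "('i => 'c::topological_space) set"
by (rule continuous_on_product_then_coordinatewise[OF continuous_on_id])

lemma continuous_on_circ: "continuous_on S (circ l)"
proof (rule continuous_on_coordinatewise_then_product)
show "continuous_on S (%v. circ l v i)" for i by (cases "i = l") (simp_all add: circ_def)
qed

lemma torus_compact: "compact (torus k)"
proof -
have "torus k = (\<Pi>\<^sub>E i\<in>UNIV. if i < k then sphere 0 1 else {1})"
 by (auto simp: torus_def PiE_iff split: if_splits)
moreover have "compactin (product_topology (%i. euclidean) UNIV) (\<Pi>\<^sub>E i\<in>UNIV. if i < k then sphere (0::complex) 1 else {1})"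
 unfolding compactin_PiE by auto
ultimately show ?thesis by (simp add: euclidean_product_topology)
qed

definition torus_hom :: "nat => nat => ((nat => complex) => nat => complex) => bool" where
"torus_hom k n bet \<longleftrightarrow> (ALL t:torus k. bet t:torus n) &
 (ALL s:torus k. ALL t:torus k. bet (tmul s t) = tmul (bet s) (bet t)) & continuous_on (torus k) bet"

lemma torus_homD:
assumes "torus_hom k n bet"
shows "t:torus k ==> bet t:torus n"
 and "s:torus k ==> t:torus k ==> bet (tmul s t) = tmul (bet s) (bet t)"
 and "continuous_on (torus k) bet"
using assms unfolding torus_hom_def by simp_all

lemma torus_hom_one: assumes "torus_hom k n bet" shows "bet (%_. 1) = (%_. 1)"
proof
fix i
have "bet (%_. 1) i = bet (%_. 1) i * bet (%_. 1) i"
 using torus_homD(2)[OF assms torus_one torus_one] by (simp add: fun_eq_iff)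
moreover have "bet (%_. 1) i ~= 0" using torus_nonzero[OF torus_homD(1)[OF assms torus_one]] .
ultimately show "bet (%_. 1) i = 1" by simp
qed

lemma torus_hom_compose: "torus_hom k n bet ==> torus_hom n m gmm ==> torus_hom k m (%t. gmm (bet t))"
unfolding torus_hom_def
by (intro conjI ballI, simp_all) (elim conjE, rule continuous_on_compose2[of "torus n" gmm "torus k" bet], auto)

text \<open>
A continuous character of the circle is differentiable, because it is a constant multiple of a
difference of its antiderivative; so it solves \<open>f' = c f\<close>.
\<close>

lemma circle_character:
assumes cont: "continuous_on (sphere 0 1) f"
 and hom: "!!v w. cmod v = 1 ==> cmod w = 1 ==> f (v * w) = f v * f w"
 and unit: "!!v. cmod v = 1 ==> cmod (f v) = 1"
shows "\<exists>a::int. ALL v. cmod v = 1 --> f v = v powi a"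
proof -
define h where "h t = f (cis t)" for t
have hh: "h (s + t) = h s * h t" for s t using hom[of "cis s" "cis t"] by (simp add: h_def cis_mult)
have hc: "continuous_on S h" for S
 unfolding h_def by (rule continuous_on_compose2[OF cont]) (auto intro!: continuous_intros)
have h1: "cmod (h t) = 1" for t using unit by (simp add: h_def)
have h0: "h 0 = 1"
proof -
 have "h 0 = h 0 * h 0" using hh[of 0 0] by simp
 moreover have "h 0 ~= 0" using h1[of 0] by auto
 ultimately show ?thesis by simp
qed
obtain g where g: "!!x. x:{-2..2} ==> (g has_vector_derivative h x) (at x within {-2..2})"
 using antiderivative_continuous[OF hc[of "{-2..2}"]] by blast
have g': "(g has_vector_derivative h x) (at x)" if "x:{-2<..<2}" for x
 using g[of x] that at_within_interior[of x "{-2..2}"] by simp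
have ex: "EX d:{0<..<1}. g d ~= g 0"
proof (rule ccontr)
 assume "\<not> ?thesis"
 hence c: "g d = g 0" if "d:{0<..<1}" for d using that by blast
 have "(g has_vector_derivative h (1/2)) (at (1/2))" by (rule g') simp
 moreover have "(g has_vector_derivative 0) (at (1/2))"
 proof (rule has_vector_derivative_transform_within_open[of "%_. g 0" _ _ "{0<..<1}"])
 show "((%_. g 0) has_vector_derivative 0) (at (1/2))" by (rule has_vector_derivative_const)
 qed (use c in auto)
 ultimately have "h (1/2) = 0" by (rule vector_derivative_unique_at)
 thus False using h1[of "1/2"] by simp
qed
then obtain d where d: "0 < d" "d < 1" "g d ~= g 0" by auto
have key: "h t * (g d - g 0) = g (t + d) - g t" if t: "t:{-1<..<1}" for t
proof -
 define k where "k s = h t * (g s - g 0) - (g (t + s) - g t)" for s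
 have "(k has_vector_derivative 0) (at s within {0..d})" if s: "s:{0..d}" for s
 proof -
 have 1: "(g has_vector_derivative h s) (at s)" by (rule g') (use s d in auto)
 have "(g has_vector_derivative h (t + s)) (at (t + s))" by (rule g') (use s t d in auto)
 hence 2: "((%s. g (t + s)) has_vector_derivative h (t + s)) (at s)"
  using vector_diff_chain_at[of "%s. t + s" 1 s g "h (t + s)"]
  by (simp add: o_def has_vector_derivative_add_const has_vector_derivative_id add.commute)
 have "(k has_vector_derivative h t * (h s - 0) - (h (t + s) - 0)) (at s)"
  unfolding k_def by (intro derivative_intros has_vector_derivative_mult_right 1 2)
 thus ?thesis by (simp add: hh has_vector_derivative_at_within)
 qed
 then obtain c where c: "!!s. s:{0..d} ==> k s = c"
 using has_vector_derivative_zero_constant[of "{0..d}" k] by auto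
 have "k d = k 0" using c[of d] c[of 0] d by simp
 thus ?thesis by (simp add: k_def)
qed
have d0: "g d - g 0 ~= 0" using d by simp
define c where "c = (h d - h 0) / (g d - g 0)"
have der0: "(h has_vector_derivative c) (at 0)"
proof -
 have 1: "(g has_vector_derivative h 0) (at 0)" by (rule g') simp
 have "(g has_vector_derivative h d) (at (0 + d))" using g'[of d] d by simp
 hence 2: "((%t. g (t + d)) has_vector_derivative h d) (at 0)"
 using vector_diff_chain_at[of "%s. s + d" 1 0 g "h d"]
 by (simp add: o_def has_vector_derivative_add_const has_vector_derivative_id)
 have "((%t. (g (t + d) - g t) * inverse (g d - g 0)) has_vector_derivative (h d - h 0) * inverse (g d - g 0)) (at 0)"
 by (intro derivative_intros has_vector_derivative_mult_left 1 2)
 thus ?thesis unfolding c_def divide_inverse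
 proof (rule has_vector_derivative_transform_within_open[of _ _ _ "{-1<..<1}"])
 fix t :: real assume "t:{-1<..<1}"
 from key[OF this] show "(g (t + d) - g t) * inverse (g d - g 0) = h t" using d0 by (simp add: field_simps)
 qed auto
qed
have der: "(h has_vector_derivative c * h t) (at t)" for t
proof -
 have "(h has_vector_derivative c) (at (t - t))" using der0 by simp
 hence "((%s. h (s - t)) has_vector_derivative c) (at t)"
 using vector_diff_chain_at[of "%s. s - t" 1 t h c]
 by (simp add: o_def has_vector_derivative_diff_const has_vector_derivative_id)
 hence "((%s. h (s - t) * h t) has_vector_derivative c * h t) (at t)"
 by (rule has_vector_derivative_mult_left)
 moreover have "h (s - t) * h t = h s" for s using hh[of "s - t" t] by simp
 ultimately show ?thesis by (simp only:)
qed
have "(%t. h t * exp (- (c * of_real t))) constant_on UNIV"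
proof -
 have "((%t. h t * exp (- (c * of_real t))) has_vector_derivative 0) (at t within UNIV)" for t
 proof -
 have "((%z. exp (- (c * z))) has_field_derivative exp (- (c * of_real t)) * (- c)) (at (of_real t))"
  by (auto intro!: derivative_eq_intros)
 hence e: "((%t. exp (- (c * of_real t))) has_vector_derivative exp (- (c * of_real t)) * (- c)) (at t)"
  by (rule has_vector_derivative_real_field)
 show ?thesis using has_vector_derivative_mult[OF der[of t] e] by (simp add: algebra_simps)
 qed
 from has_vector_derivative_zero_constant[OF convex_UNIV this] show ?thesis unfolding constant_on_def by blast
qed
then obtain C where C: "!!t. h t * exp (- (c * of_real t)) = C" unfolding constant_on_def by auto
have hexp: "h t = exp (c * of_real t)" for t
proof -
 have "C = 1" using C[of 0] h0 by simp
 hence "h t * exp (- (c * of_real t)) = 1" using C by simp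
 thus ?thesis by (simp add: exp_minus field_simps)
qed
have "Re c = 0" using h1[of 1] hexp[of 1] by simp
have "h (2 * pi) = 1" using h0 by (simp add: h_def)
hence "exp (c * of_real (2 * pi)) = 1" unfolding hexp .
hence "\<exists>m::int. Im (c * of_real (2 * pi)) = of_int (2 * m) * pi" unfolding exp_eq_1 by (rule conjunct2)
then obtain m :: int where "Im (c * of_real (2 * pi)) = of_int (2 * m) * pi" ..
moreover have "Im (c * of_real (2 * pi)) = Im c * (2 * pi)" by simp
moreover have "of_int (2 * m) * pi = real_of_int m * (2 * pi)" by simp
ultimately have "Im c * (2 * pi) = real_of_int m * (2 * pi)" by (simp only:)
hence m: "Im c = of_int m" unfolding mult_cancel_right by (simp only: mult_eq_0_iff pi_neq_zero zero_neq_numeral[symmetric] simp_thms)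
have "f v = v powi m" if "cmod v = 1" for v
proof -
 have t0: "cis (Arg2pi v) = v" using that unfolding complex_norm_eq_1_exp cis_conv_exp .
 define t where "t = Arg2pi v"
 have t: "v = cis t" using t0 by (simp add: t_def)
 have "c = \<i> * of_int m" using \<open>Re c = 0\<close> m by (simp add: complex_eq_iff)
 hence "h t = cis (of_int m * t)" using hexp[of t] by (simp add: cis_conv_exp mult.assoc)
 thus ?thesis by (simp add: h_def t cis_power_int)
qed
thus ?thesis by blast
qed

lemma torus_hom_circ_prod:
assumes "torus_hom k n bet" "t:torus k"
shows "bet t i = (\<Prod>l<k. bet (circ l (t l)) i)"
proof -
define trunc where "trunc j = (%i. if i < j then t i else 1)" for j
have tr: "trunc j:torus k" for j using assms(2) torus_cmod[OF assms(2)] by (auto simp: torus_def trunc_def)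
have "j \<le> k ==> bet (trunc j) i = (\<Prod>l<j. bet (circ l (t l)) i)" for j
proof (induction j)
 case 0
 have "trunc 0 = (%_. 1)" by (simp add: trunc_def)
 thus ?case using torus_hom_one[OF assms(1)] by simp
next
 case (Suc j)
 have "trunc (Suc j) = tmul (trunc j) (circ j (t j))"
 by (auto simp: trunc_def circ_def fun_eq_iff less_Suc_eq)
 hence "bet (trunc (Suc j)) i = bet (trunc j) i * bet (circ j (t j)) i"
 using torus_homD(2)[OF assms(1) tr circ_torus] Suc.prems torus_cmod[OF assms(2)] by simp
 thus ?case using Suc by simp
qed
moreover have "trunc k = t" using assms(2) by (auto simp: trunc_def torus_def fun_eq_iff)
ultimately show ?thesis by (metis order_refl)
qed

lemma torus_hom_circ_character:
assumes "torus_hom k n bet" "l < k"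
shows "\<exists>a::int. ALL v. cmod v = 1 --> bet (circ l v) i = v powi a"
proof (rule circle_character)
have "continuous_on (sphere 0 1) (%v. bet (circ l v))"
 by (rule continuous_on_compose2[OF torus_homD(3)[OF assms(1)] continuous_on_circ]) (auto intro: circ_torus assms)
thus "continuous_on (sphere 0 1) (%v. bet (circ l v) i)" by (rule continuous_on_product_then_coordinatewise)
show "bet (circ l (v * w)) i = bet (circ l v) i * bet (circ l w) i" if "cmod v = 1" "cmod w = 1" for v w
 unfolding circ_mult torus_homD(2)[OF assms(1) circ_torus[OF assms(2) that(1)] circ_torus[OF assms(2) that(2)]] ..
show "cmod (bet (circ l v) i) = 1" if "cmod v = 1" for v
 by (rule torus_cmod[OF torus_homD(1)[OF assms(1) circ_torus[OF assms(2) that]]])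
qed

lemma (in manifold) csm_powi:
assumes "csm X W f" "!!x. x:W ==> f x ~= 0" shows "csm X W (%x. f x powi a)"
unfolding power_int_def by (cases "a \<ge> 0") (simp_all add: csm_power csm_inverse assms)

text \<open>Continuous homomorphisms of tori are smooth, being given by monomials.\<close>

lemma (in manifold) csm_torus_hom:
assumes "torus_hom k n bet" and t: "!!x. x:W ==> t x:torus k" "!!l. l < k ==> csm X W (%x. t x l)"
shows "csm X W (%x. bet (t x) i)"
proof -
have "\<exists>a::int. ALL v. cmod v = 1 --> bet (circ l v) i = v powi a" if "l < k" for l
 by (rule torus_hom_circ_character[OF assms(1) that])
then obtain a :: "nat => int" where a: "!!l v. l < k ==> cmod v = 1 ==> bet (circ l v) i = v powi a l" by metis
have "csm X W (%x. \<Prod>l<k. t x l powi a l)"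
 by (intro csm_prod finite_lessThan csm_powi) (use t(2) torus_nonzero[OF t(1)] in simp_all)
thus ?thesis
proof (rule csm_cong)
 fix x assume "x:W"
 hence "t x:torus k" by (rule t(1))
 thus "(\<Prod>l<k. t x l powi a l) = bet (t x) i"
 using torus_hom_circ_prod[OF assms(1)] a torus_cmod by simp
qed
qed

text \<open>An injective character of the circle is the identity or complex conjugation.\<close>

lemma injective_circle_character:
fixes a :: int
assumes "!!v. cmod v = 1 ==> v powi a = 1 ==> v = 1"
shows "(ALL v. cmod v = 1 --> v powi a = v) \<or> (ALL v. cmod v = 1 --> v powi a = cnj v)"
proof -
have "a ~= 0" using assms[of "-1"] by auto
define v where "v = cis (2 * pi / of_int a)"
have "v powi a = 1" using \<open>a ~= 0\<close> by (simp add: v_def cis_power_int)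
hence "v = 1" using assms[of v] by (simp add: v_def)
hence "cis (2 * pi / of_int a) = 1" by (simp add: v_def)
hence "exp (\<i> * of_real (2 * pi / of_int a)) = 1" by (simp add: cis_conv_exp)
then obtain m :: int where "Im (\<i> * of_real (2 * pi / of_int a)) = of_int (2 * m) * pi" unfolding exp_eq_1 by blast
hence "2 * pi / of_int a = of_int (2 * m) * pi" by simp
hence "1 = real_of_int m * of_int a" using \<open>a ~= 0\<close> by (simp add: field_simps)
hence "m * a = 1" by (metis of_int_1 of_int_eq_iff of_int_mult)
hence "a = 1 \<or> a = -1" by (metis mult.commute zmult_eq_1_iff)
thus ?thesis
proof
 assume "a = -1"
 hence "v powi a = cnj v" if "cmod v = 1" for v
 using that complex_norm_square[of v] by (simp add: power_int_minus inverse_unique)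
 thus ?thesis by blast
qed simp
qed

section \<open>Linear actions of the torus\<close>

abbreviation cscale :: "complex => (nat => complex) => nat => complex" where
"cscale c z \<equiv> (%i. c * z i)"

interpretation cvs: vector_space cscale
by unfold_locales (auto simp: fun_eq_iff algebra_simps)

definition unit_vec :: "nat => nat => complex" where
"unit_vec i = (%j. if j = i then 1 else 0)"

lemma sum_fun_eval: "(\<Sum>i\<in>I. f i) x = (\<Sum>i\<in>I. f i x)" for f :: "'i => 'a => complex"
by (induction I rule: infinite_finite_induct) simp_all

lemma subspace_C_vecs: "cvs.subspace (C_vecs n)"
by (rule cvs.subspaceI) (auto simp: C_vecs_def)

lemma unit_vec_sum: "(\<Sum>i<n. a i * unit_vec i x) = (if x < n then a x else 0)"
proof -
have "a i * unit_vec i x = (if x = i then a i else 0)" for i by (simp add: unit_vec_def)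
hence "(\<Sum>i<n. a i * unit_vec i x) = (\<Sum>i<n. if x = i then a i else 0)" by (simp only:)
also have "\<dots> = (if x < n then a x else 0)" by (simp only: sum.delta' finite_lessThan lessThan_iff)
finally show ?thesis .
qed

lemma C_vecs_expand: assumes "z:C_vecs n" shows "z = (\<Sum>i<n. cscale (z i) (unit_vec i))"
proof
fix x show "z x = (\<Sum>i<n. cscale (z i) (unit_vec i)) x"
 unfolding sum_fun_eval unit_vec_sum using assms by (simp add: C_vecs_def)
qed

lemma unit_vec_in: "i < n ==> unit_vec i:C_vecs n"
by (auto simp: unit_vec_def C_vecs_def)

lemma C_vecs_span: "C_vecs n \<subseteq> cvs.span (unit_vec ` {..<n})"
proof
fix z assume z: "z:C_vecs n"
have "(\<Sum>i<n. cscale (z i) (unit_vec i)):cvs.span (unit_vec ` {..<n})"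
 by (intro cvs.span_sum cvs.span_scale cvs.span_base imageI)
thus "z:cvs.span (unit_vec ` {..<n})" by (subst C_vecs_expand[OF z])
qed

lemma independent_C_vecs_card:
assumes "cvs.independent B" "B \<subseteq> C_vecs n" shows "finite B & card B \<le> n"
proof -
have "B \<subseteq> cvs.span (unit_vec ` {..<n})" using assms(2) C_vecs_span by blast
from cvs.independent_span_bound[OF _ assms(1) this] have "finite B & card B \<le> card (unit_vec ` {..<n})" by simp
moreover have "card (unit_vec ` {..<n}) \<le> n" using card_image_le[of "{..<n}" unit_vec] by simp
ultimately show ?thesis by linarith
qed

lemma independent_unit_vecs: "cvs.independent (unit_vec ` {..<n}) & inj_on unit_vec {..<n}"
proof
show inj: "inj_on unit_vec {..<n}"
proof (rule inj_onI)
 fix x y assume "unit_vec x = unit_vec y"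
 hence "unit_vec x x = unit_vec y x" by (rule fun_cong)
 thus "x = y" by (simp add: unit_vec_def split: if_splits)
qed
show "cvs.independent (unit_vec ` {..<n})"
proof (rule cvs.independent_if_scalars_zero)
 fix f x assume s: "(\<Sum>x\<in>unit_vec ` {..<n}. cscale (f x) x) = 0" and x: "x:unit_vec ` {..<n}"
 obtain j where j: "j < n" "x = unit_vec j" using x by blast
 have "(\<Sum>i<n. cscale (f (unit_vec i)) (unit_vec i)) = 0"
 using s by (simp add: sum.reindex[OF inj] o_def)
 hence "(\<Sum>i<n. cscale (f (unit_vec i)) (unit_vec i)) j = 0" by simp
 thus "f x = 0" using j unfolding sum_fun_eval unit_vec_sum by simp
qed simp
qed

lemma dim_psubspace:
assumes W: "cvs.subspace W" "W \<subseteq> C_vecs n" and W': "cvs.subspace W'" "W' \<subset> W"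
shows "cvs.dim W' < cvs.dim W"
proof -
obtain B where B: "B \<subseteq> W" "cvs.independent B" "W \<subseteq> cvs.span B" "card B = cvs.dim W" by (rule cvs.basis_exists)
obtain B' where B': "B' \<subseteq> W'" "cvs.independent B'" "W' \<subseteq> cvs.span B'" "card B' = cvs.dim W'" by (rule cvs.basis_exists)
obtain w where w: "w:W" "w \<notin> W'" using W' by blast
have "cvs.span B' \<subseteq> W'" by (rule cvs.span_minimal[OF B'(1) W'(1)])
hence nw: "w \<notin> cvs.span B'" using w by blast
have i: "cvs.independent (insert w B')" by (rule cvs.independent_insertI[OF nw B'(2)])
have fB: "finite B" using independent_C_vecs_card[OF B(2)] B(1) W(2) by blast
have "insert w B' \<subseteq> cvs.span B" using w(1) B'(1) W'(2) B(3) by blast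
from cvs.independent_span_bound[OF fB i this] have c: "finite (insert w B')" "card (insert w B') \<le> card B" by simp_all
have "w \<notin> B'" using nw cvs.span_base by blast
hence "card (insert w B') = Suc (card B')" using c(1) by simp
thus ?thesis using c(2) B(4) B'(4) by simp
qed

lemma cis_root_of_unity: assumes "N > 0" shows "cis (- (2 * pi / real N)) ^ N = 1"
proof -
have e: "real N * (- (2 * pi / real N)) = - (2 * pi)" using assms by simp
show ?thesis unfolding Complex.DeMoivre e by (simp add: complex_eq_iff)
qed

lemma root_of_unity_sum:
assumes "N > 0" "i < N"
shows "(\<Sum>j<N. cis (- (2 * pi / real N)) ^ (i * j)) = (if i = 0 then of_nat N else 0)"
proof (cases "i = 0")
case False
define x where "x = cis (- (2 * pi / real N)) ^ i"
have xN: "x ^ N = 1"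
proof -
 have "x ^ N = (cis (- (2 * pi / real N)) ^ N) ^ i" unfolding x_def by (simp add: power_mult[symmetric] mult.commute)
 also have "cis (- (2 * pi / real N)) ^ N = 1" by (rule cis_root_of_unity[OF assms(1)])
 finally show ?thesis by simp
qed
have "x ~= 1"
proof
 assume "x = 1"
 hence "exp (\<i> * of_real (real i * (- (2 * pi / real N)))) = 1" unfolding x_def Complex.DeMoivre unfolding cis_conv_exp .
 hence "\<exists>m::int. Im (\<i> * of_real (real i * (- (2 * pi / real N)))) = of_int (2 * m) * pi"
 unfolding exp_eq_1 by (rule conjunct2)
 then obtain m :: int where "real i * (- (2 * pi / real N)) = of_int (2 * m) * pi" by auto
 hence "pi * (- real i) = pi * (real_of_int m * real N)" using assms(1) by (simp add: field_simps)
 hence "- real i = of_int m * real N" unfolding mult_cancel_left using pi_neq_zero by blast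
 hence "real_of_int (- int i) = real_of_int (m * int N)" by simp
 hence "- int i = m * int N" by (simp only: of_int_eq_iff)
 hence "int N dvd int i" by (metis dvd_minus_iff dvd_triv_right)
 hence "N dvd i" by simp
 thus False using assms False by (auto dest: dvd_imp_le)
qed
have "(\<Sum>j<N. cis (- (2 * pi / real N)) ^ (i * j)) = (\<Sum>j<N. x ^ j)" by (simp add: x_def power_mult)
also have "\<dots> = (x ^ N - 1) / (x - 1)" by (rule geometric_sum[OF \<open>x ~= 1\<close>])
finally show ?thesis using xN False by simp
qed simp

text \<open>
Commuting operators of finite order are simultaneously diagonalizable: unless all of them are
scalar, the eigenspaces of one of them are smaller invariant subspaces whose sum is everything.
\<close>

lemma joint_eigenvectors_span:
fixes F :: "((nat => complex) => nat => complex) set"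
assumes add: "!!A z w. A:F ==> z:C_vecs n ==> w:C_vecs n ==> A (z + w) = A z + A w"
 and scale: "!!A z c. A:F ==> z:C_vecs n ==> A (cscale c z) = cscale c (A z)"
 and comm: "!!A B z. A:F ==> B:F ==> z:C_vecs n ==> A (B z) = B (A z)"
 and ord: "!!A. A:F ==> \<exists>N>0. ALL z:C_vecs n. (A ^^ N) z = z"
shows "cvs.subspace W ==> W \<subseteq> C_vecs n ==> (!!A z. A:F ==> z:W ==> A z:W) ==>
 W \<subseteq> cvs.span {w\<in>W. ALL A:F. EX c. A w = cscale c w}"
proof (induction "cvs.dim W" arbitrary: W rule: less_induct)
case less
note W = less.prems(1) and WV = less.prems(2) and inv = less.prems(3)
show ?case
proof (cases "ALL A:F. EX c. ALL w:W. A w = cscale c w")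
 case True
 hence "W \<subseteq> {w\<in>W. ALL A:F. EX c. A w = cscale c w}" by blast
 thus ?thesis using cvs.span_superset by blast
next
 case False
 then obtain A where A: "A:F" "\<not> (EX c. ALL w:W. A w = cscale c w)" by blast
 obtain N where N: "N > 0" "ALL z:C_vecs n. (A ^^ N) z = z" using ord[OF A(1)] by blast
 define om where "om = cis (2 * pi / real N)"
 define om' where "om' = cis (- (2 * pi / real N))"
 have ww: "om * om' = 1" by (simp add: om_def om'_def cis_mult)
 have wN: "om' ^ N = 1" unfolding om'_def by (rule cis_root_of_unity[OF N(1)])
 have Asum: "A (\<Sum>i<m. cscale (a i) (v i)) = (\<Sum>i<m. cscale (a i) (A (v i)))"
 if "!!i. v i:W" for m :: nat and a v
 proof (induction m)
 case 0
 have "A (cscale 0 (v 0)) = cscale 0 (A (v 0))" by (rule scale[OF A(1)]) (use that WV in blast)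
 thus ?case by (simp add: zero_fun_def)
 next
 case (Suc m)
 have 1: "(\<Sum>i<m. cscale (a i) (v i)):C_vecs n"
 proof (rule subsetD[OF WV])
  show "(\<Sum>i<m. cscale (a i) (v i)):W"
  by (rule cvs.subspace_sum[OF W]) (rule cvs.subspace_scale[OF W that])
 qed
 have 2: "cscale (a m) (v m):C_vecs n" using WV cvs.subspace_scale[OF W that] by blast
 have 3: "v m:C_vecs n" using WV that by blast
 show ?case unfolding sum.lessThan_Suc add[OF A(1) 1 2] Suc.IH scale[OF A(1) 3] ..
 qed
 define Wj where "Wj j = {w\<in>W. A w = cscale (om ^ j) w}" for j
 have Wj_sub: "cvs.subspace (Wj j)" for j
 proof (rule cvs.subspaceI)
 have "A (cscale 0 0) = cscale 0 (A 0)" by (rule scale[OF A(1)]) (use WV cvs.subspace_0[OF W] in blast)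
 hence "A 0 = 0" by (simp add: zero_fun_def)
 thus "0:Wj j" using cvs.subspace_0[OF W] by (simp add: Wj_def zero_fun_def)
 show "x + y:Wj j" if "x:Wj j" "y:Wj j" for x y
 proof -
  have "x:W" "y:W" "A x = cscale (om ^ j) x" "A y = cscale (om ^ j) y" using that by (simp_all add: Wj_def)
  moreover from this have "A (x + y) = A x + A y" using add[OF A(1)] WV by blast
  moreover have "cscale (om ^ j) x + cscale (om ^ j) y = cscale (om ^ j) (x + y)"
  by (rule cvs.scale_right_distrib[symmetric])
  ultimately have "A (x + y) = cscale (om ^ j) (x + y)" by (simp only:)
  thus ?thesis using cvs.subspace_add[OF W \<open>x:W\<close> \<open>y:W\<close>] unfolding Wj_def by blast
 qed
 show "cscale c x:Wj j" if "x:Wj j" for c x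
 proof -
  have x: "x:W" "A x = cscale (om ^ j) x" using that by (simp_all add: Wj_def)
  hence "A (cscale c x) = cscale c (A x)" using scale[OF A(1)] WV by blast
  thus ?thesis using x cvs.subspace_scale[OF W x(1)] by (simp add: Wj_def mult.left_commute)
 qed
 qed
 have Wj_W: "Wj j \<subseteq> W" for j by (auto simp: Wj_def)
 have "Wj j ~= W" for j using A(2) unfolding Wj_def by blast
 hence Wj_lt: "cvs.dim (Wj j) < cvs.dim W" for j
 using dim_psubspace[OF W WV Wj_sub] Wj_W by blast
 have Wj_inv: "B z:Wj j" if B: "B:F" and z: "z:Wj j" for B z j
 proof -
 have z': "z:W" "A z = cscale (om ^ j) z" "z:C_vecs n" using z WV by (auto simp: Wj_def)
 have "A (B z) = B (A z)" by (rule comm[OF A(1) B z'(3)])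
 also have "\<dots> = cscale (om ^ j) (B z)" unfolding z'(2) by (rule scale[OF B z'(3)])
 finally show ?thesis using inv[OF B z'(1)] by (simp add: Wj_def)
 qed
 have IH: "Wj j \<subseteq> cvs.span {w\<in>W. ALL A:F. EX c. A w = cscale c w}" for j
 proof -
 have "Wj j \<subseteq> cvs.span {w\<in>Wj j. ALL A:F. EX c. A w = cscale c w}"
  by (rule less.hyps[OF Wj_lt Wj_sub]) (use Wj_W WV Wj_inv in blast)+
 also have "\<dots> \<subseteq> cvs.span {w\<in>W. ALL A:F. EX c. A w = cscale c w}"
  by (rule cvs.span_mono) (use Wj_W in blast)
 finally show ?thesis .
 qed
 show ?thesis
 proof
 fix w assume w: "w:W"
 define v where "v i = (A ^^ i) w" for i
 have v: "v i:W" for i by (induction i) (simp_all add: v_def w inv[OF A(1)])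
 have vS: "A (v i) = v (Suc i)" for i by (simp add: v_def)
 have vN: "v N = v 0" using N(2) w WV by (auto simp: v_def)
 define e where "e j = (\<Sum>i<N. cscale (om' ^ (i * j) / of_nat N) (v i))" for j
 have eW: "e j:W" for j unfolding e_def
  by (rule cvs.subspace_sum[OF W]) (rule cvs.subspace_scale[OF W v])
 have eA: "A (e j) = cscale (om ^ j) (e j)" for j
 proof -
  define h where "h i = cscale (om' ^ (i * j) / of_nat N) (v i)" for i
  have hN: "h N = h 0" using vN wN by (simp add: h_def power_mult)
  have shift: "cscale (om' ^ (i * j) / of_nat N) (v (Suc i)) = cscale (om ^ j) (h (Suc i))" for i
  proof -
  have "om ^ j * om' ^ (Suc i * j) = (om * om') ^ j * om' ^ (i * j)" by (simp add: power_add power_mult_distrib)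
  hence "om ^ j * om' ^ (Suc i * j) = om' ^ (i * j)" by (simp add: ww)
  thus ?thesis unfolding h_def by (simp only: mult.assoc[symmetric] times_divide_eq_right)
  qed
  have "A (e j) = (\<Sum>i<N. cscale (om ^ j) (h (Suc i)))"
  unfolding e_def Asum[OF v] vS shift ..
  also have "\<dots> = cscale (om ^ j) (\<Sum>i<N. h (Suc i))" by (rule cvs.scale_sum_right[symmetric])
  also have "(\<Sum>i<N. h (Suc i)) = (\<Sum>i<N. h i)"
  using sum.lessThan_Suc_shift[of h N] sum.lessThan_Suc[of h N] hN by (simp add: add.commute)
  finally show ?thesis by (simp only: e_def h_def)
 qed
 have "(\<Sum>j<N. e j) = w"
 proof -
  have "(\<Sum>j<N. e j) = (\<Sum>i<N. \<Sum>j<N. cscale (om' ^ (i * j) / of_nat N) (v i))"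
  unfolding e_def by (rule sum.swap)
  also have "\<dots> = (\<Sum>i<N. cscale (\<Sum>j<N. om' ^ (i * j) / of_nat N) (v i))"
  by (simp only: cvs.scale_sum_left)
  also have "\<dots> = (\<Sum>i<N. if i = 0 then v i else 0)"
  proof (rule sum.cong[OF refl])
  fix i assume "i:{..<N}"
  hence "(\<Sum>j<N. om' ^ (i * j) / of_nat N) = (if i = 0 then 1 else 0)"
   unfolding sum_divide_distrib[symmetric] om'_def using root_of_unity_sum[OF N(1), of i] N(1) by simp
  thus "cscale (\<Sum>j<N. om' ^ (i * j) / of_nat N) (v i) = (if i = 0 then v i else 0)"
   by (auto simp: zero_fun_def)
  qed
  also have "\<dots> = w" using N(1) by (simp add: v_def)
  finally show ?thesis .
 qed
 moreover have "e j:cvs.span {w\<in>W. ALL A:F. EX c. A w = cscale c w}" for j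
 proof (rule subsetD[OF IH[of j]])
  show "e j:Wj j" using eW eA by (simp only: Wj_def mem_Collect_eq simp_thms)
 qed
 hence "(\<Sum>j<N. e j):cvs.span {w\<in>W. ALL A:F. EX c. A w = cscale c w}"
  by (rule cvs.span_sum)
 ultimately show "w:cvs.span {w\<in>W. ALL A:F. EX c. A w = cscale c w}" by (simp only:)
 qed
qed
qed

definition torsion :: "nat => (nat => complex) set" where
"torsion n = {g\<in>torus n. \<exists>N>0. ALL i. g i ^ N = 1}"

lemma torsion_dense:
fixes f :: "(nat => complex) => 'b::t2_space"
assumes f: "continuous_on (torus n) f" and c: "!!g. g:torsion n ==> f g = c" and g: "g:torus n"
shows "f g = c"
proof -
define x where "x i = Arg2pi (g i) / (2 * pi)" for i
define q where "q m i = of_int \<lfloor>real (Suc m) * x i\<rfloor> / real (Suc m)" for m i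
define G where "G m = (%i. if i < n then cis (2 * pi * q m i) else 1)" for m
have gx: "g i = cis (2 * pi * x i)" for i
 using torus_cmod[OF g, of i] unfolding complex_norm_eq_1_exp by (simp add: x_def cis_conv_exp)
have GT: "G m:torsion n" for m
proof -
 have "G m i ^ Suc m = 1" for i
 proof (cases "i < n")
 case True
 have "real (Suc m) * (2 * pi * q m i) = 2 * pi * of_int \<lfloor>real (Suc m) * x i\<rfloor>" by (simp add: q_def)
 hence "cis (real (Suc m) * (2 * pi * q m i)) = 1"
  using cis_multiple_2pi[of "of_int \<lfloor>real (Suc m) * x i\<rfloor>"] by (simp only: Ints_of_int)
 hence "cis (2 * pi * q m i) ^ Suc m = 1" by (simp only: Complex.DeMoivre)
 thus ?thesis using True by (simp only: G_def if_True)
 qed (simp add: G_def)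
 hence "\<exists>N>0. ALL i. G m i ^ N = 1" by (intro exI[of _ "Suc m"]) blast
 moreover have "G m:torus n" by (auto simp: torus_def G_def)
 ultimately show ?thesis by (simp add: torsion_def)
qed
have q: "(%m. q m i) \<longlonglongrightarrow> x i" for i
proof (rule LIMSEQ_I)
 have b: "\<bar>q m i - x i\<bar> \<le> inverse (real (Suc m))" for m
 proof -
 define M where "M = real (Suc m)"
 have M: "M > 0" by (simp add: M_def)
 have "\<bar>of_int \<lfloor>M * x i\<rfloor> - M * x i\<bar> \<le> 1" by linarith
 moreover have "q m i = of_int \<lfloor>M * x i\<rfloor> / M" by (simp only: q_def M_def)
 hence "of_int \<lfloor>M * x i\<rfloor> - M * x i = M * (q m i - x i)"
  using M by (simp add: right_diff_distrib)
 ultimately have "M * \<bar>q m i - x i\<bar> \<le> 1" using M by (simp add: abs_mult)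
 thus ?thesis using M unfolding M_def[symmetric] by (simp add: field_simps)
 qed
 fix r :: real assume "r > 0"
 then obtain m0 where m0: "inverse (real (Suc m0)) < r" using reals_Archimedean by blast
 have "norm (q m i - x i) < r" if "m \<ge> m0" for m
 proof -
 have 1: "inverse (real (Suc m)) \<le> inverse (real (Suc m0))" using that by (intro le_imp_inverse_le) auto
 show ?thesis unfolding real_norm_def by (rule le_less_trans[OF order_trans[OF b[of m] 1] m0])
 qed
 thus "EX no. \<forall>m\<ge>no. norm (q m i - x i) < r" by blast
qed
have "(%m. G m i) \<longlonglongrightarrow> g i" for i
proof (cases "i < n")
 case True
 have "(%m. cis (2 * pi * q m i)) \<longlonglongrightarrow> cis (2 * pi * x i)"
 unfolding cis_conv_exp by (intro tendsto_intros q)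
 thus ?thesis using True by (simp add: G_def gx)
next
 case False thus ?thesis using torus_ge[OF g, of i] by (simp add: G_def)
qed
hence "limitin (product_topology (%_. euclidean) UNIV) G g sequentially"
 unfolding limitin_componentwise by simp
hence "G \<longlonglongrightarrow> g" by (simp add: euclidean_product_topology)
hence "(%m. f (G m)) \<longlonglongrightarrow> f g"
 by (rule continuous_on_tendsto_compose[OF f _ g]) (use GT in \<open>simp add: torsion_def\<close>)
moreover have "(%m. f (G m)) = (%m. c)" using c GT by simp
ultimately have "(%m::nat. c) \<longlonglongrightarrow> f g" by simp
thus ?thesis using LIMSEQ_unique tendsto_const by blast
qed

text \<open>
An injective endomorphism of a torus is onto: it permutes the finitely many points of each order,
so its image contains the dense set of torsion points.
\<close>

lemma injective_torus_endomorphism_surj: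
assumes h: "torus_hom n n al" and inj: "inj_on al (torus n)"
shows "al ` torus n = torus n"
proof
show "al ` torus n \<subseteq> torus n" using torus_homD(1)[OF h] by blast
have pow: "al (%i. g i ^ m) = (%i. al g i ^ m)" and powT: "(%i. g i ^ m):torus n" if "g:torus n" for g m
proof (induction m)
 case 0
 { case 1 thus ?case using torus_hom_one[OF h] by simp }
 { case 2 thus ?case by (simp add: torus_one) }
next
 case (Suc m)
 { case 1 show ?case using torus_homD(2)[OF h that Suc(2)] Suc(1) by simp }
 { case 2 show ?case using torus_mult[OF that Suc(2)] by simp }
qed
have tors: "torsion n \<subseteq> al ` torus n"
proof
 fix g assume g: "g:torsion n"
 then obtain N where N: "N > 0" "ALL i. g i ^ N = 1" by (auto simp: torsion_def)
 define T where "T = {g\<in>torus n. ALL i. g i ^ N = 1}"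
 have "finite T"
 proof (rule finite_subset)
 show "T \<subseteq> (\<Pi>\<^sub>E i\<in>UNIV. if i < n then {z. z ^ N = 1} else {1})" by (auto simp: T_def torus_def)
 have eq: "(\<Pi>\<^sub>E i\<in>UNIV. if i < n then {z::complex. z ^ N = 1} else {1})
  \<subseteq> (%u i. if i < n then u i else 1) ` (\<Pi>\<^sub>E i\<in>{..<n}. {z. z ^ N = 1})"
 proof
  fix u assume u: "u:(\<Pi>\<^sub>E i\<in>UNIV. if i < n then {z::complex. z ^ N = 1} else {1})"
  have "u i = 1" if "\<not> i < n" for i using PiE_mem[OF u, of i] that by simp
  moreover have "u i ^ N = 1" if "i < n" for i using PiE_mem[OF u, of i] that by simp
  ultimately show "u:(%u i. if i < n then u i else 1) ` (\<Pi>\<^sub>E i\<in>{..<n}. {z. z ^ N = 1})"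
  by (intro image_eqI[of _ _ "restrict u {..<n}"]) (auto simp: fun_eq_iff)
 qed
 have "finite (\<Pi>\<^sub>E i\<in>{..<n}. {z::complex. z ^ N = 1})"
  by (rule finite_PiE) (use N in \<open>auto intro: finite_roots_unity\<close>)
 thus "finite (\<Pi>\<^sub>E i\<in>UNIV. if i < n then {z::complex. z ^ N = 1} else {1})"
  using finite_subset[OF eq finite_imageI] by blast
 qed
 moreover have "al ` T \<subseteq> T"
 proof
 fix y assume "y:al ` T"
 then obtain t where t: "t:torus n" "ALL i. t i ^ N = 1" "y = al t" by (auto simp: T_def)
 have "(%i. t i ^ N) = (%_. 1)" using t(2) by auto
 hence "(%i. al t i ^ N) = (%_. 1)" using pow[OF t(1), of N] torus_hom_one[OF h] by simp
 hence "ALL i. al t i ^ N = 1" by (simp add: fun_eq_iff)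
 thus "y:T" using t torus_homD(1)[OF h t(1)] by (simp add: T_def)
 qed
 moreover have "inj_on al T" using inj by (rule inj_on_subset) (auto simp: T_def)
 ultimately have "al ` T = T" by (rule endo_inj_surj)
 moreover have "g:T" using g N by (simp add: T_def torsion_def)
 ultimately show "g:al ` torus n" by (auto simp: T_def)
qed
show "torus n \<subseteq> al ` torus n"
proof (rule ccontr)
 assume "\<not> ?thesis"
 then obtain g where g: "g:torus n" "g \<notin> al ` torus n" by blast
 define K where "K = al ` torus n"
 have "compact K" unfolding K_def by (rule compact_continuous_image[OF torus_homD(3)[OF h] torus_compact])
 hence "closed K" by (rule compact_imp_closed)
 hence "continuous_on UNIV (%x. infdist x K)" by (intro continuous_intros)
 hence "continuous_on (torus n) (%x. infdist x K)" by (rule continuous_on_subset) simp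
 moreover have "infdist x K = 0" if "x:torsion n" for x
 using tors that unfolding K_def by (intro infdist_zero) blast
 ultimately have "infdist g K = 0" using torsion_dense g(1) by blast
 moreover have "K ~= {}" using torus_one unfolding K_def by blast
 ultimately have "g:K" using in_closed_iff_infdist_zero[OF \<open>closed K\<close>] by blast
 thus False using g(2) by (simp add: K_def)
qed
qed

text \<open>
An effective linear action is diagonal in a suitable basis: the torsion points act by commuting
operators of finite order, and they are dense. Its weights form an automorphism of the torus.
\<close>

theorem effective_linear_action_diagonal:
assumes eff: "effective_linear_action n rh"
obtains al p q where "torus_hom n n al" "inj_on al (torus n)"
 "!!z i. z:C_vecs n ==> i < n ==> (\<Sum>j<n. p i j * (\<Sum>l<n. q j l * z l)) = z i"
 "!!z i. z:C_vecs n ==> i < n ==> (\<Sum>j<n. q i j * (\<Sum>l<n. p j l * z l)) = z i"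
 "!!g z i. g:torus n ==> z:C_vecs n ==> i < n ==> (\<Sum>j<n. p i j * rh g z j) = al g i * (\<Sum>j<n. p i j * z j)"
proof -
note e1 = eff[unfolded effective_linear_action_def, THEN conjunct1]
note e2 = eff[unfolded effective_linear_action_def, THEN conjunct2, THEN conjunct1]
note e3 = eff[unfolded effective_linear_action_def, THEN conjunct2, THEN conjunct2]
have ga: "group_action (torus_group n) (C_vecs n) rh" using e1 by (rule faithful_action.axioms(1))
have carrier: "carrier (torus_group n) = torus n" by (simp add: torus_group_def)
have rin: "rh g z:C_vecs n" if "g:torus n" "z:C_vecs n" for g z
 by (rule group_action.element_image[OF ga _ that(2) refl]) (simp add: carrier that)
have rmul: "rh (tmul g h) z = rh g (rh h z)" if "g:torus n" "h:torus n" "z:C_vecs n" for g h z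
 using group_action.composition_rule[OF ga that(3), of g h] that by (simp add: torus_group_def)
have rone: "rh (%_. 1) z = z" if "z:C_vecs n" for z
proof -
 have "(\<lambda>x\<in>C_vecs n. x) = rh \<one>\<^bsub>torus_group n\<^esub>" by (rule group_action.id_eq_one[OF ga])
 hence "(\<lambda>x\<in>C_vecs n. x) = rh (%_. 1)" by (simp add: torus_group_def)
 from fun_cong[OF this, of z] show ?thesis using that by simp
qed
have radd: "rh g (z + w) = rh g z + rh g w" if "g:torus n" "z:C_vecs n" "w:C_vecs n" for g z w
 using e2 that unfolding plus_fun_def by blast
have rscale: "rh g (cscale c z) = cscale c (rh g z)" if "g:torus n" "z:C_vecs n" for g z c
 using e2 that by blast
have V: "cvs.subspace (C_vecs n)" by (rule subspace_C_vecs)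
have Vsum: "(\<Sum>i<m. cscale (a i) (v i)):C_vecs n" if "!!i. i < m ==> v i:C_vecs n" for m :: nat and a v
 by (rule cvs.subspace_sum[OF V], rule cvs.subspace_scale[OF V]) (simp add: that)
have rsum: "rh g (\<Sum>i<m. cscale (a i) (v i)) = (\<Sum>i<m. cscale (a i) (rh g (v i)))"
 if g: "g:torus n" and v: "!!i. i < m ==> v i:C_vecs n" for m :: nat and a v g
 using v
proof (induction m)
 case 0
 have "0:C_vecs n" by (rule cvs.subspace_0[OF V])
 from rscale[OF g this, of 0] show ?case by (simp add: zero_fun_def)
next
 case (Suc m)
 have 1: "(\<Sum>i<m. cscale (a i) (v i)):C_vecs n" by (rule Vsum) (use Suc.prems in simp)
 have 3: "v m:C_vecs n" using Suc.prems by simp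
 have 2: "cscale (a m) (v m):C_vecs n" by (rule cvs.subspace_scale[OF V 3])
 have IH: "rh g (\<Sum>i<m. cscale (a i) (v i)) = (\<Sum>i<m. cscale (a i) (rh g (v i)))"
 by (rule Suc.IH) (use Suc.prems in simp)
 show ?case unfolding sum.lessThan_Suc radd[OF g 1 2] IH rscale[OF g 3] ..
qed
have powT: "(%i. g i ^ m):torus n" if "g:torus n" for g m
 using that torus_cmod[OF that] by (auto simp: torus_def norm_power)
have rpow: "(rh g ^^ m) z = rh (%i. g i ^ m) z" if g: "g:torus n" and z: "z:C_vecs n" for g m z
proof (induction m)
 case 0 thus ?case using rone[OF z] by simp
next
 case (Suc m)
 have "rh (%i. g i ^ Suc m) z = rh g (rh (%i. g i ^ m) z)"
 using rmul[OF g powT[OF g] z] by simp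
 thus ?case using Suc by simp
qed
define F where "F = rh ` torsion n"
define J where "J = {w\<in>C_vecs n. ALL A:F. EX c. A w = cscale c w}"
have tT: "g:torus n" if "g:torsion n" for g using that by (simp add: torsion_def)
have "C_vecs n \<subseteq> cvs.span J" unfolding J_def
proof (rule joint_eigenvectors_span[where n = n])
 fix A assume "A:F"
 then obtain g where g: "g:torsion n" "A = rh g" by (auto simp: F_def)
 show "A (z + w) = A z + A w" if "z:C_vecs n" "w:C_vecs n" for z w
 unfolding g(2) by (rule radd[OF tT[OF g(1)] that])
 show "A (cscale c z) = cscale c (A z)" if "z:C_vecs n" for z c
 unfolding g(2) by (rule rscale[OF tT[OF g(1)] that])
 show "A z:C_vecs n" if "z:C_vecs n" for z
 unfolding g(2) by (rule rin[OF tT[OF g(1)] that])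
 show "\<exists>N>0. ALL z:C_vecs n. (A ^^ N) z = z"
 proof -
 obtain N where N: "N > 0" "ALL i. g i ^ N = 1" using g(1) by (auto simp: torsion_def)
 have "(A ^^ N) z = z" if "z:C_vecs n" for z
  unfolding g(2) rpow[OF tT[OF g(1)] that] using N(2) rone[OF that] by simp
 thus ?thesis using N(1) by blast
 qed
 show "A (B z) = B (A z)" if B: "B:F" and z: "z:C_vecs n" for B z
 proof -
 obtain h where h: "h:torsion n" "B = rh h" using B by (auto simp: F_def)
 have "tmul g h = tmul h g" by (simp add: mult.commute)
 thus ?thesis unfolding g(2) h(2)
  using rmul[OF tT[OF g(1)] tT[OF h(1)] z] rmul[OF tT[OF h(1)] tT[OF g(1)] z] by simp
 qed
qed (use V in simp_all)
moreover obtain B where B: "B \<subseteq> J" "cvs.independent B" "J \<subseteq> cvs.span B"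
 by (rule cvs.maximal_independent_subset)
ultimately have VB: "C_vecs n \<subseteq> cvs.span B"
 using cvs.span_minimal[OF B(3) cvs.subspace_span] by blast
have BV: "B \<subseteq> C_vecs n" using B(1) by (auto simp: J_def)
have fB: "finite B" "card B \<le> n" using independent_C_vecs_card[OF B(2) BV] by simp_all
have "n \<le> card B"
proof -
 have "unit_vec ` {..<n} \<subseteq> cvs.span B" using unit_vec_in VB by blast
 from cvs.independent_span_bound[OF fB(1) conjunct1[OF independent_unit_vecs] this]
 show ?thesis using card_image[OF conjunct2[OF independent_unit_vecs[of n]]] by simp
qed
hence "card B = n" using fB by simp
then obtain b where b: "bij_betw b {..<n} B"
 using ex_bij_betw_nat_finite[OF fB(1)] by (auto simp: atLeast0LessThan)
have bB: "b i:B" if "i < n" for i using b that by (auto simp: bij_betw_def)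
have bV: "b i:C_vecs n" if "i < n" for i using bB[OF that] BV by blast
define R where "R z i = cvs.representation B z (b i)" for z i
have Rexp: "z = (\<Sum>i<n. cscale (R z i) (b i))" if z: "z:C_vecs n" for z
proof -
 have "(\<Sum>v\<in>B. cscale (cvs.representation B z v) v) = z"
 by (rule cvs.sum_representation_eq[OF B(2) _ fB(1) order_refl]) (use z VB in blast)
 thus ?thesis
 using sum.reindex_bij_betw[OF b, of "%v. cscale (cvs.representation B z v) v"] by (simp add: R_def)
qed
have Rsum: "R (\<Sum>j<m. cscale (a j) (v j)) i = (\<Sum>j<m. a j * R (v j) i)"
 if v: "!!j. j < m ==> v j:C_vecs n" for m :: nat and a v i
proof -
 have s: "v j:cvs.span B" if "j < m" for j using v[OF that] VB by blast
 have "cvs.representation B (\<Sum>j<m. cscale (a j) (v j)) = (%x. \<Sum>j<m. cvs.representation B (cscale (a j) (v j)) x)"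
 by (rule cvs.representation_sum[OF B(2)]) (use s cvs.span_scale in simp)
 thus ?thesis using cvs.representation_scale[OF B(2) s] by (simp add: R_def)
qed
have Rb: "R (b j) i = (if i = j then 1 else 0)" if "i < n" "j < n" for i j
 unfolding R_def cvs.representation_basis[OF B(2) bB[OF that(2)]]
 using b that by (auto simp: bij_betw_def inj_on_def)
have Rcomb: "R (\<Sum>j<n. cscale (a j) (b j)) i = a i" if "i < n" for a i
proof -
 have "R (\<Sum>j<n. cscale (a j) (b j)) i = (\<Sum>j<n. a j * R (b j) i)" by (rule Rsum) (rule bV)
 also have "\<dots> = (\<Sum>j<n. if i = j then a j else 0)" by (rule sum.cong[OF refl]) (use Rb that in auto)
 finally show ?thesis using that by simp
qed
define p where "p i j = R (unit_vec j) i" for i j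
define q where "q j l = b l j" for j l
have Rp: "R z i = (\<Sum>j<n. p i j * z j)" if z: "z:C_vecs n" for z i
proof -
 have "R (\<Sum>j<n. cscale (z j) (unit_vec j)) i = (\<Sum>j<n. z j * R (unit_vec j) i)" by (rule Rsum) (rule unit_vec_in)
 thus ?thesis unfolding C_vecs_expand[OF z, symmetric] by (simp add: p_def mult.commute)
qed
define c where "c g i = R (rh g (b i)) i" for g i
have cont: "continuous_on (torus n) (%g. R (rh g (b i)) l)" if i: "i < n" for i l
proof -
 have "continuous_map (top_of_set (torus n)) (prod_topology (top_of_set (torus n)) (top_of_set (C_vecs n))) (%g. (g, b i))"
 using bV[OF i] by (intro continuous_map_pairedI) (simp_all add: continuous_map_const)
 from continuous_map_compose[OF this e3]
 have "continuous_map (top_of_set (torus n)) (top_of_set (C_vecs n)) (%g. rh g (b i))" by (simp add: o_def)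
 hence "continuous_on (torus n) (%g. rh g (b i))"
 by (simp add: continuous_map_in_subtopology)
 hence "continuous_on (torus n) (%g. rh g (b i) j)" for j by (rule continuous_on_product_then_coordinatewise)
 hence "continuous_on (torus n) (%g. \<Sum>j<n. p l j * rh g (b i) j)" by (intro continuous_intros)
 thus ?thesis using Rp[OF rin[OF _ bV[OF i]]] by (simp cong: continuous_on_cong_simp)
qed
have off: "R (rh g (b i)) l = 0" if "g:torus n" "i < n" "l < n" "l ~= i" for g i l
proof (rule torsion_dense[OF cont[OF that(2)] _ that(1)])
 fix h assume h: "h:torsion n"
 have "b i:J" using bB[OF that(2)] B(1) by blast
 then obtain d where d: "rh h (b i) = cscale d (b i)" using h unfolding J_def F_def by blast
 have "cscale d (b i) = (\<Sum>j<n. cscale (if j = i then d else 0) (b j))"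
 proof -
 have "(\<Sum>j<n. cscale (if j = i then d else 0) (b j)) = (\<Sum>j<n. if j = i then cscale d (b j) else 0)"
  by (rule sum.cong[OF refl]) (auto simp: zero_fun_def)
 thus ?thesis using that(2) by simp
 qed
 thus "R (rh h (b i)) l = 0" unfolding d using Rcomb[OF that(3), of "%j. if j = i then d else 0"] that(4) by simp
qed
have eig: "rh g (b i) = cscale (c g i) (b i)" if g: "g:torus n" and i: "i < n" for g i
proof -
 have "(\<Sum>l<n. cscale (R (rh g (b i)) l) (b l)) = (\<Sum>l<n. if l = i then cscale (c g i) (b i) else 0)"
 by (rule sum.cong[OF refl]) (use off[OF g i] in \<open>auto simp: zero_fun_def c_def\<close>)
 also have "\<dots> = cscale (c g i) (b i)" using i by simp
 finally show ?thesis unfolding Rexp[OF rin[OF g bV[OF i]], symmetric] .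
qed
have Rsc: "R (cscale d (b i)) i = d" if "i < n" for d i
proof -
 have "b i:cvs.span B" using bV[OF that] VB by blast
 thus ?thesis using Rb[OF that that] cvs.representation_scale[OF B(2)] by (simp add: R_def)
qed
have cmul: "c (tmul g h) i = c g i * c h i" if "g:torus n" "h:torus n" "i < n" for g h i
proof -
 have "rh (tmul g h) (b i) = rh g (rh h (b i))" by (rule rmul[OF that(1,2) bV[OF that(3)]])
 also have "\<dots> = rh g (cscale (c h i) (b i))" by (rule arg_cong[OF eig[OF that(2,3)]])
 also have "\<dots> = cscale (c h i) (rh g (b i))" by (rule rscale[OF that(1) bV[OF that(3)]])
 also have "\<dots> = cscale (c h i) (cscale (c g i) (b i))" by (rule arg_cong[OF eig[OF that(1,3)]])
 also have "\<dots> = cscale (c h i * c g i) (b i)" by (simp only: mult.assoc)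
 finally have "R (rh (tmul g h) (b i)) i = R (cscale (c h i * c g i) (b i)) i" by (rule arg_cong)
 hence "c (tmul g h) i = c h i * c g i" unfolding Rsc[OF that(3)] by (simp only: c_def)
 thus ?thesis by (simp only: mult.commute)
qed
have c1: "c (%_. 1) i = 1" if "i < n" for i
 using Rb[OF that that] rone[OF bV[OF that]] by (simp add: c_def)
have cpow: "c (%i. g i ^ m) i = c g i ^ m" if "g:torus n" "i < n" for g m i
proof (induction m)
 case 0 thus ?case using c1[OF that(2)] by simp
next
 case (Suc m) thus ?case using cmul[OF that(1) powT[OF that(1)] that(2), of m] by simp
qed
have cn: "cmod (c g i) = 1" if "g:torus n" "i < n" for g i
proof (rule torsion_dense[of n "%g. cmod (c g i)", OF _ _ that(1)])
 show "continuous_on (torus n) (%g. cmod (c g i))" unfolding c_def by (intro continuous_intros cont that)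
 fix h assume h: "h:torsion n"
 then obtain N where N: "N > 0" "ALL i. h i ^ N = 1" by (auto simp: torsion_def)
 hence "c h i ^ N = 1" using cpow[OF tT[OF h] that(2), of N] c1[OF that(2)] by simp
 thus "cmod (c h i) = 1" using N(1) power_eq_1_iff by blast
qed
define al where "al g = (%i. if i < n then c g i else 1)" for g
have "torus_hom n n al" unfolding torus_hom_def
proof (intro conjI ballI)
 show "al t:torus n" if "t:torus n" for t using cn[OF that] by (simp add: torus_def al_def)
 show "al (tmul s t) = tmul (al s) (al t)" if "s:torus n" "t:torus n" for s t
 using cmul[OF that] by (auto simp: al_def fun_eq_iff)
 show "continuous_on (torus n) al"
 proof (rule continuous_on_coordinatewise_then_product)
 show "continuous_on (torus n) (%g. al g i)" for i
  using cont[of i i] by (cases "i < n") (simp_all add: al_def c_def)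
 qed
qed
have act: "rh g z = (\<Sum>l<n. cscale (R z l * c g l) (b l))" if g: "g:torus n" and z: "z:C_vecs n" for g z
proof -
 have e: "cscale (R z i) (rh g (b i)) = cscale (R z i * c g i) (b i)" if "i < n" for i
 proof -
 have "cscale (R z i) (rh g (b i)) = cscale (R z i) (cscale (c g i) (b i))"
  by (rule arg_cong[OF eig[OF g that]])
 also have "\<dots> = cscale (R z i * c g i) (b i)" by (simp only: mult.assoc)
 finally show ?thesis .
 qed
 have "rh g z = rh g (\<Sum>i<n. cscale (R z i) (b i))" by (rule arg_cong[OF Rexp[OF z]])
 also have "\<dots> = (\<Sum>i<n. cscale (R z i) (rh g (b i)))"
 by (rule rsum[where a = "R z" and v = b, OF g]) (rule bV)
 also have "\<dots> = (\<Sum>l<n. cscale (R z l * c g l) (b l))"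
 by (rule sum.cong[OF refl]) (rule e, simp only: lessThan_iff)
 finally show ?thesis .
qed
have "inj_on al (torus n)"
proof (rule inj_onI)
 fix g h assume gh: "g:torus n" "h:torus n" "al g = al h"
 have "c g i = c h i" if "i < n" for i using fun_cong[OF gh(3), of i] that by (simp add: al_def)
 hence same: "rh g z = rh h z" if "z:C_vecs n" for z
 proof -
 have "(\<Sum>l<n. cscale (R z l * c g l) (b l)) = (\<Sum>l<n. cscale (R z l * c h l) (b l))"
  by (rule sum.cong[OF refl]) (simp only: lessThan_iff \<open>!!i. i < n ==> c g i = c h i\<close>)
 thus ?thesis by (rule trans[OF act[OF gh(1) that] trans[OF _ act[OF gh(2) that, symmetric]]])
 qed
 have "rh g:extensional (C_vecs n)" "rh h:extensional (C_vecs n)"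
 using group_action.bij_prop0[OF ga] gh by (auto simp: carrier Bij_def)
 hence "rh g = rh h" by (rule extensionalityI) (rule same)
 thus "g = h" using inj_onD[OF faithful_action.faithful[OF e1], of g h] gh(1,2) unfolding carrier by simp
qed
have pq: "(\<Sum>j<n. p i j * (\<Sum>l<n. q j l * z l)) = z i" if "z:C_vecs n" "i < n" for z i
proof -
 have w: "(\<Sum>l<n. cscale (z l) (b l)):C_vecs n" by (rule Vsum) (rule bV)
 have "(\<Sum>j<n. p i j * (\<Sum>l<n. cscale (z l) (b l)) j) = z i"
 by (rule trans[OF Rp[OF w, symmetric] Rcomb[OF that(2)]])
 thus ?thesis unfolding sum_fun_eval q_def by (simp only: mult.commute[of "b _ _"])
qed
have qp: "(\<Sum>j<n. q i j * (\<Sum>l<n. p j l * z l)) = z i" if "z:C_vecs n" "i < n" for z i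
proof -
 have "(\<Sum>l<n. R z l * b l i) = z i"
 using fun_cong[OF Rexp[OF that(1)], of i, symmetric] unfolding sum_fun_eval .
 thus ?thesis unfolding q_def Rp[OF that(1), symmetric] by (simp only: mult.commute[of "b _ _"])
qed
have eq: "(\<Sum>j<n. p i j * rh g z j) = al g i * (\<Sum>j<n. p i j * z j)" if "g:torus n" "z:C_vecs n" "i < n" for g z i
proof -
 have "R (rh g z) i = R z i * c g i"
 by (rule trans[OF arg_cong[OF act[OF that(1,2)], of "%z. R z i"] Rcomb[where a = "%l. R z l * c g l", OF that(3)]])
 hence "(\<Sum>j<n. p i j * rh g z j) = (\<Sum>j<n. p i j * z j) * c g i"
 by (simp only: Rp[OF rin[OF that(1,2)], symmetric] Rp[OF that(2), symmetric])
 thus ?thesis using that(3) by (simp add: al_def mult.commute)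
qed
show ?thesis by (rule that[OF \<open>torus_hom n n al\<close> \<open>inj_on al (torus n)\<close> pq qp eq])
qed

section \<open>Standard charts of a locally standard torus manifold\<close>

definition zc :: "(nat => real) => nat => complex" where
"zc v i = Complex (v (2 * i)) (v (2 * i + 1))"

definition std_image :: "nat => nat => nat => (nat => real) set" where
"std_image k n m = {v:R_vecs (2 * k + m). ALL i. n \<le> i & i < k --> cmod (zc v i) = 1}"

text \<open>
A model chart in real coordinates: \<open>c\<close> lists the \<open>k\<close> complex coordinates, of which the last
\<open>k - n\<close> have modulus \<open>1\<close>, and then the \<open>m\<close> real ones. The torus acts on the complex coordinates
through the automorphism \<open>bet\<close>.
\<close>

definition std_chart ::
"nat => 'a smooth_space => ((nat => complex) => 'a => 'a) => nat => nat => ((nat => complex) => nat => complex) =>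
'a set => ('a => nat => real) => bool" where
"std_chart k X tht n m bet U c \<longleftrightarrow> n \<le> k & torus_hom k k bet & bij_betw bet (torus k) (torus k) &
 openin (underlying X) U & (ALL t:torus k. ALL x:U. tht t x:U) &
 bij_betw c U (std_image k n m) &
 (ALL V. openin (underlying X) V --> V \<subseteq> U --> (EX T. openR (2 * k + m) T & c ` V = std_image k n m \<inter> T)) &
 (ALL t:torus k. ALL x:U. ALL i<k. zc (c (tht t x)) i = bet t i * zc (c x) i) &
 (ALL t:torus k. ALL x:U. \<forall>j\<ge>2*k. c (tht t x) j = c x j) &
 (ALL j. sm X U (%x. c x j)) &
 (ALL V F. openin (underlying X) V --> V \<subseteq> U --> sm X V F --> smooth_on (2 * k + m) (c ` V) (%v. F (inv_into U c v))) &
 (EX psi. (n + m, orbit_map k tht ` U, psi):charts (orbit_space k X tht) &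
  (ALL x:U. psi (orbit_map k tht x) = (%j. if j < n then (cmod (zc (c x) j))\<^sup>2 else c x (2 * k + (j - n)))))"

definition model_coords :: "nat => nat => nat => model => nat => real" where
"model_coords k n m = (%(x, y) j. if j < 2 * n then real_coords n x j
 else (%(x, y) j. if j < 2 * (k - n) then real_coords (k - n) x j else y (j - 2 * (k - n))) y (j - 2 * n))"

definition model_points :: "nat => nat => nat => model set" where
"model_points k n m = C_vecs n \<times> torus (k - n) \<times> R_vecs m"

lemma model_space_charts:
assumes "n \<le> k"
shows "charts (model_space k n m) = {(2 * k + m, model_points k n m, model_coords k n m)}"
 and "points (model_space k n m) = model_points k n m"
proof -
have "2 * n + (2 * (k - n) + m) = 2 * k + m" using assms by simp
thus "charts (model_space k n m) = {(2 * k + m, model_points k n m, model_coords k n m)}"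
 by (simp add: model_space_def prod_space_def C_space_def T_space_def R_space_def model_coords_def model_points_def
  topspace_Euclidean_space)
show "points (model_space k n m) = model_points k n m"
 by (simp add: model_space_def prod_space_def C_space_def T_space_def R_space_def model_points_def topspace_Euclidean_space)
qed

lemma model_underlying:
"underlying (model_space k n m) = prod_topology (top_of_set (C_vecs n)) (prod_topology (top_of_set (torus (k - n))) (Euclidean_space m))"
by (simp add: model_space_def prod_space_def C_space_def T_space_def R_space_def)

lemma zc_model_coords:
assumes "n \<le> k" "i < k"
shows "zc (model_coords k n m (z, w, y)) i = (if i < n then z i else w (i - n))"
proof (cases "i < n")
case True
thus ?thesis by (simp add: zc_def model_coords_def real_coords_def)
next
case False
have 1: "2 * i - 2 * n = 2 * (i - n)" "2 * i + 1 - 2 * n = 2 * (i - n) + 1" "Suc (2 * i) - 2 * n = Suc (2 * (i - n))" using False by simp_all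
have 2: "2 * (i - n) < 2 * (k - n)" "2 * (i - n) + 1 < 2 * (k - n)" using False assms by simp_all
show ?thesis using False 1 2 by (simp add: zc_def model_coords_def real_coords_def)
qed

lemma model_coords_real:
assumes "n \<le> k" "j \<ge> 2 * k" shows "model_coords k n m (z, w, y) j = y (j - 2 * k)"
proof -
have "\<not> j < 2 * n" "\<not> j - 2 * n < 2 * (k - n)" "j - 2 * n - 2 * (k - n) = j - 2 * k" using assms by simp_all
thus ?thesis by (simp add: model_coords_def)
qed

lemma real_vec_eqI:
assumes "!!i. i < k ==> zc u i = zc v i" "!!j. j \<ge> 2 * k ==> u j = v j" shows "u = v"
proof
fix j show "u j = v j"
proof (cases "j < 2 * k")
 case True
 hence h: "zc u (j div 2) = zc v (j div 2)" by (intro assms(1)) simp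
 show ?thesis
 proof (cases "even j")
 case True
 hence "2 * (j div 2) = j" by simp
 thus ?thesis using h by (simp add: zc_def)
 next
 case False
 hence "Suc (2 * (j div 2)) = j" by simp
 thus ?thesis using h by (simp add: zc_def)
 qed
qed (use assms(2) in simp)
qed

definition model_of_coords :: "nat => nat => (nat => real) => model" where
"model_of_coords k n v = ((%i. if i < n then zc v i else 0), (%i. if i < k - n then zc v (n + i) else 1), (%l. v (2 * k + l)))"

lemma model_coords_in:
assumes "n \<le> k" "p:model_points k n m" shows "model_coords k n m p:std_image k n m"
proof -
obtain z w y where p: "p = (z, w, y)" by (cases p)
have "model_coords k n m p j = 0" if "j \<ge> 2 * k + m" for j
 using that assms(2) model_coords_real[OF assms(1), of j m z w y] by (auto simp: p model_points_def topspace_Euclidean_space)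
moreover have "cmod (zc (model_coords k n m p) i) = 1" if "n \<le> i" "i < k" for i
 using zc_model_coords[OF assms(1) that(2), of m z w y] assms(2) that by (auto simp: p model_points_def torus_def)
ultimately show ?thesis by (simp add: std_image_def topspace_Euclidean_space)
qed

lemma model_of_coords_in: "n \<le> k ==> v:std_image k n m ==> model_of_coords k n v:model_points k n m"
by (auto simp: model_of_coords_def model_points_def std_image_def C_vecs_def torus_def topspace_Euclidean_space)

lemma model_of_coords_inverse:
assumes "n \<le> k" "p:model_points k n m" shows "model_of_coords k n (model_coords k n m p) = p"
proof -
obtain z w y where p: "p = (z, w, y)" by (cases p)
have "(%i. if i < n then zc (model_coords k n m p) i else 0) = z"
 using assms zc_model_coords[OF assms(1)] by (auto simp: p model_points_def C_vecs_def fun_eq_iff)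
moreover have "(%i. if i < k - n then zc (model_coords k n m p) (n + i) else 1) = w"
 using assms zc_model_coords[OF assms(1)] by (auto simp: p model_points_def torus_def fun_eq_iff)
moreover have "(%l. model_coords k n m p (2 * k + l)) = y"
 using model_coords_real[OF assms(1)] by (simp add: p)
ultimately show ?thesis unfolding model_of_coords_def p[symmetric] by (simp only: p)
qed

lemma model_coords_inverse:
assumes "n \<le> k" "v:std_image k n m" shows "model_coords k n m (model_of_coords k n v) = v"
proof (rule real_vec_eqI[where k = k])
show "zc (model_coords k n m (model_of_coords k n v)) i = zc v i" if "i < k" for i
proof -
 have "\<not> i < n ==> i - n < k - n & n + (i - n) = i" using that by linarith
 thus ?thesis using zc_model_coords[OF assms(1) that] by (simp add: model_of_coords_def)
qed
show "model_coords k n m (model_of_coords k n v) j = v j" if "2 * k \<le> j" for j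
 using model_coords_real[OF assms(1) that] that by (simp add: model_of_coords_def)
qed

lemma continuous_on_zc: "continuous_on S (%v. zc v i)"
unfolding zc_def Complex_eq by (intro continuous_intros continuous_on_coord)

lemma continuous_model_of_coords:
assumes "n \<le> k"
shows "continuous_map (top_of_set (std_image k n m)) (underlying (model_space k n m)) (model_of_coords k n)"
proof -
let ?S = "std_image k n m"
have 1: "continuous_on ?S (%v i. if i < n then zc v i else 0)"
proof (rule continuous_on_coordinatewise_then_product)
 show "continuous_on ?S (%v. if i < n then zc v i else 0)" for i by (cases "i < n") (simp_all add: continuous_on_zc)
qed
have 2: "continuous_on ?S (%v i. if i < k - n then zc v (n + i) else 1)"
proof (rule continuous_on_coordinatewise_then_product)
 show "continuous_on ?S (%v. if i < k - n then zc v (n + i) else 1)" for i by (cases "i < k - n") (simp_all add: continuous_on_zc)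
qed
have 3: "continuous_on ?S (%v l. v (2 * k + l))" by (rule continuous_on_coordinatewise_then_product, rule continuous_on_coord)
have in': "model_of_coords k n v:model_points k n m" if "v:?S" for v by (rule model_of_coords_in[OF assms that])
have c1: "continuous_map (top_of_set ?S) (top_of_set (C_vecs n)) (%v i. if i < n then zc v i else 0)"
 by (rule continuous_map_into_subtopology) (use 1 in' in \<open>auto simp: model_of_coords_def model_points_def\<close>)
have c2: "continuous_map (top_of_set ?S) (top_of_set (torus (k - n))) (%v i. if i < k - n then zc v (n + i) else 1)"
 by (rule continuous_map_into_subtopology) (use 2 in' in \<open>auto simp: model_of_coords_def model_points_def\<close>)
have c3: "continuous_map (top_of_set ?S) (Euclidean_space m) (%v l. v (2 * k + l))"
 unfolding Euclidean_space_eq_top_of_set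
 by (rule continuous_map_into_subtopology) (use 3 in' in \<open>auto simp: model_of_coords_def model_points_def topspace_Euclidean_space\<close>)
show ?thesis unfolding model_underlying model_of_coords_def
 by (intro continuous_map_pairedI c1 c2 c3)
qed

section \<open>Charts with a coordinate-wise action\<close>

lemma diffeomorphismD:
assumes "diffeomorphism X Y f"
shows "bij_betw f (points X) (points Y)" "smooth_map X Y f" "smooth_map Y X (inv_into (points X) f)"
using assms unfolding diffeomorphism_def by simp_all

lemma smooth_mapD:
assumes "smooth_map X Y f" "(a, U, ph):charts X" "(b, V, psi):charts Y" "j < b"
shows "smooth_on a (ph ` {x\<in>U. f x:V}) (%u. psi (f (inv_into U ph u)) j)"
proof -
have "\<forall>(a, U, ph)\<in>charts X. \<forall>(b, V, psi)\<in>charts Y. ALL j<b. smooth_on a (ph ` {x\<in>U. f x:V}) (%u. psi (f (inv_into U ph u)) j)"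
 using assms(1) unfolding smooth_map_def by (rule conjunct2)
from bspec[OF this assms(2)] have "\<forall>(b, V, psi)\<in>charts Y. ALL j<b. smooth_on a (ph ` {x\<in>U. f x:V}) (%u. psi (f (inv_into U ph u)) j)"
 by simp
from bspec[OF this assms(3)] show ?thesis using assms(4) by simp
qed

lemma smooth_map_continuous: "smooth_map X Y f ==> continuous_map (underlying X) (underlying Y) f"
unfolding smooth_map_def by (rule conjunct1)

lemma smooth_mapI:
assumes "continuous_map (underlying X) (underlying Y) f"
 "!!a U ph b V psi j. (a, U, ph):charts X ==> (b, V, psi):charts Y ==> j < b ==>
 smooth_on a (ph ` {x\<in>U. f x:V}) (%u. psi (f (inv_into U ph u)) j)"
shows "smooth_map X Y f"
unfolding smooth_map_def using assms by auto

lemma points_open_subspace: "openin (underlying X) U ==> points (open_subspace X U) = U"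
using openin_subset[of "underlying X" U] by (auto simp: open_subspace_def)

context manifold begin

lemma std_chart_of_model_chart:
assumes mc: "model_chart k X tht n m si (%g. \<lambda>z\<in>C_vecs n. (%i. al g i * z i)) U ph"
 and al: "torus_hom n n al" "inj_on al (torus n)"
shows "EX bet. std_chart k X tht n m bet U (%x. model_coords k n m (ph x))"
proof -
let ?rh = "%g. \<lambda>z\<in>C_vecs n. (%i. al g i * z i)"
note mc' = mc[unfolded model_chart_def]
have U: "opn U" using mc' by (elim conjE)
have Uinv: "ALL t:torus k. ALL x:U. tht t x:U" using mc' by (elim conjE)
have sp: "torus_splitting k n si" using mc' by (elim conjE)
have df: "diffeomorphism (open_subspace X U) (model_space k n m) ph" using mc' by (elim conjE)
have eqv: "ALL t:torus k. ALL x:U. ph (tht t x) = model_action si ?rh t (ph x)" using mc' by (elim conjE)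
note sp' = sp[unfolded torus_splitting_def]
have nk: "n \<le> k" using sp' by (elim conjE)
have iso: "si:iso (torus_group k) (torus_group n \<times>\<times> torus_group (k - n))" using sp' by (elim conjE)
have hom: "homeomorphic_map (top_of_set (torus k)) (prod_topology (top_of_set (torus n)) (top_of_set (torus (k - n)))) si"
 using sp' by (elim conjE)
have UX: "U \<subseteq> points X" by (rule openin_subset[OF U])
have pU: "points (open_subspace X U) = U" by (rule points_open_subspace[OF U])
note mch = model_space_charts[OF nk, of m]
have bij: "bij_betw ph U (model_points k n m)" using diffeomorphismD(1)[OF df] unfolding pU mch(2) .
have sm1: "smooth_map (open_subspace X U) (model_space k n m) ph" by (rule diffeomorphismD(2)[OF df])
have sm2: "smooth_map (model_space k n m) (open_subspace X U) (inv_into U ph)" using diffeomorphismD(3)[OF df] unfolding pU .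
have phin: "ph x:model_points k n m" if "x:U" for x using bij that by (auto simp: bij_betw_def)
define c where "c x = model_coords k n m (ph x)" for x
define S where "S = std_image k n m"
define E where "E v = inv_into U ph (model_of_coords k n v)" for v
have EU: "E v:U" if "v:S" for v
 unfolding E_def using bij model_of_coords_in[OF nk that[unfolded S_def]] by (metis bij_betw_def inv_into_into)
have cE: "c (E v) = v" if "v:S" for v
proof -
 have "ph (E v) = model_of_coords k n v" unfolding E_def
 using bij model_of_coords_in[OF nk that[unfolded S_def]] by (metis bij_betw_def f_inv_into_f)
 thus ?thesis unfolding c_def using model_coords_inverse[OF nk that[unfolded S_def]] by simp
qed
have cS: "c x:S" if "x:U" for x unfolding c_def S_def by (rule model_coords_in[OF nk phin[OF that]])
have Ec: "E (c x) = x" if "x:U" for x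
 unfolding E_def c_def model_of_coords_inverse[OF nk phin[OF that]] using bij that by (simp add: bij_betw_def)
have cbij: "bij_betw c U S"
 by (rule bij_betw_byWitness[where f' = E]) (use Ec cE cS EU in auto)
have invc: "inv_into U c v = E v" if "v:S" for v
 using cbij cE[OF that] EU[OF that] by (metis bij_betw_def inv_into_f_f)
have homeo: "EX T. openR (2 * k + m) T & c ` V = S \<inter> T" if V: "opn V" "V \<subseteq> U" for V
proof -
 have "continuous_map (underlying (model_space k n m)) (subtopology (underlying X) U) (inv_into U ph)"
 using smooth_map_continuous[OF sm2] by (simp add: open_subspace_def)
 hence "continuous_map (underlying (model_space k n m)) (underlying X) (inv_into U ph)"
 by (simp add: continuous_map_in_subtopology)
 from continuous_map_compose[OF continuous_model_of_coords[OF nk] this]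
 have "continuous_map (top_of_set S) (underlying X) E" by (simp add: o_def E_def[abs_def] S_def)
 from openin_continuous_map_preimage[OF this V(1)] have "openin (top_of_set S) {v\<in>S. E v:V}" by simp
 moreover have "{v\<in>S. E v:V} = c ` V"
 proof
 show "c ` V \<subseteq> {v\<in>S. E v:V}" using V(2) cS Ec by auto
 show "{v\<in>S. E v:V} \<subseteq> c ` V" using cE by (metis (mono_tags, lifting) imageI mem_Collect_eq subsetI)
 qed
 ultimately obtain T where "open T" "c ` V = S \<inter> T" by (auto simp: openin_open)
 thus ?thesis
 by (intro exI[of _ "R_vecs (2 * k + m) \<inter> T"]) (auto simp: openR_iff S_def std_image_def)
qed
have act: "EX z w y. ph x = (z, w, y) & z:C_vecs n & ph (tht t x) = (%i. al (fst (si t)) i * z i, %i. snd (si t) i * w i, y)"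
 if "t:torus k" "x:U" for t x
proof -
 obtain z w y where p: "ph x = (z, w, y)" by (cases "ph x")
 have "z:C_vecs n" using phin[OF that(2)] by (simp add: p model_points_def)
 thus ?thesis using eqv that by (auto simp: p model_action_def)
qed
define bet where "bet t = (%i. if i < n then al (fst (si t)) i else if i < k then snd (si t) (i - n) else 1)" for t
have zact: "zc (c (tht t x)) i = bet t i * zc (c x) i" if "t:torus k" "x:U" "i < k" for t x i
 using act[OF that(1,2)] zc_model_coords[OF nk that(3)] that(3) by (auto simp: c_def bet_def)
have ract: "c (tht t x) j = c x j" if "t:torus k" "x:U" "2 * k \<le> j" for t x j
 using act[OF that(1,2)] model_coords_real[OF nk that(3)] by (auto simp: c_def)
have siin: "si t:torus n \<times> torus (k - n)" if "t:torus k" for t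
 using iso that by (auto simp: iso_def hom_def torus_group_def DirProd_def Pi_iff)
have simul: "si (tmul s t) = (tmul (fst (si s)) (fst (si t)), tmul (snd (si s)) (snd (si t)))" if "s:torus k" "t:torus k" for s t
 using iso that by (auto simp: iso_def hom_def torus_group_def DirProd_def case_prod_beta)
have siinj: "inj_on si (torus k)" using iso by (auto simp: iso_def torus_group_def bij_betw_def)
have sic: "continuous_map (top_of_set (torus k)) (top_of_set (torus n)) (fst \<circ> si)"
 "continuous_map (top_of_set (torus k)) (top_of_set (torus (k - n))) (snd \<circ> si)"
 by (rule continuous_map_compose[OF homeomorphic_imp_continuous_map[OF hom] continuous_map_fst],
  rule continuous_map_compose[OF homeomorphic_imp_continuous_map[OF hom] continuous_map_snd])
have bethom: "torus_hom k k bet" unfolding torus_hom_def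
proof (intro conjI ballI)
 show "bet t:torus k" if t: "t:torus k" for t
 proof (rule torusI)
 show "cmod (bet t i) = 1" if "i < k" for i
  using siin[OF t] torus_cmod[OF torus_homD(1)[OF al(1)]] torus_cmod that by (auto simp: bet_def)
 qed (use nk in \<open>simp add: bet_def\<close>)
 show "bet (tmul s t) = tmul (bet s) (bet t)" if st: "s:torus k" "t:torus k" for s t
 using simul[OF st] torus_homD(2)[OF al(1), of "fst (si s)" "fst (si t)"] siin[OF st(1)] siin[OF st(2)]
 by (auto simp: bet_def fun_eq_iff)
 show "continuous_on (torus k) bet"
 proof (rule continuous_on_coordinatewise_then_product)
 fix i
 have f: "continuous_on (torus k) (%t. fst (si t))" "continuous_on (torus k) (%t. snd (si t))"
  using sic by (simp_all add: continuous_map_in_subtopology o_def)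
 have "continuous_on (torus k) (%t. al (fst (si t)))"
 proof (rule continuous_on_compose2[OF torus_homD(3)[OF al(1)] f(1)], rule image_subsetI)
  show "fst (si t):torus n" if "t:torus k" for t using siin[OF that] by (simp add: mem_Times_iff)
 qed
 from continuous_on_product_then_coordinatewise[OF this] continuous_on_product_then_coordinatewise[OF f(2)]
 show "continuous_on (torus k) (%t. bet t i)"
  by (cases "i < n"; cases "i < k") (simp_all add: bet_def)
 qed
qed
have betinj: "inj_on bet (torus k)"
proof (rule inj_onI)
 fix s t assume st: "s:torus k" "t:torus k" "bet s = bet t"
 have 1: "fst (si s):torus n" "fst (si t):torus n" "snd (si s):torus (k - n)" "snd (si t):torus (k - n)"
 using siin[OF st(1)] siin[OF st(2)] by auto
 have "al (fst (si s)) = al (fst (si t))"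
 proof
 fix i show "al (fst (si s)) i = al (fst (si t)) i"
  using fun_cong[OF st(3), of i] torus_ge[OF torus_homD(1)[OF al(1) 1(1)], of i] torus_ge[OF torus_homD(1)[OF al(1) 1(2)], of i]
  by (cases "i < n") (simp_all add: bet_def)
 qed
 hence f: "fst (si s) = fst (si t)" using al(2) 1 by (auto dest: inj_onD)
 have "snd (si s) = snd (si t)"
 proof
 fix i show "snd (si s) i = snd (si t) i"
 proof (cases "i < k - n")
  case True
  hence "\<not> n + i < n" "n + i < k" "n + i - n = i" by simp_all
  thus ?thesis using fun_cong[OF st(3), of "n + i"] unfolding bet_def by (simp only: if_True if_False)
 next
  case False
  thus ?thesis using torus_ge[OF 1(3), of i] torus_ge[OF 1(4), of i] by simp
 qed
 qed
 hence "si s = si t" using f by (simp add: prod_eq_iff)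
 thus "s = t" using siinj st by (auto dest: inj_onD)
qed
have betbij: "bij_betw bet (torus k) (torus k)"
 using injective_torus_endomorphism_surj[OF bethom betinj] betinj by (simp add: bij_betw_def)
have csm: "sm X U (%x. c x j)" for j
proof (cases "j < 2 * k + m")
 case True
 show ?thesis
 proof (rule smI)
 fix a V bmp assume ch: "(a, V, bmp):charts X"
 hence ch': "(a, V \<inter> U, bmp):charts (open_subspace X U)" by (auto simp: open_subspace_def)
 have mm: "(2 * k + m, model_points k n m, model_coords k n m):charts (model_space k n m)" by (simp add: mch)
 have "{x\<in>V \<inter> U. ph x:model_points k n m} = V \<inter> U" using phin by auto
 with smooth_mapD[OF sm1 ch' mm True]
 have "smooth_on a (bmp ` (V \<inter> U)) (%u. model_coords k n m (ph (inv_into (V \<inter> U) bmp u)) j)" by simp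
 thus "smooth_on a (bmp ` (V \<inter> U)) (%u. c (inv_into V bmp u) j)"
 proof (rule smooth_on_cong)
  fix u assume "u:bmp ` (V \<inter> U)"
  then obtain x where x: "x:V \<inter> U" "u = bmp x" by blast
  have "inv_into (V \<inter> U) bmp u = x" "inv_into V bmp u = x"
  using x chart_inj[OF ch] inj_on_subset[OF chart_inj[OF ch], of "V \<inter> U"] by auto
  thus "model_coords k n m (ph (inv_into (V \<inter> U) bmp u)) j = c (inv_into V bmp u) j" by (simp add: c_def)
 qed
 qed
next
 case False
 have "c x j = 0" if "x:U" for x using cS[OF that] False by (auto simp: S_def std_image_def topspace_Euclidean_space)
 thus ?thesis by (intro sm_cong[OF sm_const[of U 0]]) simp
qed
have fac: "smooth_on (2 * k + m) (c ` V) (%v. F (inv_into U c v))" if V: "opn V" "V \<subseteq> U" "sm X V F" for V F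
proof (rule smooth_on_local)
 fix v assume "v:c ` V"
 then obtain x where x: "x:V" "v = c x" by blast
 hence "x:points X" using V(2) UX by blast
 then obtain a W bmp where ch: "(a, W, bmp):charts X" "x:W" by (rule chart_covers)
 hence ch': "(a, W \<inter> U, bmp):charts (open_subspace X U)" by (auto simp: open_subspace_def)
 have mm: "(2 * k + m, model_points k n m, model_coords k n m):charts (model_space k n m)" by (simp add: mch)
 have VW: "opn (V \<inter> W)" using V(1) chart_open[OF ch(1)] by blast
 obtain T where T: "openR (2 * k + m) T" "c ` (V \<inter> W) = S \<inter> T" using homeo[OF VW] V(2) by blast
 have cV: "c ` V \<inter> T = c ` (V \<inter> W)"
 proof
 show "c ` V \<inter> T \<subseteq> c ` (V \<inter> W)" unfolding T(2) using cS V(2) by blast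
 show "c ` (V \<inter> W) \<subseteq> c ` V \<inter> T" using T(2) by blast
 qed
 have "smooth_on (2 * k + m) (c ` (V \<inter> W)) (%v. F (inv_into W bmp (bmp (E v))))"
 proof (rule smooth_on_compose[where f = "%u. F (inv_into W bmp u)" and b = a and V = "bmp ` (W \<inter> V)" and G = "%v. bmp (E v)"])
 show "smooth_on a (bmp ` (W \<inter> V)) (%u. F (inv_into W bmp u))" by (rule smD[OF V(3) ch(1)])
 show "bmp ` (W \<inter> V) \<subseteq> R_vecs a" using chart_image_sub[OF ch(1)] by blast
 show "c ` (V \<inter> W) \<subseteq> R_vecs (2 * k + m)" unfolding T(2) by (auto simp: S_def std_image_def)
 show "bmp (E v):bmp ` (W \<inter> V)" if "v:c ` (V \<inter> W)" for v using that Ec V(2) by auto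
 fix i assume i: "i < a"
 have 1: "smooth_on (2 * k + m) (model_coords k n m ` {p\<in>model_points k n m. inv_into U ph p:W \<inter> U})
  (%v. bmp (inv_into U ph (inv_into (model_points k n m) (model_coords k n m) v)) i)"
  by (rule smooth_mapD[OF sm2 mm ch' i])
 have sub: "c ` (V \<inter> W) \<subseteq> model_coords k n m ` {p\<in>model_points k n m. inv_into U ph p:W \<inter> U}"
 proof
  fix v assume "v:c ` (V \<inter> W)"
  then obtain y where y: "y:V" "y:W" "v = c y" by blast
  have yU: "y:U" using y V(2) by blast
  have "inv_into U ph (ph y) = y" using bij yU by (simp add: bij_betw_def)
  hence "ph y:{p\<in>model_points k n m. inv_into U ph p:W \<inter> U}" using phin[OF yU] y yU by simp
  thus "v:model_coords k n m ` {p\<in>model_points k n m. inv_into U ph p:W \<inter> U}"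
  unfolding y(3) c_def by (rule imageI)
 qed
 show "smooth_on (2 * k + m) (c ` (V \<inter> W)) (%v. bmp (E v) i)"
 proof (rule smooth_on_cong[OF smooth_on_subset[OF 1 sub]])
  fix v assume "v:c ` (V \<inter> W)"
  hence vS: "v:S" using T(2) by blast
  have "inj_on (model_coords k n m) (model_points k n m)"
  by (rule inj_on_inverseI[where g = "model_of_coords k n"]) (rule model_of_coords_inverse[OF nk])
  from inv_into_f_f[OF this model_of_coords_in[OF nk vS[unfolded S_def]]]
  have "inv_into (model_points k n m) (model_coords k n m) v = model_of_coords k n v"
  unfolding model_coords_inverse[OF nk vS[unfolded S_def]] .
  thus "bmp (inv_into U ph (inv_into (model_points k n m) (model_coords k n m) v)) i = bmp (E v) i"
  by (simp add: E_def)
 qed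
 qed
 hence "smooth_on (2 * k + m) (c ` (V \<inter> W)) (%v. F (inv_into U c v))"
 proof (rule smooth_on_cong)
 fix v assume "v:c ` (V \<inter> W)"
 then obtain y where y: "y:V" "y:W" "v = c y" by blast
 hence yU: "y:U" using V(2) by blast
 have "E v = y" using Ec[OF yU] y by simp
 moreover have "inv_into U c v = E v" using invc cS[OF yU] y by simp
 ultimately show "F (inv_into W bmp (bmp (E v))) = F (inv_into U c v)"
  using chart_inj[OF ch(1)] y(2) by simp
 qed
 moreover have "v:T" using T(2) x ch(2) by blast
 ultimately show "EX T. openR (2 * k + m) T & v:T & smooth_on (2 * k + m) (c ` V \<inter> T) (%v. F (inv_into U c v))"
 using T(1) unfolding cV[symmetric] by (intro exI[of _ T] conjI)
qed
define psi where "psi p = model_orbit_coords n (ph (SOME x. x:U & orbit_map k tht x = p))" for p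
have mo: "model_orbit_coords n (ph x) = (%j. if j < n then (cmod (zc (c x) j))\<^sup>2 else c x (2 * k + (j - n)))" for x
proof -
 obtain z w y where p: "ph x = (z, w, y)" by (cases "ph x")
 show ?thesis using zc_model_coords[OF nk, of _ m z w y] model_coords_real[OF nk, of _ m z w y] nk
 by (auto simp: fun_eq_iff p c_def model_orbit_coords_def)
qed
have mo_inv: "model_orbit_coords n (ph (tht t x)) = model_orbit_coords n (ph x)" if "t:torus k" "x:U" for t x
proof -
 have "cmod (zc (c (tht t x)) j) = cmod (zc (c x) j)" if "j < n" for j
 using zact[OF \<open>t:torus k\<close> \<open>x:U\<close>, of j] torus_cmod[OF torus_homD(1)[OF bethom \<open>t:torus k\<close>], of j] that nk
 by (simp add: norm_mult)
 thus ?thesis unfolding mo using ract[OF that] by (auto simp: fun_eq_iff)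
qed
have psi: "psi (orbit_map k tht x) = model_orbit_coords n (ph x)" if x: "x:U" for x
proof -
 define y where "y = (SOME y. y:U & orbit_map k tht y = orbit_map k tht x)"
 have y: "y:U & orbit_map k tht y = orbit_map k tht x"
 unfolding y_def by (rule someI[of _ x]) (use x in simp)
 have "(%_. 1):torus k" by (rule torus_one)
 hence "tht (%_. 1) y:orbit_map k tht x" "tht (%_. 1) x:orbit_map k tht x"
 using y by (auto simp: orbit_def torus_group_def)
 then obtain t where t: "t:torus k" "tht (%_. 1) y = tht t x" by (auto simp: orbit_def torus_group_def)
 have "model_orbit_coords n (ph y) = model_orbit_coords n (ph x)"
 using mo_inv[OF torus_one, of y] mo_inv[OF t(1) x] y t(2) by simp
 thus ?thesis unfolding psi_def y_def .
qed
have ch: "(n + m, orbit_map k tht ` U, psi):charts (orbit_space k X tht)"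
proof -
 have "torus_automorphism n al"
 proof -
 have s: "al ` torus n = torus n" by (rule injective_torus_endomorphism_surj[OF al])
 hence b: "bij_betw al (torus n) (torus n)" using al(2) by (simp add: bij_betw_def)
 have "al:iso (torus_group n) (torus_group n)"
  using b torus_homD[OF al(1)] by (auto simp: iso_def hom_def torus_group_def)
 moreover have "homeomorphic_map (top_of_set (torus n)) (top_of_set (torus n)) al"
 proof (rule continuous_imp_homeomorphic_map)
  show "compact_space (top_of_set (torus n))" using torus_compact by (simp add: compact_space_subtopology)
  show "Hausdorff_space (top_of_set (torus n))" by (simp add: Hausdorff_space_subtopology)
  show "continuous_map (top_of_set (torus n)) (top_of_set (torus n)) al"
  by (rule continuous_map_into_subtopology) (use torus_homD[OF al(1)] in auto)
  show "al ` topspace (top_of_set (torus n)) = topspace (top_of_set (torus n))" using s by simp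
  show "inj_on al (topspace (top_of_set (torus n)))" using al(2) by simp
 qed
 ultimately show ?thesis unfolding torus_automorphism_def by (rule conjI)
 qed
 hence "EX si al ph. torus_automorphism n al &
  model_chart k X tht n m si (%g. \<lambda>z\<in>C_vecs n. (%i. al g i * z i)) U ph &
  (ALL x:U. psi (orbit_map k tht x) = model_orbit_coords n (ph x))"
 using mc psi by (intro exI[of _ si] exI[of _ al] exI[of _ ph] conjI ballI)
 thus ?thesis unfolding orbit_space_def smooth_space.simps mem_Collect_eq
 by (intro exI[of _ n] exI[of _ m] exI[of _ U] exI[of _ psi] conjI refl)
qed
have "std_chart k X tht n m bet U c"
 unfolding std_chart_def S_def[symmetric]
 apply (intro conjI)
 apply (rule nk) apply (rule bethom) apply (rule betbij) apply (rule U) apply (rule Uinv) apply (rule cbij)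
 subgoal using homeo by simp
 subgoal using zact by simp
 subgoal using ract by simp
 subgoal using csm by simp
 subgoal using fac by simp
 subgoal using ch psi mo by (intro exI[of _ psi] conjI ballI) simp_all
 done
hence "std_chart k X tht n m bet U (%x. model_coords k n m (ph x))" unfolding c_def[abs_def] .
thus ?thesis by (intro exI)
qed

end

section \<open>Existence of standard charts\<close>

definition good_charts :: "'a smooth_space => bool" where
"good_charts A \<longleftrightarrow> (\<forall>(a, V, bmp)\<in>charts A. inj_on bmp V & bmp ` V \<subseteq> R_vecs a & V \<subseteq> points A)"

lemma good_chartsD:
assumes "good_charts A" "(a, V, bmp):charts A"
shows "inj_on bmp V" "bmp ` V \<subseteq> R_vecs a" "V \<subseteq> points A"
using bspec[OF assms(1)[unfolded good_charts_def] assms(2)] by simp_all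

lemma (in manifold) good_charts_open_subspace: "opn U ==> good_charts (open_subspace X U)"
unfolding good_charts_def
proof (clarify, intro conjI)
fix a V bmp assume U: "opn U" and "(a, V, bmp):charts (open_subspace X U)"
then obtain W where W: "(a, W, bmp):charts X" "V = W \<inter> U" by (auto simp: open_subspace_def)
show "inj_on bmp V" unfolding W(2) by (rule inj_on_subset[OF chart_inj[OF W(1)]]) simp
show "bmp ` V \<subseteq> R_vecs a" using chart_image_sub[OF W(1)] W(2) by blast
show "V \<subseteq> points (open_subspace X U)" unfolding points_open_subspace[OF U] W(2) by simp
qed

lemma inj_model_coords: "n \<le> k ==> inj_on (model_coords k n m) (model_points k n m)"
by (rule inj_on_inverseI[where g = "model_of_coords k n"]) (rule model_of_coords_inverse)

lemma std_image_sub: "std_image k n m \<subseteq> R_vecs (2 * k + m)" by (auto simp: std_image_def)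

lemma good_charts_model: "n \<le> k ==> good_charts (model_space k n m)"
unfolding good_charts_def model_space_charts
using inj_model_coords model_coords_in std_image_sub by fastforce

lemma smooth_map_cong:
assumes f: "smooth_map A B f" and A: "good_charts A" and fg: "!!x. x:points A ==> f x = g x"
shows "smooth_map A B g"
proof (rule smooth_mapI)
show "continuous_map (underlying A) (underlying B) g"
 by (rule continuous_map_eq[OF smooth_map_continuous[OF f]]) (rule fg)
fix a U ph b V psi j assume c: "(a, U, ph):charts A" "(b, V, psi):charts B" "j < b"
have U: "U \<subseteq> points A" by (rule good_chartsD(3)[OF A c(1)])
hence s: "{x\<in>U. f x:V} = {x\<in>U. g x:V}" using fg by auto
show "smooth_on a (ph ` {x\<in>U. g x:V}) (%u. psi (g (inv_into U ph u)) j)"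
proof (rule smooth_on_cong[OF smooth_mapD[OF f c, unfolded s]])
 fix u assume "u:ph ` {x\<in>U. g x:V}"
 hence "inv_into U ph u:points A" using U inv_into_into[of u ph U] by blast
 thus "psi (f (inv_into U ph u)) j = psi (g (inv_into U ph u)) j" using fg by simp
qed
qed

lemma smooth_map_through_model:
assumes nk: "n \<le> k" and A: "good_charts A" and f: "smooth_map A (model_space k n m) f" and g: "smooth_map (model_space k n m) B g"
shows "smooth_map A B (%x. g (f x))"
proof (rule smooth_mapI)
note mch = model_space_charts[OF nk, of m]
have mm: "(2 * k + m, model_points k n m, model_coords k n m):charts (model_space k n m)" by (simp add: mch)
show "continuous_map (underlying A) (underlying B) (%x. g (f x))"
 using continuous_map_compose[OF smooth_map_continuous[OF f] smooth_map_continuous[OF g]] by (simp add: o_def)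
have fin: "f x:model_points k n m" if "x:points A" for x
 using continuous_map_funspace[OF smooth_map_continuous[OF f]] that unfolding mch(2) by blast
fix a U ph b V psi j assume c: "(a, U, ph):charts A" "(b, V, psi):charts B" "j < b"
note gc = good_chartsD[OF A c(1)]
define ka where "ka = model_coords k n m"
define M where "M = model_points k n m"
have kka: "inv_into M ka (ka p) = p" if "p:M" for p
 using inj_model_coords[OF nk, of m] that unfolding M_def ka_def by simp
let ?S = "ph ` {x\<in>U. g (f x):V}"
have inU: "inv_into U ph u:U & g (f (inv_into U ph u)):V" if "u:?S" for u
 using that gc(1) by auto
have "smooth_on a ?S (%u. psi (g (inv_into M ka (ka (f (inv_into U ph u))))) j)"
proof (rule smooth_on_compose[where f = "%v. psi (g (inv_into M ka v)) j" and b = "2 * k + m" and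
  V = "ka ` {p\<in>M. g p:V}" and G = "%u. ka (f (inv_into U ph u))"])
 show "smooth_on (2 * k + m) (ka ` {p\<in>M. g p:V}) (%v. psi (g (inv_into M ka v)) j)"
 unfolding M_def ka_def by (rule smooth_mapD[OF g mm c(2,3)])
 show "ka ` {p\<in>M. g p:V} \<subseteq> R_vecs (2 * k + m)"
 using model_coords_in[OF nk] std_image_sub unfolding M_def ka_def by fast
 show "?S \<subseteq> R_vecs a" using gc(2) by blast
 show "ka (f (inv_into U ph u)):ka ` {p\<in>M. g p:V}" if "u:?S" for u
 using inU[OF that] fin gc(3) unfolding M_def by blast
 show "smooth_on a ?S (%u. ka (f (inv_into U ph u)) i)" if "i < 2 * k + m" for i
 by (rule smooth_on_subset[OF smooth_mapD[OF f c(1) mm that, folded ka_def]]) (use fin gc(3) in blast)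
qed
thus "smooth_on a ?S (%u. psi (g (f (inv_into U ph u))) j)"
proof (rule smooth_on_cong)
 fix u assume "u:?S"
 hence "f (inv_into U ph u):M" using inU fin gc(3) unfolding M_def by blast
 thus "psi (g (inv_into M ka (ka (f (inv_into U ph u))))) j = psi (g (f (inv_into U ph u))) j" by (simp add: kka)
qed
qed

definition linfun :: "nat => (nat => nat => complex) => (nat => complex) => nat => complex" where
"linfun n p z = (%i. if i < n then \<Sum>j<n. p i j * z j else 0)"

definition linmap :: "nat => (nat => nat => complex) => model => model" where
"linmap n p x = (linfun n p (fst x), snd x)"

lemma linfun_in: "linfun n p z:C_vecs n" by (simp add: linfun_def C_vecs_def)

lemma linmap_in: "x:model_points k n m ==> linmap n p x:model_points k n m"
by (auto simp: linmap_def model_points_def linfun_in)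

lemma smooth_on_sum: "finite I ==> S \<subseteq> R_vecs n ==> (!!i. i:I ==> smooth_on n S (f i)) ==> smooth_on n S (%x. \<Sum>i\<in>I. f i x)"
by (induction I rule: finite_induct) (simp_all add: smooth_on_const smooth_on_add)

lemma smooth_map_linmap:
assumes nk: "n \<le> k" shows "smooth_map (model_space k n m) (model_space k n m) (linmap n p)"
proof (rule smooth_mapI)
note mch = model_space_charts[OF nk, of m]
have "continuous_on (C_vecs n) (linfun n p)"
proof (rule continuous_on_coordinatewise_then_product)
 show "continuous_on (C_vecs n) (%z. linfun n p z i)" for i
 by (cases "i < n") (auto simp: linfun_def intro!: continuous_intros continuous_on_coord)
qed
hence 1: "continuous_map (top_of_set (C_vecs n)) (top_of_set (C_vecs n)) (linfun n p)"
 by (intro continuous_map_into_subtopology) (auto simp: linfun_in)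
show "continuous_map (underlying (model_space k n m)) (underlying (model_space k n m)) (linmap n p)"
 unfolding model_underlying linmap_def[abs_def]
 by (rule continuous_map_pairedI[OF continuous_map_compose[OF continuous_map_fst 1, unfolded o_def] continuous_map_snd])
fix a U ph b V psi j assume "(a, U, ph):charts (model_space k n m)" "(b, V, psi):charts (model_space k n m)" "j < b"
hence e: "a = 2 * k + m" "U = model_points k n m" "ph = model_coords k n m" "V = model_points k n m"
 "psi = model_coords k n m" by (simp_all add: mch)
let ?ka = "model_coords k n m" and ?M = "model_points k n m"
have SR: "?ka ` ?M \<subseteq> R_vecs (2 * k + m)" using model_coords_in[OF nk] std_image_sub by fast
define h where "h v = (if j < 2 * n then (if even j
 then \<Sum>l<n. Re (p (j div 2) l) * v (2 * l) + (- Im (p (j div 2) l)) * v (2 * l + 1)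
 else \<Sum>l<n. Re (p (j div 2) l) * v (2 * l + 1) + Im (p (j div 2) l) * v (2 * l)) else v j)" for v :: "nat => real"
have 1: "smooth_on (2 * k + m) (?ka ` ?M) (%v. \<Sum>l<n. Re (p (j div 2) l) * v (2 * l) + (- Im (p (j div 2) l)) * v (2 * l + 1))"
 by (intro smooth_on_sum finite_lessThan smooth_on_add smooth_on_mult smooth_on_const smooth_on_coord SR)
have 2: "smooth_on (2 * k + m) (?ka ` ?M) (%v. \<Sum>l<n. Re (p (j div 2) l) * v (2 * l + 1) + Im (p (j div 2) l) * v (2 * l))"
 by (intro smooth_on_sum finite_lessThan smooth_on_add smooth_on_mult smooth_on_const smooth_on_coord SR)
have "smooth_on (2 * k + m) (?ka ` ?M) h"
 unfolding h_def[abs_def] using 1 2 smooth_on_coord[OF SR, of j]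
 by (cases "j < 2 * n"; cases "even j") (simp_all only: if_True if_False simp_thms)
hence "smooth_on (2 * k + m) (?ka ` ?M) (%u. ?ka (linmap n p (inv_into ?M ?ka u)) j)"
proof (rule smooth_on_cong)
 fix u assume "u:?ka ` ?M"
 then obtain x where x: "x:?M" "u = ?ka x" by blast
 obtain z w y where p: "x = (z, w, y)" by (cases x)
 have i: "inv_into ?M ?ka u = x" using x inj_model_coords[OF nk] by simp
 have zl: "Re (z l) = u (2 * l)" "Im (z l) = u (2 * l + 1)" if "l < n" for l
 proof -
 have "zc u l = z l" using zc_model_coords[OF nk, of l m z w y] that nk x(2) by (simp add: p)
 hence "Complex (u (2 * l)) (u (2 * l + 1)) = z l" unfolding zc_def .
 thus "Re (z l) = u (2 * l)" "Im (z l) = u (2 * l + 1)" by (metis complex.sel(1), metis complex.sel(2))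
 qed
 show "h u = ?ka (linmap n p (inv_into ?M ?ka u)) j" unfolding i
 proof (cases "j < 2 * n")
 case False
 thus "h u = ?ka (linmap n p x) j" using x(2) by (simp add: h_def p linmap_def model_coords_def)
 next
 case True
 hence "j div 2 < n" by simp
 have "h u = (if even j then \<Sum>l<n. Re (p (j div 2) l) * Re (z l) + (- Im (p (j div 2) l)) * Im (z l)
  else \<Sum>l<n. Re (p (j div 2) l) * Im (z l) + Im (p (j div 2) l) * Re (z l))"
  unfolding h_def using True zl by simp
 thus "h u = ?ka (linmap n p x) j" using True \<open>j div 2 < n\<close>
  by (simp add: p linmap_def model_coords_def real_coords_def linfun_def)
 qed
qed
moreover have "{x\<in>?M. linmap n p x:?M} = ?M" using linmap_in by blast
ultimately show "smooth_on a (ph ` {x\<in>U. linmap n p x:V}) (%u. psi (linmap n p (inv_into U ph u)) j)"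
 unfolding e by simp
qed

lemma effective_coordinatewise:
assumes al: "torus_hom n n al" "inj_on al (torus n)"
shows "effective_linear_action n (%g. \<lambda>z\<in>C_vecs n. (%i. al g i * z i))"
proof -
let ?rh = "%g. \<lambda>z\<in>C_vecs n. (%i. al g i * z i)"
have in': "(%i. d i * z i):C_vecs n" if "z:C_vecs n" for d z using that by (simp add: C_vecs_def)
have nz: "al g i ~= 0" if "g:torus n" for g i by (rule torus_nonzero[OF torus_homD(1)[OF al(1) that]])
have bij: "?rh g:Bij (C_vecs n)" if g: "g:torus n" for g
proof -
 have "bij_betw (?rh g) (C_vecs n) (C_vecs n)"
 by (rule bij_betw_byWitness[where f' = "%z. (%i. inverse (al g i) * z i)"]) (use in' nz[OF g] in \<open>auto simp: mult.assoc[symmetric]\<close>)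
 thus ?thesis by (simp add: Bij_def)
qed
have hom: "?rh:hom (torus_group n) (BijGroup (C_vecs n))"
proof (rule homI)
 show "?rh g:carrier (BijGroup (C_vecs n))" if "g:carrier (torus_group n)" for g
 using bij that by (simp add: BijGroup_def torus_group_def)
 fix g h assume gh: "g:carrier (torus_group n)" "h:carrier (torus_group n)"
 hence T: "g:torus n" "h:torus n" by (simp_all add: torus_group_def)
 have "?rh (tmul g h) = compose (C_vecs n) (?rh g) (?rh h)"
 using torus_homD(2)[OF al(1) T] in' by (auto simp: compose_def fun_eq_iff mult.assoc)
 thus "?rh (g \<otimes>\<^bsub>torus_group n\<^esub> h) = ?rh g \<otimes>\<^bsub>BijGroup (C_vecs n)\<^esub> ?rh h"
 using bij[OF T(1)] bij[OF T(2)] by (simp add: BijGroup_def torus_group_def)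
qed
have gh: "group_hom (torus_group n) (BijGroup (C_vecs n)) ?rh"
 by (intro group_hom.intro group_hom_axioms.intro torus_group_group group_BijGroup hom)
have inj: "inj_on ?rh (carrier (torus_group n))"
proof (rule inj_onI)
 fix g h assume "g:carrier (torus_group n)" "h:carrier (torus_group n)" and e: "?rh g = ?rh h"
 hence T: "g:torus n" "h:torus n" by (simp_all add: torus_group_def)
 have "al g = al h"
 proof
 fix i show "al g i = al h i"
 proof (cases "i < n")
  case True
  have "?rh g (unit_vec i) i = ?rh h (unit_vec i) i" unfolding e ..
  thus ?thesis using unit_vec_in[OF True] by (simp add: unit_vec_def)
 next
  case False
  thus ?thesis using torus_ge[OF torus_homD(1)[OF al(1) T(1)]] torus_ge[OF torus_homD(1)[OF al(1) T(2)]] by simp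
 qed
 qed
 thus "g = h" using al(2) T by (auto dest: inj_onD)
qed
have f: "faithful_action (torus_group n) (C_vecs n) ?rh"
 by (intro faithful_action.intro group_action.intro faithful_action_axioms.intro gh inj)
have c: "continuous_map (prod_topology (top_of_set (torus n)) (top_of_set (C_vecs n))) (top_of_set (C_vecs n)) (%(g, z). ?rh g z)"
proof (rule continuous_map_into_subtopology)
 have "continuous_on (torus n \<times> C_vecs n) (%p i. al (fst p) i * snd p i)"
 proof (rule continuous_on_coordinatewise_then_product)
 fix i
 have 1: "continuous_on (torus n \<times> C_vecs n) (%p. al (fst p))"
  by (rule continuous_on_compose2[OF torus_homD(3)[OF al(1)] continuous_on_fst[OF continuous_on_id]]) auto
 have 2: "continuous_on (torus n \<times> C_vecs n) (%p. snd p i)"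
  by (rule continuous_on_product_then_coordinatewise[OF continuous_on_snd[OF continuous_on_id]])
 show "continuous_on (torus n \<times> C_vecs n) (%p. al (fst p) i * snd p i)"
  by (intro continuous_on_mult continuous_on_product_then_coordinatewise[OF 1] 2)
 qed
 hence "continuous_on (torus n \<times> C_vecs n) (%(g, z). ?rh g z)"
 by (rule continuous_on_eq) auto
 thus "continuous_map (prod_topology (top_of_set (torus n)) (top_of_set (C_vecs n))) euclidean (%(g, z). ?rh g z)" by simp
 show "(%(g, z). ?rh g z):topspace (prod_topology (top_of_set (torus n)) (top_of_set (C_vecs n))) \<rightarrow> C_vecs n"
 using in' by auto
qed
have l: "ALL g:torus n. ALL z:C_vecs n. ALL w:C_vecs n. ALL c.
  ?rh g (%i. z i + w i) = (%i. ?rh g z i + ?rh g w i) &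
  ?rh g (%i. c * z i) = (%i. c * ?rh g z i)"
proof (intro ballI allI)
 fix g z w :: "nat => complex" and c assume "z:C_vecs n" "w:C_vecs n"
 moreover from this have "(%i. z i + w i):C_vecs n" "(%i. c * z i):C_vecs n" by (simp_all add: C_vecs_def)
 ultimately show "?rh g (%i. z i + w i) = (%i. ?rh g z i + ?rh g w i) & ?rh g (%i. c * z i) = (%i. c * ?rh g z i)"
 by (simp add: distrib_left mult.left_commute)
qed
show ?thesis unfolding effective_linear_action_def using f l c by (intro conjI)
qed

context manifold begin

lemma model_chart_diagonal:
assumes mc: "model_chart k X tht n m si rh U ph"
 and al: "torus_hom n n al" "inj_on al (torus n)"
 and pq: "!!z i. z:C_vecs n ==> i < n ==> (\<Sum>j<n. p i j * (\<Sum>l<n. q j l * z l)) = z i"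
 and qp: "!!z i. z:C_vecs n ==> i < n ==> (\<Sum>j<n. q i j * (\<Sum>l<n. p j l * z l)) = z i"
 and eq: "!!g z i. g:torus n ==> z:C_vecs n ==> i < n ==> (\<Sum>j<n. p i j * rh g z j) = al g i * (\<Sum>j<n. p i j * z j)"
shows "model_chart k X tht n m si (%g. \<lambda>z\<in>C_vecs n. (%i. al g i * z i)) U (%x. linmap n p (ph x))"
proof -
let ?rh = "%g. \<lambda>z\<in>C_vecs n. (%i. al g i * z i)"
note mc' = mc[unfolded model_chart_def]
have U: "opn U" using mc' by (elim conjE)
have Uinv: "ALL t:torus k. ALL x:U. tht t x:U" using mc' by (elim conjE)
have sp: "torus_splitting k n si" using mc' by (elim conjE)
have df: "diffeomorphism (open_subspace X U) (model_space k n m) ph" using mc' by (elim conjE)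
have eqv: "ALL t:torus k. ALL x:U. ph (tht t x) = model_action si rh t (ph x)" using mc' by (elim conjE)
note sp' = sp[unfolded torus_splitting_def]
have nk: "n \<le> k" using sp' by (elim conjE)
have iso: "si:iso (torus_group k) (torus_group n \<times>\<times> torus_group (k - n))" using sp' by (elim conjE)
have siin: "fst (si t):torus n" if "t:torus k" for t
 using iso that by (auto simp: iso_def hom_def torus_group_def DirProd_def Pi_iff)
have pU: "points (open_subspace X U) = U" by (rule points_open_subspace[OF U])
note mch = model_space_charts[OF nk, of m]
let ?M = "model_points k n m" and ?L = "linmap n p" and ?K = "linmap n q"
have bij: "bij_betw ph U ?M" using diffeomorphismD(1)[OF df] unfolding pU mch(2) .
have phin: "ph x:?M" if "x:U" for x using bij that by (auto simp: bij_betw_def)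
have LK: "?L (?K x) = x" if "x:?M" for x
proof -
 have z: "fst x:C_vecs n" using that by (auto simp: model_points_def)
 have "linfun n p (linfun n q (fst x)) = fst x"
 proof
 fix i show "linfun n p (linfun n q (fst x)) i = fst x i"
  using pq[OF z, of i] z by (simp add: linfun_def C_vecs_def)
 qed
 thus ?thesis by (simp add: linmap_def)
qed
have KL: "?K (?L x) = x" if "x:?M" for x
proof -
 have z: "fst x:C_vecs n" using that by (auto simp: model_points_def)
 have "linfun n q (linfun n p (fst x)) = fst x"
 proof
 fix i show "linfun n q (linfun n p (fst x)) i = fst x i"
  using qp[OF z, of i] z by (simp add: linfun_def C_vecs_def)
 qed
 thus ?thesis by (simp add: linmap_def)
qed
have bijL: "bij_betw ?L ?M ?M"
 by (rule bij_betw_byWitness[where f' = ?K]) (use LK KL linmap_in in auto)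
have b: "bij_betw (%x. ?L (ph x)) U ?M"
 using bij_betw_trans[OF bij bijL] by (simp add: o_def)
have gU: "good_charts (open_subspace X U)" by (rule good_charts_open_subspace[OF U])
have gM: "good_charts (model_space k n m)" by (rule good_charts_model[OF nk])
have s1: "smooth_map (open_subspace X U) (model_space k n m) (%x. ?L (ph x))"
 by (rule smooth_map_through_model[OF nk gU diffeomorphismD(2)[OF df] smooth_map_linmap[OF nk]])
have "smooth_map (model_space k n m) (open_subspace X U) (%y. inv_into U ph (?K y))"
 using smooth_map_through_model[OF nk gM smooth_map_linmap[OF nk] diffeomorphismD(3)[OF df]] unfolding pU .
hence s2: "smooth_map (model_space k n m) (open_subspace X U) (inv_into U (%x. ?L (ph x)))"
proof (rule smooth_map_cong[OF _ gM])
 fix y assume "y:points (model_space k n m)"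
 hence y: "y:?M" unfolding mch(2) .
 have Ky: "?K y:?M" by (rule linmap_in[OF y])
 define x where "x = inv_into U ph (?K y)"
 have x: "x:U" "ph x = ?K y" unfolding x_def
 using bij Ky by (metis bij_betw_def inv_into_into, metis bij_betw_def f_inv_into_f)
 have "inv_into U (%x. ?L (ph x)) (?L (ph x)) = x"
 by (rule inv_into_f_f[OF bij_betw_imp_inj_on[OF b] x(1)])
 thus "inv_into U ph (?K y) = inv_into U (%x. ?L (ph x)) y" using x(2) LK[OF y] by (simp add: x_def)
qed
have df': "diffeomorphism (open_subspace X U) (model_space k n m) (%x. ?L (ph x))"
 unfolding diffeomorphism_def pU mch(2) using b s1 s2 by (intro conjI)
have "ALL t:torus k. ALL x:U. ?L (ph (tht t x)) = model_action si ?rh t (?L (ph x))"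
proof (intro ballI)
 fix t x assume t: "t:torus k" and x: "x:U"
 obtain z w y where p: "ph x = (z, w, y)" by (cases "ph x")
 have z: "z:C_vecs n" using phin[OF x] by (simp add: p model_points_def)
 have "linfun n p (rh (fst (si t)) z) = (%i. al (fst (si t)) i * linfun n p z i)"
 using eq[OF siin[OF t] z] by (auto simp: linfun_def fun_eq_iff)
 thus "?L (ph (tht t x)) = model_action si ?rh t (?L (ph x))"
 using eqv t x by (simp add: p model_action_def linmap_def linfun_in)
qed
thus ?thesis unfolding model_chart_def using U Uinv sp effective_coordinatewise[OF al] df' by (intro conjI)
qed

lemma std_chart_exists:
assumes ls: "locally_standard k X tht" and x: "x:points X"
shows "EX n m bet U c. x:U & std_chart k X tht n m bet U c"
proof -
have 1: "ALL p:orbits (torus_group k) (points X) tht. EX n m si rh U ph. p \<subseteq> U & model_chart k X tht n m si rh U ph"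
 using ls unfolding locally_standard_def by (elim conjE)
have ga: "group_action (torus_group k) (points X) tht"
 using ls unfolding locally_standard_def smooth_torus_action_def by (elim conjE)
have "orbit_map k tht x:orbits (torus_group k) (points X) tht" using x by (auto simp: orbits_def)
from bspec[OF 1 this] obtain n m si rh U ph where mc: "orbit_map k tht x \<subseteq> U" "model_chart k X tht n m si rh U ph" by blast
have xU: "x:U" using group_action.orbit_refl[OF ga x] mc(1) by blast
have eff: "effective_linear_action n rh" using mc(2) unfolding model_chart_def by (elim conjE)
obtain al p q where a: "torus_hom n n al" "inj_on al (torus n)"
 "!!z i. z:C_vecs n ==> i < n ==> (\<Sum>j<n. p i j * (\<Sum>l<n. q j l * z l)) = z i"
 "!!z i. z:C_vecs n ==> i < n ==> (\<Sum>j<n. q i j * (\<Sum>l<n. p j l * z l)) = z i"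
 "!!g z i. g:torus n ==> z:C_vecs n ==> i < n ==> (\<Sum>j<n. p i j * rh g z j) = al g i * (\<Sum>j<n. p i j * z j)"
 by (rule effective_linear_action_diagonal[OF eff], rule that)
from std_chart_of_model_chart[OF model_chart_diagonal[OF mc(2) a] a(1,2)] xU show ?thesis by blast
qed

end

section \<open>Locally standard torus manifolds in standard charts\<close>

locale torus_manifold =
fixes X :: "'a smooth_space" and k :: nat and tht :: "(nat => complex) => 'a => 'a"
assumes locally_standard: "locally_standard k X tht"
begin

lemma smooth_manifold: "smooth_manifold X"
using locally_standard unfolding locally_standard_def by (elim conjE)

sublocale manifold X by (rule manifold.intro[OF smooth_manifold])

lemma action: "group_action (torus_group k) (points X) tht"
using locally_standard unfolding locally_standard_def smooth_torus_action_def by (elim conjE)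

lemma smooth_action: "smooth_map (prod_space (T_space k) X) X (%(t, x). tht t x)"
using locally_standard unfolding locally_standard_def smooth_torus_action_def by (elim conjE)

lemma act_in: "t:torus k ==> x:points X ==> tht t x:points X"
using group_action.element_image[OF action, of t x] by (simp add: torus_group_def)

lemma act_mult: "s:torus k ==> t:torus k ==> x:points X ==> tht (tmul s t) x = tht s (tht t x)"
using group_action.composition_rule[OF action, of x s t] by (simp add: torus_group_def)

lemma act_one: assumes "x:points X" shows "tht (%_. 1) x = x"
proof -
have "(\<lambda>x\<in>points X. x) = tht \<one>\<^bsub>torus_group k\<^esub>" by (rule group_action.id_eq_one[OF action])
hence "(\<lambda>x\<in>points X. x) = tht (%_. 1)" by (simp add: torus_group_def)
from fun_cong[OF this, of x] show ?thesis using assms by simp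
qed

lemma act_inverse: assumes "t:torus k" "x:points X" shows "tht (%i. inverse (t i)) (tht t x) = x"
using act_mult[OF torus_inverse[OF assms(1)] assms] tmul_inverse(2)[OF assms(1)] act_one[OF assms(2)] by simp

lemma act_continuous: assumes "t:torus k" shows "continuous_map (underlying X) (underlying X) (tht t)"
proof -
have "continuous_map (prod_topology (top_of_set (torus k)) (underlying X)) (underlying X) (%(t, x). tht t x)"
 using smooth_map_continuous[OF smooth_action] by (simp add: prod_space_def T_space_def)
moreover have "continuous_map (underlying X) (prod_topology (top_of_set (torus k)) (underlying X)) (%x. (t, x))"
 by (intro continuous_map_pairedI) (use assms in \<open>simp_all add: continuous_map_const\<close>)
ultimately have "continuous_map (underlying X) (underlying X) ((%(t, x). tht t x) \<circ> (%x. (t, x)))"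
 by (rule continuous_map_compose[rotated])
thus ?thesis by (simp add: o_def)
qed

end

locale chart = torus_manifold X k tht
for X :: "'a smooth_space" and k tht +
fixes n m :: nat and bet :: "(nat => complex) => nat => complex" and U :: "'a set" and c :: "'a => nat => real"
assumes std: "std_chart k X tht n m bet U c"
begin

lemma nk: "n \<le> k"
using std unfolding std_chart_def by (elim conjE)

lemma bet_hom: "torus_hom k k bet"
using std unfolding std_chart_def by (elim conjE)

lemma bet_bij: "bij_betw bet (torus k) (torus k)"
using std unfolding std_chart_def by (elim conjE)

lemma U_open: "opn U"
using std unfolding std_chart_def by (elim conjE)

lemma U_inv: "ALL t:torus k. ALL x:U. tht t x:U"
using std unfolding std_chart_def by (elim conjE)

lemma c_bij: "bij_betw c U (std_image k n m)"
using std unfolding std_chart_def by (elim conjE)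

lemma homeo: "ALL V. opn V --> V \<subseteq> U --> (EX T. openR (2 * k + m) T & c ` V = std_image k n m \<inter> T)"
using std unfolding std_chart_def by (elim conjE)

lemma zact: "ALL t:torus k. ALL x:U. ALL i<k. zc (c (tht t x)) i = bet t i * zc (c x) i"
using std unfolding std_chart_def by (elim conjE)

lemma ract: "ALL t:torus k. ALL x:U. \<forall>j\<ge>2*k. c (tht t x) j = c x j"
using std unfolding std_chart_def by (elim conjE)

lemma c_sm: "ALL j. sm X U (%x. c x j)"
using std unfolding std_chart_def by (elim conjE)

lemma factor: "ALL V F. opn V --> V \<subseteq> U --> sm X V F --> smooth_on (2 * k + m) (c ` V) (%v. F (inv_into U c v))"
using std unfolding std_chart_def by (elim conjE)

lemma orbit_chart: "EX psi. (n + m, orbit_map k tht ` U, psi):charts (orbit_space k X tht) &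
  (ALL x:U. psi (orbit_map k tht x) = (%j. if j < n then (cmod (zc (c x) j))\<^sup>2 else c x (2 * k + (j - n))))"
using std unfolding std_chart_def by (elim conjE)

abbreviation zeta :: "'a => nat => complex" where "zeta x \<equiv> zc (c x)"

lemma U_sub: "U \<subseteq> points X" by (rule openin_subset[OF U_open])

lemma U_act: "t:torus k ==> x:U ==> tht t x:U" using U_inv by blast

lemma zeta_act: "t:torus k ==> x:U ==> i < k ==> zeta (tht t x) i = bet t i * zeta x i"
using zact by blast

lemma c_act: "t:torus k ==> x:U ==> 2 * k \<le> j ==> c (tht t x) j = c x j" using ract by blast

lemma c_smooth: "sm X U (%x. c x j)" using c_sm by (rule spec)

lemma zeta_csm: "csm X U (%x. zeta x i)" using c_smooth by (simp add: csm_def zc_def)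

lemma c_in: "x:U ==> c x:std_image k n m" using c_bij by (auto simp: bij_betw_def)

lemma c_in_R: "x:U ==> c x:R_vecs (2 * k + m)" using c_in std_image_sub by blast

lemma zeta_unit: "x:U ==> n \<le> i ==> i < k ==> cmod (zeta x i) = 1"
using c_in by (auto simp: std_image_def)

lemma c_inj: "x:U ==> y:U ==> c x = c y ==> x = y"
using c_bij by (auto simp: bij_betw_def inj_on_def)

lemma inv_c: "x:U ==> inv_into U c (c x) = x" using c_bij by (simp add: bij_betw_def)

lemma point_in: "v:std_image k n m ==> inv_into U c v:U"
and c_point: "v:std_image k n m ==> c (inv_into U c v) = v"
using c_bij by (metis bij_betw_def inv_into_into, metis bij_betw_def f_inv_into_f)

lemma open_image:
assumes "opn V" "V \<subseteq> U" obtains T where "openR (2 * k + m) T" "c ` V = std_image k n m \<inter> T"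
using homeo assms by blast

lemma eqI:
assumes "x:U" "y:U" "!!i. i < k ==> zeta x i = zeta y i" "!!j. 2 * k \<le> j ==> c x j = c y j" shows "x = y"
by (rule c_inj[OF assms(1,2)], rule real_vec_eqI[where k = k]) (use assms(3,4) in auto)

definition bet' :: "(nat => complex) => nat => complex" where "bet' = inv_into (torus k) bet"

lemma bet'_in: "s:torus k ==> bet' s:torus k" and bet_bet': "s:torus k ==> bet (bet' s) = s"
and bet'_bet: "s:torus k ==> bet' (bet s) = s"
unfolding bet'_def using bet_bij
by (metis bij_betw_def inv_into_into, metis bij_betw_def f_inv_into_f, metis bij_betw_def inv_into_f_f)

lemma bet'_hom: "torus_hom k k bet'"
unfolding torus_hom_def
proof (intro conjI ballI)
show "bet' t:torus k" if "t:torus k" for t by (rule bet'_in[OF that])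
show "bet' (tmul s t) = tmul (bet' s) (bet' t)" if "s:torus k" "t:torus k" for s t
proof -
 have "bet (tmul (bet' s) (bet' t)) = tmul s t"
 unfolding torus_homD(2)[OF bet_hom bet'_in[OF that(1)] bet'_in[OF that(2)]] bet_bet'[OF that(1)] bet_bet'[OF that(2)] ..
 thus ?thesis using bet'_bet[OF torus_mult[OF bet'_in[OF that(1)] bet'_in[OF that(2)]]] by simp
qed
have "continuous_on (bet ` torus k) bet'"
 by (rule continuous_on_inv[OF torus_homD(3)[OF bet_hom] torus_compact]) (use bet'_bet in blast)
thus "continuous_on (torus k) bet'" using bet_bij by (simp add: bij_betw_def)
qed

lemma cmod_zeta_act: "t:torus k ==> x:U ==> i < k ==> cmod (zeta (tht t x) i) = cmod (zeta x i)"
using zeta_act torus_cmod[OF torus_homD(1)[OF bet_hom]] by (simp add: norm_mult)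

lemma zeta_zero_lt: "x:U ==> i < k ==> zeta x i = 0 ==> i < n"
using zeta_unit[of x i] by (cases "i < n") auto

text \<open>The orbits in a chart are the fibres of the orbit coordinates.\<close>

lemma same_orbit:
assumes x: "x:U" and y: "y:U" and z: "!!i. i < k ==> cmod (zeta x i) = cmod (zeta y i)"
 and r: "!!j. 2 * k \<le> j ==> c x j = c y j"
shows "EX t:torus k. y = tht t x"
proof -
define s where "s i = (if i < k & zeta x i ~= 0 then zeta y i / zeta x i else 1)" for i
have s: "s:torus k"
proof (rule torusI)
 show "cmod (s i) = 1" if "i < k" for i using z[OF that] by (auto simp: s_def norm_divide)
qed (simp add: s_def)
have t: "bet' s:torus k" by (rule bet'_in[OF s])
have "y = tht (bet' s) x"
proof (rule eqI[OF y U_act[OF t x]])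
 show "zeta y i = zeta (tht (bet' s) x) i" if i: "i < k" for i
 unfolding zeta_act[OF t x i] bet_bet'[OF s] using z[OF i] i by (auto simp: s_def)
 show "c y j = c (tht (bet' s) x) j" if "2 * k \<le> j" for j unfolding c_act[OF t x that] using r[OF that] by simp
qed
thus ?thesis using t by blast
qed

lemma stabilizer_iff:
assumes x: "x:U" and t: "t:torus k" shows "tht t x = x \<longleftrightarrow> (ALL i<k. zeta x i ~= 0 --> bet t i = 1)"
proof
assume "tht t x = x"
thus "ALL i<k. zeta x i ~= 0 --> bet t i = 1" using zeta_act[OF t x] by auto
next
assume *: "ALL i<k. zeta x i ~= 0 --> bet t i = 1"
show "tht t x = x"
proof (rule eqI[OF U_act[OF t x] x])
 show "zeta (tht t x) i = zeta x i" if "i < k" for i using zeta_act[OF t x that] * that by (cases "zeta x i = 0") auto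
qed (rule c_act[OF t x])
qed

lemma perturb:
assumes V: "opn V" "V \<subseteq> U" "x:V"
obtains x' where "x':V" "!!i. i < k ==> i:J ==> zeta x' i = zeta x i" "!!i. i < k ==> i \<notin> J ==> zeta x' i ~= 0"
proof -
obtain T where T: "openR (2 * k + m) T" "c ` V = std_image k n m \<inter> T" using open_image[OF V(1,2)] by blast
have xU: "x:U" using V by blast
have "c x:T" using T(2) V(3) by blast
obtain de where d: "de > 0" "!!y. y:R_vecs (2 * k + m) ==> (!!j. j < 2 * k + m ==> \<bar>y j - c x j\<bar> < de) ==> y:T"
 using openR_contains_box[OF T(1) \<open>c x:T\<close>] by blast
define w where "w j = (if j < 2 * k & even j & j div 2 \<notin> J & zeta x (j div 2) = 0 then de / 2 else c x j)" for j
have c0: "c x j = 0" if "j < 2 * k" "zeta x (j div 2) = 0" "even j" for j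
 using that(2,3) by (auto simp: zc_def complex_eq_iff)
have wR: "w:R_vecs (2 * k + m)" using c_in_R[OF xU] by (auto simp: w_def topspace_Euclidean_space)
have wz: "zc w i = (if i \<notin> J & zeta x i = 0 then of_real (de / 2) else zeta x i)" if "i < k" for i
proof -
 have "Suc (2 * i) div 2 = i" "odd (Suc (2 * i))" by simp_all
 moreover have "c x (Suc (2 * i)) = 0" if "zeta x i = 0" using that by (auto simp: zc_def complex_eq_iff)
 ultimately show ?thesis using that by (auto simp: w_def zc_def complex_eq_iff)
qed
have "w:T"
proof (rule d(2)[OF wR])
 show "\<bar>w j - c x j\<bar> < de" for j using d(1) c0[of j] by (auto simp: w_def)
qed
moreover have "w:std_image k n m"
proof -
 have "cmod (zc w i) = 1" if "n \<le> i" "i < k" for i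
 proof -
 have "zeta x i ~= 0" using zeta_unit[OF xU that] by auto
 thus ?thesis using wz[OF that(2)] zeta_unit[OF xU that] by simp
 qed
 thus ?thesis using wR by (simp add: std_image_def)
qed
ultimately have "w:c ` V" using T(2) by blast
then obtain x' where x': "x':V" "w = c x'" by blast
show ?thesis
proof (rule that[OF x'(1)])
 show "zeta x' i = zeta x i" if "i < k" "i:J" for i using wz[OF that(1)] that(2) unfolding x'(2) by simp
 show "zeta x' i ~= 0" if "i < k" "i \<notin> J" for i using wz[OF that(1)] that(2) d(1) unfolding x'(2) by auto
qed
qed

lemma rotate_plane_chart:
assumes x: "x:U" and j: "j < k" and uv: "u\<^sup>2 + v\<^sup>2 = 1"
shows "rotate_plane (2 * j) (2 * j + 1) u v (c x) = c (tht (bet' (circ j (Complex u v))) x)"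
proof -
have "cmod (Complex u v) = 1" using uv by (simp add: cmod_def)
hence ct: "circ j (Complex u v):torus k" by (rule circ_torus[OF j])
have t: "bet' (circ j (Complex u v)):torus k" by (rule bet'_in[OF ct])
show ?thesis
proof (rule real_vec_eqI[where k = k])
 fix i assume i: "i < k"
 show "zc (rotate_plane (2 * j) (2 * j + 1) u v (c x)) i = zeta (tht (bet' (circ j (Complex u v))) x) i"
 unfolding zeta_act[OF t x i] bet_bet'[OF ct]
 proof (cases "i = j")
 case True
 thus "zc (rotate_plane (2 * j) (2 * j + 1) u v (c x)) i = circ j (Complex u v) i * zeta x i"
  by (simp add: zc_def rotate_plane_def circ_def complex_eq_iff)
 next
 case False
 hence "2 * i ~= 2 * j" "2 * i ~= 2 * j + 1" "2 * i + 1 ~= 2 * j" "2 * i + 1 ~= 2 * j + 1" by presburger+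
 thus "zc (rotate_plane (2 * j) (2 * j + 1) u v (c x)) i = circ j (Complex u v) i * zeta x i"
  using False by (simp add: zc_def rotate_plane_def circ_def)
 qed
next
 fix l assume "2 * k \<le> l"
 thus "rotate_plane (2 * j) (2 * j + 1) u v (c x) l = c (tht (bet' (circ j (Complex u v))) x) l"
 using c_act[OF t x] j by (simp add: rotate_plane_def)
qed
qed

lemma rotational_image:
assumes V: "opn V" "V \<subseteq> U" and inv: "!!t x. t:torus k ==> x:V ==> tht t x:V" and j: "j < n"
shows "rotational (2 * k + m) (2 * j) (2 * j + 1) (c ` V)"
proof -
have jk: "j < k" using j nk by simp
obtain T where T: "openR (2 * k + m) T" "c ` V = std_image k n m \<inter> T" using open_image[OF V(1,2)] by blast
have rot: "rotate_plane (2 * j) (2 * j + 1) u v w:c ` V" if w: "w:c ` V" and uv: "u\<^sup>2 + v\<^sup>2 = 1" for u v w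
proof -
 obtain x where x: "x:V" "w = c x" using w by blast
 hence xU: "x:U" using V(2) by blast
 have "cmod (Complex u v) = 1" using uv by (simp add: cmod_def)
 hence "bet' (circ j (Complex u v)):torus k" by (intro bet'_in circ_torus jk)
 thus ?thesis unfolding x(2) rotate_plane_chart[OF xU jk uv] using inv x(1) by blast
qed
have disc: "\<exists>de>0. ALL x:c ` V \<inter> box_at (2 * k + m) p de. ALL u. \<bar>u\<bar> < de --> x (2 * j + 1) = 0 --> x(2 * j := u):c ` V"
 if p: "p:c ` V" "p (2 * j) = 0" for p
proof -
 have "p:T" using p(1) T(2) by blast
 obtain de where d: "de > 0" "!!y. y:R_vecs (2 * k + m) ==> (!!j. j < 2 * k + m ==> \<bar>y j - p j\<bar> < de) ==> y:T"
 using openR_contains_box[OF T(1) \<open>p:T\<close>] by blast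
 have "x(2 * j := u):c ` V" if x: "x:c ` V" "x:box_at (2 * k + m) p de" and u: "\<bar>u\<bar> < de" for x u
 proof -
 have xS: "x:std_image k n m" using x(1) T(2) by blast
 have R: "x(2 * j := u):R_vecs (2 * k + m)" using x(2) jk by (auto simp: topspace_Euclidean_space)
 have "x(2 * j := u):T"
  by (rule d(2)[OF R]) (use x(2) u p(2) in auto)
 moreover have "zc (x(2 * j := u)) i = zc x i" if "n \<le> i" for i
 proof -
  have "2 * i ~= 2 * j" "2 * i + 1 ~= 2 * j" using that j by presburger+
  thus ?thesis by (simp add: zc_def)
 qed
 hence "x(2 * j := u):std_image k n m" using xS R by (auto simp: std_image_def)
 ultimately show ?thesis using T(2) by blast
 qed
 thus ?thesis using d(1) by (intro exI[of _ de]) blast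
qed
have "c ` V \<subseteq> R_vecs (2 * k + m)" using T(2) std_image_sub by blast
thus ?thesis unfolding rotational_def using rot disc jk by auto
qed

lemma sm_of_coords:
assumes V: "V \<subseteq> U" and F: "smooth_on (2 * k + m) (c ` V) F" shows "sm X V (%x. F (c x))"
proof (rule sm_compose[OF F])
show "c ` V \<subseteq> R_vecs (2 * k + m)" using c_in_R V by blast
show "sm X V (%x. c x j)" for j by (rule sm_subset[OF c_smooth V])
qed simp

text \<open>A function of weight one for the \<open>j\<close>th circle is \<open>ze_j\<close> times a smooth function.\<close>

lemma divide_weight_one:
assumes V: "opn V" "V \<subseteq> U" and inv: "!!t x. t:torus k ==> x:V ==> tht t x:V" and j: "j < k" and F: "csm X V F"
 and wt: "!!v x. cmod v = 1 ==> x:V ==> F (tht (bet' (circ j v)) x) = v * F x"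
shows "EX A. csm X V A & (ALL x:V. F x = zeta x j * A x)"
proof (cases "j < n")
case False
have nz: "zeta x j ~= 0" if "x:V" for x using zeta_zero_lt[of x j] V(2) that j False by blast
have "csm X V (%x. F x / zeta x j)" by (intro csm_divide F csm_subset[OF zeta_csm V(2)] nz)
thus ?thesis using nz by (intro exI[of _ "%x. F x / zeta x j"]) auto
next
case True
define F1 where "F1 v = Re (F (inv_into U c v))" for v
define F2 where "F2 v = Im (F (inv_into U c v))" for v
have FF: "F x = Complex (F1 (c x)) (F2 (c x))" if "x:V" for x
 using inv_c[of x] V(2) that by (auto simp: F1_def F2_def)
have s: "smooth_on (2 * k + m) (c ` V) F1" "smooth_on (2 * k + m) (c ` V) F2"
 unfolding F1_def F2_def using factor V F unfolding csm_def by blast+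
have "EX A1 A2. smooth_on (2 * k + m) (c ` V) A1 & smooth_on (2 * k + m) (c ` V) A2 &
 (ALL x:c ` V. F1 x = x (2 * j) * A1 x - x (2 * j + 1) * A2 x & F2 x = x (2 * j) * A2 x + x (2 * j + 1) * A1 x)"
proof (rule weight_one_division[OF rotational_image[OF V inv True] s])
 fix w u v assume w: "w:c ` V" and uv: "u\<^sup>2 + v\<^sup>2 = (1::real)"
 obtain x where x: "x:V" "w = c x" using w by blast
 hence xU: "x:U" using V(2) by blast
 have cm: "cmod (Complex u v) = 1" using uv by (simp add: cmod_def)
 hence tT: "bet' (circ j (Complex u v)):torus k" by (intro bet'_in circ_torus j)
 have "Complex (F1 (rotate_plane (2 * j) (2 * j + 1) u v w)) (F2 (rotate_plane (2 * j) (2 * j + 1) u v w))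
  = Complex u v * Complex (F1 w) (F2 w)"
 unfolding x(2) rotate_plane_chart[OF xU j uv] FF[OF inv[OF tT x(1)], symmetric] FF[OF x(1), symmetric]
 by (rule wt[OF cm x(1)])
 thus "F1 (rotate_plane (2 * j) (2 * j + 1) u v w) = u * F1 w - v * F2 w &
 F2 (rotate_plane (2 * j) (2 * j + 1) u v w) = u * F2 w + v * F1 w" by (simp add: complex_eq_iff)
qed (use inv in blast)+
then obtain A1 A2 where A: "smooth_on (2 * k + m) (c ` V) A1" "smooth_on (2 * k + m) (c ` V) A2"
 "ALL x:c ` V. F1 x = x (2 * j) * A1 x - x (2 * j + 1) * A2 x & F2 x = x (2 * j) * A2 x + x (2 * j + 1) * A1 x" by blast
have "csm X V (%x. Complex (A1 (c x)) (A2 (c x)))"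
 unfolding csm_def using sm_of_coords[OF V(2) A(1)] sm_of_coords[OF V(2) A(2)] by simp
moreover have "F x = zeta x j * Complex (A1 (c x)) (A2 (c x))" if "x:V" for x
 using A(3) that unfolding FF[OF that] by (auto simp: zc_def complex_eq_iff)
ultimately show ?thesis by blast
qed

lemma divide_invariant:
assumes V: "opn V" "V \<subseteq> U" and inv: "!!t x. t:torus k ==> x:V ==> tht t x:V" and j: "j < k" and f: "sm X V f"
 and finv: "!!t x. t:torus k ==> x:V ==> f (tht t x) = f x"
 and zero: "!!x. x:V ==> zeta x j = 0 ==> f x = 0"
shows "EX g. sm X V g & (ALL x:V. f x = (cmod (zeta x j))\<^sup>2 * g x)"
proof (cases "j < n")
case False
have "cmod (zeta x j) = 1" if "x:V" for x using zeta_unit[of x j] V(2) that j False by (auto simp: not_less)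
thus ?thesis using f by (intro exI[of _ f]) simp
next
case True
define F where "F v = f (inv_into U c v)" for v
have FF: "f x = F (c x)" if "x:V" for x using inv_c[of x] V(2) that by (auto simp: F_def)
have s: "smooth_on (2 * k + m) (c ` V) F" unfolding F_def using factor V f by blast
have "EX g. smooth_on (2 * k + m) (c ` V) g & (ALL x:c ` V. F x = ((x (2 * j))\<^sup>2 + (x (2 * j + 1))\<^sup>2) * g x)"
proof (rule invariant_division[OF rotational_image[OF V inv True] s])
 fix w u v assume w: "w:c ` V" and uv: "u\<^sup>2 + v\<^sup>2 = (1::real)"
 obtain x where x: "x:V" "w = c x" using w by blast
 hence xU: "x:U" using V(2) by blast
 have cm: "cmod (Complex u v) = 1" using uv by (simp add: cmod_def)
 hence tT: "bet' (circ j (Complex u v)):torus k" by (intro bet'_in circ_torus j)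
 show "F (rotate_plane (2 * j) (2 * j + 1) u v w) = F w"
 unfolding x(2) rotate_plane_chart[OF xU j uv] FF[OF inv[OF tT x(1)], symmetric] FF[OF x(1), symmetric]
 by (rule finv[OF tT x(1)])
next
 fix w assume w: "w:c ` V" and w0: "w (2 * j) = 0" "w (2 * j + 1) = 0"
 obtain x where x: "x:V" "w = c x" using w by blast
 have "zeta x j = 0" using w0 by (simp add: zc_def x(2) complex_eq_iff)
 thus "F w = 0" unfolding x(2) FF[OF x(1), symmetric] by (rule zero[OF x(1)])
qed (use inv in blast)+
then obtain g where g: "smooth_on (2 * k + m) (c ` V) g" "ALL x:c ` V. F x = ((x (2 * j))\<^sup>2 + (x (2 * j + 1))\<^sup>2) * g x" by blast
have "f x = (cmod (zeta x j))\<^sup>2 * g (c x)" if "x:V" for x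
 using g(2) that unfolding FF[OF that] by (simp add: cmod_power2 zc_def)
thus ?thesis using sm_of_coords[OF V(2) g(1)] by blast
qed

end

lemma (in chart) smap_chartI:
assumes X': "smooth_manifold X'" and W: "openin (underlying X') W" and into: "!!x. x:W ==> psi x:U"
 and s: "!!j. sm X' W (%x. c (psi x) j)"
shows "smap X' W X psi"
proof -
interpret X': manifold X' by (rule manifold.intro[OF X'])
have tW: "topspace (subtopology (underlying X') W) = W" using openin_subset[OF W] by auto
have cc: "continuous_map (subtopology (underlying X') W) euclidean (%x. c (psi x))"
proof -
 have "continuous_map (subtopology (underlying X') W) (powertop_real UNIV) (%x. c (psi x))"
 unfolding continuous_map_componentwise_UNIV using X'.sm_continuous[OF s W] by simp
 thus ?thesis by (simp add: euclidean_product_topology)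
qed
have op: "openin (subtopology (underlying X') W) {x\<in>W. psi x:V}" if V: "opn V" for V
proof -
 have VU: "opn (V \<inter> U)" using V U_open by blast
 obtain T where T: "openR (2 * k + m) T" "c ` (V \<inter> U) = std_image k n m \<inter> T" using open_image[OF VU] by blast
 obtain T' where T': "open T'" "T = R_vecs (2 * k + m) \<inter> T'" using T(1) unfolding openR_iff by blast
 have "{x\<in>W. psi x:V} = {x\<in>W. c (psi x):T'}"
 proof (rule Collect_cong, rule conj_cong[OF refl])
 fix x assume x: "x:W"
 have "psi x:V \<longleftrightarrow> c (psi x):c ` (V \<inter> U)"
  using into[OF x] c_inj by blast
 also have "\<dots> \<longleftrightarrow> c (psi x):T'"
  unfolding T(2) T'(2) using c_in[OF into[OF x]] std_image_sub by blast
 finally show "psi x:V \<longleftrightarrow> c (psi x):T'" .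
 qed
 moreover have "openin (subtopology (underlying X') W) {x:topspace (subtopology (underlying X') W). c (psi x):T'}"
 by (rule openin_continuous_map_preimage[OF cc]) (use T' in simp)
 ultimately show ?thesis unfolding tW by simp
qed
show ?thesis unfolding smap_def
proof (intro conjI allI impI)
 show "continuous_map (subtopology (underlying X') W) (underlying X) psi"
 unfolding continuous_map_def tW using op into U_sub by blast
 fix V F assume V: "opn V" and F: "sm X V F"
 have VU: "opn (V \<inter> U)" using V U_open by blast
 have "smooth_on (2 * k + m) (c ` (V \<inter> U)) (%v. F (inv_into U c v))"
 using factor VU sm_subset[OF F, of "V \<inter> U"] by blast
 hence "sm X' {x\<in>W. psi x:V} (%x. F (inv_into U c (c (psi x))))"
 proof (rule X'.sm_compose)
 show "c ` (V \<inter> U) \<subseteq> R_vecs (2 * k + m)" using c_in_R by blast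
 show "sm X' {x\<in>W. psi x:V} (%x. c (psi x) j)" for j by (rule sm_subset[OF s]) blast
 qed (use into in blast)
 thus "sm X' {x\<in>W. psi x:V} (%x. F (psi x))"
 by (rule X'.sm_cong) (use into inv_c in simp)
qed
qed

section \<open>Two torus manifolds over the same orbit space\<close>

text \<open>A continuous map \<open>f\<close> from \<open>X\<close> to \<open>Y\<close> that induces an isotropy preserving diffeomorphism of orbit spaces,
with \<open>g\<close> inducing the inverse. It is typically not equivariant, and smooth only after passing to orbit coordinates.\<close>

definition orbit_lift ::
"nat => 'a smooth_space => ((nat => complex) => 'a => 'a) => 'b smooth_space => ((nat => complex) => 'b => 'b) =>
('a => 'b) => ('b => 'a) => bool" where
"orbit_lift k X tht Y et f g \<longleftrightarrow> continuous_map (underlying X) (underlying Y) f &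
 (ALL t:torus k. ALL x:points X. f (tht t x) = f x) &
 (ALL x:points X. EX t:torus k. g (f x) = tht t x) &
 (ALL t:torus k. ALL x:points X. et t (f x) = f x \<longleftrightarrow> tht t x = x) &
 (ALL n m bet U c. std_chart k Y et n m bet U c -->
  (ALL i<n. sm X {x\<in>points X. f x:U} (%x. (cmod (zc (c (f x)) i))\<^sup>2)) &
  (\<forall>j\<ge>2*k. sm X {x\<in>points X. f x:U} (%x. c (f x) j)))"

locale torus_pair = X: torus_manifold X k tht + Y: torus_manifold Y k et
for X :: "'a smooth_space" and tht and Y :: "'b smooth_space" and et and k +
fixes lam :: "'a => 'b" and lam' :: "'b => 'a"
assumes fwd: "orbit_lift k X tht Y et lam lam'" and bwd: "orbit_lift k Y et X tht lam' lam"
begin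

lemma swap: "torus_pair Y et X tht k lam' lam"
by unfold_locales (rule bwd, rule fwd)

lemma lam_continuous: "continuous_map (underlying X) (underlying Y) lam"
using fwd unfolding orbit_lift_def by (elim conjE)

lemma lam_inv: "t:torus k ==> x:points X ==> lam (tht t x) = lam x"
using fwd[unfolded orbit_lift_def, THEN conjunct2, THEN conjunct1] by blast

lemma lam_back: "x:points X ==> EX t:torus k. lam' (lam x) = tht t x"
using fwd[unfolded orbit_lift_def, THEN conjunct2, THEN conjunct2, THEN conjunct1] by blast

lemma stab: "t:torus k ==> x:points X ==> et t (lam x) = lam x \<longleftrightarrow> tht t x = x"
using fwd[unfolded orbit_lift_def, THEN conjunct2, THEN conjunct2, THEN conjunct2, THEN conjunct1] by blast

lemma lam_sm:
assumes "std_chart k Y et n m bet U c"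
shows "i < n ==> sm X {x\<in>points X. lam x:U} (%x. (cmod (zc (c (lam x)) i))\<^sup>2)"
 and "2 * k \<le> j ==> sm X {x\<in>points X. lam x:U} (%x. c (lam x) j)"
using fwd[unfolded orbit_lift_def, THEN conjunct2, THEN conjunct2, THEN conjunct2, THEN conjunct2, rule_format, OF assms]
by simp_all

lemma lam_in: "x:points X ==> lam x:points Y"
using continuous_map_funspace[OF lam_continuous] by fastforce

lemma lam_open: assumes "openin (underlying Y) V" shows "openin (underlying X) {x\<in>points X. lam x:V}"
by (rule openin_continuous_map_preimage[OF lam_continuous assms])

definition lift :: "'a set => ('a => 'b) => bool" where
"lift W psi \<longleftrightarrow> openin (underlying X) W & (ALL t:torus k. ALL x:W. tht t x:W & psi (tht t x) = et t (psi x)) &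
 smap X W Y psi & (ALL x:W. EX t:torus k. psi x = et t (lam x))"

lemma liftD:
assumes "lift W psi"
shows "openin (underlying X) W" "t:torus k ==> x:W ==> tht t x:W"
 "t:torus k ==> x:W ==> psi (tht t x) = et t (psi x)" "smap X W Y psi" "x:W ==> EX t:torus k. psi x = et t (lam x)"
using assms unfolding lift_def by simp_all

end

text \<open>A bounded quantifier over indices is a finite intersection.\<close>

lemma openin_Ball_less:
assumes "openin T V" "!!l. l < (k::nat) ==> openin T {x\<in>V. P l x}" shows "openin T {x\<in>V. ALL l<k. P l x}"
using assms(2)
proof (induction k)
case 0 show ?case using assms(1) by simp
next
case (Suc k)
have "openin T {x\<in>V. ALL l<k. P l x}" by (rule Suc.IH) (use Suc.prems in simp)
moreover have "{x\<in>V. ALL l<Suc k. P l x} = {x\<in>V. ALL l<k. P l x} \<inter> {x\<in>V. P k x}" by (auto simp: less_Suc_eq)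
ultimately show ?case using openin_Int Suc.prems[of k] by fastforce
qed

text \<open>The points with all \<open>ze_i\<close> nonzero are dense, so continuous identities need only be checked there.\<close>

lemma (in chart) dense_eq:
assumes V: "opn V" "V \<subseteq> U" and f: "continuous_map (subtopology (underlying X) V) Z f"
 and g: "continuous_map (subtopology (underlying X) V) Z g" and Z: "Hausdorff_space Z"
 and eq: "!!x. x:V ==> (!!i. i < k ==> zeta x i ~= 0) ==> f x = g x" and x: "x:V"
shows "f x = g x"
proof (rule ccontr)
assume ne: "f x ~= g x"
have tV: "topspace (subtopology (underlying X) V) = V" using openin_subset[OF V(1)] by auto
have "closedin (subtopology (underlying X) V) {y\<in>V. f y = g y}"
 using closedin_continuous_maps_eq[OF Z f g] unfolding tV .
hence "openin (subtopology (underlying X) V) (V - {y\<in>V. f y = g y})" unfolding closedin_def tV by (rule conjunct2)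
hence o: "opn (V - {y\<in>V. f y = g y})" by (rule openin_trans_full[OF _ V(1)])
have sub: "V - {y\<in>V. f y = g y} \<subseteq> U" using V(2) by blast
have xi: "x:V - {y\<in>V. f y = g y}" using x ne by simp
obtain x' where x': "x':V - {y\<in>V. f y = g y}" "!!i. i < k ==> i \<notin> {} ==> zeta x' i ~= 0"
 using perturb[OF o sub xi, of "{}"] by (metis empty_iff)
have "f x' = g x'" by (rule eq) (use x' in auto)
thus False using x'(1) by simp
qed

lemma (in chart) perturb_ex:
assumes V: "opn V" "V \<subseteq> U" "x:V"
shows "EX x':V. (ALL i<k. i:J --> zeta x' i = zeta x i) & (ALL i<k. i \<notin> J --> zeta x' i ~= 0)"
proof (rule perturb[OF V, of J])
fix x' assume x': "x':V" "!!i. i < k ==> i:J ==> zeta x' i = zeta x i" "!!i. i < k ==> i \<notin> J ==> zeta x' i ~= 0"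
show ?thesis by (rule bexI[OF _ x'(1)]) (simp add: x'(2,3))
qed

text \<open>The two automorphisms of the circle.\<close>

definition pw :: "bool => complex => complex" where "pw b z = (if b then z else cnj z)"

lemma pw_simps [simp]: "pw b (z * w) = pw b z * pw b w" "cmod (pw b z) = cmod z" "pw b (pw b z) = z" "pw b z = 0 \<longleftrightarrow> z = 0"
"pw b 1 = 1" "pw b (- z) = - pw b z" "pw b (complex_of_real r) = complex_of_real r" "pw b (z / w) = pw b z / pw b w"
by (auto simp: pw_def)

lemma (in manifold) csm_pw: "csm X W f ==> csm X W (%x. pw b (f x))"
by (cases b) (simp_all add: pw_def csm_cnj)

lemma circ_one: "circ l 1 = (%_. 1)" by (auto simp: circ_def)

lemma circ_minus_one_fixes: "j < k ==> (ALL l<k. z l ~= 0 --> circ j (- 1 :: complex) l = 1) \<longleftrightarrow> z j = (0::complex)"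
by (auto simp: circ_def)

locale chart_pair = torus_pair X tht Y et k lam lam' + A: chart X k tht n_1 m_1 bet_1 U_1 c_1 + B: chart Y k et n_2 m_2 bet_2 U_2 c_2
for X :: "'a smooth_space" and tht and Y :: "'b smooth_space" and et and k lam lam' and n_1 m_1 bet_1 U_1 c_1 n_2 m_2 bet_2 U_2 c_2 +
fixes p :: 'a
assumes p: "p:U_1" "lam p:U_2"
begin

abbreviation "z1 x \<equiv> zc (c_1 x)"
abbreviation "z2 x \<equiv> zc (c_2 x)"
abbreviation "J1 \<equiv> {i. i < k & z1 p i = 0}"
abbreviation "J2 \<equiv> {i. i < k & z2 (lam p) i = 0}"
abbreviation "gam s \<equiv> bet_2 (A.bet' s)"
abbreviation "pairing j i b \<equiv> j < k & i < k & (ALL v. cmod v = 1 --> gam (circ j v) = circ i (pw b v))"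
abbreviation "reg \<equiv> {x\<in>points X. x:U_1 & lam x:U_2}"
abbreviation "good \<equiv> {x\<in>reg. ALL l<k. (l:J1 \<or> z1 x l ~= 0) & (l:J2 \<or> z2 (lam x) l ~= 0)}"

lemma p_reg: "p:reg" using p A.U_sub by blast

lemma swap_chart: "chart_pair Y et X tht k lam' lam n_2 m_2 bet_2 U_2 c_2 n_1 m_1 bet_1 U_1 c_1 (lam p)"
proof -
obtain t where "t:torus k" "lam' (lam p) = tht t p" using lam_back p_reg by blast
hence "lam' (lam p):U_1" using A.U_act p(1) by simp
thus ?thesis by (rule chart_pair.intro[OF swap B.chart_axioms A.chart_axioms chart_pair_axioms.intro[OF p(2)]])
qed

lemma gam_hom: "torus_hom k k gam" by (rule torus_hom_compose[OF A.bet'_hom B.bet_hom])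

lemma gam_inj: assumes "s:torus k" "t:torus k" "gam s = gam t" shows "s = t"
proof -
have "B.bet' (gam s) = B.bet' (gam t)" using assms(3) by (rule arg_cong)
hence "A.bet' s = A.bet' t" unfolding B.bet'_bet[OF A.bet'_in[OF assms(1)]] B.bet'_bet[OF A.bet'_in[OF assms(2)]] .
hence "bet_1 (A.bet' s) = bet_1 (A.bet' t)" by (rule arg_cong)
thus ?thesis unfolding A.bet_bet'[OF assms(1)] A.bet_bet'[OF assms(2)] .
qed

lemma gam_kernel: assumes "s:torus k" "gam s = (%_. 1)" shows "s = (%_. 1)"
by (rule gam_inj[OF assms(1) torus_one trans[OF assms(2) torus_hom_one[OF gam_hom, symmetric]]])

lemma reg_open: "X.opn reg"
proof -
have "reg = U_1 \<inter> {x\<in>points X. lam x:U_2}" using A.U_sub by blast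
thus ?thesis using openin_Int[OF A.U_open lam_open[OF B.U_open]] by simp
qed

lemma reg_act: "t:torus k ==> x:reg ==> tht t x:reg"
using A.U_act X.act_in lam_inv by simp

lemma good_open: "X.opn good"
proof (rule openin_Ball_less[OF reg_open])
fix l assume "l < k"
have "X.opn {x\<in>U_1. z1 x l ~= 0}" by (rule X.csm_open_nonzero[OF A.zeta_csm A.U_open])
moreover have "X.opn {x\<in>points X. lam x:{y\<in>U_2. z2 y l ~= 0}}"
 by (rule lam_open, rule Y.csm_open_nonzero[OF B.zeta_csm B.U_open])
ultimately have "X.opn ((if l:J1 then reg else reg \<inter> {x\<in>U_1. z1 x l ~= 0}) \<inter>
 (if l:J2 then reg else reg \<inter> {x\<in>points X. lam x:{y\<in>U_2. z2 y l ~= 0}}))"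
 by (intro openin_Int) (simp_all only: if_split, auto intro!: openin_Int reg_open)
moreover have "(if l:J1 then reg else reg \<inter> {x\<in>U_1. z1 x l ~= 0}) \<inter>
 (if l:J2 then reg else reg \<inter> {x\<in>points X. lam x:{y\<in>U_2. z2 y l ~= 0}}) =
 {x\<in>reg. (l:J1 \<or> z1 x l ~= 0) & (l:J2 \<or> z2 (lam x) l ~= 0)}" by auto
ultimately show "X.opn {x\<in>reg. (l:J1 \<or> z1 x l ~= 0) & (l:J2 \<or> z2 (lam x) l ~= 0)}" by simp
qed

lemma p_good: "p:good" using p_reg by simp

lemma good_act: assumes t: "t:torus k" and x: "x:good" shows "tht t x:good"
proof -
have xd: "x:reg" "x:points X" "x:U_1" using x by simp_all
have "lam (tht t x) = lam x" by (rule lam_inv[OF t xd(2)])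
moreover have "z1 (tht t x) l ~= 0 \<longleftrightarrow> z1 x l ~= 0" if "l < k" for l
 using A.cmod_zeta_act[OF t xd(3) that] by (metis norm_eq_zero)
ultimately show ?thesis using reg_act[OF t xd(1)] x by simp
qed

lemma stab_chart:
assumes x: "x:reg" and s: "s:torus k"
shows "(ALL i<k. z1 x i ~= 0 --> s i = 1) \<longleftrightarrow> (ALL i<k. z2 (lam x) i ~= 0 --> gam s i = 1)"
proof -
have xU: "x:points X" "x:U_1" "lam x:U_2" using x by simp_all
have t: "A.bet' s:torus k" by (rule A.bet'_in[OF s])
show ?thesis using A.stabilizer_iff[OF xU(2) t] B.stabilizer_iff[OF xU(3) t] stab[OF t xU(1)]
 unfolding A.bet_bet'[OF s] by simp
qed

text \<open>
Isotropy groups match the coordinate circles of the two charts: near \<open>p\<close> there are points where just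
\<open>ze_j\<close> vanishes, and their isotropy group is one circle, which has a unique element of order two.
\<close>

lemma face:
assumes j: "j:J1" shows "EX i:J2. EX b. pairing j i b"
proof -
have jk: "j < k" using j by simp
have gU: "good \<subseteq> U_1" by blast
obtain x where x: "x:good" "ALL i<k. i:{j} --> z1 x i = z1 p i" "ALL i<k. i \<notin> {j} --> z1 x i ~= 0"
 using A.perturb_ex[OF good_open gU p_good, of "{j}"] by (elim bexE conjE) (rule that)
have xd: "x:reg" using x(1) by simp
have zj: "z1 x j = 0" using x(2) j by simp
have left: "(ALL i<k. z1 x i ~= 0 --> s i = 1) \<longleftrightarrow> (ALL i<k. i ~= j --> s i = 1)" for s :: "nat => complex"
proof -
 have "z1 x i ~= 0 \<longleftrightarrow> i ~= j" if "i < k" for i using zj x(3) that by (cases "i = j") auto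
 thus ?thesis by (simp cong: imp_cong)
qed
define e where "e = circ j (- 1)"
have eT: "e:torus k" unfolding e_def by (rule circ_torus[OF jk]) simp
have ge: "ALL i<k. z2 (lam x) i ~= 0 --> gam e i = 1"
 using stab_chart[OF xd eT] left by (simp add: e_def circ_def)
have "gam e ~= (%_. 1)"
proof
 assume "gam e = (%_. 1)"
 from fun_cong[OF gam_kernel[OF eT this], of j] show False by (simp add: e_def circ_def)
qed
then obtain i where i: "gam e i ~= 1" unfolding fun_eq_iff by blast
have gT: "gam e:torus k" by (rule torus_homD(1)[OF gam_hom eT])
have ik: "i < k" using torus_ge[OF gT, of i] i by (meson not_less)
have zi: "z2 (lam x) i = 0" using ge ik i by blast
have iJ: "i:J2" using x(1) ik zi by blast
have only: "l = i" if l: "l < k" "z2 (lam x) l = 0" for l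
proof -
 have cT: "circ l (- 1):torus k" by (rule circ_torus[OF l(1)]) simp
 define s where "s = bet_1 (B.bet' (circ l (- 1)))"
 have sT: "s:torus k" unfolding s_def by (rule torus_homD(1)[OF A.bet_hom B.bet'_in[OF cT]])
 have gs: "gam s = circ l (- 1)" unfolding s_def A.bet'_bet[OF B.bet'_in[OF cT]] by (rule B.bet_bet'[OF cT])
 have "ALL i<k. z2 (lam x) i ~= 0 --> gam s i = 1" unfolding gs using l(2) by (auto simp: circ_def)
 hence s1: "ALL i<k. i ~= j --> s i = 1" using stab_chart[OF xd sT] left by simp
 have "gam (tmul s s) = (%_. 1)" unfolding torus_homD(2)[OF gam_hom sT sT] gs by (auto simp: circ_def)
 hence ss: "tmul s s = (%_. 1)" by (rule gam_kernel[OF torus_mult[OF sT sT]])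
 have "s ~= (%_. 1)"
 proof
 assume "s = (%_. 1)"
 hence "circ l (- 1) = (%_. 1)" using gs torus_hom_one[OF gam_hom] by simp
 from fun_cong[OF this, of l] show False by (simp add: circ_def)
 qed
 have "s j * s j = 1" using fun_cong[OF ss, of j] by simp
 hence sj: "s j = 1 \<or> s j = - 1" by (simp add: square_eq_1_iff)
 have "s = e"
 proof
 fix a
 have "s j ~= 1"
 proof
  assume "s j = 1"
  hence "s a = 1" for a using s1 torus_ge[OF sT, of a] by (metis not_less)
  thus False using \<open>s ~= (%_. 1)\<close> by blast
 qed
 thus "s a = e a" using sj s1 torus_ge[OF sT, of a] unfolding e_def circ_def by (cases "a < k") auto
 qed
 hence "gam e i = circ l (- 1) i" using gs by simp
 thus ?thesis using i by (auto simp: circ_def split: if_splits)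
qed
have single: "gam (circ j v) = circ i (gam (circ j v) i)" if v: "cmod v = 1" for v
proof
 fix l
 have vT: "circ j v:torus k" by (rule circ_torus[OF jk v])
 have "ALL i<k. z2 (lam x) i ~= 0 --> gam (circ j v) i = 1"
 using stab_chart[OF xd vT] left by (simp add: circ_def)
 thus "gam (circ j v) l = circ i (gam (circ j v) i) l"
 using only[of l] torus_ge[OF torus_homD(1)[OF gam_hom vT], of l] by (cases "l < k") (auto simp: circ_def)
qed
obtain a :: int where a: "ALL v. cmod v = 1 --> gam (circ j v) i = v powi a"
 using torus_hom_circ_character[OF gam_hom jk] by blast
have "v = 1" if v: "cmod v = 1" "v powi a = 1" for v
proof -
 have "gam (circ j v) i = 1" using a v by simp
 hence "gam (circ j v) = (%_. 1)" using single[OF v(1)] circ_one by simp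
 hence "circ j v = (%_. 1)" by (rule gam_kernel[OF circ_torus[OF jk v(1)]])
 from fun_cong[OF this, of j] show ?thesis by (simp add: circ_def)
qed
hence "(ALL v. cmod v = 1 --> v powi a = v) \<or> (ALL v. cmod v = 1 --> v powi a = cnj v)"
 by (rule injective_circle_character)
then obtain b where b: "ALL v. cmod v = 1 --> v powi a = pw b v"
 unfolding pw_def by (metis (full_types))
have "gam (circ j v) = circ i (pw b v)" if v: "cmod v = 1" for v
 using single[OF v] a b v by simp
thus ?thesis using iJ ik jk by blast
qed

lemma pairing_swap:
assumes "pairing j i b" and v: "cmod v = 1" shows "bet_1 (B.bet' (circ i v)) = circ j (pw b v)"
proof -
have jk: "j < k" using assms by simp
have c: "circ j (pw b v):torus k" using circ_torus[OF jk] v by simp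
have "gam (circ j (pw b v)) = circ i v" using assms by simp
hence "bet_1 (B.bet' (circ i v)) = bet_1 (B.bet' (bet_2 (A.bet' (circ j (pw b v)))))" by simp
also have "\<dots> = circ j (pw b v)" unfolding B.bet'_bet[OF A.bet'_in[OF c]] by (rule A.bet_bet'[OF c])
finally show ?thesis .
qed

lemma cmod_z1_back: assumes "x:reg" "i < k" shows "cmod (z1 (lam' (lam x)) i) = cmod (z1 x i)" "lam x:points Y" "lam' (lam x):U_1"
proof -
have x: "x:points X" "x:U_1" using assms by simp_all
obtain t where t: "t:torus k" "lam' (lam x) = tht t x" using lam_back[OF x(1)] by blast
show "cmod (z1 (lam' (lam x)) i) = cmod (z1 x i)" unfolding t(2) by (rule A.cmod_zeta_act[OF t(1) x(2) assms(2)])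
show "lam' (lam x):U_1" unfolding t(2) by (rule A.U_act[OF t(1) x(2)])
show "lam x:points Y" by (rule lam_in[OF x(1)])
qed

lemma face_back:
assumes i: "i:J2" shows "EX j:J1. EX b. pairing j i b"
proof -
interpret S: chart_pair Y et X tht k lam' lam n_2 m_2 bet_2 U_2 c_2 n_1 m_1 bet_1 U_1 c_1 "lam p" by (rule swap_chart)
obtain j b where j: "j < k" "z1 (lam' (lam p)) j = 0" "S.pairing i j b" using S.face[OF i] by blast
have "z1 p j = 0" using cmod_z1_back(1)[OF p_reg j(1)] j(2) by simp
moreover have "gam (circ j v) = circ i (pw b v)" if "cmod v = 1" for v by (rule S.pairing_swap[OF j(3) that])
ultimately show ?thesis using i j(1) by blast
qed

lemma zero_iff:
assumes P: "pairing j i b" and x: "x:reg" shows "z1 x j = 0 \<longleftrightarrow> z2 (lam x) i = 0"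
proof -
have jk: "j < k" and ik: "i < k" using P by simp_all
have T: "circ j (- 1):torus k" by (rule circ_torus[OF jk]) simp
have "gam (circ j (- 1)) = circ i (- 1)" using P by simp
thus ?thesis using stab_chart[OF x T] circ_minus_one_fixes[OF jk] circ_minus_one_fixes[OF ik] by simp
qed

text \<open>The squared modulus of the paired coordinate is invariant and vanishes exactly where \<open>ze_j\<close> does.\<close>

lemma norm_divides:
assumes P: "pairing j i b" and i: "i < n_2"
shows "EX g. sm X reg g & (ALL x:reg. (cmod (z2 (lam x) i))\<^sup>2 = (cmod (z1 x j))\<^sup>2 * g x)"
proof (rule A.divide_invariant[OF reg_open])
show "reg \<subseteq> U_1" by blast
show "tht t x:reg" if "t:torus k" "x:reg" for t x by (rule reg_act[OF that])
show "j < k" using P by simp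
show "sm X reg (%x. (cmod (z2 (lam x) i))\<^sup>2)" by (rule sm_subset[OF lam_sm(1)[OF B.std i]]) blast
show "(cmod (z2 (lam (tht t x)) i))\<^sup>2 = (cmod (z2 (lam x) i))\<^sup>2" if "t:torus k" "x:reg" for t x
 using lam_inv[OF that(1)] that(2) by simp
show "(cmod (z2 (lam x) i))\<^sup>2 = 0" if "x:reg" "z1 x j = 0" for x using zero_iff[OF P that(1)] that(2) by simp
qed

lemma continuous_back:
assumes "openin (underlying Y) V" "continuous_map (subtopology (underlying Y) V) Z g" "W \<subseteq> points X" "!!x. x:W ==> lam x:V"
shows "continuous_map (subtopology (underlying X) W) Z (%x. g (lam x))"
proof -
have "continuous_map (subtopology (underlying X) W) (subtopology (underlying Y) V) lam"
 unfolding continuous_map_in_subtopology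
 using continuous_map_from_subtopology[OF lam_continuous] assms(4) by auto
from continuous_map_compose[OF this assms(2)] show ?thesis by (simp add: o_def)
qed

text \<open>The quotients in the two directions are mutually inverse on the dense set where \<open>ze_j\<close> does not vanish,
hence everywhere; this rules out zeros of \<open>g\<close>.\<close>

lemma norm_quotient:
assumes P: "pairing j i b" and i: "i:J2" and j: "j:J1"
shows "EX g. sm X reg g & (ALL x:reg. g x > 0 & (cmod (z2 (lam x) i))\<^sup>2 = (cmod (z1 x j))\<^sup>2 * g x)"
proof -
interpret S: chart_pair Y et X tht k lam' lam n_2 m_2 bet_2 U_2 c_2 n_1 m_1 bet_1 U_1 c_1 "lam p" by (rule swap_chart)
have i2: "i < n_2" using B.zeta_zero_lt[OF p(2)] i by simp
have j1: "j < n_1" using A.zeta_zero_lt[OF p(1)] j by simp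
have jk: "j < k" using j by simp
have dU: "reg \<subseteq> U_1" "reg \<subseteq> points X" by blast+
obtain g where g: "sm X reg g" "ALL x:reg. (cmod (z2 (lam x) i))\<^sup>2 = (cmod (z1 x j))\<^sup>2 * g x"
 using norm_divides[OF P i2] by blast
have P': "S.pairing i j b" using P pairing_swap[OF P] by blast
obtain h where h: "sm Y S.reg h" "ALL y:S.reg. (cmod (z1 (lam' y) j))\<^sup>2 = (cmod (z2 y i))\<^sup>2 * h y"
 using S.norm_divides[OF P' j1] by blast
have sd: "lam x:S.reg" if "x:reg" for x using cmod_z1_back(2,3)[OF that jk] that by simp
have cg: "continuous_map (subtopology (underlying X) reg) euclidean g" by (rule X.sm_continuous[OF g(1) reg_open])
have ch: "continuous_map (subtopology (underlying X) reg) euclidean (%x. h (lam x))"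
 by (rule continuous_back[OF S.reg_open Y.sm_continuous[OF h(1) S.reg_open] dU(2) sd])
have gh: "g x * h (lam x) = 1" if x: "x:reg" for x
proof (rule A.dense_eq[OF reg_open dU(1) continuous_map_real_mult[OF cg ch] _ _ _ x])
 show "continuous_map (subtopology (underlying X) reg) euclidean (%x. 1::real)" by simp
 fix x assume x: "x:reg" and nz: "!!i. i < k ==> z1 x i ~= 0"
 have "(cmod (z1 x j))\<^sup>2 = (cmod (z1 x j))\<^sup>2 * (g x * h (lam x))"
 using h(2)[rule_format, OF sd[OF x]] g(2)[rule_format, OF x] cmod_z1_back(1)[OF x jk] by simp
 thus "g x * h (lam x) = 1" using nz[OF jk] by simp
qed simp
have ga: "\<bar>g x\<bar> = g x" if x: "x:reg" for x
proof (rule A.dense_eq[OF reg_open dU(1) continuous_map_real_abs[OF cg] cg _ _ x])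
 fix x assume x: "x:reg" and nz: "!!i. i < k ==> z1 x i ~= 0"
 have "0 \<le> (cmod (z1 x j))\<^sup>2 * g x" using g(2)[rule_format, OF x] zero_le_power2 by metis
 moreover have "0 < (cmod (z1 x j))\<^sup>2" using nz[OF jk] by simp
 ultimately show "\<bar>g x\<bar> = g x" by (simp add: zero_le_mult_iff)
qed simp
have "g x > 0" if x: "x:reg" for x
proof -
 have "g x ~= 0" using gh[OF x] by auto
 thus ?thesis using ga[OF x] by linarith
qed
thus ?thesis using g by blast
qed

end

section \<open>Smooth equivariant lifts near a point\<close>

lemma (in manifold) sm_cmod:
assumes "csm X W f" "!!x. x:W ==> f x ~= 0" shows "sm X W (%x. cmod (f x))"
proof (rule sm_cong[OF sm_sqrt[OF sm_cmod2[OF assms(1)]]])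
show "0 < (cmod (f x))\<^sup>2" if "x:W" for x using assms(2)[OF that] by simp
qed simp

lemma (in torus_manifold) continuous_act:
assumes V: "opn V" and inv: "!!x. x:V ==> tht t x:V" and t: "t:torus k"
 and f: "continuous_map (subtopology (underlying X) V) Z f"
shows "continuous_map (subtopology (underlying X) V) Z (%x. f (tht t x))"
proof -
have "continuous_map (subtopology (underlying X) V) (subtopology (underlying X) V) (tht t)"
 unfolding continuous_map_in_subtopology
 using continuous_map_from_subtopology[OF act_continuous[OF t]] inv by auto
from continuous_map_compose[OF this f] show ?thesis by (simp add: o_def)
qed

lemma (in torus_pair) lift_restrict:
assumes L: "lift W psi" and V: "openin (underlying X) V" "V \<subseteq> W" and inv: "!!t x. t:torus k ==> x:V ==> tht t x:V"
shows "lift V psi"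
unfolding lift_def
proof (intro conjI ballI)
show "smap X V Y psi" by (rule smap_subset[OF liftD(4)[OF L] V(2)])
fix x assume x: "x:V"
hence xW: "x:W" using V(2) by blast
show "EX t:torus k. psi x = et t (lam x)" by (rule liftD(5)[OF L xW])
fix t assume t: "t:torus k"
show "tht t x:V" by (rule inv[OF t x])
show "psi (tht t x) = et t (psi x)" by (rule liftD(3)[OF L t xW])
qed (rule V(1))

context chart_pair
begin

lemma norm_quotient_invariant:
assumes P: "pairing j i b" and i: "i:J2" and j: "j:J1"
shows "EX g. sm X reg g & (ALL x:reg. g x > 0 & (cmod (z2 (lam x) i))\<^sup>2 = (cmod (z1 x j))\<^sup>2 * g x) &
 (ALL t:torus k. ALL x:reg. g (tht t x) = g x)"
proof -
obtain g where g: "sm X reg g" "ALL x:reg. g x > 0 & (cmod (z2 (lam x) i))\<^sup>2 = (cmod (z1 x j))\<^sup>2 * g x"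
 using norm_quotient[OF P i j] by blast
have jk: "j < k" using j by simp
have dU: "reg \<subseteq> U_1" by blast
have cg: "continuous_map (subtopology (underlying X) reg) euclidean g" by (rule X.sm_continuous[OF g(1) reg_open])
have "g (tht t x) = g x" if t: "t:torus k" and x: "x:reg" for t x
proof (rule A.dense_eq[OF reg_open dU X.continuous_act[OF reg_open reg_act[OF t] t cg] cg _ _ x])
 fix x assume x: "x:reg" and nz: "!!i. i < k ==> z1 x i ~= 0"
 have xU: "x:U_1" "x:points X" using x by simp_all
 have "(cmod (z1 x j))\<^sup>2 * g (tht t x) = (cmod (z1 x j))\<^sup>2 * g x"
 using g(2)[rule_format, OF reg_act[OF t x]] g(2)[rule_format, OF x] lam_inv[OF t xU(2)] A.cmod_zeta_act[OF t xU(1) jk] by auto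
 thus "g (tht t x) = g x" using nz[OF jk] by simp
qed simp_all
thus ?thesis using g by blast
qed

lemma lift_coords:
assumes L: "lift W psi" and x: "x:W" "x:reg"
shows "psi x:U_2" "i < k ==> cmod (z2 (psi x) i) = cmod (z2 (lam x) i)" "2 * k \<le> j ==> c_2 (psi x) j = c_2 (lam x) j"
proof -
obtain t where t: "t:torus k" "psi x = et t (lam x)" using liftD(5)[OF L x(1)] by blast
have l: "lam x:U_2" using x(2) by simp
show "psi x:U_2" unfolding t(2) by (rule B.U_act[OF t(1) l])
show "cmod (z2 (psi x) i) = cmod (z2 (lam x) i)" if "i < k" unfolding t(2) by (rule B.cmod_zeta_act[OF t(1) l that])
show "c_2 (psi x) j = c_2 (lam x) j" if "2 * k \<le> j" unfolding t(2) by (rule B.c_act[OF t(1) l that])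
qed

lemma pairing_unique:
assumes "pairing j i b" "pairing l i b'" shows "l = j"
proof -
have T: "circ j (- 1):torus k" "circ l (- 1):torus k" using assms by (simp_all add: circ_torus)
have "gam (circ j (- 1)) = circ i (- 1)" "gam (circ l (- 1)) = circ i (- 1)" using assms by simp_all
hence "gam (circ j (- 1)) = gam (circ l (- 1))" by (rule trans_sym)
from fun_cong[OF gam_inj[OF T this], of l] show ?thesis by (simp add: circ_def split: if_splits)
qed

text \<open>On the product of the circles that fix coordinates of \<open>p\<close>, the change of tori between the charts permutes the
coordinates and conjugates some of them.\<close>

lemma gam_on_face:
assumes mu: "ALL i:J2. mu i:J1 & pairing (mu i) i (bs i)" and s: "s:torus k" and i: "i < k"
shows "gam (%l. if l:J1 then s l else 1) i = (if i:J2 then pw (bs i) (s (mu i)) else 1)"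
proof -
define sJ where "sJ l = (if l:J1 then s l else 1)" for l
have sT: "sJ:torus k" by (rule torusI) (use torus_cmod[OF s] torus_ge[OF s] in \<open>simp_all add: sJ_def\<close>)
have f: "gam (circ l (sJ l)) i = (if l = mu i then (if i:J2 then pw (bs i) (s (mu i)) else 1) else 1)" if l: "l < k" for l
proof (cases "l:J1")
 case False
 hence "sJ l = 1" unfolding sJ_def by (rule if_not_P)
 hence "gam (circ l (sJ l)) i = 1" using torus_hom_one[OF gam_hom] by (simp add: circ_one)
 moreover have "\<not> (l = mu i & i:J2)" using mu False by blast
 ultimately show ?thesis by auto
next
 case True
 obtain i' b' where i': "i':J2" "pairing l i' b'" using face[OF True] by blast
 have sl: "sJ l = s l" using True unfolding sJ_def by simp
 have e: "gam (circ l (sJ l)) = circ i' (pw b' (s l))" unfolding sl using i'(2) torus_cmod[OF s] by simp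
 show ?thesis
 proof (cases "i = i'")
 case True
 have Pi: "pairing (mu i) i (bs i)" using mu i'(1) True by blast
 have lm: "l = mu i" by (rule pairing_unique[OF Pi, of l b']) (use i'(2) True in simp)
 have "gam (circ (mu i) (s (mu i))) = circ i (pw (bs i) (s (mu i)))" using Pi torus_cmod[OF s] by simp
 hence "gam (circ l (sJ l)) i = pw (bs i) (s (mu i))" unfolding sl unfolding lm by (simp add: circ_same)
 thus ?thesis using lm True i'(1) by simp
 next
 case False
 have "\<not> (l = mu i & i:J2)"
 proof
  assume a: "l = mu i & i:J2"
  hence "pairing l i (bs i)" using mu by blast
  hence "gam (circ l (- 1)) = circ i (- 1)" by simp
  moreover have "gam (circ l (- 1)) = circ i' (- 1)" using i'(2) by simp
  ultimately have "circ i (- 1) i = circ i' (- 1) i" by simp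
  thus False using False by (simp add: circ_def)
 qed
 thus ?thesis unfolding e using False by (auto simp: circ_def)
 qed
qed
have "gam sJ i = (\<Prod>l<k. gam (circ l (sJ l)) i)" by (rule torus_hom_circ_prod[OF gam_hom sT])
also have "\<dots> = (\<Prod>l<k. if l = mu i then (if i:J2 then pw (bs i) (s (mu i)) else 1) else 1)"
 by (rule prod.cong) (use f in simp_all)
also have "\<dots> = (if i:J2 then pw (bs i) (s (mu i)) else 1)"
proof (cases "i:J2")
 case True
 hence "mu i < k" using mu by blast
 thus ?thesis using True by (simp add: prod.delta)
next
 case False
 show ?thesis unfolding if_not_P[OF False] by simp
qed
finally show ?thesis unfolding sJ_def .
qed

text \<open>The phases of the nonvanishing coordinates at \<open>p\<close> are transported by the change of tori \<open>gam\<close>; a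
coordinate that vanishes at \<open>p\<close> becomes \<open>ze_j\<close> or its conjugate, corrected by the square root of the quotient of squared moduli.\<close>

lemma local_lift: "EX psi. lift good psi"
proof -
have "ALL i:J2. EX q. fst q:J1 & pairing (fst q) i (snd q)" using face_back by fastforce
from bchoice[OF this] obtain q where q: "ALL i:J2. fst (q i):J1 & pairing (fst (q i)) i (snd (q i))" by (elim exE)
define mu bs where "mu i = fst (q i)" and "bs i = snd (q i)" for i
have mu: "ALL i:J2. mu i:J1 & pairing (mu i) i (bs i)" using q unfolding mu_def bs_def .
have "ALL i:J2. EX g. sm X reg g & (ALL x:reg. g x > 0 & (cmod (z2 (lam x) i))\<^sup>2 = (cmod (z1 x (mu i)))\<^sup>2 * g x) &
 (ALL t:torus k. ALL x:reg. g (tht t x) = g x)"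
proof
 fix i assume i: "i:J2"
 have "pairing (mu i) i (bs i)" "mu i:J1" using mu i by blast+
 thus "EX g. sm X reg g & (ALL x:reg. g x > 0 & (cmod (z2 (lam x) i))\<^sup>2 = (cmod (z1 x (mu i)))\<^sup>2 * g x) &
 (ALL t:torus k. ALL x:reg. g (tht t x) = g x)" by (rule norm_quotient_invariant[OF _ i])
qed
from bchoice[OF this] obtain G where G: "ALL i:J2. sm X reg (G i) & (ALL x:reg. G i x > 0 &
 (cmod (z2 (lam x) i))\<^sup>2 = (cmod (z1 x (mu i)))\<^sup>2 * G i x) & (ALL t:torus k. ALL x:reg. G i (tht t x) = G i x)" by (elim exE)
have gr: "good \<subseteq> reg" and gU: "good \<subseteq> U_1" and gX: "good \<subseteq> points X" by blast+
have n1: "z1 x l ~= 0" if "x:good" "l < k" "l \<notin> J1" for x l using that by blast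
have n2: "z2 (lam x) l ~= 0" if "x:good" "l < k" "l \<notin> J2" for x l using that by blast
have l2: "lam x:U_2" if "x:good" for x using that by simp
define u where "u x l = (if l < k & l \<notin> J1 then z1 x l / complex_of_real (cmod (z1 x l)) else 1)" for x l
have uT: "u x:torus k" if x: "x:good" for x
 by (rule torusI) (use n1[OF x] in \<open>simp_all add: u_def norm_divide\<close>)
have ucsm: "csm X good (%x. u x l)" for l
proof (cases "l < k & l \<notin> J1")
 case True
 have z: "csm X good (%x. z1 x l)" by (rule csm_subset[OF A.zeta_csm gU])
 have nz: "z1 x l ~= 0" if "x:good" for x using n1 that True by blast
 have "csm X good (%x. z1 x l / complex_of_real (cmod (z1 x l)))"
 by (rule X.csm_divide[OF z X.csm_of_real[OF X.sm_cmod[OF z nz]]]) (use nz in simp_all)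
 thus ?thesis unfolding u_def using True by simp
next
 case False
 thus ?thesis unfolding u_def using X.csm_const by auto
qed
define r where "r x i = (if i:J2 then pw (bs i) (z1 x (mu i)) * complex_of_real (sqrt (G i x)) else complex_of_real (cmod (z2 (lam x) i)))" for x i
define w where "w x i = gam (u x) i * r x i" for x i
have rcsm: "csm X good (%x. r x i)" if ik: "i < k" for i
proof (cases "i:J2")
 case True
 have "sm X good (G i)" by (rule sm_subset[OF _ gr]) (use G True in blast)
 moreover have "0 < G i x" if "x:good" for x using G True gr that by blast
 ultimately have "csm X good (%x. pw (bs i) (z1 x (mu i)) * complex_of_real (sqrt (G i x)))"
 by (intro X.csm_mult X.csm_pw X.csm_of_real X.sm_sqrt csm_subset[OF A.zeta_csm gU])
 thus ?thesis unfolding r_def using True by simp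
next
 case False
 have "sm X good (%x. cmod (z2 (lam x) i))"
 proof (cases "i < n_2")
 case True
 have "sm X good (%x. (cmod (z2 (lam x) i))\<^sup>2)" by (rule sm_subset[OF lam_sm(1)[OF B.std True]]) blast
 moreover have "0 < (cmod (z2 (lam x) i))\<^sup>2" if "x:good" for x using n2[OF that ik False] by simp
 ultimately have "sm X good (%x. sqrt ((cmod (z2 (lam x) i))\<^sup>2))" by (rule X.sm_sqrt)
 thus ?thesis by simp
 next
 case F: False
 show ?thesis by (rule X.sm_cong[OF X.sm_const[where c = 1]]) (use B.zeta_unit[OF l2 _ ik] F in simp)
 qed
 hence "csm X good (%x. complex_of_real (cmod (z2 (lam x) i)))" by (rule X.csm_of_real)
 thus ?thesis unfolding r_def if_not_P[OF False] .
qed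
have wcsm: "csm X good (%x. w x i)" if ik: "i < k" for i
 unfolding w_def by (rule X.csm_mult[OF X.csm_torus_hom[OF gam_hom uT ucsm] rcsm[OF ik]])
have rnorm: "cmod (r x i) = cmod (z2 (lam x) i)" if x: "x:good" and ik: "i < k" for x i
proof (cases "i:J2")
 case True
 have g: "G i x > 0" "(cmod (z2 (lam x) i))\<^sup>2 = (cmod (z1 x (mu i)))\<^sup>2 * G i x" using G True gr x by blast+
 have "sqrt ((cmod (z2 (lam x) i))\<^sup>2) = sqrt ((cmod (z1 x (mu i)))\<^sup>2) * sqrt (G i x)" unfolding g(2) by (rule real_sqrt_mult)
 thus ?thesis unfolding r_def if_P[OF True] using g(1) by (simp add: norm_mult)
next
 case False
 show ?thesis unfolding r_def if_not_P[OF False] by simp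
qed
have wnorm: "cmod (w x i) = cmod (z2 (lam x) i)" if x: "x:good" and ik: "i < k" for x i
 unfolding w_def norm_mult rnorm[OF x ik] using torus_cmod[OF torus_homD(1)[OF gam_hom uT[OF x]]] by simp
have ract: "r (tht t x) i = gam (%l. if l:J1 then bet_1 t l else 1) i * r x i" if t: "t:torus k" and x: "x:good" and ik: "i < k" for t x i
proof -
 have xx: "x:U_1" "x:points X" "x:reg" using x by simp_all
 have bT: "bet_1 t:torus k" by (rule torus_homD(1)[OF A.bet_hom t])
 show ?thesis
 proof (cases "i:J2")
 case True
 have mk: "mu i < k" using mu True by blast
 have "G i (tht t x) = G i x" using G True t xx(3) by blast
 thus ?thesis unfolding gam_on_face[OF mu bT ik] r_def A.zeta_act[OF t xx(1) mk] using True by simp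
 next
 case False
 thus ?thesis unfolding gam_on_face[OF mu bT ik] r_def lam_inv[OF t xx(2)] by (simp only: if_False mult_1)
 qed
qed
have wact: "w (tht t x) i = bet_2 t i * w x i" if t: "t:torus k" and x: "x:good" and ik: "i < k" for t x i
proof -
 define s where "s = bet_1 t"
 have sT: "s:torus k" unfolding s_def by (rule torus_homD(1)[OF A.bet_hom t])
 define sJ sN where "sJ l = (if l:J1 then s l else 1)" and "sN l = (if l:J1 then 1 else s l)" for l
 have jT: "sJ:torus k" by (rule torusI) (use torus_cmod[OF sT] in \<open>simp_all add: sJ_def\<close>)
 have nT: "sN:torus k" by (rule torusI) (use torus_cmod[OF sT] torus_ge[OF sT] in \<open>simp_all add: sN_def\<close>)
 have x1: "x:U_1" using x by simp
 have "u (tht t x) = tmul sN (u x)"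
 proof
 fix l
 show "u (tht t x) l = sN l * u x l"
 proof (cases "l < k & l \<notin> J1")
  case True
  hence lk: "l < k" by simp
  have "sN l = s l" unfolding sN_def using True by simp
  thus ?thesis unfolding u_def A.zeta_act[OF t x1 lk] s_def[symmetric] norm_mult torus_cmod[OF sT] using True by simp
 next
  case False
  hence "sN l = 1" unfolding sN_def using torus_ge[OF sT, of l] by (cases "l < k") auto
  thus ?thesis unfolding u_def using False by auto
 qed
 qed
 hence gu: "gam (u (tht t x)) i = gam sN i * gam (u x) i" using torus_homD(2)[OF gam_hom nT uT[OF x]] by simp
 have "s = tmul sJ sN" unfolding sJ_def sN_def by auto
 hence "gam s = tmul (gam sJ) (gam sN)" using torus_homD(2)[OF gam_hom jT nT] by simp
 moreover have "gam s = bet_2 t" unfolding s_def A.bet'_bet[OF t] ..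
 ultimately have b: "bet_2 t i = gam sJ i * gam sN i" by simp
 have ra: "r (tht t x) i = gam sJ i * r x i" using ract[OF t x ik] unfolding sJ_def[abs_def] s_def .
 show ?thesis unfolding w_def gu ra b by (simp only: mult_ac)
qed
define v where "v x j = (if j < 2 * k then (if even j then Re (w x (j div 2)) else Im (w x (j div 2))) else c_2 (lam x) j)" for x j
have vz: "zc (v x) i = w x i" if "i < k" for x i using that by (simp add: zc_def v_def)
have vin: "v x:std_image k n_2 m_2" if x: "x:good" for x
proof -
 have "v x:R_vecs (2 * k + m_2)" using B.c_in_R[OF l2[OF x]] by (auto simp: v_def topspace_Euclidean_space)
 moreover have "cmod (zc (v x) i) = 1" if "n_2 \<le> i" "i < k" for i
 unfolding vz[OF that(2)] wnorm[OF x that(2)] by (rule B.zeta_unit[OF l2[OF x] that])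
 ultimately show ?thesis by (simp add: std_image_def)
qed
define psi where "psi x = inv_into U_2 c_2 (v x)" for x
have pU: "psi x:U_2" if "x:good" for x unfolding psi_def by (rule B.point_in[OF vin[OF that]])
have pc: "c_2 (psi x) = v x" if "x:good" for x unfolding psi_def by (rule B.c_point[OF vin[OF that]])
have pr: "c_2 (psi x) j = c_2 (lam x) j" if "x:good" "2 * k \<le> j" for x j unfolding pc[OF that(1)] v_def using that(2) by simp
have pz: "z2 (psi x) i = w x i" if "x:good" "i < k" for x i unfolding pc[OF that(1)] by (rule vz[OF that(2)])
have "lift good psi"
 unfolding lift_def
proof (intro conjI ballI)
 show "X.opn good" by (rule good_open)
 show "smap X good Y psi"
 proof (rule B.smap_chartI[OF X.smooth_manifold good_open pU])
 fix j
 have "sm X good (%x. v x j)"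
 proof (cases "j < 2 * k")
  case True
  hence "j div 2 < k" by linarith
  thus ?thesis using wcsm[of "j div 2"] True by (cases "even j") (simp_all add: v_def csm_def)
 next
  case False
  have "sm X good (%x. c_2 (lam x) j)" by (rule sm_subset[OF lam_sm(2)[OF B.std]]) (use False in auto)
  thus ?thesis using False by (simp add: v_def)
 qed
 thus "sm X good (%x. c_2 (psi x) j)" by (rule X.sm_cong) (use pc in simp)
 qed
 fix x assume x: "x:good"
 show "EX t:torus k. psi x = et t (lam x)"
 proof (rule B.same_orbit[OF l2[OF x] pU[OF x]])
 show "cmod (z2 (lam x) i) = cmod (z2 (psi x) i)" if "i < k" for i unfolding pz[OF x that] wnorm[OF x that] ..
 show "c_2 (lam x) j = c_2 (psi x) j" if "2 * k \<le> j" for j using pr[OF x that] by simp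
 qed
 fix t assume t: "t:torus k"
 show tx: "tht t x:good" by (rule good_act[OF t x])
 show "psi (tht t x) = et t (psi x)"
 proof (rule B.eqI[OF pU[OF tx] B.U_act[OF t pU[OF x]]])
 show "z2 (psi (tht t x)) i = z2 (et t (psi x)) i" if "i < k" for i
  unfolding pz[OF tx that] B.zeta_act[OF t pU[OF x] that] pz[OF x that] by (rule wact[OF t x that])
 show "c_2 (psi (tht t x)) j = c_2 (et t (psi x)) j" if "2 * k \<le> j" for j
  unfolding pr[OF tx that] B.c_act[OF t pU[OF x] that] pr[OF x that] using lam_inv[OF t] gX x by auto
 qed
qed
thus ?thesis by blast
qed

text \<open>Paired coordinates of both lifts are divisible by the same \<open>ze_j\<close> (or its conjugate), and the two cofactors
have the same positive modulus.\<close>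

lemma lift_ratio:
assumes L: "lift W psi" and L': "lift W psi'" and W: "W \<subseteq> good" and ik: "i < k"
shows "EX q. csm X W q & (ALL x:W. cmod (q x) = 1 & z2 (psi' x) i = q x * z2 (psi x) i)"
proof -
note Wo = liftD(1)[OF L]
have WU: "W \<subseteq> U_1" and Wr: "W \<subseteq> reg" using W by blast+
have rW: "x:reg" if "x:W" for x using Wr that by blast
have hc: "csm X W (%x. z2 (ph x) i)" if L: "lift W ph" for ph
proof -
 have "csm X {x\<in>W. ph x:U_2} (%x. z2 (ph x) i)" by (rule smap_cpullback[OF liftD(4)[OF L] B.U_open B.zeta_csm])
 thus ?thesis by (rule csm_subset) (use lift_coords(1)[OF L _ rW] in blast)
qed
have hn: "cmod (z2 (ph x) i) = cmod (z2 (lam x) i)" if "lift W ph" "x:W" for ph x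
 by (rule lift_coords(2)[OF that rW[OF that(2)] ik])
show ?thesis
proof (cases "i:J2")
 case False
 have nz: "z2 (lam x) i ~= 0" if "x:W" for x using W that ik False by blast
 have nz': "z2 (ph x) i ~= 0" if "lift W ph" "x:W" for ph x
 proof
 assume "z2 (ph x) i = 0" thus False using hn[OF that] nz[OF that(2)] by simp
 qed
 have "csm X W (%x. z2 (psi' x) i / z2 (psi x) i)" by (rule X.csm_divide[OF hc[OF L'] hc[OF L] nz'[OF L]])
 moreover have "cmod (z2 (psi' x) i / z2 (psi x) i) = 1 & z2 (psi' x) i = z2 (psi' x) i / z2 (psi x) i * z2 (psi x) i" if "x:W" for x
 unfolding norm_divide hn[OF L that] hn[OF L' that] using nz[OF that] nz'[OF L that] by simp
 ultimately show ?thesis by (intro exI[of _ "%x. z2 (psi' x) i / z2 (psi x) i"]) blast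
next
 case True
 obtain j b where jJ: "j:J1" and P: "pairing j i b" using face_back[OF True] by blast
 have jk: "j < k" using jJ by simp
 obtain g where g: "sm X reg g" "ALL x:reg. g x > 0 & (cmod (z2 (lam x) i))\<^sup>2 = (cmod (z1 x j))\<^sup>2 * g x"
 using norm_quotient[OF P True jJ] by blast
 have div: "EX A. csm X W A & (ALL x:W. pw b (z2 (ph x) i) = z1 x j * A x)" if L1: "lift W ph" for ph
 proof (rule A.divide_weight_one[OF Wo WU liftD(2)[OF L] jk X.csm_pw[OF hc[OF L1]]])
 fix v x assume v: "cmod v = 1" and x: "x:W"
 have t: "A.bet' (circ j v):torus k" by (rule A.bet'_in[OF circ_torus[OF jk v]])
 have "gam (circ j v) i = pw b v" using P v by (simp add: circ_same)
 thus "pw b (z2 (ph (tht (A.bet' (circ j v)) x)) i) = v * pw b (z2 (ph x) i)"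
  unfolding liftD(3)[OF L1 t x] B.zeta_act[OF t lift_coords(1)[OF L1 x rW[OF x]] ik] by simp
 qed
 have norm: "(cmod (A x))\<^sup>2 = g x" if L1: "lift W ph" and A: "csm X W A" "ALL x:W. pw b (z2 (ph x) i) = z1 x j * A x" and x: "x:W" for ph A x
 proof (rule A.dense_eq[OF Wo WU X.sm_continuous[OF X.sm_cmod2[OF A(1)] Wo] X.sm_continuous[OF sm_subset[OF g(1) Wr] Wo] _ _ x])
 fix x assume x: "x:W" and nz: "!!i. i < k ==> z1 x i ~= 0"
 have "(cmod (z1 x j * A x))\<^sup>2 = (cmod (pw b (z2 (ph x) i)))\<^sup>2" using A(2) x by simp
 also have "\<dots> = (cmod (z2 (lam x) i))\<^sup>2" using hn[OF L1 x] by simp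
 also have "\<dots> = (cmod (z1 x j))\<^sup>2 * g x" using g(2) rW[OF x] by blast
 finally have "(cmod (z1 x j))\<^sup>2 * (cmod (A x))\<^sup>2 = (cmod (z1 x j))\<^sup>2 * g x" by (simp add: norm_mult power_mult_distrib)
 thus "(cmod (A x))\<^sup>2 = g x" using nz[OF jk] by simp
 qed simp
 obtain A where A: "csm X W A" "ALL x:W. pw b (z2 (psi x) i) = z1 x j * A x" using div[OF L] by blast
 obtain A' where A': "csm X W A'" "ALL x:W. pw b (z2 (psi' x) i) = z1 x j * A' x" using div[OF L'] by blast
 have A0: "A x ~= 0" if "x:W" for x
 proof
 assume "A x = 0"
 hence "g x = 0" using norm[OF L A that] by simp
 thus False using g(2) rW[OF that] by (metis less_irrefl)
 qed
 have "csm X W (%x. pw b (A' x / A x))" by (rule X.csm_pw[OF X.csm_divide[OF A'(1) A(1) A0]])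
 moreover have "cmod (pw b (A' x / A x)) = 1 & z2 (psi' x) i = pw b (A' x / A x) * z2 (psi x) i" if x: "x:W" for x
 proof
 have "(cmod (A' x))\<^sup>2 = (cmod (A x))\<^sup>2" unfolding norm[OF L A x] norm[OF L' A' x] ..
 hence "cmod (A' x) = cmod (A x)" by (simp add: power2_eq_iff_nonneg)
 thus "cmod (pw b (A' x / A x)) = 1" using A0[OF x] by (simp add: norm_divide)
 have "pw b (pw b (z2 (psi' x) i)) = pw b (A' x / A x * pw b (z2 (psi x) i))"
  unfolding A(2)[rule_format, OF x] A'(2)[rule_format, OF x] using A0[OF x] by simp
 thus "z2 (psi' x) i = pw b (A' x / A x) * z2 (psi x) i" by simp
 qed
 ultimately show ?thesis by (intro exI[of _ "%x. pw b (A' x / A x)"]) blast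
qed
qed

lemma z2_nonzero:
assumes x: "x:good" and nz: "!!i. i < k ==> z1 x i ~= 0" and ik: "i < k" shows "z2 (lam x) i ~= 0"
proof (cases "i:J2")
case True
obtain j b where P: "pairing j i b" using face_back[OF True] by blast
have "x:reg" using x by simp
moreover have "j < k" using P by simp
ultimately show ?thesis using zero_iff[OF P] nz by blast
next
case False thus ?thesis using x ik by blast
qed

lemma compare:
assumes L: "lift W psi" and L': "lift W psi'" and W: "W \<subseteq> good"
shows "EX f. (ALL x:W. f x:torus k & psi' x = et (f x) (psi x)) & (ALL t:torus k. ALL x:W. f (tht t x) = f x) &
 (ALL i. csm X W (%x. f x i))"
proof -
note Wo = liftD(1)[OF L]
have WU: "W \<subseteq> U_1" using W by blast
have rW: "x:reg" if "x:W" for x using W that by blast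
have "ALL i:{..<k}. EX q. csm X W q & (ALL x:W. cmod (q x) = 1 & z2 (psi' x) i = q x * z2 (psi x) i)"
 using lift_ratio[OF L L' W] by simp
from bchoice[OF this] obtain q where "ALL i:{..<k}. csm X W (q i) & (ALL x:W. cmod (q i x) = 1 & z2 (psi' x) i = q i x * z2 (psi x) i)" ..
hence q: "csm X W (q i)" "x:W ==> cmod (q i x) = 1" "x:W ==> z2 (psi' x) i = q i x * z2 (psi x) i" if "i < k" for i x
 using that by simp_all
define e where "e x i = (if i < k then q i x else 1)" for x i
have eT: "e x:torus k" if "x:W" for x by (rule torusI) (simp_all add: e_def q(2)[OF _ that])
have qinv: "q i (tht t x) = q i x" if ik: "i < k" and t: "t:torus k" and x: "x:W" for i t x
proof -
 have cq: "continuous_map (subtopology (underlying X) W) euclidean (q i)" by (rule X.csm_continuous[OF q(1)[OF ik] Wo])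
 show ?thesis
 proof (rule A.dense_eq[OF Wo WU X.continuous_act[OF Wo liftD(2)[OF L t] t cq] cq _ _ x])
 fix x assume x: "x:W" and nz: "!!i. i < k ==> z1 x i ~= 0"
 have xg: "x:good" using W x by blast
 have "cmod (z2 (psi x) i) = cmod (z2 (lam x) i)" by (rule lift_coords(2)[OF L x rW[OF x] ik])
 hence n2: "z2 (psi x) i ~= 0" using z2_nonzero[OF xg nz ik] by auto
 have b0: "bet_2 t i ~= 0" by (rule torus_nonzero[OF torus_homD(1)[OF B.bet_hom t]])
 have "z2 (psi' (tht t x)) i = q i (tht t x) * z2 (psi (tht t x)) i" by (rule q(3)[OF ik liftD(2)[OF L t x]])
 hence "bet_2 t i * (q i x * z2 (psi x) i) = q i (tht t x) * (bet_2 t i * z2 (psi x) i)"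
  unfolding liftD(3)[OF L t x] liftD(3)[OF L' t x] B.zeta_act[OF t lift_coords(1)[OF L x rW[OF x]] ik]
  B.zeta_act[OF t lift_coords(1)[OF L' x rW[OF x]] ik] q(3)[OF ik x] .
 hence "(bet_2 t i * z2 (psi x) i) * q i (tht t x) = (bet_2 t i * z2 (psi x) i) * q i x" by (simp only: mult_ac)
 thus "q i (tht t x) = q i x" using b0 n2 by (simp only: mult_cancel_left) simp
 qed simp_all
qed
define f where "f x = B.bet' (e x)" for x
have fT: "f x:torus k" if "x:W" for x unfolding f_def by (rule B.bet'_in[OF eT[OF that]])
have "psi' x = et (f x) (psi x)" if x: "x:W" for x
proof (rule B.eqI[OF lift_coords(1)[OF L' x rW[OF x]] B.U_act[OF fT[OF x] lift_coords(1)[OF L x rW[OF x]]]])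
 show "z2 (psi' x) i = z2 (et (f x) (psi x)) i" if ik: "i < k" for i
 unfolding B.zeta_act[OF fT[OF x] lift_coords(1)[OF L x rW[OF x]] ik] q(3)[OF ik x]
 unfolding f_def B.bet_bet'[OF eT[OF x]] by (simp add: e_def ik)
 show "c_2 (psi' x) j = c_2 (et (f x) (psi x)) j" if j: "2 * k \<le> j" for j
 unfolding B.c_act[OF fT[OF x] lift_coords(1)[OF L x rW[OF x]] j] lift_coords(3)[OF L x rW[OF x] j]
  lift_coords(3)[OF L' x rW[OF x] j] ..
qed
moreover have "f (tht t x) = f x" if t: "t:torus k" and x: "x:W" for t x
proof -
 have "e (tht t x) = e x" unfolding e_def using qinv[OF _ t x] by auto
 thus ?thesis unfolding f_def by (rule arg_cong)
qed
moreover have "csm X W (%x. f x i)" for i unfolding f_def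
 by (rule X.csm_torus_hom[OF B.bet'_hom eT]) (simp_all add: e_def q(1))
ultimately show ?thesis using fT by (intro exI[of _ f]) blast
qed

end

section \<open>Boxes in the orbit coordinates of a chart\<close>

lemma continuous_map_euclidean_compose:
assumes f: "continuous_map T euclidean f" and S: "!!x. x:topspace T ==> f x:S" and g: "continuous_on S g"
shows "continuous_map T euclidean (%x. g (f x))"
proof -
have "continuous_map T (top_of_set S) f" unfolding continuous_map_in_subtopology using f S by auto
moreover have "continuous_map (top_of_set S) euclidean g" using g by simp
ultimately have "continuous_map T euclidean (g \<circ> f)" by (rule continuous_map_compose)
thus ?thesis by (simp add: o_def)
qed

definition coordinate_bcontfun :: "nat => nat \<Rightarrow>\<^sub>C real" where
"coordinate_bcontfun j = Bcontfun (%i. if i = j then 1 else 0)"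

text \<open>Finite coordinate vectors as elements of a normed space, in which contractibility and logarithms are available.\<close>

definition emb :: "nat => (nat => real) => nat \<Rightarrow>\<^sub>C real" where
"emb N v = (\<Sum>j<N. v j *\<^sub>R coordinate_bcontfun j)"

lemma apply_emb: assumes "v:R_vecs N" shows "apply_bcontfun (emb N v) = v"
proof
fix i
have "(%i::nat. if i = j then 1 else 0 :: real):bcontfun" for j
proof -
 have "bounded (range (%i::nat. if i = j then 1 else 0 :: real))"
 by (rule bounded_subset[of "{0, 1}"]) auto
 moreover have "continuous_on UNIV (%i::nat. if i = j then 1 else 0 :: real)"
 unfolding continuous_on_open_invariant by (auto simp: open_discrete)
 ultimately show ?thesis by (simp add: bcontfun_def)
qed
hence c: "apply_bcontfun (coordinate_bcontfun j) i = (if i = j then 1 else 0)" for j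
 unfolding coordinate_bcontfun_def by (simp add: Bcontfun_inverse)
have "apply_bcontfun (\<Sum>j<M. v j *\<^sub>R coordinate_bcontfun j) i = (\<Sum>j<M. v j * (if i = j then 1 else 0))" for M
 by (induction M) (simp_all add: c plus_bcontfun.rep_eq zero_bcontfun.rep_eq scaleR_bcontfun.rep_eq)
also have "(\<Sum>j<N. v j * (if i = j then 1 else 0)) = (if i < N then v i else 0)"
 by (simp add: mult_delta_right sum.delta cong: if_cong)
finally have "apply_bcontfun (emb N v) i = (if i < N then v i else 0)" unfolding emb_def by simp
thus "apply_bcontfun (emb N v) i = v i" using assms by (auto simp: topspace_Euclidean_space)
qed

lemma continuous_emb: "continuous_on S (emb N)"
unfolding emb_def[abs_def] by (intro continuous_intros continuous_on_coord)

lemma continuous_apply_bcontfun: "continuous_on S (apply_bcontfun :: (nat \<Rightarrow>\<^sub>C real) => nat => real)"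
proof (rule continuous_on_coordinatewise_then_product)
fix i
show "continuous_on S (%h::nat \<Rightarrow>\<^sub>C real. apply_bcontfun h i)"
 unfolding continuous_on_iff
proof (intro ballI allI impI)
 fix h and e :: real assume "0 < e"
 thus "\<exists>d>0. ALL h':S. dist h' h < d --> dist (apply_bcontfun h' i) (apply_bcontfun h i) < e"
 using dist_bounded[of _ i h] by (intro exI[of _ e]) (meson le_less_trans)
qed
qed

context chart
begin

lemma inv_chart_continuous: "continuous_map (top_of_set (std_image k n m)) (underlying X) (inv_into U c)"
unfolding continuous_map_def
proof (intro conjI allI impI)
show "inv_into U c:topspace (top_of_set (std_image k n m)) \<rightarrow> points X"
 using point_in U_sub by auto
fix V assume V: "opn V"
have VU: "opn (V \<inter> U)" using V U_open by blast
obtain T where T: "openR (2 * k + m) T" "c ` (V \<inter> U) = std_image k n m \<inter> T" using open_image[OF VU] by blast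
obtain T' where T': "open T'" "T = R_vecs (2 * k + m) \<inter> T'" using T(1) unfolding openR_iff by blast
have "{v:topspace (top_of_set (std_image k n m)). inv_into U c v:V} = c ` (V \<inter> U)"
proof (rule equalityI; rule subsetI)
 fix v assume "v:{v:topspace (top_of_set (std_image k n m)). inv_into U c v:V}"
 hence v: "v:std_image k n m" "inv_into U c v:V" by simp_all
 have "c (inv_into U c v):c ` (V \<inter> U)" by (rule imageI) (use v point_in[OF v(1)] in blast)
 thus "v:c ` (V \<inter> U)" unfolding c_point[OF v(1)] .
next
 fix v assume "v:c ` (V \<inter> U)"
 then obtain x where x: "x:V" "x:U" "v = c x" by blast
 thus "v:{v:topspace (top_of_set (std_image k n m)). inv_into U c v:V}" using inv_c[OF x(2)] c_in[OF x(2)] by simp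
qed
also have "\<dots> = std_image k n m \<inter> T'" unfolding T(2) T'(2) using std_image_sub by blast
finally show "openin (top_of_set (std_image k n m)) {v:topspace (top_of_set (std_image k n m)). inv_into U c v:V}"
 using T'(1) by (simp add: openin_open_Int)
qed

definition rho :: "'a => nat => real" where
"rho x j = (if j < n then (cmod (zeta x j))\<^sup>2 else c x (2 * k + (j - n)))"

definition box :: "'a => real => 'a set" where
"box p de = {x\<in>U. ALL j<n + m. \<bar>rho x j - rho p j\<bar> < de}"

abbreviation free_part :: "'a set => 'a set" where "free_part W \<equiv> {x\<in>W. ALL i<k. zeta x i ~= 0}"

lemma rho_sm: "sm X U (%x. rho x j)"
by (cases "j < n") (simp_all add: rho_def sm_cmod2[OF zeta_csm] c_smooth)

lemma rho_act: "t:torus k ==> x:U ==> rho (tht t x) j = rho x j"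
proof (cases "j < n")
case True
hence "j < k" using nk by simp
thus "t:torus k ==> x:U ==> rho (tht t x) j = rho x j" using True cmod_zeta_act by (simp add: rho_def)
next
case False
have "2 * k \<le> 2 * k + (j - n)" by simp
thus "t:torus k ==> x:U ==> rho (tht t x) j = rho x j" unfolding rho_def if_not_P[OF False] by (intro c_act)
qed

lemma rho_in: assumes "x:U" shows "rho x:R_vecs (n + m)"
using c_in_R[OF assms] by (auto simp: rho_def topspace_Euclidean_space)

lemma box_open: "opn (box p de)"
unfolding box_def
proof (rule openin_Ball_less[OF U_open])
fix j
have "opn {x\<in>U. rho x j:ball (rho p j) de}" by (rule sm_preimage_open[OF rho_sm U_open]) simp
thus "opn {x\<in>U. \<bar>rho x j - rho p j\<bar> < de}" by (simp add: dist_real_def abs_minus_commute)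
qed

lemma box_sub: "box p de \<subseteq> U" by (auto simp: box_def)

lemma box_center: "p:U ==> 0 < de ==> p:box p de" by (simp add: box_def)

lemma box_act: "t:torus k ==> x:box p de ==> tht t x:box p de"
using U_act rho_act by (simp add: box_def)

text \<open>A point whose orbit coordinates are close to those of \<open>p\<close> can be rotated to have the phases of \<open>p\<close>,
and is then close to \<open>p\<close>.\<close>

lemma small_box:
assumes V: "opn V" "V \<subseteq> U" "p:V" and inv: "!!t x. t:torus k ==> x:V ==> tht t x:V"
shows "\<exists>de>0. box p de \<subseteq> V"
proof -
have pU: "p:U" using V by blast
obtain T where T: "openR (2 * k + m) T" "c ` V = std_image k n m \<inter> T" using open_image[OF V(1,2)] by blast
have "c p:T" using T(2) V(3) by blast
obtain d where d: "d > 0" "!!y. y:R_vecs (2 * k + m) ==> (!!j. j < 2 * k + m ==> \<bar>y j - c p j\<bar> < d) ==> y:T"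
 using openR_contains_box[OF T(1) \<open>c p:T\<close>] by blast
define de where "de = min d (d\<^sup>2)"
have d0: "de > 0" "de \<le> d" "de \<le> d\<^sup>2" unfolding de_def using d(1) by simp_all
have "x:V" if x: "x:box p de" for x
proof -
 have xU: "x:U" and xr: "!!j. j < n + m ==> \<bar>rho x j - rho p j\<bar> < de" using x by (simp_all add: box_def)
 define s where "s i = (if i < k & zeta x i ~= 0 & zeta p i ~= 0 then (zeta p i / of_real (cmod (zeta p i))) / (zeta x i / of_real (cmod (zeta x i))) else 1)" for i
 have unit: "cmod (z / of_real (cmod z)) = 1" if "z ~= 0" for z using that by (simp add: norm_divide)
 have s: "s:torus k"
 proof (rule torusI)
 show "cmod (s i) = 1" for i
 proof (cases "i < k & zeta x i ~= 0 & zeta p i ~= 0")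
  case True
  hence nz: "zeta p i ~= 0" "zeta x i ~= 0" by simp_all
  show ?thesis unfolding s_def if_P[OF True] norm_divide[of "_ / _" "_ / _"] unit[OF nz(1)] unit[OF nz(2)] by simp
 next
  case False
  show ?thesis unfolding s_def if_not_P[OF False] by simp
 qed
 qed (simp add: s_def)
 have t: "bet' s:torus k" by (rule bet'_in[OF s])
 define y where "y = tht (bet' s) x"
 have yU: "y:U" unfolding y_def by (rule U_act[OF t xU])
 have dist: "cmod (zeta y i - zeta p i) = \<bar>cmod (zeta x i) - cmod (zeta p i)\<bar>" if ik: "i < k" for i
 proof (cases "zeta x i ~= 0 & zeta p i ~= 0")
 case True
 define q where "q = zeta p i / of_real (cmod (zeta p i))"
 have q1: "cmod q = 1" unfolding q_def using True by (simp add: norm_divide)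
 have e1: "zeta y i = of_real (cmod (zeta x i)) * q"
  unfolding y_def zeta_act[OF t xU ik] bet_bet'[OF s] s_def q_def using True ik by simp
 have e2: "zeta p i = of_real (cmod (zeta p i)) * q" unfolding q_def using True by simp
 have "zeta y i - zeta p i = of_real (cmod (zeta x i)) * q - of_real (cmod (zeta p i)) * q"
  by (rule arg_cong2[of _ _ _ _ minus, OF e1 e2])
 also have "\<dots> = of_real (cmod (zeta x i) - cmod (zeta p i)) * q" by (simp add: left_diff_distrib)
 finally show ?thesis by (simp only: norm_mult norm_of_real q1 mult_1_right)
 next
 case False
 hence "zeta y i = zeta x i" unfolding y_def zeta_act[OF t xU ik] bet_bet'[OF s] s_def by auto
 thus ?thesis using False by auto
 qed
 have small: "cmod (zeta y i - zeta p i) < d" if ik: "i < k" for i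
 proof (cases "i < n")
 case False
 thus ?thesis unfolding dist[OF ik] using zeta_unit[OF xU _ ik] zeta_unit[OF pU _ ik] d(1) by simp
 next
 case True
 define a b where "a = cmod (zeta x i)" and "b = cmod (zeta p i)"
 have ab: "0 \<le> a" "0 \<le> b" unfolding a_def b_def by simp_all
 have "\<bar>a\<^sup>2 - b\<^sup>2\<bar> < d\<^sup>2" using xr[of i] True d0(3) unfolding rho_def a_def b_def by simp
 moreover have "\<bar>a - b\<bar>\<^sup>2 \<le> \<bar>a\<^sup>2 - b\<^sup>2\<bar>"
 proof -
  have "\<bar>a - b\<bar> * \<bar>a - b\<bar> \<le> \<bar>a - b\<bar> * \<bar>a + b\<bar>" by (rule mult_left_mono) (use ab in auto)
  also have "\<dots> = \<bar>a\<^sup>2 - b\<^sup>2\<bar>" by (simp add: abs_mult[symmetric] power2_eq_square algebra_simps)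
  finally show ?thesis by (simp add: power2_eq_square)
 qed
 ultimately have "\<bar>a - b\<bar>\<^sup>2 < d\<^sup>2" by linarith
 hence "\<bar>a - b\<bar> < d" by (rule power2_less_imp_less) (use d(1) in simp)
 thus ?thesis unfolding dist[OF ik] a_def b_def .
 qed
 have "c y:T"
 proof (rule d(2)[OF c_in_R[OF yU]])
 fix j assume j: "j < 2 * k + m"
 show "\<bar>c y j - c p j\<bar> < d"
 proof (cases "j < 2 * k")
  case True
  hence ik: "j div 2 < k" by linarith
  have "\<bar>c y j - c p j\<bar> \<le> cmod (zeta y (j div 2) - zeta p (j div 2))"
  proof (cases "even j")
  case True
  hence "c y j - c p j = Re (zeta y (j div 2) - zeta p (j div 2))" by (simp add: zc_def)
  thus ?thesis using abs_Re_le_cmod by metis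
  next
  case False
  hence "c y j - c p j = Im (zeta y (j div 2) - zeta p (j div 2))" by (simp add: zc_def)
  thus ?thesis using abs_Im_le_cmod by metis
  qed
  thus ?thesis using small[OF ik] by linarith
 next
  case False
  define l where "l = n + (j - 2 * k)"
  have l: "l < n + m" "\<not> l < n" "2 * k + (l - n) = j" using False j unfolding l_def by simp_all
  have "c y j = c x j" unfolding y_def by (rule c_act[OF t xU]) (use False in simp)
  thus ?thesis using xr[OF l(1)] d0(2) unfolding rho_def if_not_P[OF l(2)] l(3) by simp
 qed
 qed
 hence "c y:c ` V" using T(2) c_in[OF yU] by blast
 hence "y:V" using c_inj yU V(2) by blast
 hence "tht (%i. inverse (bet' s i)) y:V" by (rule inv[OF torus_inverse[OF t]])
 thus "x:V" unfolding y_def using act_inverse[OF t, of x] xU U_sub by auto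
qed
thus ?thesis using d0(1) by blast
qed

section \<open>A convex slice\<close>

definition quadrant :: "'a => real => (nat => real) set" where
"quadrant p de = {v\<in>R_vecs (n + m). (ALL j<n. 0 < v j) & (ALL j<n + m. \<bar>v j - rho p j\<bar> < de)}"

text \<open>Real nonnegative coordinates single out one point in each orbit.\<close>

definition slice_coords :: "(nat => real) => nat => real" where
"slice_coords v l = (if l < 2 * k then (if even l then (if l div 2 < n then sqrt (v (l div 2)) else 1) else 0) else v (n + (l - 2 * k)))"

definition slice :: "(nat => real) => 'a" where "slice v = inv_into U c (slice_coords v)"

lemma zc_slice_coords: "i < k ==> zc (slice_coords v) i = complex_of_real (if i < n then sqrt (v i) else 1)"
by (auto simp: zc_def slice_coords_def complex_eq_iff)

lemma slice_coords_in: assumes "v:R_vecs (n + m)" shows "slice_coords v:std_image k n m"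
proof -
have "slice_coords v:R_vecs (2 * k + m)" using assms by (auto simp: slice_coords_def topspace_Euclidean_space)
thus ?thesis by (simp add: std_image_def zc_slice_coords)
qed

lemma slice:
assumes v: "v:quadrant p de" shows "slice v:free_part (box p de)" "rho (slice v) = v"
proof -
have vR: "v:R_vecs (n + m)" and v0: "!!j. j < n ==> 0 < v j" and vd: "ALL j<n + m. \<bar>v j - rho p j\<bar> < de"
 using v by (simp_all add: quadrant_def)
have c: "c (slice v) = slice_coords v" and U: "slice v:U"
 unfolding slice_def by (rule c_point[OF slice_coords_in[OF vR]], rule point_in[OF slice_coords_in[OF vR]])
show r: "rho (slice v) = v"
proof
 fix j show "rho (slice v) j = v j"
 proof (cases "j < n")
 case True
 hence "j < k" using nk by simp
 thus ?thesis using True v0[OF True] by (simp add: rho_def c zc_slice_coords)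
 next
 case False
 have e: "\<not> 2 * k + (j - n) < 2 * k" "n + (2 * k + (j - n) - 2 * k) = j" using False by simp_all
 show ?thesis unfolding rho_def if_not_P[OF False] c slice_coords_def if_not_P[OF e(1)] e(2) ..
 qed
qed
have "zeta (slice v) i ~= 0" if "i < k" for i
proof (cases "i < n")
 case True thus ?thesis using v0[OF True] by (simp add: c zc_slice_coords[OF that])
qed (simp add: c zc_slice_coords[OF that])
thus "slice v:free_part (box p de)" using U vd by (simp add: box_def r)
qed

lemma rho_quadrant: assumes "x:free_part (box p de)" shows "rho x:quadrant p de"
proof -
have x: "x:U" "ALL j<n + m. \<bar>rho x j - rho p j\<bar> < de" "ALL i<k. zeta x i ~= 0" using assms by (simp_all add: box_def)
have "0 < rho x j" if "j < n" for j using x(3) that nk by (simp add: rho_def)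
thus ?thesis using x rho_in[OF x(1)] by (simp add: quadrant_def)
qed

lemma slice_orbit:
assumes x: "x:free_part (box p de)" shows "EX t:torus k. x = tht t (slice (rho x))"
proof (rule same_orbit)
note q = slice[OF rho_quadrant[OF x]]
have s: "slice (rho x):U" and xU: "x:U" using q(1) x box_sub by blast+
show "slice (rho x):U" by (rule s)
show "x:U" by (rule xU)
fix i assume ik: "i < k"
show "cmod (zeta (slice (rho x)) i) = cmod (zeta x i)"
proof (cases "i < n")
 case True
 hence "(cmod (zeta (slice (rho x)) i))\<^sup>2 = (cmod (zeta x i))\<^sup>2" using fun_cong[OF q(2), of i] by (simp add: rho_def)
 thus ?thesis by (simp add: power2_eq_iff_nonneg)
next
 case False thus ?thesis using zeta_unit[OF s _ ik] zeta_unit[OF xU _ ik] by simp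
qed
next
note q = slice[OF rho_quadrant[OF x]]
fix j assume j: "2 * k \<le> j"
have "rho (slice (rho x)) (n + (j - 2 * k)) = rho x (n + (j - 2 * k))" unfolding q(2) ..
moreover have e: "\<not> n + (j - 2 * k) < n" "2 * k + (n + (j - 2 * k) - n) = j" using j by simp_all
ultimately show "c (slice (rho x)) j = c x j" unfolding rho_def if_not_P[OF e(1)] e(2) by simp
qed

lemma slice_continuous: "continuous_map (top_of_set (quadrant p de)) (underlying X) slice"
proof -
have "continuous_on (quadrant p de) slice_coords"
proof (rule continuous_on_coordinatewise_then_product)
 fix l show "continuous_on (quadrant p de) (%v. slice_coords v l)"
 unfolding slice_coords_def by (cases "l < 2 * k"; cases "even l"; cases "l div 2 < n")
  (simp_all add: continuous_on_coord continuous_on_real_sqrt)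
qed
hence "continuous_map (top_of_set (quadrant p de)) (top_of_set (std_image k n m)) slice_coords"
 unfolding continuous_map_in_subtopology using slice_coords_in by (auto simp: quadrant_def)
from continuous_map_compose[OF this inv_chart_continuous] show ?thesis by (simp add: o_def slice_def[abs_def])
qed

definition slice_domain :: "'a => real => (nat \<Rightarrow>\<^sub>C real) set" where
"slice_domain p de = {h. apply_bcontfun h:quadrant p de}"

lemma convex_slice_domain: "convex (slice_domain p de)"
proof (rule convexI)
fix h h' and u v :: real assume h: "h:slice_domain p de" "h':slice_domain p de" and uv: "0 \<le> u" "0 \<le> v" "u + v = 1"
have a: "apply_bcontfun (u *\<^sub>R h + v *\<^sub>R h') j = u * apply_bcontfun h j + v * apply_bcontfun h' j" for j
 by (simp add: plus_bcontfun.rep_eq scaleR_bcontfun.rep_eq)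
have H: "apply_bcontfun h:quadrant p de" "apply_bcontfun h':quadrant p de" using h by (simp_all add: slice_domain_def)
have "apply_bcontfun (u *\<^sub>R h + v *\<^sub>R h'):quadrant p de"
 unfolding quadrant_def
proof (intro CollectI conjI allI impI)
 show "apply_bcontfun (u *\<^sub>R h + v *\<^sub>R h'):R_vecs (n + m)"
 using H by (simp add: quadrant_def topspace_Euclidean_space a)
 fix j assume j: "j < n"
 have p: "0 < apply_bcontfun h j" "0 < apply_bcontfun h' j" using H j by (simp_all add: quadrant_def)
 show "0 < apply_bcontfun (u *\<^sub>R h + v *\<^sub>R h') j" unfolding a
 using convex_bound_lt[of "- apply_bcontfun h j" 0 "- apply_bcontfun h' j" u v] p uv by simp
next
 fix j assume j: "j < n + m"
 have p: "\<bar>apply_bcontfun h j - rho p j\<bar> < de" "\<bar>apply_bcontfun h' j - rho p j\<bar> < de" using H j by (simp_all add: quadrant_def)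
 have u: "u = 1 - v" using uv(3) by simp
 have "u * apply_bcontfun h j + v * apply_bcontfun h' j - rho p j = u * (apply_bcontfun h j - rho p j) + v * (apply_bcontfun h' j - rho p j)"
 unfolding u by (simp add: algebra_simps)
 also have "\<bar>\<dots>\<bar> \<le> u * \<bar>apply_bcontfun h j - rho p j\<bar> + v * \<bar>apply_bcontfun h' j - rho p j\<bar>"
 using abs_triangle_ineq[of "u * (apply_bcontfun h j - rho p j)" "v * (apply_bcontfun h' j - rho p j)"] uv by (simp add: abs_mult)
 also have "\<dots> < de" by (rule convex_bound_lt[OF p uv])
 finally show "\<bar>apply_bcontfun (u *\<^sub>R h + v *\<^sub>R h') j - rho p j\<bar> < de" unfolding a .
qed
thus "u *\<^sub>R h + v *\<^sub>R h':slice_domain p de" by (simp add: slice_domain_def)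
qed

lemma on_slice_domain:
assumes f: "continuous_map (subtopology (underlying X) (free_part (box p de))) euclidean f"
shows "continuous_on (slice_domain p de) (%h. f (slice (apply_bcontfun h)))"
proof -
have "continuous_map (top_of_set (quadrant p de)) (subtopology (underlying X) (free_part (box p de))) slice"
 unfolding continuous_map_in_subtopology using slice_continuous slice(1)[of _ p de] by auto
from continuous_map_compose[OF this f] have "continuous_on (quadrant p de) (%v. f (slice v))" by (simp add: o_def)
moreover have "apply_bcontfun ` slice_domain p de \<subseteq> quadrant p de" by (auto simp: slice_domain_def)
ultimately show ?thesis by (rule continuous_on_compose2[OF _ continuous_apply_bcontfun])
qed

lemma emb_domain: "x:free_part (box p de) ==> emb (n + m) (rho x):slice_domain p de & apply_bcontfun (emb (n + m) (rho x)) = rho x"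
using rho_quadrant[of x p de] apply_emb[of "rho x" "n + m"] by (simp add: slice_domain_def quadrant_def)

lemma continuous_logarithm_on_box:
assumes f: "continuous_map (subtopology (underlying X) (free_part (box p de))) euclidean f"
 and u: "!!x. x:free_part (box p de) ==> cmod (f x) = 1"
 and inv: "!!t x. t:torus k ==> x:free_part (box p de) ==> f (tht t x) = f x"
shows "EX g. continuous_map (subtopology (underlying X) (free_part (box p de))) euclidean g &
 (ALL x:free_part (box p de). f x = cis (g x)) & (ALL t:torus k. ALL x:U. g (tht t x) = g x)"
proof -
have sl: "slice (apply_bcontfun h):free_part (box p de)" if "h:slice_domain p de" for h
 using slice(1) that by (simp add: slice_domain_def)
obtain L where L: "continuous_on (slice_domain p de) L" "!!h. h:slice_domain p de ==> f (slice (apply_bcontfun h)) = exp (L h)"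
proof -
 have nz: "f (slice (apply_bcontfun h)) ~= 0" if "h:slice_domain p de" for h using u[OF sl[OF that]] by auto
 show thesis if "!!L. continuous_on (slice_domain p de) L ==>
 (!!h. h:slice_domain p de ==> f (slice (apply_bcontfun h)) = exp (L h)) ==> thesis"
 by (rule continuous_logarithm_on_contractible[OF on_slice_domain[OF f] convex_imp_contractible[OF convex_slice_domain] nz],
  assumption, (rule that; simp))
qed
define g where "g x = Im (L (emb (n + m) (rho x)))" for x
have fp: "free_part (box p de) \<subseteq> U" using box_sub by blast
have "f x = cis (g x)" if x: "x:free_part (box p de)" for x
proof -
 note e = emb_domain[OF x, THEN conjunct1] and e' = emb_domain[OF x, THEN conjunct2]
 have q: "slice (rho x):free_part (box p de)" by (rule slice(1)[OF rho_quadrant[OF x]])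
 obtain t where t: "t:torus k" "x = tht t (slice (rho x))" using slice_orbit[OF x] by blast
 have fx: "f x = exp (L (emb (n + m) (rho x)))" using L(2)[OF e] inv[OF t(1) q] t(2) e' by simp
 have "exp (Re (L (emb (n + m) (rho x)))) = 1" using u[OF x] unfolding fx by (simp add: norm_exp_eq_Re)
 hence "Re (L (emb (n + m) (rho x))) = 0" by simp
 thus ?thesis unfolding fx g_def by (simp add: exp_eq_polar)
qed
moreover have "continuous_map (subtopology (underlying X) (free_part (box p de))) euclidean g"
proof -
 have tU: "topspace (subtopology (underlying X) (free_part (box p de))) = free_part (box p de)" using fp U_sub by auto
 have "continuous_map (subtopology (underlying X) U) euclidean rho"
 using sm_continuous[OF rho_sm U_open] unfolding euclidean_product_topology[symmetric] continuous_map_componentwise_UNIV by blast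
 hence r: "continuous_map (subtopology (underlying X) (free_part (box p de))) euclidean rho"
 by (rule continuous_map_from_subtopology_mono[OF _ fp])
 have "continuous_map (subtopology (underlying X) (free_part (box p de))) euclidean (%x. emb (n + m) (rho x))"
 by (rule continuous_map_euclidean_compose[OF r UNIV_I continuous_emb])
 hence "continuous_map (subtopology (underlying X) (free_part (box p de))) euclidean (%x. L (emb (n + m) (rho x)))"
 by (rule continuous_map_euclidean_compose[OF _ _ L(1)]) (use emb_domain tU in blast)
 thus ?thesis unfolding g_def by (rule continuous_map_euclidean_compose[OF _ UNIV_I]) (intro continuous_intros)
qed
moreover have "g (tht t x) = g x" if "t:torus k" "x:U" for t x
proof -
 have "rho (tht t x) = rho x" using rho_act[OF that] by blast
 thus ?thesis unfolding g_def by simp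
qed
ultimately show ?thesis by blast
qed

text \<open>Angles that are multiples of \<open>2\<pi>\<close> are locally constant, and the slice is connected.\<close>

lemma constant_on_box:
assumes g: "continuous_map (subtopology (underlying X) (free_part (box p de))) euclidean g"
 and one: "!!x. x:free_part (box p de) ==> cis (g x) = 1"
 and inv: "!!t x. t:torus k ==> x:free_part (box p de) ==> g (tht t x) = g x"
shows "EX a. ALL x:free_part (box p de). g x = (a::real)"
proof -
let ?G = "%h. g (slice (apply_bcontfun h))"
have G1: "cis (?G h) = 1" if "h:slice_domain p de" for h
 using one slice(1)[of "apply_bcontfun h" p de] that by (simp add: slice_domain_def)
have "?G constant_on slice_domain p de"
proof (rule continuous_discrete_range_constant[OF convex_connected[OF convex_slice_domain] on_slice_domain[OF g]])
 fix h assume h: "h:slice_domain p de"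
 have "1 \<le> norm (?G h' - ?G h)" if h': "h':slice_domain p de" "?G h' ~= ?G h" for h'
 proof -
 have "cis (?G h' - ?G h) = 1" using G1[OF h] G1[OF h'(1)] by (simp add: cis_divide[symmetric])
 hence "cos (?G h' - ?G h) = 1" by (metis cis.sel(1) one_complex.sel(1))
 then obtain i :: int where i: "?G h' - ?G h = of_int i * 2 * pi" by (auto simp: cos_one_2pi_int)
 hence "i ~= 0" using h'(2) by auto
 hence "1 \<le> \<bar>real_of_int i\<bar>" by linarith
 hence "1 * 1 \<le> \<bar>real_of_int i\<bar> * (2 * pi)" using pi_gt3 by (intro mult_mono) auto
 thus ?thesis unfolding i by (simp add: abs_mult)
 qed
 thus "\<exists>e>0. ALL y. y:slice_domain p de & ?G y ~= ?G h --> e \<le> norm (?G y - ?G h)" by (intro exI[of _ 1]) auto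
qed
then obtain a where a: "ALL h:slice_domain p de. ?G h = a" unfolding constant_on_def by blast
have "g x = a" if x: "x:free_part (box p de)" for x
proof -
 note e = emb_domain[OF x, THEN conjunct1] and e' = emb_domain[OF x, THEN conjunct2]
 have q: "slice (rho x):free_part (box p de)" by (rule slice(1)[OF rho_quadrant[OF x]])
 obtain t where t: "t:torus k" "x = tht t (slice (rho x))" using slice_orbit[OF x] by blast
 have "g x = g (slice (rho x))" using inv[OF t(1) q] t(2) by simp
 moreover have "g (slice (rho x)) = a" using a[rule_format, OF e] unfolding e' .
 ultimately show ?thesis by simp
qed
thus ?thesis by blast
qed

end

section \<open>Invariant bump functions, free orbits and twisting\<close>

lemma continuous_zc: "continuous_on S (%v. zc v i)"
unfolding zc_def by (intro continuous_intros continuous_on_coord)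

lemma compact_real_box: "compact {v :: nat => real. ALL j. v j:(if j < N then {- b..b} else {0})}"
proof -
have "compactin (product_topology (%_. euclideanreal) UNIV) (PiE UNIV (%j. if j < N then {- b..b} else {0}))"
 unfolding compactin_PiE by auto
thus ?thesis unfolding euclidean_product_topology by (simp add: PiE_UNIV_domain Pi_def)
qed

context chart
begin

text \<open>The sublevel set is compact in the chart, hence closed in the whole manifold; this lets bump functions be extended by zero.\<close>

lemma compact_sublevel:
assumes d: "0 < de" and K: "!!x. x:U ==> (\<Sum>j<n + m. (rho x j - rho p j)\<^sup>2) \<le> r ==> x:box p de"
shows "closedin (underlying X) {x\<in>U. (\<Sum>j<n + m. (rho x j - rho p j)\<^sup>2) \<le> r}"
proof -
define b where "b = 1 + de + (\<Sum>j<n + m. \<bar>rho p j\<bar>)"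
have b1: "1 \<le> b" and bj: "\<bar>rho p j\<bar> + de \<le> b" if "j < n + m" for j
 using d sum_nonneg[of "{..<n + m}" "%j. \<bar>rho p j\<bar>"] member_le_sum[of j "{..<n + m}" "%j. \<bar>rho p j\<bar>"] that by (auto simp: b_def)
have b1: "1 \<le> b" using d sum_nonneg[of "{..<n + m}" "%j. \<bar>rho p j\<bar>"] by (auto simp: b_def)
define rr where "rr v j = (if j < n then (cmod (zc v j))\<^sup>2 else v (2 * k + (j - n)))" for v :: "nat => real" and j
define C where "C = {v :: nat => real. ALL j. v j:(if j < 2 * k + m then {- b..b} else {0})}"
define K' where "K' = C \<inter> ({v. ALL i. n \<le> i & i < k --> cmod (zc v i) = 1} \<inter> {v. (\<Sum>j<n + m. (rr v j - rho p j)\<^sup>2) \<le> r})"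
have crr: "continuous_on UNIV (%v. rr v j)" for j
 unfolding rr_def by (cases "j < n") (simp_all add: continuous_on_coord continuous_zc continuous_on_norm continuous_on_power)
have "closed {v. ALL i. n \<le> i & i < k --> cmod (zc v i) = 1}"
 by (intro closed_Collect_all closed_Collect_imp closed_Collect_eq open_Collect_const continuous_on_norm continuous_zc continuous_on_const)
moreover have "closed {v. (\<Sum>j<n + m. (rr v j - rho p j)\<^sup>2) \<le> r}"
 by (intro closed_Collect_le continuous_on_sum continuous_on_power continuous_on_diff crr continuous_on_const)
ultimately have cK: "compact K'" unfolding K'_def C_def by (intro compact_Int_closed compact_real_box closed_Int)
have CR: "C \<subseteq> R_vecs (2 * k + m)"
proof
 fix v assume v: "v:C"
 have "v j = 0" if "2 * k + m \<le> j" for j using v[unfolded C_def, THEN CollectD, THEN spec, of j] that by simp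
 thus "v:R_vecs (2 * k + m)" by (simp add: topspace_Euclidean_space)
qed
have sub: "K' \<subseteq> std_image k n m" using CR unfolding K'_def std_image_def by blast
have rc: "rr (c x) j = rho x j" for x j by (simp add: rr_def rho_def)
have "{x\<in>U. (\<Sum>j<n + m. (rho x j - rho p j)\<^sup>2) \<le> r} = inv_into U c ` K'"
proof (rule equalityI; rule subsetI)
 fix x assume "x:{x\<in>U. (\<Sum>j<n + m. (rho x j - rho p j)\<^sup>2) \<le> r}"
 hence x: "x:U" "(\<Sum>j<n + m. (rho x j - rho p j)\<^sup>2) \<le> r" by simp_all
 have xr: "\<bar>rho x j\<bar> \<le> b" if "j < n + m" for j
 proof -
 have "\<bar>rho x j - rho p j\<bar> < de" using K[OF x] that by (simp add: box_def)
 thus ?thesis using bj[OF that] by linarith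
 qed
 have z: "cmod (zeta x i) \<le> b" if ik: "i < k" for i
 proof (cases "i < n")
 case True
 have "(cmod (zeta x i))\<^sup>2 \<le> b" using xr[of i] True by (simp add: rho_def)
 also have "b \<le> b\<^sup>2" using b1 by (simp add: power2_eq_square)
 finally show ?thesis by (rule power2_le_imp_le) (use b1 in simp)
 next
 case False thus ?thesis using zeta_unit[OF x(1) _ ik] b1 by simp
 qed
 have "c x j:(if j < 2 * k + m then {- b..b} else {0})" for j
 proof -
 consider (c) "j < 2 * k" | (r) "2 * k \<le> j" "j < 2 * k + m" | (o) "2 * k + m \<le> j" by linarith
 thus ?thesis
 proof cases
  case c
  hence ik: "j div 2 < k" by linarith
  have "\<bar>c x j\<bar> \<le> cmod (zeta x (j div 2))"
  proof (cases "even j")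
  case True thus ?thesis using abs_Re_le_cmod[of "zeta x (j div 2)"] by (simp add: zc_def)
  next
  case False thus ?thesis using abs_Im_le_cmod[of "zeta x (j div 2)"] by (simp add: zc_def)
  qed
  thus ?thesis using z[OF ik] c by (simp add: abs_le_iff)
 next
  case r
  have e: "\<not> n + (j - 2 * k) < n" "2 * k + (n + (j - 2 * k) - n) = j" "n + (j - 2 * k) < n + m" using r by simp_all
  have "\<bar>c x j\<bar> \<le> b" using xr[OF e(3)] unfolding rho_def if_not_P[OF e(1)] e(2) .
  thus ?thesis using r by (simp add: abs_le_iff)
 next
  case o thus ?thesis using c_in_R[OF x(1)] by (simp add: topspace_Euclidean_space)
 qed
 qed
 hence "c x:K'" unfolding K'_def C_def using x(2) zeta_unit[OF x(1)] by (simp add: rc)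
 hence "inv_into U c (c x):inv_into U c ` K'" by (rule imageI)
 thus "x:inv_into U c ` K'" unfolding inv_c[OF x(1)] .
next
 fix x assume "x:inv_into U c ` K'"
 then obtain v where v: "v:K'" "x = inv_into U c v" by blast
 have vs: "v:std_image k n m" using sub v(1) by blast
 have "(\<Sum>j<n + m. (rr v j - rho p j)\<^sup>2) \<le> r" using v(1) by (simp add: K'_def)
 moreover have "rr v = rho x" using rc[of x] unfolding v(2) c_point[OF vs] by blast
 ultimately show "x:{x\<in>U. (\<Sum>j<n + m. (rho x j - rho p j)\<^sup>2) \<le> r}" using point_in[OF vs] v(2) by simp
qed
moreover have "compactin (underlying X) (inv_into U c ` K')"
 by (rule image_compactin[OF _ inv_chart_continuous]) (simp add: compactin_subtopology sub cK)
ultimately show ?thesis using compactin_imp_closedin[OF Hausdorff] by simp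
qed

lemma bump:
assumes p: "p:U" and d: "0 < de"
shows "EX bmp K V. sm X (points X) bmp & closedin (underlying X) K & K \<subseteq> box p de & opn V & p:V & V \<subseteq> box p de &
 (ALL x:V. bmp x = 1) & (ALL x:points X - K. bmp x = 0) & (ALL t:torus k. ALL x:V. tht t x:V) &
 (ALL t:torus k. ALL x:points X. bmp (tht t x) = bmp x)"
proof -
define D where "D x = (\<Sum>j<n + m. (rho x j - rho p j)\<^sup>2)" for x
define K where "K = {x\<in>U. D x \<le> de\<^sup>2 / 2}"
define V where "V = {x\<in>U. D x:{..<de\<^sup>2 / 4}}"
define bmp where "bmp x = (if x:U then cutoff (4 / de\<^sup>2 * D x) else 0)" for x
have Dact: "D (tht t x) = D x" if "t:torus k" "x:U" for t x unfolding D_def rho_act[OF that] ..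
have Dsm: "sm X U D" unfolding D_def[abs_def] by (intro sm_sum sm_power sm_diff rho_sm sm_const) simp
have inbox: "x:box p de" if x: "x:U" "D x \<le> de\<^sup>2 / 2" for x
 unfolding box_def
proof (intro CollectI conjI allI impI)
 fix j assume j: "j < n + m"
 have "(rho x j - rho p j)\<^sup>2 \<le> D x" unfolding D_def by (rule member_le_sum) (use j in auto)
 hence "(rho x j - rho p j)\<^sup>2 < de\<^sup>2" using x(2) d by (smt (verit) field_sum_of_halves zero_less_power)
 hence "\<bar>rho x j - rho p j\<bar>\<^sup>2 < de\<^sup>2" by simp
 thus "\<bar>rho x j - rho p j\<bar> < de" by (rule power2_less_imp_less) (use d in simp)
qed (rule x(1))
have Kc: "closedin (underlying X) K" unfolding K_def D_def by (rule compact_sublevel[OF d]) (rule inbox, simp_all add: D_def)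
have Kb: "K \<subseteq> box p de" using inbox by (auto simp: K_def)
have Vo: "opn V" unfolding V_def by (rule sm_preimage_open[OF Dsm U_open]) simp
have pV: "p:V" using p d by (simp add: V_def D_def)
have Vb: "V \<subseteq> box p de"
proof
 fix x assume "x:V"
 hence x: "x:U" "D x < de\<^sup>2 / 4" by (simp_all add: V_def)
 have "0 < de\<^sup>2" using d by simp
 thus "x:box p de" by (intro inbox x(1)) (use x(2) in linarith)
qed
have bmp1: "bmp x = 1" if "x:V" for x
proof -
 have "4 / de\<^sup>2 * D x \<le> 1" using that d by (simp add: V_def field_simps)
 thus ?thesis using that by (simp add: bmp_def V_def cutoff_one)
qed
have bmp0: "bmp x = 0" if "x:points X - K" for x
proof (cases "x:U")
 case True
 hence "de\<^sup>2 / 2 < D x" using that by (simp add: K_def)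
 hence "2 \<le> 4 / de\<^sup>2 * D x" using d by (simp add: field_simps)
 thus ?thesis by (simp add: bmp_def cutoff_zero)
qed (simp add: bmp_def)
have sm: "sm X (points X) bmp"
proof (rule sm_local)
 fix x assume x: "x:points X"
 show "EX V. opn V & x:V & sm X (points X \<inter> V) bmp"
 proof (cases "x:U")
 case True
 have "sm X U (%x. cutoff (4 / de\<^sup>2 * D x))" by (intro sm_cutoff sm_mult sm_const Dsm)
 hence "sm X U bmp" by (rule sm_cong) (simp add: bmp_def)
 hence "sm X (points X \<inter> U) bmp" by (rule sm_subset) blast
 thus ?thesis using True U_open by blast
 next
 case False
 have "opn (points X - K)" using Kc by blast
 moreover have "x:points X - K" using False x by (simp add: K_def)
 moreover have "sm X (points X \<inter> (points X - K)) bmp" by (rule sm_cong[OF sm_const[where c = 0]]) (simp add: bmp0)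
 ultimately show ?thesis by blast
 qed
qed
have Vact: "tht t x:V" if "t:torus k" "x:V" for t x using that U_act Dact by (simp add: V_def)
have bmpact: "bmp (tht t x) = bmp x" if t: "t:torus k" and x: "x:points X" for t x
proof (cases "x:U")
 case True thus ?thesis using U_act[OF t True] Dact[OF t True] by (simp add: bmp_def)
next
 case False
 have "tht t x \<notin> U"
 proof
 assume "tht t x:U"
 hence "tht (%i. inverse (t i)) (tht t x):U" by (rule U_act[OF torus_inverse[OF t]])
 thus False using False act_inverse[OF t x] by simp
 qed
 thus ?thesis using False by (simp add: bmp_def)
qed
show ?thesis by (intro exI[of _ bmp] exI[of _ K] exI[of _ V] conjI ballI sm Kc Kb Vo pV Vb bmp1 bmp0 Vact bmpact)
qed

end

definition (in torus_manifold) free :: "'a => bool" where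
"free x \<longleftrightarrow> x:points X & (ALL t:torus k. tht t x = x --> t = (%_. 1))"

lemma (in chart) free_iff: assumes x: "x:U" shows "free x \<longleftrightarrow> (ALL i<k. zeta x i ~= 0)"
proof
assume f: "free x"
show "ALL i<k. zeta x i ~= 0"
proof (intro allI impI notI)
 fix i assume i: "i < k" and z: "zeta x i = 0"
 have c: "circ i (- 1):torus k" by (rule circ_torus[OF i]) simp
 have t: "bet' (circ i (- 1)):torus k" by (rule bet'_in[OF c])
 have "tht (bet' (circ i (- 1))) x = x" unfolding stabilizer_iff[OF x t] bet_bet'[OF c] using z by (auto simp: circ_def)
 hence "bet' (circ i (- 1)) = (%_. 1)" using f t by (simp add: free_def)
 hence "circ i (- 1) = bet (%_. 1)" using bet_bet'[OF c] by simp
 hence "circ i (- 1) = (%_. 1)" unfolding torus_hom_one[OF bet_hom] .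
 from fun_cong[OF this, of i] show False by (simp add: circ_def)
qed
next
assume nz: "ALL i<k. zeta x i ~= 0"
have "t = (%_. 1)" if t: "t:torus k" "tht t x = x" for t
proof -
 have "ALL i<k. bet t i = 1" using stabilizer_iff[OF x t(1)] t(2) nz by blast
 hence "bet t = (%_. 1)" using torus_ge[OF torus_homD(1)[OF bet_hom t(1)]] by (metis not_less)
 hence "bet' (bet t) = (%_. 1)" using torus_hom_one[OF bet'_hom] by simp
 thus ?thesis unfolding bet'_bet[OF t(1)] .
qed
thus "free x" using x U_sub by (auto simp: free_def)
qed

lemma (in chart) free_part_eq: "W \<subseteq> U ==> free_part W = {x\<in>W. free x}"
using free_iff by blast

lemma (in torus_manifold) free_act_cancel:
assumes x: "free x" and s: "s:torus k" and t: "t:torus k" and eq: "tht s x = tht t x" shows "s = t"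
proof -
have xX: "x:points X" using x by (simp add: free_def)
have "tht (tmul (%i. inverse (t i)) s) x = x"
 unfolding act_mult[OF torus_inverse[OF t] s xX] eq by (rule act_inverse[OF t xX])
hence "tmul (%i. inverse (t i)) s = (%_. 1)" using x torus_mult[OF torus_inverse[OF t] s] by (simp add: free_def)
hence "inverse (t i) * s i = 1" for i by (rule fun_cong)
thus ?thesis using torus_nonzero[OF t] by (intro ext) (metis inverse_inverse_eq inverse_unique)
qed

lemma (in torus_manifold) smap_twist:
assumes X': "smooth_manifold X'" and W: "openin (underlying X') W" and psi: "smap X' W X psi"
 and ta: "!!x. x:W ==> ta x:torus k" "!!l. csm X' W (%x. ta x l)"
shows "smap X' W X (%x. tht (ta x) (psi x))"
proof -
interpret X': manifold X' by (rule manifold.intro[OF X'])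
have WX: "W \<subseteq> points X'" by (rule openin_subset[OF W])
show ?thesis
proof (rule X'.smap_local[OF W])
 fix x assume x: "x:W"
 have "psi x:points X" by (rule smap_into[OF psi WX x])
 then obtain n m bet U c where c: "psi x:U" "std_chart k X tht n m bet U c"
 using std_chart_exists[OF locally_standard] by blast
 interpret c: chart X k tht n m bet U c by (rule chart.intro[OF torus_manifold_axioms chart_axioms.intro[OF c(2)]])
 define V where "V = {x\<in>W. psi x:U}"
 have Vo: "openin (underlying X') V" unfolding V_def by (rule smap_preimage_open[OF psi W c.U_open])
 have VW: "V \<subseteq> W" and VU: "!!x. x:V ==> psi x:U" and Vta: "!!x. x:V ==> ta x:torus k" using ta(1) by (auto simp: V_def)
 have coord: "sm X' V (%x. c (psi x) j)" for j unfolding V_def by (rule smap_pullback[OF psi c.U_open c.c_smooth])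
 have zs: "csm X' V (%x. zc (c (tht (ta x) (psi x))) i)" if ik: "i < k" for i
 proof (rule X'.csm_cong)
 have b: "csm X' V (%x. bet (ta x) i)"
  by (rule X'.csm_torus_hom[OF c.bet_hom]) (erule Vta, rule csm_subset[OF ta(2) VW])
 have "csm X' V (%x. c.zeta (psi x) i)" using coord by (simp add: csm_def zc_def)
 thus "csm X' V (%x. bet (ta x) i * c.zeta (psi x) i)"
  by (rule X'.csm_mult[OF b])
 show "bet (ta x) i * c.zeta (psi x) i = zc (c (tht (ta x) (psi x))) i" if "x:V" for x
  using c.zeta_act[OF Vta[OF that] VU[OF that] ik] by simp
 qed
 have "smap X' V X (%x. tht (ta x) (psi x))"
 proof (rule c.smap_chartI[OF X' Vo])
 show "tht (ta x) (psi x):U" if "x:V" for x by (rule c.U_act[OF Vta[OF that] VU[OF that]])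
 show "sm X' V (%x. c (tht (ta x) (psi x)) j)" for j
 proof (cases "j < 2 * k")
  case True
  hence "j div 2 < k" by linarith
  from zs[OF this] show ?thesis by (cases "even j") (simp_all add: csm_def zc_def)
 next
  case False
  show ?thesis by (rule X'.sm_cong[OF coord[of j]]) (use c.c_act[OF Vta VU] False in simp)
 qed
 qed
 thus "EX V psi'. openin (underlying X') V & x:V & V \<subseteq> W & smap X' V X psi' & (ALL z:V. tht (ta z) (psi z) = psi' z)"
 using Vo VW x c(1) by (intro exI[of _ V] exI[of _ "%x. tht (ta x) (psi x)"]) (simp add: V_def)
qed
qed

section \<open>Smoothing a continuous section\<close>

lemma continuous_map_into_functions:
assumes "!!i. continuous_map T euclidean (%x. f x i)" shows "continuous_map T euclidean f"
unfolding euclidean_product_topology[symmetric] continuous_map_componentwise_UNIV using assms by blast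

lemma continuous_map_complex_divide:
assumes a: "continuous_map T euclidean a" and b: "continuous_map T euclidean b" and nz: "!!x. x:topspace T ==> b x ~= (0::complex)"
shows "continuous_map T euclidean (%x. a x / b x)"
proof -
have P: "continuous_map T euclidean (%x (i::nat). if i = 0 then a x else b x)"
 by (rule continuous_map_into_functions) (use a b in \<open>simp split: if_split\<close>)
have D: "continuous_on {v :: nat => complex. v 1 ~= 0} (%v. v 0 / v 1)"
 by (intro continuous_on_divide continuous_on_coord) simp
have "continuous_map T euclidean (%x. (%v. v 0 / v 1) (%i::nat. if i = 0 then a x else b x))"
 by (rule continuous_map_euclidean_compose[OF P _ D]) (use nz in simp)
thus ?thesis by simp
qed

lemma unit_cis_arctan:
assumes q: "cmod q = 1" "0 < Re q" shows "q = cis (arctan (Im q * inverse (Re q)))"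
proof -
have s: "(Re q)\<^sup>2 + (Im q)\<^sup>2 = 1" using q(1) by (simp add: cmod_def)
have "1 + (Im q * inverse (Re q))\<^sup>2 = ((Re q)\<^sup>2 + (Im q)\<^sup>2) * (inverse (Re q))\<^sup>2"
 using q(2) by (simp add: power_mult_distrib field_simps)
hence e: "1 + (Im q * inverse (Re q))\<^sup>2 = (inverse (Re q))\<^sup>2" unfolding s by simp
have r: "sqrt (1 + (Im q * inverse (Re q))\<^sup>2) = inverse (Re q)" unfolding e using q(2) by simp
show ?thesis
proof (rule complex_eqI)
 show "Re q = Re (cis (arctan (Im q * inverse (Re q))))" unfolding cis.sel cos_arctan r by (simp add: divide_inverse)
 show "Im q = Im (cis (arctan (Im q * inverse (Re q))))" unfolding cis.sel sin_arctan r using q(2) by simp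
qed
qed

lemma (in torus_manifold) act_commute:
assumes "s:torus k" "t:torus k" "x:points X" shows "tht s (tht t x) = tht t (tht s x)"
using act_mult[OF assms] act_mult[OF assms(2,1,3)] by (simp add: mult.commute)

lemma (in torus_manifold) act_inverse': assumes "t:torus k" "x:points X" shows "tht t (tht (%i. inverse (t i)) x) = x"
using act_commute[OF assms(1) torus_inverse[OF assms(1)] assms(2)] act_inverse[OF assms] by simp

locale section_pair = torus_pair X tht Y et k lam lam'
for X :: "'a smooth_space" and tht and Y :: "'b smooth_space" and et and k lam lam' +
fixes e :: "'a => 'a"
assumes e_continuous: "continuous_map (underlying X) (underlying X) e"
 and e_inv: "!!t x. t:torus k ==> x:points X ==> e (tht t x) = e x"
 and e_orbit: "!!x. x:points X ==> EX t:torus k. x = tht t (e x)"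
begin

definition trans :: "'a => nat => complex" where "trans x = (SOME t. t:torus k & x = tht t (e x))"

text \<open>The continuous equivariant lift \<open>t \<cdot> e x \<mapsto> t \<cdot> lam x\<close> determined by the two sections.\<close>

definition base :: "'a => 'b" where "base x = et (trans x) (lam x)"

lemma trans: assumes "x:points X" shows "trans x:torus k" "tht (trans x) (e x) = x"
proof -
have "EX t. t:torus k & x = tht t (e x)" using e_orbit[OF assms] by blast
from someI_ex[OF this] show "trans x:torus k" "tht (trans x) (e x) = x" unfolding trans_def by simp_all
qed

lemma e_in: "x:points X ==> e x:points X"
using continuous_map_funspace[OF e_continuous] by fastforce

lemma e_act: assumes x: "x:points X" shows "EX t:torus k. e x = tht t x"
using X.act_inverse[OF trans(1)[OF x] e_in[OF x]] torus_inverse[OF trans(1)[OF x]] unfolding trans(2)[OF x] by metis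

lemma lam_e: assumes x: "x:points X" shows "lam (e x) = lam x"
using lam_inv[OF trans(1)[OF x] e_in[OF x]] unfolding trans(2)[OF x] by simp

lemma same_act:
assumes a: "a:torus k" and b: "b:torus k" and x: "x:points X" and eq: "tht a x = tht b x"
shows "et a (lam x) = et b (lam x)"
proof -
have i: "(%i. inverse (a i)):torus k" by (rule torus_inverse[OF a])
have l: "lam x:points Y" by (rule lam_in[OF x])
have "tht (tmul (%i. inverse (a i)) b) x = x"
 unfolding X.act_mult[OF i b x] eq[symmetric] by (rule X.act_inverse[OF a x])
hence "et (tmul (%i. inverse (a i)) b) (lam x) = lam x" using stab[OF torus_mult[OF i b] x] by simp
hence s: "et (%i. inverse (a i)) (et b (lam x)) = lam x" unfolding Y.act_mult[OF i b l] .
have "et a (et (%i. inverse (a i)) (et b (lam x))) = et b (lam x)" by (rule Y.act_inverse'[OF a Y.act_in[OF b l]])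
thus ?thesis unfolding s .
qed

lemma base_in: "x:points X ==> base x:points Y"
unfolding base_def by (rule Y.act_in[OF trans(1) lam_in])

lemma base_act: assumes s: "s:torus k" and x: "x:points X" shows "base (tht s x) = et s (base x)"
proof -
have sx: "tht s x:points X" by (rule X.act_in[OF s x])
note t = trans(1)[OF x]
have "tht (trans (tht s x)) (e x) = tht (tmul s (trans x)) (e x)"
 using trans(2)[OF sx] unfolding e_inv[OF s x] X.act_mult[OF s t e_in[OF x]] trans(2)[OF x] .
from same_act[OF trans(1)[OF sx] torus_mult[OF s t] e_in[OF x] this]
show ?thesis unfolding base_def lam_inv[OF s x] lam_e[OF x] Y.act_mult[OF s t lam_in[OF x]] .
qed

lemma base_free: assumes x: "X.free x" shows "Y.free (base x)"
proof -
have xX: "x:points X" using x by (simp add: X.free_def)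
note t = trans(1)[OF xX] and l = lam_in[OF xX]
have "s = (%_. 1)" if s: "s:torus k" "et s (base x) = base x" for s
proof -
 have "et (trans x) (et s (lam x)) = et (trans x) (lam x)"
 using s(2) unfolding base_def Y.act_commute[OF s(1) t l] .
 hence "et (%i. inverse (trans x i)) (et (trans x) (et s (lam x))) = et (%i. inverse (trans x i)) (et (trans x) (lam x))" by simp
 hence "et s (lam x) = lam x" unfolding Y.act_inverse[OF t Y.act_in[OF s(1) l]] Y.act_inverse[OF t l] .
 thus ?thesis using stab[OF s(1) xX] x s(1) by (simp add: X.free_def)
qed
thus ?thesis using base_in[OF xX] by (simp add: Y.free_def)
qed

definition cisv :: "(nat => real) => nat => complex" where "cisv g = (%l. if l < k then cis (g l) else 1)"

lemma cisv_torus: "cisv g:torus k" by (rule torusI) (simp_all add: cisv_def)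

lemma cisv_add: "cisv (%l. g l + h l) = tmul (cisv g) (cisv h)" by (auto simp: cisv_def cis_mult)

text \<open>
A piece of the construction: a smooth lift \<open>psi\<close> on \<open>D\<close> that differs from \<^const>\<open>base\<close> by a torus element
with continuous angles \<open>g\<close> on the free orbits, and a bump function for a smaller set.
\<close>

definition patch where
"patch V D K h psi g \<longleftrightarrow> openin (underlying X) V & V \<subseteq> D & closedin (underlying X) K & K \<subseteq> D &
 sm X (points X) h & (ALL x:V. h x = 1) & (ALL x:points X - K. h x = (0::real)) &
 (ALL t:torus k. ALL x:V. tht t x:V) & (ALL t:torus k. ALL x:points X. h (tht t x) = h x) & lift D psi &
 (ALL x:D. X.free x --> psi x = et (cisv (g x)) (base x)) &
 (ALL l. continuous_map (subtopology (underlying X) {x\<in>D. X.free x}) euclidean (%x. g x l :: real)) &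
 (ALL t:torus k. ALL x:D. g (tht t x) = g x)"

lemma patchD:
assumes "patch V D K h psi g"
shows "openin (underlying X) V" "V \<subseteq> D" "closedin (underlying X) K" "K \<subseteq> D" "sm X (points X) h"
 "x:V ==> h x = 1" "x:points X ==> x \<notin> K ==> h x = 0" "t:torus k ==> x:V ==> tht t x:V"
 "t:torus k ==> x:points X ==> h (tht t x) = h x" "lift D psi"
 "x:D ==> X.free x ==> psi x = et (cisv (g x)) (base x)"
 "continuous_map (subtopology (underlying X) {x\<in>D. X.free x}) euclidean (%x. g x l)"
 "t:torus k ==> x:D ==> g (tht t x) = g x"
using assms unfolding patch_def by simp_all

lemma charts_at:
assumes p: "p:points X"
obtains n_1 m_1 bet_1 U_1 c_1 n_2 m_2 bet_2 U_2 c_2 where "chart_pair X tht Y et k lam lam' n_1 m_1 bet_1 U_1 c_1 n_2 m_2 bet_2 U_2 c_2 p"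
proof -
obtain n_1 m_1 bet_1 U_1 c_1 where 1: "p:U_1" "std_chart k X tht n_1 m_1 bet_1 U_1 c_1"
 using X.std_chart_exists[OF X.locally_standard p] by blast
obtain n_2 m_2 bet_2 U_2 c_2 where 2: "lam p:U_2" "std_chart k Y et n_2 m_2 bet_2 U_2 c_2"
 using Y.std_chart_exists[OF Y.locally_standard lam_in[OF p]] by blast
have ax: "chart_pair_axioms lam U_1 U_2 p" by (rule chart_pair_axioms.intro) (rule 1(1), rule 2(1))
show thesis
 by (rule that, rule chart_pair.intro[OF torus_pair_axioms chart.intro[OF X.torus_manifold_axioms chart_axioms.intro[OF 1(2)]]
 chart.intro[OF Y.torus_manifold_axioms chart_axioms.intro[OF 2(2)]] ax])
qed

end

locale section_chart = section_pair X tht Y et k lam lam' e + chart_pair X tht Y et k lam lam' n_1 m_1 bet_1 U_1 c_1 n_2 m_2 bet_2 U_2 c_2 p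
for X :: "'a smooth_space" and tht and Y :: "'b smooth_space" and et and k lam lam' e n_1 m_1 bet_1 U_1 c_1 n_2 m_2 bet_2 U_2 c_2 p
begin

text \<open>At \<open>e x\<close> the coordinates of \<open>psi\<close> and of \<open>lam x\<close> can be divided, since none vanishes on a free orbit; by
equivariance the quotient is the same along the orbit.\<close>

lemma ratio_exists:
assumes L: "lift W psi" and W: "W \<subseteq> good"
shows "EX F. (ALL x:W. X.free x --> F x:torus k & psi x = et (F x) (base x)) & (ALL t:torus k. ALL x:W. F (tht t x) = F x) &
 (ALL i. continuous_map (subtopology (underlying X) {x\<in>W. X.free x}) euclidean (%x. F x i))"
proof -
note Wo = liftD(1)[OF L]
have WU: "W \<subseteq> U_1" and WX: "W \<subseteq> points X" using W by blast+
have rW: "x:reg" if "x:W" for x using W that by blast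
define E where "E x i = (if i < k then z2 (psi (e x)) i / z2 (lam x) i else 1)" for x i
define F where "F x = B.bet' (E x)" for x
have eW: "e x:W" if x: "x:W" for x
proof -
 obtain t where "t:torus k" "e x = tht t x" using e_act WX x by blast
 thus ?thesis using liftD(2)[OF L] x by simp
qed
have nz: "z2 (lam x) i ~= 0" if x: "x:W" "X.free x" and ik: "i < k" for x i
proof (rule z2_nonzero[OF _ _ ik])
 show "x:good" using W x(1) by blast
 have "x:U_1" using WU x(1) by blast
 thus "z1 x i ~= 0" if "i < k" for i using A.free_iff x(2) that by blast
qed
have ET: "E x:torus k" if x: "x:W" "X.free x" for x
proof (rule torusI)
 have xX: "x:points X" using WX x(1) by blast
 fix i assume ik: "i < k"
 have "cmod (z2 (psi (e x)) i) = cmod (z2 (lam x) i)"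
 using lift_coords(2)[OF L eW[OF x(1)] rW[OF eW[OF x(1)]] ik] unfolding lam_e[OF xX] .
 thus "cmod (E x i) = 1" using nz[OF x ik] ik by (simp add: E_def norm_divide)
qed (simp add: E_def)
have main: "F x:torus k & psi x = et (F x) (base x)" if x: "x:W" "X.free x" for x
proof
 show FT: "F x:torus k" unfolding F_def by (rule B.bet'_in[OF ET[OF x]])
 have xX: "x:points X" using WX x(1) by blast
 have l2: "lam x:U_2" using rW[OF x(1)] by simp
 have pU: "psi (e x):U_2" by (rule lift_coords(1)[OF L eW[OF x(1)] rW[OF eW[OF x(1)]]])
 have ee: "psi (e x) = et (F x) (lam x)"
 proof (rule B.eqI[OF pU B.U_act[OF FT l2]])
 show "z2 (psi (e x)) i = z2 (et (F x) (lam x)) i" if ik: "i < k" for i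
  unfolding B.zeta_act[OF FT l2 ik] unfolding F_def B.bet_bet'[OF ET[OF x]] using nz[OF x ik] ik by (simp add: E_def)
 show "c_2 (psi (e x)) j = c_2 (et (F x) (lam x)) j" if j: "2 * k \<le> j" for j
  unfolding B.c_act[OF FT l2 j] lift_coords(3)[OF L eW[OF x(1)] rW[OF eW[OF x(1)]] j] lam_e[OF xX] ..
 qed
 note t = trans(1)[OF xX]
 have "psi x = psi (tht (trans x) (e x))" unfolding trans(2)[OF xX] ..
 also have "\<dots> = et (trans x) (et (F x) (lam x))" unfolding liftD(3)[OF L t eW[OF x(1)]] ee ..
 also have "\<dots> = et (F x) (base x)" unfolding base_def by (rule Y.act_commute[OF t FT lam_in[OF xX]])
 finally show "psi x = et (F x) (base x)" .
qed
have inv: "F (tht t x) = F x" if t: "t:torus k" and x: "x:W" for t x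
proof -
 have xX: "x:points X" using WX x by blast
 have "E (tht t x) = E x" unfolding E_def[abs_def] e_inv[OF t xX] lam_inv[OF t xX] ..
 thus ?thesis unfolding F_def by (rule arg_cong)
qed
let ?S = "subtopology (underlying X) {x\<in>W. X.free x}"
have tS: "topspace ?S = {x\<in>W. X.free x}" using WX by auto
have cE: "continuous_map ?S euclidean (%x. E x i)" for i
proof (cases "i < k")
 case True
 have "csm X {x\<in>W. psi x:U_2} (%x. z2 (psi x) i)" by (rule smap_cpullback[OF liftD(4)[OF L] B.U_open B.zeta_csm])
 hence "csm X W (%x. z2 (psi x) i)" by (rule csm_subset) (use lift_coords(1)[OF L _ rW] in blast)
 hence c1: "continuous_map (subtopology (underlying X) W) euclidean (%x. z2 (psi x) i)" by (rule X.csm_continuous[OF _ Wo])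
 have "continuous_map ?S (subtopology (underlying X) W) e"
 unfolding continuous_map_in_subtopology using continuous_map_from_subtopology[OF e_continuous] eW tS by auto
 from continuous_map_compose[OF this c1] have a: "continuous_map ?S euclidean (%x. z2 (psi (e x)) i)" by (simp add: o_def)
 have b: "continuous_map ?S euclidean (%x. z2 (lam x) i)"
 by (rule continuous_back[OF B.U_open Y.csm_continuous[OF B.zeta_csm B.U_open]]) (use WX rW in auto)
 have "continuous_map ?S euclidean (%x. z2 (psi (e x)) i / z2 (lam x) i)"
 by (rule continuous_map_complex_divide[OF a b]) (use nz True tS in blast)
 thus ?thesis using True by (simp add: E_def)
qed (simp add: E_def)
have cF: "continuous_map ?S euclidean F" unfolding F_def
 by (rule continuous_map_euclidean_compose[OF continuous_map_into_functions[OF cE] _ torus_homD(3)[OF B.bet'_hom]]) (use ET tS in blast)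
have "continuous_map ?S euclidean (%x. F x i)" for i
 by (rule continuous_map_euclidean_compose[OF cF UNIV_I continuous_on_coord])
thus ?thesis using main inv by (intro exI[of _ F]) blast
qed

lemma patch_at: "EX V D K h psi g. p:V & patch V D K h psi g"
proof -
obtain psi0 where L0: "lift good psi0" using local_lift by blast
have gU: "good \<subseteq> U_1" by blast
obtain de where d: "de > 0" "A.box p de \<subseteq> good" using A.small_box[OF good_open gU p_good good_act] by blast
have L: "lift (A.box p de) psi0" by (rule lift_restrict[OF L0 A.box_open d(2) A.box_act])
obtain F where F: "ALL x:A.box p de. X.free x --> F x:torus k & psi0 x = et (F x) (base x)"
 "ALL t:torus k. ALL x:A.box p de. F (tht t x) = F x"
 "ALL i. continuous_map (subtopology (underlying X) {x\<in>A.box p de. X.free x}) euclidean (%x. F x i)"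
 using ratio_exists[OF L d(2)] by blast
have fp: "A.free_part (A.box p de) = {x\<in>A.box p de. X.free x}" by (rule A.free_part_eq[OF A.box_sub])
have "ALL i. EX g. continuous_map (subtopology (underlying X) {x\<in>A.box p de. X.free x}) euclidean g &
 (ALL x:{x\<in>A.box p de. X.free x}. F x i = cis (g x)) & (ALL t:torus k. ALL x:U_1. g (tht t x) = g x)"
proof
 fix i
 show "EX g. continuous_map (subtopology (underlying X) {x\<in>A.box p de. X.free x}) euclidean g &
 (ALL x:{x\<in>A.box p de. X.free x}. F x i = cis (g x)) & (ALL t:torus k. ALL x:U_1. g (tht t x) = g x)"
 unfolding fp[symmetric]
 proof (rule A.continuous_logarithm_on_box)
 show "continuous_map (subtopology (underlying X) (A.free_part (A.box p de))) euclidean (%x. F x i)" unfolding fp using F(3) by blast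
 show "cmod (F x i) = 1" if "x:A.free_part (A.box p de)" for x using F(1) that torus_cmod unfolding fp by blast
 show "F (tht t x) i = F x i" if "t:torus k" "x:A.free_part (A.box p de)" for t x using F(2) that unfolding fp by simp
 qed
qed
from choice[OF this] obtain g where g: "ALL i. continuous_map (subtopology (underlying X) {x\<in>A.box p de. X.free x}) euclidean (g i) &
 (ALL x:{x\<in>A.box p de. X.free x}. F x i = cis (g i x)) & (ALL t:torus k. ALL x:U_1. g i (tht t x) = g i x)" by (elim exE)
obtain h K V where b: "sm X (points X) h" "closedin (underlying X) K" "K \<subseteq> A.box p de" "openin (underlying X) V" "p:V" "V \<subseteq> A.box p de"
 "ALL x:V. h x = 1" "ALL x:points X - K. h x = 0" "ALL t:torus k. ALL x:V. tht t x:V" "ALL t:torus k. ALL x:points X. h (tht t x) = h x"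
 using A.bump[OF p(1) d(1)] by (elim exE conjE) (rule that)
have "patch V (A.box p de) K h psi0 (%x i. g i x)"
 unfolding patch_def
proof (intro conjI)
 show "ALL x:A.box p de. X.free x --> psi0 x = et (cisv (%i. g i x)) (base x)"
 proof (intro ballI impI)
 fix x assume x: "x:A.box p de" "X.free x"
 have "F x i = cisv (%i. g i x) i" for i using g x torus_ge[of "F x" k i] F(1) by (auto simp: cisv_def)
 hence "F x = cisv (%i. g i x)" by blast
 thus "psi0 x = et (cisv (%i. g i x)) (base x)" using F(1) x by simp
 qed
 show "ALL l. continuous_map (subtopology (underlying X) {x:A.box p de. X.free x}) euclidean (%x. g l x)" using g by simp
 show "ALL t:torus k. ALL x:A.box p de. (%i. g i (tht t x)) = (%i. g i x)" using g A.box_sub by blast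
qed (rule b L)+
thus ?thesis using b(5) by blast
qed

text \<open>On the free part the difference of angles is an angle of the smooth function provided by \<open>compare\<close>, up to a
constant; that function has a smooth angle near \<open>p\<close>.\<close>

lemma transition_at:
assumes P: "patch V D K h psi g" and P': "patch V' D' K' h' psi' g'" and pD: "p:D" "p:D'"
shows "EX N H. X.opn N & p:N & (ALL l. sm X N (%x. H x l)) & (ALL x:N. X.free x --> (ALL l<k. H x l = g x l - g' x l))"
proof -
note L0 = patchD(10)[OF P] and L0' = patchD(10)[OF P']
define W where "W = good \<inter> D \<inter> D'"
have Wo: "X.opn W" unfolding W_def by (intro openin_Int good_open liftD(1)[OF L0] liftD(1)[OF L0'])
have Wact: "tht t x:W" if "t:torus k" "x:W" for t x
 using that good_act[OF that(1)] liftD(2)[OF L0 that(1)] liftD(2)[OF L0' that(1)] unfolding W_def by blast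
have Wg: "W \<subseteq> good" and WD: "W \<subseteq> D" "W \<subseteq> D'" and WU: "W \<subseteq> U_1" unfolding W_def by blast+
have pW: "p:W" using p_good pD unfolding W_def by blast
have L: "lift W psi" "lift W psi'" by (rule lift_restrict[OF L0 Wo WD(1) Wact], assumption+, rule lift_restrict[OF L0' Wo WD(2) Wact], assumption+)
obtain f where f: "ALL x:W. f x:torus k & psi x = et (f x) (psi' x)" "ALL t:torus k. ALL x:W. f (tht t x) = f x" "ALL i. csm X W (%x. f x i)"
 using compare[OF L(2,1) Wg] by blast
define q where "q l x = f x l * cis (- Arg (f p l))" for l x
have fn: "cmod (f x l) = 1" if "x:W" for x l using f(1) that torus_cmod by blast
have qn: "cmod (q l x) = 1" if "x:W" for x l using fn[OF that] by (simp add: q_def norm_mult)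
have qc: "csm X W (q l)" for l unfolding q_def[abs_def] by (intro X.csm_mult X.csm_const) (use f(3) in blast)
have qs: "sm X W (%x. Re (q l x))" "sm X W (%x. Im (q l x))" for l using qc[of l] by (simp_all add: csm_def)
define N1 where "N1 = {x\<in>W. ALL l<k. 0 < Re (q l x)}"
have N1o: "X.opn N1" unfolding N1_def
proof (rule openin_Ball_less[OF Wo])
 fix l
 have "X.opn {x\<in>W. Re (q l x):{0<..}}" by (rule X.sm_preimage_open[OF qs(1) Wo]) simp
 thus "X.opn {x\<in>W. 0 < Re (q l x)}" by simp
qed
have N1U: "N1 \<subseteq> U_1" using WU unfolding N1_def by blast
have "q l p = 1" for l
proof -
 have "f p l = cis (Arg (f p l))" using cis_Arg_unique cis_Arg[of "f p l"] fn[OF pW, of l] by (metis norm_zero sgn_eq div_by_1 of_real_1 zero_neq_one)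
 hence "q l p = cis (Arg (f p l)) * cis (- Arg (f p l))" unfolding q_def by simp
 thus ?thesis by (simp add: cis_mult)
qed
hence pN1: "p:N1" using pW unfolding N1_def by simp
have N1act: "tht t x:N1" if "t:torus k" "x:N1" for t x
 using that Wact[OF that(1)] f(2) unfolding N1_def q_def by auto
obtain de where d: "de > 0" "A.box p de \<subseteq> N1" using A.small_box[OF N1o N1U pN1 N1act] by blast
define N where "N = A.box p de"
have NW: "N \<subseteq> W" using d(2) unfolding N_def N1_def by blast
have Npos: "0 < Re (q l x)" if "x:N" "l < k" for x l using d(2) that unfolding N_def N1_def by blast
have fp: "A.free_part N = {x\<in>N. X.free x}" unfolding N_def by (rule A.free_part_eq[OF A.box_sub])
define a where "a l x = Arg (f p l) + arctan (Im (q l x) * inverse (Re (q l x)))" for l x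
have asm: "sm X N (a l)" if l: "l < k" for l
proof -
 have nzq: "Re (q l x) ~= 0" if "x:N" for x using Npos[OF that l] by simp
 show ?thesis unfolding a_def[abs_def]
 by (intro sm_add X.sm_const sm_arctan sm_mult X.sm_inverse sm_subset[OF qs(1) NW] sm_subset[OF qs(2) NW] nzq)
qed
have fa: "f x l = cis (a l x)" if x: "x:N" and l: "l < k" for x l
proof -
 have "cis (a l x) = cis (Arg (f p l)) * q l x"
 using unit_cis_arctan[OF qn Npos[OF x l]] NW x unfolding a_def cis_mult[symmetric] by auto
 also have "\<dots> = f x l * (cis (Arg (f p l)) * cis (- Arg (f p l)))" unfolding q_def by simp
 finally show ?thesis by (simp add: cis_mult)
qed
have aact: "a l (tht t x) = a l x" if "t:torus k" "x:N" for l t x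
 using f(2) that NW unfolding a_def q_def by auto
have "EX b. ALL x:A.free_part (A.box p de). g x l - g' x l - a l x = b" if l: "l < k" for l
proof (rule A.constant_on_box)
 have s: "A.free_part (A.box p de) \<subseteq> {x\<in>D. X.free x}" "A.free_part (A.box p de) \<subseteq> {x\<in>D'. X.free x}" "A.free_part (A.box p de) \<subseteq> N"
 unfolding fp[unfolded N_def] using NW WD unfolding N_def by blast+
 show "continuous_map (subtopology (underlying X) (A.free_part (A.box p de))) euclidean (%x. g x l - g' x l - a l x)"
 by (intro continuous_map_diff continuous_map_from_subtopology_mono[OF patchD(12)[OF P] s(1)]
  continuous_map_from_subtopology_mono[OF patchD(12)[OF P'] s(2)]
  continuous_map_from_subtopology_mono[OF X.sm_continuous[OF asm[OF l] A.box_open[of p de, folded N_def]] s(3)])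
 fix x assume "x:A.free_part (A.box p de)"
 hence x: "x:N" "X.free x" using fp unfolding N_def by blast+
 have xD: "x:D" "x:D'" "x:W" "x:points X" using x NW WD W_def x(2) by (auto simp: X.free_def)
 have fT: "f x:torus k" using f(1) xD(3) by blast
 have "et (cisv (g x)) (base x) = et (f x) (et (cisv (g' x)) (base x))"
 using f(1) xD(3) patchD(11)[OF P xD(1) x(2)] patchD(11)[OF P' xD(2) x(2)] by simp
 hence "cisv (g x) = tmul (f x) (cisv (g' x))"
 unfolding Y.act_mult[OF fT cisv_torus base_in[OF xD(4)], symmetric]
 by (rule Y.free_act_cancel[OF base_free[OF x(2)] cisv_torus torus_mult[OF fT cisv_torus]])
 from fun_cong[OF this, of l] have "cis (g x l) = cis (a l x) * cis (g' x l)" using l fa[OF x(1) l] by (simp add: cisv_def)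
 thus "cis (g x l - g' x l - a l x) = 1" by (simp add: cis_divide[symmetric])
 fix t assume t: "t:torus k"
 show "g (tht t x) l - g' (tht t x) l - a l (tht t x) = g x l - g' x l - a l x"
 unfolding patchD(13)[OF P t xD(1)] patchD(13)[OF P' t xD(2)] aact[OF t x(1)] ..
qed
hence "ALL l:{..<k}. EX b. ALL x:A.free_part (A.box p de). g x l - g' x l - a l x = b" by simp
from bchoice[OF this] obtain b where b: "ALL l:{..<k}. ALL x:A.free_part (A.box p de). g x l - g' x l - a l x = b l" by (elim exE)
define H where "H x l = (if l < k then a l x + b l else 0)" for x l
have "sm X N (%x. H x l)" for l
 unfolding H_def using asm[of l] by (cases "l < k") (simp_all add: sm_add X.sm_const)
moreover have "H x l = g x l - g' x l" if "x:N" "X.free x" "l < k" for x l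
proof -
 have "x:A.free_part (A.box p de)" using that fp unfolding N_def by blast
 hence "g x l - g' x l - a l x = b l" using b that(3) by blast
 thus ?thesis using that(3) by (simp add: H_def)
qed
moreover have "X.opn N" "p:N" unfolding N_def by (rule A.box_open, rule A.box_center[OF p(1) d(1)])
ultimately show ?thesis by blast
qed

end

section \<open>Gluing the local lifts\<close>

lemma (in torus_manifold) free_act: assumes t: "t:torus k" and x: "free x" shows "free (tht t x)"
proof -
have xX: "x:points X" using x by (simp add: free_def)
have "s = (%_. 1)" if s: "s:torus k" "tht s (tht t x) = tht t x" for s
proof -
 have "tht (%i. inverse (t i)) (tht t (tht s x)) = tht (%i. inverse (t i)) (tht t x)" using s(2) unfolding act_commute[OF s(1) t xX] by simp
 hence "tht s x = x" unfolding act_inverse[OF t act_in[OF s(1) xX]] act_inverse[OF t xX] .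
 thus ?thesis using x s(1) by (simp add: free_def)
qed
thus ?thesis using act_in[OF t xX] by (simp add: free_def)
qed

lemma (in torus_manifold) free_dense_eq:
assumes V: "opn V" and f: "continuous_map (subtopology (underlying X) V) Z f"
 and g: "continuous_map (subtopology (underlying X) V) Z g" and Z: "Hausdorff_space Z"
 and eq: "!!x. x:V ==> free x ==> f x = g x" and x: "x:V"
shows "f x = g x"
proof -
have "x:points X" using openin_subset[OF V] x by blast
then obtain n m bet U c where c: "x:U" "std_chart k X tht n m bet U c"
 using std_chart_exists[OF locally_standard] by blast
interpret c: chart X k tht n m bet U c by (rule chart.intro[OF torus_manifold_axioms chart_axioms.intro[OF c(2)]])
have VU: "opn (V \<inter> U)" by (rule openin_Int[OF V c.U_open])
show ?thesis
proof (rule c.dense_eq[OF VU _ continuous_map_from_subtopology_mono[OF f] continuous_map_from_subtopology_mono[OF g] Z])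
 fix y assume y: "y:V \<inter> U" and nz: "!!i. i < k ==> c.zeta y i ~= 0"
 have "free y" using c.free_iff[of y] y nz by blast
 thus "f y = g y" using eq y by blast
qed (use c(1) x in auto)
qed

context section_pair
begin

lemma patch_exists: assumes p: "p:points X" shows "EX V D K h psi g. p:V & patch V D K h psi g"
proof (rule charts_at[OF p])
fix n_1 m_1 bet_1 U_1 c_1 n_2 m_2 bet_2 U_2 c_2
assume "chart_pair X tht Y et k lam lam' n_1 m_1 bet_1 U_1 c_1 n_2 m_2 bet_2 U_2 c_2 p"
then interpret C: section_chart X tht Y et k lam lam' e n_1 m_1 bet_1 U_1 c_1 n_2 m_2 bet_2 U_2 c_2 p
 by (intro section_chart.intro section_pair_axioms)
show ?thesis by (rule C.patch_at)
qed

lemma transition: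
assumes P: "patch V D K h psi g" and P': "patch V' D' K' h' psi' g'" and pD: "p:D" "p:D'"
shows "EX N H. X.opn N & p:N & (ALL l. sm X N (%x. H x l)) & (ALL x:N. X.free x --> (ALL l<k. H x l = g x l - g' x l))"
proof (rule charts_at)
show "p:points X" using openin_subset[OF liftD(1)[OF patchD(10)[OF P]]] pD(1) by blast
fix n_1 m_1 bet_1 U_1 c_1 n_2 m_2 bet_2 U_2 c_2
assume "chart_pair X tht Y et k lam lam' n_1 m_1 bet_1 U_1 c_1 n_2 m_2 bet_2 U_2 c_2 p"
then interpret C: section_chart X tht Y et k lam lam' e n_1 m_1 bet_1 U_1 c_1 n_2 m_2 bet_2 U_2 c_2 p
 by (intro section_chart.intro section_pair_axioms)
show ?thesis by (rule C.transition_at[OF P P' pD])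
qed

text \<open>Local extensions of one function on the dense free part agree on overlaps.\<close>

lemma glue:
assumes loc: "!!p. p:points X ==> EX N ph. X.opn N & p:N & smap X N Y ph &
 (ALL x:N. EX t:torus k. ph x = et t (lam x)) & (ALL x:N. X.free x --> ph x = f x)"
 and f: "!!t x. t:torus k ==> X.free x ==> f (tht t x) = et t (f x)"
shows "EX Ps. lift (points X) Ps"
proof -
have "ALL p:points X. EX q. X.opn (fst q) & p:fst q & smap X (fst q) Y (snd q) &
 (ALL x:fst q. EX t:torus k. snd q x = et t (lam x)) & (ALL x:fst q. X.free x --> snd q x = f x)"
 using loc by simp
from bchoice[OF this] obtain q where q: "ALL p:points X. X.opn (fst (q p)) & p:fst (q p) & smap X (fst (q p)) Y (snd (q p)) &
 (ALL x:fst (q p). EX t:torus k. snd (q p) x = et t (lam x)) & (ALL x:fst (q p). X.free x --> snd (q p) x = f x)" by (elim exE)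
define N ph where "N p = fst (q p)" and "ph p = snd (q p)" for p
have N: "X.opn (N p)" "p:N p" "smap X (N p) Y (ph p)" "x:N p ==> EX t:torus k. ph p x = et t (lam x)"
 "x:N p ==> X.free x ==> ph p x = f x" if "p:points X" for p x
 using q that unfolding N_def ph_def by simp_all
define Ps where "Ps x = ph x x" for x
have agree: "Ps z = ph p z" if p: "p:points X" and z: "z:N p" for p z
 unfolding Ps_def
proof (rule X.free_dense_eq[where f = "ph z" and g = "ph p" and x = z and V = "N z \<inter> N p" and Z = "underlying Y"])
 have zX: "z:points X" using openin_subset[OF N(1)[OF p]] z by blast
 show "X.opn (N z \<inter> N p)" by (rule openin_Int[OF N(1)[OF zX] N(1)[OF p]])
 show "continuous_map (subtopology (underlying X) (N z \<inter> N p)) (underlying Y) (ph z)"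
 by (rule smap_continuous[OF smap_subset[OF N(3)[OF zX]]]) blast
 show "continuous_map (subtopology (underlying X) (N z \<inter> N p)) (underlying Y) (ph p)"
 by (rule smap_continuous[OF smap_subset[OF N(3)[OF p]]]) blast
 show "ph z x = ph p x" if "x:N z \<inter> N p" "X.free x" for x using N(5)[OF zX _ that(2)] N(5)[OF p _ that(2)] that(1) by simp
 show "z:N z \<inter> N p" using N(2)[OF zX] z by blast
qed (rule Y.Hausdorff)
have Psf: "Ps x = f x" if "X.free x" for x
proof -
 have xX: "x:points X" using that by (simp add: X.free_def)
 show ?thesis unfolding Ps_def by (rule N(5)[OF xX N(2)[OF xX] that])
qed
have S: "smap X (points X) Y Ps"
proof (rule X.smap_local[OF openin_topspace])
 fix x assume x: "x:points X"
 show "EX V psi'. X.opn V & x:V & V \<subseteq> points X & smap X V Y psi' & (ALL z:V. Ps z = psi' z)"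
 by (intro exI[of _ "N x"] exI[of _ "ph x"] conjI ballI N(1-3)[OF x] openin_subset[OF N(1)[OF x]] agree[OF x])
qed
have cPs: "continuous_map (subtopology (underlying X) (points X)) (underlying Y) Ps" by (rule smap_continuous[OF S])
have eqv: "Ps (tht t x) = et t (Ps x)" if t: "t:torus k" and x: "x:points X" for t x
proof (rule X.free_dense_eq[OF openin_topspace X.continuous_act[OF openin_topspace X.act_in[OF t] t cPs] _ Y.Hausdorff _ x])
 from continuous_map_compose[OF cPs Y.act_continuous[OF t]]
 show "continuous_map (subtopology (underlying X) (points X)) (underlying Y) (%x. et t (Ps x))" by (simp add: o_def)
 show "Ps (tht t x) = et t (Ps x)" if "X.free x" for x
 unfolding Psf[OF that] Psf[OF X.free_act[OF t that]] by (rule f[OF t that])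
qed
have "lift (points X) Ps" unfolding lift_def
proof (intro conjI ballI)
 fix x assume x: "x:points X"
 show "EX t:torus k. Ps x = et t (lam x)" unfolding Ps_def by (rule N(4)[OF x N(2)[OF x]])
qed (simp_all add: S eqv X.act_in)
thus ?thesis by blast
qed

text \<open>With the partition of unity \<open>r\<close> attached to the bump functions in order, the averaged angle is a finite sum on each
\<open>V a\<close>, and differs there from the angle of \<open>psi a\<close> by a function with smooth extension \<open>E\<close>.\<close>

theorem smooth_lift_exists: "EX Ps. lift (points X) Ps"
proof (cases "points X = {}")
case True
show ?thesis by (rule glue[where f = "%_. undefined"]) (use True in \<open>simp_all add: X.free_def\<close>)
next
case False
define \<U> where "\<U> = {V. EX D K h psi g. patch V D K h psi g}"
have op: "X.opn V" if "V:\<U>" for V using that patchD(1) unfolding \<U>_def by blast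
have cov: "\<Union>\<U> = points X"
proof
 show "\<Union>\<U> \<subseteq> points X" using op openin_subset by blast
 show "points X \<subseteq> \<Union>\<U>" using patch_exists unfolding \<U>_def by blast
qed
have "Lindelof_space (underlying X)" by (rule second_countable_imp_Lindelof_space[OF X.second_countable])
then obtain \<V> where v: "countable \<V>" "\<V> \<subseteq> \<U>" "\<Union>\<V> = points X" unfolding Lindelof_space_def using op cov by meson
have ne: "\<V> ~= {}" using v(3) False by blast
define V where "V n = from_nat_into \<V> n" for n
have Vcov: "EX n. x:V n" if "x:points X" for x
proof -
 obtain T where "T:\<V>" "x:T" using v(3) \<open>x:points X\<close> by blast
 thus ?thesis using range_from_nat_into[OF ne v(1)] unfolding V_def by (metis rangeE)
qed
have "ALL n. EX q. patch (V n) (fst q) (fst (snd q)) (fst (snd (snd q))) (fst (snd (snd (snd q)))) (snd (snd (snd (snd q))))"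
proof
 fix n
 have "V n:\<U>" using from_nat_into[OF ne] v(2) unfolding V_def by blast
 then obtain D K h psi g where "patch (V n) D K h psi g" unfolding \<U>_def by blast
 thus "EX q. patch (V n) (fst q) (fst (snd q)) (fst (snd (snd q))) (fst (snd (snd (snd q)))) (snd (snd (snd (snd q))))"
 by (intro exI[of _ "(D, K, h, psi, g)"]) simp
qed
from choice[OF this] obtain q where q: "ALL n. patch (V n) (fst (q n)) (fst (snd (q n))) (fst (snd (snd (q n)))) (fst (snd (snd (snd (q n))))) (snd (snd (snd (snd (q n)))))" by (elim exE)
define D K h psi g where "D n = fst (q n)" and "K n = fst (snd (q n))" and "h n = fst (snd (snd (q n)))"
 and "psi n = fst (snd (snd (snd (q n))))" and "g n = snd (snd (snd (snd (q n))))" for n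
have P: "patch (V n) (D n) (K n) (h n) (psi n) (g n)" for n using q unfolding D_def K_def h_def psi_def g_def by blast
define r where "r i x = h i x * (\<Prod>j<i. 1 - h j x)" for i x
have r_sum: "(\<Sum>i<M. r i x) = 1 - (\<Prod>j<M. 1 - h j x)" for M x by (induction M) (simp_all add: r_def algebra_simps)
have r_one: "(\<Sum>i<Suc a. r i x) = 1" if "x:V a" for a x
 unfolding r_sum using patchD(6)[OF P that] by simp
have r_zero: "r i x = 0" if "x:V a" "a < i" for a i x
proof -
 have "(\<Prod>j<i. 1 - h j x) = 0" by (rule prod_zero) (use patchD(6)[OF P that(1)] that(2) in auto)
 thus ?thesis by (simp add: r_def)
qed
have r_out: "r i x = 0" if "x:points X" "x \<notin> K i" for i x using patchD(7)[OF P that] by (simp add: r_def)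
have r_act: "r i (tht t x) = r i x" if "t:torus k" "x:points X" for i t x unfolding r_def patchD(9)[OF P that] ..
have r_sm: "sm X (points X) (r i)" for i unfolding r_def[abs_def]
 by (intro sm_mult X.sm_prod X.sm_diff X.sm_const patchD(5)[OF P]) simp
define idx where "idx x = (SOME a. x:V a)" for x
have idx: "x:V (idx x)" if "x:points X" for x unfolding idx_def by (rule someI_ex[OF Vcov[OF that]])
define S where "S x l = (\<Sum>i<Suc (idx x). r i x * g i x l)" for x l
have mono: "(\<Sum>i<Suc b. r i x * g i y l) = (\<Sum>i<Suc a. r i x * g i y l)" if "x:V a" "a \<le> b" for a b x y l
 by (rule sum.mono_neutral_right) (use r_zero[OF that(1)] that(2) in auto)
have S_eq: "S x l = (\<Sum>i<Suc a. r i x * g i x l)" if x: "x:V a" for x a l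
proof -
 have "x:points X" using openin_subset[OF patchD(1)[OF P]] x by blast
 note i = idx[OF this]
 show ?thesis unfolding S_def
 using mono[OF x, of "idx x" x l] mono[OF i, of a x l] by (cases "a \<le> idx x") auto
qed
have S_act: "S (tht t x) = S x" if t: "t:torus k" and x: "x:points X" for t x
proof
 fix l
 have e: "r i x * g i (tht t x) l = r i x * g i x l" for i
 proof (cases "x:D i")
 case True show ?thesis unfolding patchD(13)[OF P t True] ..
 next
 case False
 hence "x \<notin> K i" using patchD(4)[OF P] by blast
 thus ?thesis using r_out[OF x] by simp
 qed
 show "S (tht t x) l = S x l"
 unfolding S_eq[OF patchD(8)[OF P t idx[OF x]]] S_eq[OF idx[OF x]] r_act[OF t x] e ..
qed
show ?thesis
proof (rule glue[where f = "%x. et (cisv (S x)) (base x)"])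
 fix t x assume t: "t:torus k" and x: "X.free x"
 have xX: "x:points X" using x by (simp add: X.free_def)
 show "et (cisv (S (tht t x))) (base (tht t x)) = et t (et (cisv (S x)) (base x))"
 unfolding S_act[OF t xX] base_act[OF t xX] by (rule Y.act_commute[OF cisv_torus t base_in[OF xX]])
next
 fix p assume p: "p:points X"
 define a where "a = idx p"
 have pa: "p:V a" unfolding a_def by (rule idx[OF p])
 have pD: "p:D a" using pa patchD(2)[OF P] by blast
 have "ALL i:{..<Suc a}. EX q. X.opn (fst q) & p:fst q & (ALL l. sm X (fst q) (%x. snd q x l)) &
 (ALL x:fst q. X.free x --> (ALL l<k. r i x * (g a x l - g i x l) = r i x * snd q x l))"
 proof
 fix i assume "i:{..<Suc a}"
 show "EX q. X.opn (fst q) & p:fst q & (ALL l. sm X (fst q) (%x. snd q x l)) &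
  (ALL x:fst q. X.free x --> (ALL l<k. r i x * (g a x l - g i x l) = r i x * snd q x l))"
 proof (cases "p:D i")
  case True
  obtain N H where "X.opn N" "p:N" "ALL l. sm X N (%x. H x l)" "ALL x:N. X.free x --> (ALL l<k. H x l = g a x l - g i x l)"
  using transition[OF P P pD True] by blast
  thus ?thesis by (intro exI[of _ "(N, H)"]) simp
 next
  case False
  hence "p:points X - K i" using patchD(4)[OF P] p by blast
  moreover have "X.opn (points X - K i)" using patchD(3)[OF P] by blast
  moreover have "r i x * (g a x l - g i x l) = r i x * 0" if "x:points X - K i" for x l using r_out[of x i] that by simp
  ultimately show ?thesis by (intro exI[of _ "(points X - K i, %x l. 0)"]) (simp add: X.sm_const)
 qed
 qed
 from bchoice[OF this] obtain w where w: "ALL i:{..<Suc a}. X.opn (fst (w i)) & p:fst (w i) & (ALL l. sm X (fst (w i)) (%x. snd (w i) x l)) &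
 (ALL x:fst (w i). X.free x --> (ALL l<k. r i x * (g a x l - g i x l) = r i x * snd (w i) x l))" by (elim exE)
 define N where "N = {x\<in>V a. ALL i<Suc a. x:fst (w i)}"
 have No: "X.opn N" unfolding N_def
 proof (rule openin_Ball_less[OF patchD(1)[OF P]])
 fix i assume "i < Suc a"
 hence "X.opn (V a \<inter> fst (w i))" using w by (intro openin_Int patchD(1)[OF P]) blast
 thus "X.opn {x\<in>V a. x:fst (w i)}" by (simp add: Int_def)
 qed
 have pN: "p:N" using pa w unfolding N_def by simp
 have NX: "N \<subseteq> points X" by (rule openin_subset[OF No])
 have ND: "N \<subseteq> D a" using patchD(2)[OF P, of a] unfolding N_def by blast
 have Nw: "N \<subseteq> fst (w i)" if "i < Suc a" for i using that unfolding N_def by blast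
 define E where "E x l = (\<Sum>i<Suc a. r i x * snd (w i) x l)" for x l
 have Esm: "sm X N (%x. E x l)" for l unfolding E_def
 proof (rule X.sm_sum)
 fix i assume i: "i:{..<Suc a}"
 have "sm X (fst (w i)) (%x. snd (w i) x l)" using w i by blast
 thus "sm X N (%x. r i x * snd (w i) x l)" by (intro sm_mult sm_subset[OF r_sm NX] sm_subset[OF _ Nw]) (use i in auto)
 qed simp
 define ph where "ph x = et (cisv (%l. - E x l)) (psi a x)" for x
 have L: "lift (D a) (psi a)" by (rule patchD(10)[OF P])
 have sm: "smap X N Y ph" unfolding ph_def
 proof (rule Y.smap_twist[OF X.smooth_manifold No smap_subset[OF liftD(4)[OF L] ND] cisv_torus])
 show "csm X N (%x. cisv (%l. - E x l) l)" for l
  using X.csm_cis[OF X.sm_minus[OF Esm[of l]]] X.csm_const by (cases "l < k") (simp_all add: cisv_def)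
 qed
 have orb: "EX t:torus k. ph x = et t (lam x)" if x: "x:N" for x
 proof -
 obtain t where t: "t:torus k" "psi a x = et t (lam x)" using liftD(5)[OF L, of x] ND x by blast
 have l: "lam x:points Y" by (rule lam_in) (use NX x in blast)
 have "ph x = et (tmul (cisv (%l. - E x l)) t) (lam x)" unfolding ph_def t(2) Y.act_mult[OF cisv_torus t(1) l] ..
 thus ?thesis using torus_mult[OF cisv_torus t(1)] by blast
 qed
 have fr: "ph x = et (cisv (S x)) (base x)" if x: "x:N" "X.free x" for x
 proof -
 have xV: "x:V a" and xD: "x:D a" and xX: "x:points X" using x(1) ND NX unfolding N_def by blast+
 have "S x l = - E x l + g a x l" if l: "l < k" for l
 proof -
  have "E x l = (\<Sum>i<Suc a. r i x * (g a x l - g i x l))" unfolding E_def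
  proof (rule sum.cong[OF refl])
  fix i assume i: "i:{..<Suc a}"
  have xw: "x:fst (w i)" using Nw[of i] i x(1) by auto
  have "ALL x:fst (w i). X.free x --> (ALL l<k. r i x * (g a x l - g i x l) = r i x * snd (w i) x l)" using w i by blast
  from this[rule_format, OF xw x(2) l] show "r i x * snd (w i) x l = r i x * (g a x l - g i x l)" by (rule sym)
  qed
  also have "\<dots> = (\<Sum>i<Suc a. r i x) * g a x l - (\<Sum>i<Suc a. r i x * g i x l)"
  by (simp only: right_diff_distrib sum_subtractf sum_distrib_right)
  finally show ?thesis unfolding r_one[OF xV] S_eq[OF xV] by simp
 qed
 hence "cisv (S x) = cisv (%l. - E x l + g a x l)" unfolding cisv_def by auto
 hence "cisv (S x) = tmul (cisv (%l. - E x l)) (cisv (g a x))" unfolding cisv_add .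
 thus ?thesis unfolding ph_def patchD(11)[OF P xD x(2)]
  using Y.act_mult[OF cisv_torus cisv_torus base_in[OF xX]] by simp
 qed
 show "EX N ph. X.opn N & p:N & smap X N Y ph & (ALL x:N. EX t:torus k. ph x = et t (lam x)) &
 (ALL x:N. X.free x --> ph x = et (cisv (S x)) (base x))"
 using No pN sm orb fr by blast
qed
qed

end

section \<open>Inverting the lift\<close>

context section_pair
begin

text \<open>The pair \<open>(X, X)\<close> over the identity of the orbit space, needed to compare a composite of lifts with the identity.\<close>

lemma self_lift: "orbit_lift k X tht X tht e e"
unfolding orbit_lift_def
proof (intro conjI ballI allI impI)
show "continuous_map (underlying X) (underlying X) e" by (rule e_continuous)
show "e (tht t x) = e x" if "t:torus k" "x:points X" for t x by (rule e_inv[OF that])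
fix x assume x: "x:points X"
have ee: "e (e x) = e x"
proof -
 obtain t where "t:torus k" "e x = tht t x" using e_act[OF x] by blast
 thus ?thesis using e_inv[OF _ x] by metis
qed
thus "EX t:torus k. e (e x) = tht t x" using e_act[OF x] by simp
fix t assume t: "t:torus k"
have "tht t x = tht (trans x) (tht t (e x))" using X.act_commute[OF t trans(1)[OF x] e_in[OF x]] unfolding trans(2)[OF x] .
moreover have "tht (%i. inverse (trans x i)) x = e x"
 using X.act_inverse[OF trans(1)[OF x] e_in[OF x]] unfolding trans(2)[OF x] .
ultimately show "tht t (e x) = e x \<longleftrightarrow> tht t x = x"
 using trans(2)[OF x] X.act_inverse[OF trans(1)[OF x] X.act_in[OF t e_in[OF x]]] by metis
next
fix n m bet U c assume c: "std_chart k X tht n m bet U c"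
interpret c: chart X k tht n m bet U c by (rule chart.intro[OF X.torus_manifold_axioms chart_axioms.intro[OF c]])
have sub: "{x\<in>points X. e x:U} \<subseteq> U"
proof
 fix x assume "x:{x\<in>points X. e x:U}"
 hence x: "x:points X" "e x:U" by simp_all
 from c.U_act[OF trans(1)[OF x(1)] x(2)] show "x:U" unfolding trans(2)[OF x(1)] .
qed
{ fix i assume "i < n"
 hence ik: "i < k" using c.nk by simp
 have "sm X {x\<in>points X. e x:U} (%x. (cmod (c.zeta x i))\<^sup>2)" by (rule sm_subset[OF X.sm_cmod2[OF c.zeta_csm] sub])
 thus "sm X {x\<in>points X. e x:U} (%x. (cmod (zc (c (e x)) i))\<^sup>2)"
 proof (rule X.sm_cong)
 fix x assume "x:{x\<in>points X. e x:U}"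
 hence x: "x:points X" "e x:U" by simp_all
 from c.cmod_zeta_act[OF trans(1)[OF x(1)] x(2) ik] show "(cmod (c.zeta x i))\<^sup>2 = (cmod (zc (c (e x)) i))\<^sup>2"
  unfolding trans(2)[OF x(1)] by simp
 qed }
{ fix j assume j: "2 * k \<le> j"
 have "sm X {x\<in>points X. e x:U} (%x. c x j)" by (rule sm_subset[OF c.c_smooth sub])
 thus "sm X {x\<in>points X. e x:U} (%x. c (e x) j)"
 proof (rule X.sm_cong)
 fix x assume "x:{x\<in>points X. e x:U}"
 hence x: "x:points X" "e x:U" by simp_all
 from c.c_act[OF trans(1)[OF x(1)] x(2) j] show "c x j = c (e x) j" unfolding trans(2)[OF x(1)] .
 qed }
qed

lemma self_pair: "torus_pair X tht X tht k e e"
by (intro torus_pair.intro torus_pair_axioms.intro X.torus_manifold_axioms self_lift)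

end

context section_pair
begin

text \<open>Near a point the composite is \<open>x \<mapsto> f x \<cdot> x\<close> with \<open>f\<close> invariant, so \<open>y \<mapsto> (f (Ps' y))\<^sup>-\<^sup>1 \<cdot> Ps' y\<close>
inverts \<open>Ps\<close>.\<close>

lemma diffeomorphism_of_lifts:
assumes L: "lift (points X) Ps" and L': "torus_pair.lift Y et X tht k lam' (points Y) Ps'"
shows "diffeomorphism X Y Ps"
proof -
interpret S: torus_pair Y et X tht k lam' lam by (rule swap)
interpret R: torus_pair X tht X tht k e e by (rule self_pair)
have PY: "Ps x:points Y" if "x:points X" for x by (rule smap_into[OF liftD(4)[OF L] subset_refl that])
have PX: "Ps' y:points X" if "y:points Y" for y by (rule smap_into[OF S.liftD(4)[OF L'] subset_refl that])
have orb: "EX t:torus k. Ps' (Ps x) = tht t x" if x: "x:points X" for x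
proof -
 obtain t where t: "t:torus k" "Ps x = et t (lam x)" using liftD(5)[OF L x] by blast
 have l: "lam x:points Y" by (rule lam_in[OF x])
 obtain s where s: "s:torus k" "Ps' (lam x) = tht s (lam' (lam x))" using S.liftD(5)[OF L' l] by blast
 obtain u where u: "u:torus k" "lam' (lam x) = tht u x" using lam_back[OF x] by blast
 have "Ps' (Ps x) = tht t (tht s (tht u x))" unfolding t(2) S.liftD(3)[OF L' t(1) l] s(2) u(2) ..
 also have "\<dots> = tht (tmul t (tmul s u)) x"
 unfolding X.act_mult[OF t(1) torus_mult[OF s(1) u(1)] x] X.act_mult[OF s(1) u(1) x] ..
 finally show ?thesis using torus_mult[OF t(1) torus_mult[OF s(1) u(1)]] by blast
qed
have orb': "EX t:torus k. y = Ps (tht t (Ps' y))" if y: "y:points Y" for y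
proof -
 obtain s where s: "s:torus k" "Ps' y = tht s (lam' y)" using S.liftD(5)[OF L' y] by blast
 have l: "lam' y:points X" by (rule S.lam_in[OF y])
 obtain t where t: "t:torus k" "Ps (lam' y) = et t (lam (lam' y))" using liftD(5)[OF L l] by blast
 obtain u where u: "u:torus k" "lam (lam' y) = et u y" using S.lam_back[OF y] by blast
 have uy: "et u y:points Y" by (rule Y.act_in[OF u(1) y])
 define w where "w = tmul s (tmul t u)"
 have wT: "w:torus k" unfolding w_def by (rule torus_mult[OF s(1) torus_mult[OF t(1) u(1)]])
 have "Ps (Ps' y) = et s (et t (et u y))" unfolding s(2) liftD(3)[OF L s(1) l] t(2) u(2) ..
 also have "\<dots> = et w y" unfolding w_def Y.act_mult[OF s(1) torus_mult[OF t(1) u(1)] y] Y.act_mult[OF t(1) u(1) y] ..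
 finally have "Ps (tht (%i. inverse (w i)) (Ps' y)) = y"
 unfolding liftD(3)[OF L torus_inverse[OF wT] PX[OF y]] using Y.act_inverse[OF wT y] by simp
 thus ?thesis using torus_inverse[OF wT] by metis
qed
have stabPs: "tht t x = x" if t: "t:torus k" and x: "x:points X" and eq: "et t (Ps x) = Ps x" for t x
proof -
 obtain s where s: "s:torus k" "Ps x = et s (lam x)" using liftD(5)[OF L x] by blast
 have l: "lam x:points Y" by (rule lam_in[OF x])
 have "et s (et t (lam x)) = et s (lam x)" using eq unfolding s(2) Y.act_commute[OF t s(1) l] .
 hence "et (%i. inverse (s i)) (et s (et t (lam x))) = et (%i. inverse (s i)) (et s (lam x))" by simp
 hence "et t (lam x) = lam x" unfolding Y.act_inverse[OF s(1) Y.act_in[OF t l]] Y.act_inverse[OF s(1) l] .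
 thus ?thesis using stab[OF t x] by simp
qed
have inj: "inj_on Ps (points X)"
proof (rule inj_onI)
 fix x x' assume x: "x:points X" "x':points X" "Ps x = Ps x'"
 obtain t where t: "t:torus k" "Ps' (Ps x) = tht t x" using orb[OF x(1)] by blast
 obtain t' where t': "t':torus k" "Ps' (Ps x') = tht t' x'" using orb[OF x(2)] by blast
 have "tht t x = tht t' x'" using t(2) t'(2) x(3) by simp
 hence "tht (%i. inverse (t' i)) (tht t x) = x'" using X.act_inverse[OF t'(1) x(2)] by simp
 hence e: "tht (tmul (%i. inverse (t' i)) t) x = x'" unfolding X.act_mult[OF torus_inverse[OF t'(1)] t(1) x(1)] .
 note w = torus_mult[OF torus_inverse[OF t'(1)] t(1)]
 have "et (tmul (%i. inverse (t' i)) t) (Ps x) = Ps x" using liftD(3)[OF L w x(1)] x(3) unfolding e by simp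
 from stabPs[OF w x(1) this] show "x = x'" unfolding e by simp
qed
have bij: "bij_betw Ps (points X) (points Y)"
 unfolding bij_betw_def
proof (intro conjI inj equalityI subsetI)
 show "y:points Y" if "y:Ps ` points X" for y using that PY by blast
 fix y assume y: "y:points Y"
 obtain t where t: "t:torus k" "y = Ps (tht t (Ps' y))" using orb'[OF y] by blast
 from X.act_in[OF t(1) PX[OF y]] t(2) show "y:Ps ` points X" by (rule rev_image_eqI)
qed
define G where "G = inv_into (points X) Ps"
have GX: "G y:points X" and PsG: "Ps (G y) = y" if "y:points Y" for y
 using that bij unfolding G_def bij_betw_def by (simp_all add: inv_into_into f_inv_into_f)
have comp: "smap X (points X) X (%x. Ps' (Ps x))"
 by (rule smap_compose[OF liftD(4)[OF L] S.liftD(4)[OF L'] subset_refl PY openin_topspace])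
have RL: "R.lift (points X) (%x. Ps' (Ps x))"
 unfolding R.lift_def
proof (intro conjI ballI)
 show "smap X (points X) X (%x. Ps' (Ps x))" by (rule comp)
 fix x assume x: "x:points X"
 obtain t where t: "t:torus k" "Ps' (Ps x) = tht t x" using orb[OF x] by blast
 have "tht t x = tht (tmul t (trans x)) (e x)" unfolding X.act_mult[OF t(1) trans(1)[OF x] e_in[OF x]] trans(2)[OF x] ..
 thus "EX t:torus k. Ps' (Ps x) = tht t (e x)" using t torus_mult[OF t(1) trans(1)[OF x]] by metis
 fix s assume s: "s:torus k"
 show "tht s x:points X" by (rule X.act_in[OF s x])
 show "Ps' (Ps (tht s x)) = tht s (Ps' (Ps x))" unfolding liftD(3)[OF L s x] by (rule S.liftD(3)[OF L' s PY[OF x]])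
qed simp
have idmap: "smap X (points X) X (%x. x)"
 unfolding smap_def
proof (intro conjI allI impI)
 fix V F assume "sm X V F"
 thus "sm X {x\<in>points X. x:V} F" by (rule sm_subset) blast
qed simp
have RI: "R.lift (points X) (%x. x)"
 unfolding R.lift_def using e_orbit X.act_in idmap by simp
have smG: "smap Y (points Y) X G"
proof (rule Y.smap_local[OF openin_topspace])
 fix y0 assume y0: "y0:points Y"
 define p where "p = Ps' y0"
 have pX: "p:points X" unfolding p_def by (rule PX[OF y0])
 obtain n_1 m_1 bet_1 U_1 c_1 where 1: "p:U_1" "std_chart k X tht n_1 m_1 bet_1 U_1 c_1"
 using X.std_chart_exists[OF X.locally_standard pX] by blast
 interpret c1: chart X k tht n_1 m_1 bet_1 U_1 c_1 by (rule chart.intro[OF X.torus_manifold_axioms chart_axioms.intro[OF 1(2)]])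
 have ep: "e p:U_1"
 proof -
 obtain t where "t:torus k" "e p = tht t p" using e_act[OF pX] by blast
 thus ?thesis using c1.U_act 1(1) by simp
 qed
 have ax: "chart_pair_axioms e U_1 U_1 p" by (rule chart_pair_axioms.intro) (rule 1(1), rule ep)
 interpret C: chart_pair X tht X tht k e e n_1 m_1 bet_1 U_1 c_1 n_1 m_1 bet_1 U_1 c_1 p
 by (rule chart_pair.intro[OF self_pair c1.chart_axioms c1.chart_axioms ax])
 have gX: "C.good \<subseteq> points X" by blast
 have R1: "R.lift C.good (%x. x)" by (rule R.lift_restrict[OF RI C.good_open gX C.good_act])
 have R2: "R.lift C.good (%x. Ps' (Ps x))" by (rule R.lift_restrict[OF RL C.good_open gX C.good_act])
 obtain f where f: "ALL x:C.good. f x:torus k & Ps' (Ps x) = tht (f x) x" "ALL t:torus k. ALL x:C.good. f (tht t x) = f x"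
 "ALL i. csm X C.good (%x. f x i)"
 using C.compare[OF R1 R2 subset_refl] by blast
 define V where "V = {y\<in>points Y. Ps' y:C.good}"
 have Vo: "Y.opn V" unfolding V_def by (rule smap_preimage_open[OF S.liftD(4)[OF L'] openin_topspace C.good_open])
 have yV: "y0:V" using y0 C.p_good unfolding V_def p_def by blast
 have VY: "V \<subseteq> points Y" unfolding V_def by blast
 have VPs: "Ps' y:C.good" "y:points Y" if "y:V" for y using that unfolding V_def by blast+
 define ta where "ta y i = inverse (f (Ps' y) i)" for y i
 have fT: "f (Ps' y):torus k" if "y:V" for y using f(1) VPs(1)[OF that] by blast
 have sm: "smap Y V X (%y. tht (ta y) (Ps' y))"
 proof (rule X.smap_twist[OF Y.smooth_manifold Vo smap_subset[OF S.liftD(4)[OF L'] VY]])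
 show "ta y:torus k" if "y:V" for y unfolding ta_def by (rule torus_inverse[OF fT[OF that]])
 show "csm Y V (%y. ta y l)" for l unfolding ta_def
 proof (rule Y.csm_inverse)
  have "csm X C.good (%x. f x l)" using f(3) by blast
  thus "csm Y V (%y. f (Ps' y) l)" unfolding V_def by (rule smap_cpullback[OF S.liftD(4)[OF L'] C.good_open])
  show "f (Ps' y) l ~= 0" if "y:V" for y by (rule torus_nonzero[OF fT[OF that]])
 qed
 qed
 have GG: "G y = tht (ta y) (Ps' y)" if y: "y:V" for y
 proof -
 define x where "x = G y"
 have x: "x:points X" "Ps x = y" unfolding x_def by (rule GX[OF VPs(2)[OF y]], rule PsG[OF VPs(2)[OF y]])
 obtain t where t: "t:torus k" "Ps' y = tht t x" using orb[OF x(1)] unfolding x(2) by blast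
 have "tht (%i. inverse (t i)) (Ps' y):C.good" by (rule C.good_act[OF torus_inverse[OF t(1)] VPs(1)[OF y]])
 hence xg: "x:C.good" unfolding t(2) X.act_inverse[OF t(1) x(1)] .
 have fx: "f x:torus k" "Ps' y = tht (f x) x" using f(1) xg x(2) by blast+
 have "f (Ps' y) = f x" unfolding fx(2) using f(2) fx(1) xg by blast
 hence "ta y = (%i. inverse (f x i))" unfolding ta_def[abs_def] by simp
 hence "tht (ta y) (Ps' y) = x" unfolding fx(2) by (simp only: X.act_inverse[OF fx(1) x(1)])
 thus ?thesis unfolding x_def by simp
 qed
 show "EX V psi'. Y.opn V & y0:V & V \<subseteq> points Y & smap Y V X psi' & (ALL z:V. G z = psi' z)"
 using Vo yV VY sm GG by blast
qed
show ?thesis unfolding diffeomorphism_def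
 using bij smooth_map_if_smap[OF X.smooth_manifold Y.smooth_manifold liftD(4)[OF L]]
 smooth_map_if_smap[OF Y.smooth_manifold X.smooth_manifold smG] unfolding G_def by blast
qed

end

section \<open>Orbit spaces\<close>

context torus_manifold
begin

lemma orbit_eq: "orbit_map k tht x = {tht t x |t. t:torus k}"
by (simp add: orbit_def torus_group_def)

lemma mem_orbit: "y:orbit_map k tht x \<longleftrightarrow> (EX t:torus k. y = tht t x)"
unfolding orbit_eq by blast

lemma self_orbit: "x:points X ==> x:orbit_map k tht x"
unfolding mem_orbit using act_one[of x] torus_one by metis

lemma orbit_act: assumes t: "t:torus k" and x: "x:points X" shows "orbit_map k tht (tht t x) = orbit_map k tht x"
proof (intro equalityI subsetI)
fix y assume "y:orbit_map k tht (tht t x)"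
then obtain s where s: "s:torus k" "y = tht s (tht t x)" unfolding mem_orbit by blast
hence "y = tht (tmul s t) x" using act_mult[OF s(1) t x] by simp
thus "y:orbit_map k tht x" unfolding mem_orbit using torus_mult[OF s(1) t] by blast
next
fix y assume "y:orbit_map k tht x"
then obtain s where s: "s:torus k" "y = tht s x" unfolding mem_orbit by blast
have "tht (tmul s (%i. inverse (t i))) (tht t x) = tht s x"
 unfolding act_mult[OF s(1) torus_inverse[OF t] act_in[OF t x]] act_inverse[OF t x] ..
thus "y:orbit_map k tht (tht t x)" unfolding mem_orbit using s torus_mult[OF s(1) torus_inverse[OF t]] by metis
qed

lemma orbits_eq: "orbits (torus_group k) (points X) tht = orbit_map k tht ` points X"
unfolding orbits_def by blast

lemma underlying_orbit_space: "underlying (orbit_space k X tht) = orbit_topology k X tht"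
by (simp add: orbit_space_def)

lemma points_orbit_space: "points (orbit_space k X tht) = orbit_map k tht ` points X"
unfolding underlying_orbit_space
proof
have "openin (orbit_topology k X tht) (topspace (orbit_topology k X tht))" by (rule openin_topspace)
thus "topspace (orbit_topology k X tht) \<subseteq> orbit_map k tht ` points X"
 unfolding openin_orbit_topology orbits_eq by (rule conjunct1)
have "{x\<in>points X. orbit_map k tht x:orbit_map k tht ` points X} = points X" by blast
hence "openin (orbit_topology k X tht) (orbit_map k tht ` points X)" unfolding openin_orbit_topology orbits_eq by simp
thus "orbit_map k tht ` points X \<subseteq> topspace (orbit_topology k X tht)" by (rule openin_subset)
qed

lemma orbit_map_continuous: "continuous_map (underlying X) (orbit_topology k X tht) (orbit_map k tht)"
unfolding continuous_map_def
using points_orbit_space[unfolded underlying_orbit_space] by (auto simp: openin_orbit_topology)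

lemma characteristic_stabilizer: assumes x: "x:points X"
shows "characteristic_function k tht (orbit_map k tht x) = {t\<in>torus k. tht t x = x}"
proof -
have st: "stabilizer (torus_group k) tht y = {t\<in>torus k. tht t y = y}" for y by (simp add: stabilizer_def torus_group_def)
have "{t\<in>torus k. tht t y = y} = {t\<in>torus k. tht t x = x}" if "y:orbit_map k tht x" for y
proof -
 obtain s where s: "s:torus k" "y = tht s x" using \<open>y:orbit_map k tht x\<close> unfolding mem_orbit by blast
 have "tht t y = y \<longleftrightarrow> tht t x = x" if t: "t:torus k" for t
 proof
 assume "tht t y = y"
 hence "tht (%i. inverse (s i)) (tht s (tht t x)) = tht (%i. inverse (s i)) (tht s x)" unfolding s(2) act_commute[OF t s(1) x] by simp
 thus "tht t x = x" unfolding act_inverse[OF s(1) act_in[OF t x]] act_inverse[OF s(1) x] .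
 next
 assume "tht t x = x" thus "tht t y = y" unfolding s(2) act_commute[OF t s(1) x] by simp
 qed
 thus ?thesis by blast
qed
thus ?thesis unfolding characteristic_function_def st using self_orbit[OF x] by (metis (no_types, lifting) INF_eq_const empty_iff)
qed

end

text \<open>In charts of the orbit spaces, \<open>Ph\<close> is smooth in the orbit coordinates, which are smooth functions upstairs.\<close>

lemma orbit_lift_of_diffeomorphism:
assumes X: "torus_manifold X k tht" and Y: "torus_manifold Y k et"
 and s: "continuous_section k X tht s" and s': "continuous_section k Y et s'"
 and Ph: "smooth_map (orbit_space k X tht) (orbit_space k Y et) Ph"
 and inv: "!!q. q:points (orbit_space k X tht) ==> Ph' (Ph q) = q"
 and char: "!!q. q:points (orbit_space k X tht) ==> characteristic_function k tht q = characteristic_function k et (Ph q)"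
shows "orbit_lift k X tht Y et (%x. s' (Ph (orbit_map k tht x))) (%y. s (Ph' (orbit_map k et y)))"
proof -
interpret X: torus_manifold X k tht by (rule X)
interpret Y: torus_manifold Y k et by (rule Y)
let ?p = "orbit_map k tht" and ?q = "orbit_map k et"
define f where "f x = s' (Ph (?p x))" for x
have cs': "continuous_map (orbit_topology k Y et) (underlying Y) s'" and qs': "!!q. q:points (orbit_space k Y et) ==> ?q (s' q) = q"
 using s' unfolding continuous_section_def Y.underlying_orbit_space by simp_all
have ps: "!!q. q:points (orbit_space k X tht) ==> ?p (s q) = q" and cs: "continuous_map (orbit_topology k X tht) (underlying X) s"
 using s unfolding continuous_section_def X.underlying_orbit_space by simp_all
have cPh: "continuous_map (orbit_topology k X tht) (orbit_topology k Y et) Ph"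
 using Ph unfolding smooth_map_def X.underlying_orbit_space Y.underlying_orbit_space by (rule conjunct1)
have cf: "continuous_map (underlying X) (underlying Y) f"
 using continuous_map_compose[OF continuous_map_compose[OF X.orbit_map_continuous cPh] cs'] by (simp add: o_def f_def[abs_def])
have pin: "?p x:points (orbit_space k X tht)" if "x:points X" for x unfolding X.points_orbit_space using that by blast
have Phin: "Ph (?p x):points (orbit_space k Y et)" if "x:points X" for x
 using continuous_map_funspace[OF cPh] pin[OF that] unfolding X.underlying_orbit_space Y.underlying_orbit_space by blast
have qf: "?q (f x) = Ph (?p x)" if "x:points X" for x unfolding f_def by (rule qs'[OF Phin[OF that]])
have fin: "f x:points Y" if "x:points X" for x using continuous_map_funspace[OF cf] that by blast
have "orbit_lift k X tht Y et f (%y. s (Ph' (?q y)))"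
 unfolding orbit_lift_def
proof (intro conjI ballI allI impI)
 show "continuous_map (underlying X) (underlying Y) f" by (rule cf)
 show "f (tht t x) = f x" if "t:torus k" "x:points X" for t x unfolding f_def X.orbit_act[OF that] ..
 fix x assume x: "x:points X"
 have "s (Ph' (?q (f x))) = s (?p x)" unfolding qf[OF x] inv[OF pin[OF x]] ..
 moreover have "s (?p x):points X"
 using continuous_map_funspace[OF cs] pin[OF x] unfolding X.underlying_orbit_space by blast
 hence "s (?p x):?p (s (?p x))" by (rule X.self_orbit)
 ultimately show "EX t:torus k. s (Ph' (?q (f x))) = tht t x" unfolding ps[OF pin[OF x]] X.mem_orbit by simp
 fix t assume t: "t:torus k"
 have "{t\<in>torus k. tht t x = x} = {t\<in>torus k. et t (f x) = f x}"
 using char[OF pin[OF x]] unfolding X.characteristic_stabilizer[OF x] qf[OF x, symmetric] Y.characteristic_stabilizer[OF fin[OF x]] .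
 thus "et t (f x) = f x \<longleftrightarrow> tht t x = x" using t by blast
next
 fix n m bet U c assume c: "std_chart k Y et n m bet U c"
 interpret c: chart Y k et n m bet U c by (rule chart.intro[OF Y chart_axioms.intro[OF c]])
 obtain psi where psi: "(n + m, ?q ` U, psi):charts (orbit_space k Y et)"
 "ALL y:U. psi (?q y) = (%j. if j < n then (cmod (zc (c y) j))\<^sup>2 else c y (2 * k + (j - n)))"
 using c.orbit_chart by blast
 have psir: "psi (?q y) = c.rho y" if "y:U" for y using psi(2) that unfolding c.rho_def[abs_def] by blast
 have fo: "X.opn {x\<in>points X. f x:U}" by (rule openin_continuous_map_preimage[OF cf c.U_open])
 have rsm: "sm X {x\<in>points X. f x:U} (%x. c.rho (f x) j)" if j: "j < n + m" for j
 proof (rule X.sm_local)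
 fix x0 assume "x0:{x\<in>points X. f x:U}"
 hence x0: "x0:points X" "f x0:U" by simp_all
 obtain n' m' bet' U' c' where c': "x0:U'" "std_chart k X tht n' m' bet' U' c'"
  using X.std_chart_exists[OF X.locally_standard x0(1)] by blast
 interpret c': chart X k tht n' m' bet' U' c' by (rule chart.intro[OF X chart_axioms.intro[OF c'(2)]])
 obtain ph where ph: "(n' + m', ?p ` U', ph):charts (orbit_space k X tht)"
  "ALL x:U'. ph (?p x) = (%j. if j < n' then (cmod (zc (c' x) j))\<^sup>2 else c' x (2 * k + (j - n')))"
  using c'.orbit_chart by blast
 have phr: "ph (?p x) = c'.rho x" if "x:U'" for x using ph(2) that unfolding c'.rho_def[abs_def] by blast
 define Q where "Q = {w\<in>?p ` U'. Ph w:?q ` U}"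
 define F where "F u = psi (Ph (inv_into (?p ` U') ph u)) j" for u
 have F: "smooth_on (n' + m') (ph ` Q) F"
  unfolding F_def[abs_def] Q_def
  using Ph[unfolded smooth_map_def, THEN conjunct2, THEN bspec, OF ph(1)] psi(1) j by fastforce
 have inj: "inj_on ph (?p ` U')"
 proof (rule inj_onI)
  fix a b assume "a:?p ` U'" "b:?p ` U'" and ab: "ph a = ph b"
  then obtain x y where x: "x:U'" "a = ?p x" and y: "y:U'" "b = ?p y" by blast
  have e: "c'.rho x = c'.rho y" using ab unfolding x(2) y(2) phr[OF x(1)] phr[OF y(1)] .
  have "EX t:torus k. y = tht t x"
  proof (rule c'.same_orbit[OF x(1) y(1)])
  fix i assume ik: "i < k"
  show "cmod (c'.zeta x i) = cmod (c'.zeta y i)"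
  proof (cases "i < n'")
   case True
   hence "(cmod (c'.zeta x i))\<^sup>2 = (cmod (c'.zeta y i))\<^sup>2" using fun_cong[OF e, of i] by (simp add: c'.rho_def)
   thus ?thesis by (simp add: power2_eq_iff_nonneg)
  next
   case False thus ?thesis using c'.zeta_unit[OF x(1) _ ik] c'.zeta_unit[OF y(1) _ ik] by simp
  qed
  next
  fix l assume l: "2 * k \<le> l"
  have q: "\<not> n' + (l - 2 * k) < n'" "2 * k + (n' + (l - 2 * k) - n') = l" using l by simp_all
  from fun_cong[OF e, of "n' + (l - 2 * k)"] show "c' x l = c' y l" unfolding c'.rho_def if_not_P[OF q(1)] q(2) .
  qed
  thus "a = b" unfolding x(2) y(2) using X.orbit_act[of _ x] x(1) c'.U_sub by auto
 qed
 define V where "V = {x\<in>points X. f x:U} \<inter> U'"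
 have VU: "V \<subseteq> U'" unfolding V_def by blast
 have "sm X V (%x. F (c'.rho x))"
 proof (rule X.sm_compose[OF F])
  show "ph ` Q \<subseteq> R_vecs (n' + m')" unfolding Q_def using phr c'.rho_in by auto
  show "sm X V (%x. c'.rho x l)" for l by (rule sm_subset[OF c'.rho_sm VU])
  fix x assume x: "x:V"
  hence xx: "x:U'" "x:points X" "f x:U" unfolding V_def by blast+
  have "?p x:Q" unfolding Q_def using xx qf[OF xx(2)] by (metis (mono_tags, lifting) CollectI imageI)
  hence "ph (?p x):ph ` Q" by (rule imageI)
  thus "c'.rho x:ph ` Q" unfolding phr[OF xx(1)] .
 qed
 hence "sm X V (%x. c.rho (f x) j)"
 proof (rule X.sm_cong)
  fix x assume x: "x:V"
  hence xx: "x:U'" "x:points X" "f x:U" unfolding V_def by blast+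
  have "inv_into (?p ` U') ph (c'.rho x) = ?p x" unfolding phr[OF xx(1), symmetric] by (rule inv_into_f_f[OF inj]) (use xx in blast)
  thus "F (c'.rho x) = c.rho (f x) j" unfolding F_def qf[OF xx(2), symmetric] psir[OF xx(3), symmetric] using qf[OF xx(2)] by simp
 qed
 thus "EX V. X.opn V & x0:V & sm X ({x\<in>points X. f x:U} \<inter> V) (%x. c.rho (f x) j)"
  unfolding V_def using c'.U_open c'(1) by blast
 qed
 show "sm X {x\<in>points X. f x:U} (%x. (cmod (zc (c (f x)) i))\<^sup>2)" if "i < n" for i
 using rsm[of i] that by (simp add: c.rho_def)
 show "sm X {x\<in>points X. f x:U} (%x. c (f x) j)" if j: "2 * k \<le> j" for j
 proof (cases "j < 2 * k + m")
 case True
 have q: "\<not> n + (j - 2 * k) < n" "2 * k + (n + (j - 2 * k) - n) = j" "n + (j - 2 * k) < n + m" using j True by simp_all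
 from rsm[OF q(3)] show ?thesis unfolding c.rho_def if_not_P[OF q(1)] q(2) .
 next
 case False
 show ?thesis by (rule X.sm_cong[OF X.sm_const[where c = 0]]) (use c.c_in_R False in \<open>auto simp: topspace_Euclidean_space\<close>)
 qed
qed
thus ?thesis unfolding f_def[abs_def] .
qed

lemma section_pair_axioms_of_section:
assumes T: "torus_manifold M k tht" and s: "continuous_section k M tht s"
shows "section_pair_axioms M tht k (%x. s (orbit_map k tht x))"
proof (rule section_pair_axioms.intro)
interpret M: torus_manifold M k tht by (rule T)
have cs: "continuous_map (orbit_topology k M tht) (underlying M) s" and ps: "!!q. q:points (orbit_space k M tht) ==> orbit_map k tht (s q) = q"
 using s unfolding continuous_section_def M.underlying_orbit_space by simp_all
show ce: "continuous_map (underlying M) (underlying M) (%x. s (orbit_map k tht x))"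
 using continuous_map_compose[OF M.orbit_map_continuous cs] by (simp add: o_def)
show "s (orbit_map k tht (tht t x)) = s (orbit_map k tht x)" if "t:torus k" "x:points M" for t x
 unfolding M.orbit_act[OF that] ..
show "EX t:torus k. x = tht t (s (orbit_map k tht x))" if x: "x:points M" for x
proof -
 have "orbit_map k tht x:points (orbit_space k M tht)" unfolding M.points_orbit_space using x by blast
 from M.self_orbit[OF x] ps[OF this] have "x:orbit_map k tht (s (orbit_map k tht x))" by simp
 thus ?thesis unfolding M.mem_orbit .
qed
qed

theorem theorem1p1:
  fixes k :: nat
    and M\<^sub>1 :: "'a smooth_space" and \<theta>\<^sub>1 :: "(nat \<Rightarrow> complex) \<Rightarrow> 'a \<Rightarrow> 'a"
    and M\<^sub>2 :: "'b smooth_space" and \<theta>\<^sub>2 :: "(nat \<Rightarrow> complex) \<Rightarrow> 'b \<Rightarrow> 'b"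
    and s\<^sub>1 :: "'a set \<Rightarrow> 'a" and s\<^sub>2 :: "'b set \<Rightarrow> 'b" and \<Phi> :: "'a set \<Rightarrow> 'b set"
  assumes "locally_standard k M\<^sub>1 \<theta>\<^sub>1" and "locally_standard k M\<^sub>2 \<theta>\<^sub>2"
    and "continuous_section k M\<^sub>1 \<theta>\<^sub>1 s\<^sub>1" and "continuous_section k M\<^sub>2 \<theta>\<^sub>2 s\<^sub>2"
    and "diffeomorphism (orbit_space k M\<^sub>1 \<theta>\<^sub>1) (orbit_space k M\<^sub>2 \<theta>\<^sub>2) \<Phi>"
    and "\<forall>p\<in>points (orbit_space k M\<^sub>1 \<theta>\<^sub>1).
           characteristic_function k \<theta>\<^sub>1 p = characteristic_function k \<theta>\<^sub>2 (\<Phi> p)"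
  shows "\<exists>\<Psi>. diffeomorphism M\<^sub>1 M\<^sub>2 \<Psi> \<and>
           (\<forall>t\<in>torus k. \<forall>x\<in>points M\<^sub>1. \<Psi> (\<theta>\<^sub>1 t x) = \<theta>\<^sub>2 t (\<Psi> x))"
proof -
  have T1: "torus_manifold M\<^sub>1 k \<theta>\<^sub>1" and T2: "torus_manifold M\<^sub>2 k \<theta>\<^sub>2"
    by (rule torus_manifold.intro[OF assms(1)], rule torus_manifold.intro[OF assms(2)])
  let ?P1 = "orbit_space k M\<^sub>1 \<theta>\<^sub>1" and ?P2 = "orbit_space k M\<^sub>2 \<theta>\<^sub>2"
  define \<Phi>' where "\<Phi>' = inv_into (points ?P1) \<Phi>"
  have bij: "bij_betw \<Phi> (points ?P1) (points ?P2)" and sm: "smooth_map ?P1 ?P2 \<Phi>" and sm': "smooth_map ?P2 ?P1 \<Phi>'"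
    using assms(5) unfolding diffeomorphism_def \<Phi>'_def by simp_all
  have i1: "\<Phi>' (\<Phi> q) = q" if "q \<in> points ?P1" for q using bij that unfolding \<Phi>'_def bij_betw_def by simp
  have i2: "\<Phi> (\<Phi>' q) = q" "\<Phi>' q \<in> points ?P1" if "q \<in> points ?P2" for q
    using bij that unfolding \<Phi>'_def bij_betw_def by (simp_all add: f_inv_into_f inv_into_into)
  have char: "characteristic_function k \<theta>\<^sub>1 q = characteristic_function k \<theta>\<^sub>2 (\<Phi> q)" if "q \<in> points ?P1" for q
    using assms(6) that by blast
  have char': "characteristic_function k \<theta>\<^sub>2 q = characteristic_function k \<theta>\<^sub>1 (\<Phi>' q)" if "q \<in> points ?P2" for q
    using char[OF i2(2)[OF that]] i2(1)[OF that] by simp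
  define lam where "lam x = s\<^sub>2 (\<Phi> (orbit_map k \<theta>\<^sub>1 x))" for x
  define lam' where "lam' y = s\<^sub>1 (\<Phi>' (orbit_map k \<theta>\<^sub>2 y))" for y
  have o1: "orbit_lift k M\<^sub>1 \<theta>\<^sub>1 M\<^sub>2 \<theta>\<^sub>2 lam lam'" unfolding lam_def[abs_def] lam'_def[abs_def]
    by (rule orbit_lift_of_diffeomorphism[OF T1 T2 assms(3,4) sm i1 char])
  have o2: "orbit_lift k M\<^sub>2 \<theta>\<^sub>2 M\<^sub>1 \<theta>\<^sub>1 lam' lam" unfolding lam_def[abs_def] lam'_def[abs_def]
    by (rule orbit_lift_of_diffeomorphism[OF T2 T1 assms(4,3) sm' i2(1) char'])
  have tp: "torus_pair M\<^sub>1 \<theta>\<^sub>1 M\<^sub>2 \<theta>\<^sub>2 k lam lam'" by (rule torus_pair.intro[OF T1 T2 torus_pair_axioms.intro[OF o1 o2]])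
  interpret A: section_pair M\<^sub>1 \<theta>\<^sub>1 M\<^sub>2 \<theta>\<^sub>2 k lam lam' "\<lambda>x. s\<^sub>1 (orbit_map k \<theta>\<^sub>1 x)"
    by (rule section_pair.intro[OF tp section_pair_axioms_of_section[OF T1 assms(3)]])
  interpret B: section_pair M\<^sub>2 \<theta>\<^sub>2 M\<^sub>1 \<theta>\<^sub>1 k lam' lam "\<lambda>y. s\<^sub>2 (orbit_map k \<theta>\<^sub>2 y)"
    by (rule section_pair.intro[OF A.swap section_pair_axioms_of_section[OF T2 assms(4)]])
  obtain \<Psi> where L: "A.lift (points M\<^sub>1) \<Psi>" using A.smooth_lift_exists by blast
  obtain \<Psi>' where L': "B.lift (points M\<^sub>2) \<Psi>'" using B.smooth_lift_exists by blast
  have "diffeomorphism M\<^sub>1 M\<^sub>2 \<Psi>" by (rule A.diffeomorphism_of_lifts[OF L L'])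
  moreover have "\<forall>t\<in>torus k. \<forall>x\<in>points M\<^sub>1. \<Psi> (\<theta>\<^sub>1 t x) = \<theta>\<^sub>2 t (\<Psi> x)" using A.liftD(3)[OF L] by blast
  ultimately show ?thesis by blast
qed

end
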